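(* Let $P\in\Psi DO^m_{cl}(\mathbb{R}^n)$ and $Q\in\Psi DO^{m'}_{cl}(\mathbb{R}^n)$ be properly supported, with classical expansions (of their total left symbols) $\sum_{j\ge0} p_{m-j}(x,\xi)$ and $\sum_{k\ge0} q_{m'-k}(x,\xi)$ respectively. Then $PQ$ is also classical, of order $m+m'$, with asymptotic expansion $\sum_{l\ge0} r_{m+m'-l}(x,\xi)$, where $$r_{m+m'-l}=\sum_{j+k+|\alpha|=l}\frac{1}{\alpha!}\,D_\xi^\alpha p_{m-j}\cdot\partial_x^\alpha q_{m'-k},$$ and thus $$\sigma_{m+m'}(PQ)=\sigma_m(P)\,\sigma_{m'}(Q).$$
   Context: Notation: $D_{x_j}=-i\,\partial_{x_j}$, $D^\alpha=(-i)^{|\alpha|}\partial^\alpha$, $\langle\theta\rangle=(1+|\theta|^2)^{1/2}$. For $m\in\mathbb{R}$, $S^m(\mathbb{R}^N;\mathbb{R}^k)$ is the set of $a\in C^\infty(\mathbb{R}^N\times\mathbb{R}^k)$ such that for all multi-indices $\alpha,\beta$ and compact $K$ there is $C$ with $|D_x^\alpha D_\theta^\beta a(x,\theta)|\le C\langle\theta\rangle^{m-|\beta|}$ for $x\in K$ and all $\theta$. $\Psi DO^m(\mathbb{R}^n)$ is the set of operators whose Schwartz kernel is an oscillatory integral $(2\pi)^{-n}\int e^{i\langle x-y,\xi\rangle}a(x,y,\xi)\,d\xi$ with $a\in S^m(\mathbb{R}^n_x\times\mathbb{R}^n_y;\mathbb{R}^n_\xi)$. An operator is properly supported if both coordinate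 projections from the support of its kernel to $\mathbb{R}^n$ are proper. Modulo a smooth kernel, $P\in\Psi DO^m$ can be written with $a=p(x,\xi)\in S^m(\mathbb{R}^n;\mathbb{R}^n)$, the total left symbol, unique modulo $S^{-\infty}=\bigcap_m S^m$. $P$ is classical ($P\in\Psi DO^m_{cl}$) if there are $p_{m-j}(x,\xi)$, $j\ge0$, smooth on $\xi\neq0$ and positively homogeneous of degree $m-j$ in $\xi$, with $p-\sum_{j<N}(1-\phi(\xi))p_{m-j}\in S^{m-N}$ for all $N$, where $\phi\in C_0^\infty(\mathbb{R}^n)$ equals $1$ near $0$; $\sum_j p_{m-j}$ is then called the classical (asymptotic) expansion, and $\sigma_m(P)=p_m$ is the principal symbol. *)

theory Defs
  imports "HOL-Analysis.Analysis"
begin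

text \<open>
  The Euclidean space \<open>R^n\<close> is a type \<open>'a\<close> of class \<open>euclidean_space\<close>, with coordinates taken
  along \<open>Basis\<close> and \<open>n = DIM('a)\<close>; \<open>R^n \<times> R^n\<close> is \<open>'a \<times> 'a\<close>.
\<close>

subsection \<open>Partial derivatives and smooth functions\<close>

definition pdiff :: "'a::euclidean_space \<Rightarrow> ('a \<Rightarrow> 'b::real_normed_vector) \<Rightarrow> 'a \<Rightarrow> 'b" where
  "pdiff b f x = vector_derivative (\<lambda>t. f (x + t *\<^sub>R b)) (at 0)"

text \<open>Only meaningful for open \<open>S\<close>, since \<^const>\<open>pdiff\<close> is two-sided.\<close>

primrec C_on :: "nat \<Rightarrow> 'a::euclidean_space set \<Rightarrow> ('a \<Rightarrow> 'b::real_normed_vector) \<Rightarrow> bool" where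
  "C_on 0 S f \<longleftrightarrow> continuous_on S f"
| "C_on (Suc k) S f \<longleftrightarrow> f differentiable_on S \<and> (\<forall>b\<in>Basis. C_on k S (pdiff b f))"

definition smooth_on :: "'a::euclidean_space set \<Rightarrow> ('a \<Rightarrow> 'b::real_normed_vector) \<Rightarrow> bool" where
  "smooth_on S f \<longleftrightarrow> (\<forall>k. C_on k S f)"

text \<open>A multi-index assigns an exponent to every coordinate direction, and \<open>0\<close> to every vector
  outside \<open>Basis\<close>, so that there are only finitely many multi-indices of a given length.\<close>

definition multi_indices :: "('a::euclidean_space \<Rightarrow> nat) set" where
  "multi_indices = {\<alpha>. \<forall>b. b \<notin> Basis \<longrightarrow> \<alpha> b = 0}"

definition mlen :: "('a::euclidean_space \<Rightarrow> nat) \<Rightarrow> nat" where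
  "mlen \<alpha> = (\<Sum>b\<in>Basis. \<alpha> b)"

definition mfact :: "('a::euclidean_space \<Rightarrow> nat) \<Rightarrow> nat" where
  "mfact \<alpha> = (\<Prod>b\<in>Basis. fact (\<alpha> b))"

text \<open>The coordinates have no canonical order; the derivatives below are taken in one fixed
  arbitrary order, which is immaterial for smooth functions.\<close>

definition basis_list :: "'a::euclidean_space list" where
  "basis_list = (SOME bs. distinct bs \<and> set bs = Basis)"

definition mderiv ::
  "('a::euclidean_space \<Rightarrow> nat) \<Rightarrow> ('a \<Rightarrow> 'b::real_normed_vector) \<Rightarrow> 'a \<Rightarrow> 'b" where
  "mderiv \<alpha> f = foldr (\<lambda>b g. (pdiff b ^^ \<alpha> b) g) basis_list f"

definition Dderiv :: "('a::euclidean_space \<Rightarrow> nat) \<Rightarrow> ('a \<Rightarrow> complex) \<Rightarrow> 'a \<Rightarrow> complex" where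
  "Dderiv \<alpha> f x = (-\<i>) ^ mlen \<alpha> * mderiv \<alpha> f x"


subsection \<open>Test functions and distributions\<close>

definition test_functions :: "('a::euclidean_space \<Rightarrow> complex) set" where
  "test_functions = {f. smooth_on UNIV f \<and> compact (closure (support_on UNIV f))}"

text \<open>Test functions equal to \<open>1\<close> near the origin.\<close>

definition cutoffs :: "('a::euclidean_space \<Rightarrow> complex) set" where
  "cutoffs = {\<phi> \<in> test_functions. \<forall>\<^sub>F x in nhds 0. \<phi> x = 1}"

text \<open>Distributions are functionals of which only the values on test functions matter.\<close>

definition distribution :: "(('a::euclidean_space \<Rightarrow> complex) \<Rightarrow> complex) \<Rightarrow> bool" where
  "distribution K \<longleftrightarrow>
     (\<forall>\<phi>\<in>test_functions. \<forall>\<psi>\<in>test_functions. \<forall>c. K (\<lambda>x. \<phi> x + c * \<psi> x) = K \<phi> + c * K \<psi>) \<and>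
     (\<forall>C. compact C \<longrightarrow> (\<exists>N B. \<forall>\<phi>\<in>test_functions. support_on UNIV \<phi> \<subseteq> C \<longrightarrow>
        cmod (K \<phi>) \<le> B * (\<Sum>\<alpha> | \<alpha> \<in> multi_indices \<and> mlen \<alpha> \<le> N. SUP x. cmod (mderiv \<alpha> \<phi> x))))"

definition distr_support :: "(('a::euclidean_space \<Rightarrow> complex) \<Rightarrow> complex) \<Rightarrow> 'a set" where
  "distr_support K = - \<Union>{U. open U \<and>
     (\<forall>\<phi>\<in>test_functions. closure (support_on UNIV \<phi>) \<subseteq> U \<longrightarrow> K \<phi> = 0)}"


subsection \<open>Symbols and oscillatory integrals\<close>

definition japanese :: "'a::euclidean_space \<Rightarrow> real" where
  "japanese \<theta> = sqrt (1 + (norm \<theta>)\<^sup>2)"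

definition symbols :: "real \<Rightarrow> ('x::euclidean_space \<Rightarrow> 'k::euclidean_space \<Rightarrow> complex) set" where
  "symbols m = {a. smooth_on UNIV (\<lambda>(x, \<theta>). a x \<theta>) \<and>
     (\<forall>\<alpha>\<in>multi_indices. \<forall>\<beta>\<in>multi_indices. \<forall>K. compact K \<longrightarrow>
        (\<exists>C. \<forall>x\<in>K. \<forall>\<theta>. cmod (Dderiv \<alpha> (\<lambda>x. Dderiv \<beta> (a x) \<theta>) x)
                        \<le> C * japanese \<theta> powr (m - real (mlen \<beta>))))}"

text \<open>\<open>osc_integral a K\<close>: the distribution \<open>K\<close> is the oscillatory integral
  \<open>(2\<pi>)^(-n) \<integral> exp(i\<langle>x - y, \<xi>\<rangle>) a(x,y,\<xi>) d\<xi>\<close>, i.e. the limit as \<open>\<epsilon> \<rightarrow> 0+\<close> of the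
  convergent integrals regularised by \<open>\<rho>(\<epsilon>\<xi>)\<close>, whatever the cutoff \<open>\<rho>\<close>.\<close>

definition osc_integral ::
  "('a::euclidean_space \<times> 'a \<Rightarrow> 'a \<Rightarrow> complex) \<Rightarrow> (('a \<times> 'a \<Rightarrow> complex) \<Rightarrow> complex) \<Rightarrow> bool" where
  "osc_integral a K \<longleftrightarrow> (\<forall>\<phi>\<in>test_functions. \<forall>\<rho>\<in>cutoffs.
     ((\<lambda>\<epsilon>. complex_of_real (1 / (2 * pi) ^ DIM('a)) *
        integral\<^sup>L lborel (\<lambda>((x, y), \<xi>).
           \<rho> (\<epsilon> *\<^sub>R \<xi>) * exp (\<i> * complex_of_real ((x - y) \<bullet> \<xi>)) * a (x, y) \<xi> * \<phi> (x, y)))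
      \<longlongrightarrow> K \<phi>) (at_right 0))"


subsection \<open>Pseudodifferential operators\<close>

text \<open>An operator maps test functions to smooth functions; its values on other functions are
  irrelevant. (A distribution \<open>P u\<close> that is a smooth function is identified with it.)
  The kernel \<open>K\<close> is characterised by \<open>\<langle>P u, v\<rangle> = \<langle>K, v \<otimes> u\<rangle>\<close> with the bilinear pairing.\<close>

definition schwartz_kernel ::
  "(('a::euclidean_space \<Rightarrow> complex) \<Rightarrow> 'a \<Rightarrow> complex) \<Rightarrow> (('a \<times> 'a \<Rightarrow> complex) \<Rightarrow> complex) \<Rightarrow> bool"
  where
  "schwartz_kernel P K \<longleftrightarrow> distribution K \<and>
     (\<forall>u\<in>test_functions. smooth_on UNIV (P u)) \<and>
     (\<forall>u\<in>test_functions. \<forall>v\<in>test_functions.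
        (LINT x|lborel. P u x * v x) = K (\<lambda>(x, y). v x * u y))"

definition psido :: "real \<Rightarrow> (('a::euclidean_space \<Rightarrow> complex) \<Rightarrow> 'a \<Rightarrow> complex) set" where
  "psido m = {P. \<exists>a\<in>symbols m. \<exists>K. osc_integral a K \<and> schwartz_kernel P K}"

definition properly_supported ::
  "(('a::euclidean_space \<Rightarrow> complex) \<Rightarrow> 'a \<Rightarrow> complex) \<Rightarrow> bool" where
  "properly_supported P \<longleftrightarrow> (\<exists>K. schwartz_kernel P K \<and>
     proper_map (top_of_set (distr_support K)) euclidean fst \<and>
     proper_map (top_of_set (distr_support K)) euclidean snd)"

text \<open>The kernel of \<open>P\<close> is the oscillatory integral with amplitude \<open>p(x,\<xi>)\<close> plus a smooth
  function \<open>k(x,y)\<close>.\<close>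

definition total_left_symbol ::
  "real \<Rightarrow> (('a::euclidean_space \<Rightarrow> complex) \<Rightarrow> 'a \<Rightarrow> complex) \<Rightarrow> ('a \<Rightarrow> 'a \<Rightarrow> complex) \<Rightarrow> bool" where
  "total_left_symbol m P p \<longleftrightarrow> p \<in> symbols m \<and>
     (\<exists>K k. osc_integral (\<lambda>(x, y). p x) K \<and> smooth_on UNIV k \<and>
        schwartz_kernel P (\<lambda>\<phi>. K \<phi> + (LINT z|lborel. k z * \<phi> z)))"

text \<open>\<open>ps j\<close> is the term of degree \<open>m - j\<close>; its values at \<open>\<xi> = 0\<close> are irrelevant, being killed by
  \<open>1 - \<phi>\<close>. As \<open>p\<close> is unique modulo symbols of order \<open>-\<infinity>\<close>, and the condition does not depend on
  the cutoff \<open>\<phi>\<close>, the quantifiers over \<open>p\<close> and \<open>\<phi>\<close> could be of either kind.\<close>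

definition classical_expansion ::
  "real \<Rightarrow> (('a::euclidean_space \<Rightarrow> complex) \<Rightarrow> 'a \<Rightarrow> complex) \<Rightarrow> (nat \<Rightarrow> 'a \<Rightarrow> 'a \<Rightarrow> complex) \<Rightarrow> bool"
  where
  "classical_expansion m P ps \<longleftrightarrow> P \<in> psido m \<and>
     (\<forall>j. smooth_on (UNIV \<times> - {0}) (\<lambda>(x, \<xi>). ps j x \<xi>) \<and>
          (\<forall>x \<xi> t. \<xi> \<noteq> 0 \<longrightarrow> t > 0 \<longrightarrow>
             ps j x (t *\<^sub>R \<xi>) = complex_of_real (t powr (m - real j)) * ps j x \<xi>)) \<and>
     (\<exists>p. total_left_symbol m P p \<and>
        (\<forall>\<phi>\<in>cutoffs. \<forall>N. (\<lambda>x \<xi>. p x \<xi> - (\<Sum>j<N. (1 - \<phi> \<xi>) * ps j x \<xi>)) \<in> symbols (m - real N)))"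

definition psido_cl :: "real \<Rightarrow> (('a::euclidean_space \<Rightarrow> complex) \<Rightarrow> 'a \<Rightarrow> complex) set" where
  "psido_cl m = {P. \<exists>ps. classical_expansion m P ps}"

text \<open>Defined for classical \<open>P\<close> of order \<open>m\<close> and \<open>\<xi> \<noteq> 0\<close>.\<close>

definition principal_symbol ::
  "real \<Rightarrow> (('a::euclidean_space \<Rightarrow> complex) \<Rightarrow> 'a \<Rightarrow> complex) \<Rightarrow> 'a \<Rightarrow> 'a \<Rightarrow> complex" where
  "principal_symbol m P x \<xi> = (THE z. \<exists>ps. classical_expansion m P ps \<and> z = ps 0 x \<xi>)"

end

theory Submission
  imports Defs "HOL-Probability.Probability" "HOL-Combinatorics.Multiset_Permutations"
begin

text \<open>Put \<open>e_\<xi>(x) = exp(i\<langle>x, \<xi>\<rangle>)\<close>. The composition has the exact symbol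
  \<open>r(x, \<xi>) = e_\<xi>(x)^(-1) P (Q (\<chi> e_\<xi>)) (x)\<close>, where the cutoff \<open>\<chi>\<close> is \<open>1\<close> on a ball that depends on \<open>x\<close>; by
  proper support its choice is immaterial. On balls the smooth remainders of the kernels can be
  absorbed into the symbols as terms of order \<open>-\<infinity>\<close>, so that \<open>r\<close> is an absolutely convergent integral
  \<open>(2\<pi>)^(-n) \<integral> e_\<eta>(x) p(x, \<xi> + \<eta>) w^(\<eta>, \<xi>) d\<eta>\<close>, where \<open>w\<close> is given by a similar integral in terms of \<open>q\<close> and
  \<open>\<chi>\<close>, and \<open>w^\<close> is its Fourier transform in the space variable. Expanding \<open>p(x, \<xi> + \<eta>)\<close> by Taylor's formula
  in \<open>\<eta>\<close>, and bounding the remainder by Peetre's inequality, yields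
  \<open>r - \<Sum>_(|\<alpha>| < N) D_\<xi>^\<alpha> p \<partial>_x^\<alpha> q / \<alpha>! \<in> S^(m + m' - N)\<close>. Substituting the classical expansions and sorting by
  degree of homogeneity gives the claim; the principal symbol is well defined because plane waves
  determine the total symbol modulo order \<open>-\<infinity>\<close>.\<close>

subsection \<open>Partial derivatives and smooth functions\<close>

text \<open>The obstacle is that symbol estimates involve all derivatives in two groups of
  variables, while the remainder is given by an integral. Differentiation under the integral sign
  shows that \<open>comp_symbol\<close>, the Taylor terms and hence the remainder obey the product
  rule in \<open>p\<close> and \<open>w\<close>, in \<open>x\<close> as well as in
  \<open>\<xi>\<close>: differentiating the phase \<open>cis (x \<bullet> \<eta>)\<close> brings
  down \<open>\<i> * (\<eta> \<bullet> b)\<close>, which the Fourier transform turns into a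
  derivative of \<open>w\<close>. So every derivative of a remainder is a sum of remainders with
  \<open>p\<close> or \<open>w\<close> differentiated, and a single bound without derivatives,
  proved for all symbols, yields all symbol estimates. The compact support of \<open>w\<close> makes
  these integrals converge absolutely; the price is that the symbol is first obtained on balls only.
  Derivatives are indexed by words in the basis, because the sum over all words of length
  \<open>k\<close>, with the common weight \<open>1 / fact k\<close>, obeys Taylor's formula and the
  product rule with unchanged coefficients; multi-indices with \<open>1 / \<alpha>!\<close> come
  back at the very end, by counting words.\<close>

lemma pdiff_has_derivative:
  assumes "(f has_derivative f') (at x)"
  shows "pdiff b f x = f' b"
proof -
  interpret f': bounded_linear f' using assms by (rule has_derivative_bounded_linear)
  have "(f has_derivative f') (at (x + 0 *\<^sub>R b))" using assms by simp
  moreover have "((\<lambda>t. x + t *\<^sub>R b) has_derivative (\<lambda>t. t *\<^sub>R b)) (at (0::real))"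
    by (auto intro!: derivative_eq_intros)
  ultimately have "((\<lambda>t. f (x + t *\<^sub>R b)) has_derivative (\<lambda>t. f' (t *\<^sub>R b))) (at 0)"
    using has_derivative_compose by blast
  then have "((\<lambda>t. f (x + t *\<^sub>R b)) has_vector_derivative f' b) (at 0)"
    unfolding has_vector_derivative_def by (simp add: f'.scaleR)
  then show ?thesis unfolding pdiff_def by (rule vector_derivative_at)
qed

lemma has_derivative_pdiff:
  fixes f :: "'a::euclidean_space \<Rightarrow> 'b::real_normed_vector"
  assumes "f differentiable (at x)"
  shows "(f has_derivative (\<lambda>h. \<Sum>b\<in>Basis. (h \<bullet> b) *\<^sub>R pdiff b f x)) (at x)"
proof -
  obtain f' where f': "(f has_derivative f') (at x)"
    using assms by (auto simp: differentiable_def)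
  interpret f': bounded_linear f' using f' by (rule has_derivative_bounded_linear)
  have "f' h = (\<Sum>b\<in>Basis. (h \<bullet> b) *\<^sub>R pdiff b f x)" for h
  proof -
    have "f' h = f' (\<Sum>b\<in>Basis. (h \<bullet> b) *\<^sub>R b)" by (simp add: euclidean_representation)
    also have "\<dots> = (\<Sum>b\<in>Basis. (h \<bullet> b) *\<^sub>R f' b)" by (simp add: f'.sum f'.scaleR)
    finally show ?thesis by (simp add: pdiff_has_derivative[OF f'])
  qed
  then have "f' = (\<lambda>h. \<Sum>b\<in>Basis. (h \<bullet> b) *\<^sub>R pdiff b f x)" by blast
  with f' show ?thesis by simp
qed

lemma pdiff_cong_open:
  assumes "open S" "x \<in> S" "\<And>y. y \<in> S \<Longrightarrow> f y = g y"
  shows "pdiff b f x = pdiff b g x"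
proof -
  have "((\<lambda>t. x + t *\<^sub>R b) \<longlongrightarrow> x + 0 *\<^sub>R b) (nhds (0::real))"
    by (intro tendsto_intros) (auto simp: filterlim_ident)
  then have "\<forall>\<^sub>F t in nhds (0::real). x + t *\<^sub>R b \<in> S"
    using assms(1,2) by (auto simp: tendsto_def)
  then have "\<forall>\<^sub>F t in nhds (0::real). f (x + t *\<^sub>R b) = g (x + t *\<^sub>R b)"
    by eventually_elim (use assms(3) in auto)
  then show ?thesis
    unfolding pdiff_def by (intro vector_derivative_cong_eq) auto
qed

lemma pdiff_const [simp]: "pdiff b (\<lambda>x. c) x = 0"
  by (rule pdiff_has_derivative[OF has_derivative_const])

lemma pdiff_add:
  "f differentiable (at x) \<Longrightarrow> g differentiable (at x) \<Longrightarrow>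
    pdiff b (\<lambda>x. f x + g x) x = pdiff b f x + pdiff b g x"
  using pdiff_has_derivative[OF has_derivative_add] unfolding differentiable_def
  by (metis pdiff_has_derivative)

lemma pdiff_sum:
  assumes "\<And>i. i \<in> I \<Longrightarrow> f i differentiable (at x)"
  shows "pdiff b (\<lambda>x. \<Sum>i\<in>I. f i x) x = (\<Sum>i\<in>I. pdiff b (f i) x)"
proof -
  obtain f' where f': "\<And>i. i \<in> I \<Longrightarrow> (f i has_derivative f' i) (at x)"
    using assms unfolding differentiable_def by metis
  have "((\<lambda>x. \<Sum>i\<in>I. f i x) has_derivative (\<lambda>h. \<Sum>i\<in>I. f' i h)) (at x)"
    by (intro has_derivative_sum f')
  from pdiff_has_derivative[OF this] show ?thesis
    by (simp add: pdiff_has_derivative[OF f'])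
qed

lemma pdiff_bilinear:
  assumes "bounded_bilinear bop" "f differentiable (at x)" "g differentiable (at x)"
  shows "pdiff b (\<lambda>x. bop (f x) (g x)) x = bop (f x) (pdiff b g x) + bop (pdiff b f x) (g x)"
proof -
  obtain f' g' where d: "(f has_derivative f') (at x)" "(g has_derivative g') (at x)"
    using assms unfolding differentiable_def by blast
  from pdiff_has_derivative[OF bounded_bilinear.FDERIV[OF assms(1) d]] show ?thesis
    by (simp add: pdiff_has_derivative[OF d(1)] pdiff_has_derivative[OF d(2)])
qed

lemma differentiable_bilinear:
  assumes "bounded_bilinear bop" "f differentiable (at x)" "g differentiable (at x)"
  shows "(\<lambda>x. bop (f x) (g x)) differentiable (at x)"
  using assms bounded_bilinear.FDERIV[OF assms(1)] unfolding differentiable_def by blast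

lemma pdiff_mult:
  fixes f g :: "'a::euclidean_space \<Rightarrow> 'b::real_normed_algebra"
  assumes "f differentiable (at x)" "g differentiable (at x)"
  shows "pdiff b (\<lambda>x. f x * g x) x = f x * pdiff b g x + pdiff b f x * g x"
  using assms by (rule pdiff_bilinear[OF bounded_bilinear_mult])

lemma pdiff_cmult:
  fixes f :: "'a::euclidean_space \<Rightarrow> 'b::real_normed_algebra"
  assumes "f differentiable (at x)"
  shows "pdiff b (\<lambda>x. c * f x) x = c * pdiff b f x"
  using pdiff_mult[OF differentiable_const assms, of b c] by simp

lemma pdiff_diff:
  "f differentiable (at x) \<Longrightarrow> g differentiable (at x) \<Longrightarrow>
    pdiff b (\<lambda>x. f x - g x) x = pdiff b f x - pdiff b g x"
  using pdiff_has_derivative[OF has_derivative_diff] unfolding differentiable_def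
  by (metis pdiff_has_derivative)

text \<open>Two kinds of inner maps are considered. Affine maps cover slices, shifts, projections
  and substitutions such as \<open>(x, z) \<mapsto> (x, x - z)\<close>; real-valued inner maps,
  treated next, cover bumps and plane waves.\<close>

lemma pdiff_compose_linear:
  fixes f :: "'c::euclidean_space \<Rightarrow> 'b::real_normed_vector"
  assumes L: "bounded_linear L" and f: "f differentiable (at (L x + c))"
  shows "(\<lambda>x. f (L x + c)) differentiable (at x)"
    and "pdiff b (\<lambda>x. f (L x + c)) x = (\<Sum>b'\<in>Basis. (L b \<bullet> b') *\<^sub>R pdiff b' f (L x + c))"
proof -
  have "((\<lambda>x. L x + c) has_derivative L) (at x)"
    using bounded_linear_imp_has_derivative[OF L] by (auto intro!: derivative_eq_intros)
  note d = has_derivative_compose[OF this has_derivative_pdiff[OF f]]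
  show "(\<lambda>x. f (L x + c)) differentiable (at x)" using d unfolding differentiable_def by blast
  show "pdiff b (\<lambda>x. f (L x + c)) x = (\<Sum>b'\<in>Basis. (L b \<bullet> b') *\<^sub>R pdiff b' f (L x + c))"
    by (rule pdiff_has_derivative[OF d])
qed

lemma pdiff_compose_real:
  fixes h :: "real \<Rightarrow> 'b::real_normed_vector"
  assumes g: "g differentiable (at x)" and h: "h differentiable (at (g x))"
  shows "(\<lambda>x. h (g x)) differentiable (at x)"
    and "pdiff b (\<lambda>x. h (g x)) x = pdiff b g x *\<^sub>R pdiff 1 h (g x)"
proof -
  obtain g' where g': "(g has_derivative g') (at x)" using g unfolding differentiable_def by blast
  note d = has_derivative_compose[OF g' has_derivative_pdiff[OF h]]
  show "(\<lambda>x. h (g x)) differentiable (at x)" using d unfolding differentiable_def by blast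
  show "pdiff b (\<lambda>x. h (g x)) x = pdiff b g x *\<^sub>R pdiff 1 h (g x)"
    using pdiff_has_derivative[OF d] by (simp add: pdiff_has_derivative[OF g'])
qed

lemma C_on_SucI:
  assumes "\<And>x. x \<in> S \<Longrightarrow> f differentiable (at x)" "\<And>b. b \<in> Basis \<Longrightarrow> C_on k S (pdiff b f)"
  shows "C_on (Suc k) S f"
  using assms by (auto simp: differentiable_on_def intro: differentiable_at_withinI)

lemma C_on_SucD:
  assumes "open S" "C_on (Suc k) S f"
  shows "x \<in> S \<Longrightarrow> f differentiable (at x)" "b \<in> Basis \<Longrightarrow> C_on k S (pdiff b f)"
  using assms by (auto simp: differentiable_on_eq_differentiable_at)

declare C_on.simps(2) [simp del]

lemma C_on_cong:
  assumes "open S" "\<And>x. x \<in> S \<Longrightarrow> f x = g x" "C_on k S f"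
  shows "C_on k S g"
  using assms(2,3)
proof (induction k arbitrary: f g)
  case 0
  then show ?case using continuous_on_cong by fastforce
next
  case (Suc k)
  show ?case
  proof (rule C_on_SucI)
    fix x assume x: "x \<in> S"
    have "f differentiable (at x)" using C_on_SucD[OF assms(1) Suc.prems(2)] x by blast
    then obtain f' where "(f has_derivative f') (at x)" unfolding differentiable_def by blast
    then have "(g has_derivative f') (at x)"
      by (rule has_derivative_transform_within_open[OF _ assms(1) x]) (use Suc.prems(1) in auto)
    then show "g differentiable (at x)" unfolding differentiable_def by blast
  next
    fix b :: 'a assume b: "b \<in> Basis"
    show "C_on k S (pdiff b g)"
      by (rule Suc.IH[of "pdiff b f"])
        (use C_on_SucD[OF assms(1) Suc.prems(2)] b pdiff_cong_open[OF assms(1) _ Suc.prems(1)] in auto)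
  qed
qed

lemma C_on_Suc_imp: "open S \<Longrightarrow> C_on (Suc k) S f \<Longrightarrow> C_on k S f"
proof (induction k arbitrary: f)
  case 0
  then show ?case using differentiable_imp_continuous_on by (auto simp: C_on.simps(2))
next
  case (Suc k)
  show ?case
    by (rule C_on_SucI) (use C_on_SucD[OF Suc.prems(1) Suc.prems(2)] Suc.IH[OF Suc.prems(1)] in auto)
qed

lemma C_on_const: "C_on k S (\<lambda>x. c)"
proof (induction k arbitrary: c)
  case (Suc k)
  have "pdiff b (\<lambda>x::'a. c) = (\<lambda>x. 0)" for b by (rule ext) simp
  then show ?case by (intro C_on_SucI) (simp_all add: Suc)
qed auto

lemma C_on_add: "open S \<Longrightarrow> C_on k S f \<Longrightarrow> C_on k S g \<Longrightarrow> C_on k S (\<lambda>x. f x + g x)"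
proof (induction k arbitrary: f g)
  case 0
  then show ?case by (auto intro: continuous_intros)
next
  case (Suc k)
  note d = C_on_SucD[OF Suc.prems(1) Suc.prems(2)] C_on_SucD[OF Suc.prems(1) Suc.prems(3)]
  show ?case
  proof (rule C_on_SucI)
    fix b :: 'a assume b: "b \<in> Basis"
    have "C_on k S (\<lambda>x. pdiff b f x + pdiff b g x)" by (rule Suc.IH[OF Suc.prems(1) d(2)[OF b] d(4)[OF b]])
    then show "C_on k S (pdiff b (\<lambda>x. f x + g x))"
      by (rule C_on_cong[OF Suc.prems(1), rotated]) (simp add: pdiff_add d)
  next
    show "(\<lambda>x. f x + g x) differentiable (at x)" if "x \<in> S" for x
      by (rule differentiable_add[OF d(1)[OF that] d(3)[OF that]])
  qed
qed

lemma C_on_sum: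
  assumes "open S" "\<And>i. i \<in> I \<Longrightarrow> C_on k S (f i)"
  shows "C_on k S (\<lambda>x. \<Sum>i\<in>I. f i x)"
  using assms(2)
  by (induction I rule: infinite_finite_induct) (auto intro: C_on_const C_on_add[OF assms(1)])

lemma C_on_bilinear:
  fixes bop :: "'b::real_normed_vector \<Rightarrow> 'c::real_normed_vector \<Rightarrow> 'd::real_normed_vector"
  assumes "bounded_bilinear bop"
  shows "open (S :: 'a::euclidean_space set) \<Longrightarrow> C_on k S f \<Longrightarrow> C_on k S g \<Longrightarrow> C_on k S (\<lambda>x. bop (f x) (g x))"
proof (induction k arbitrary: f g)
  case 0
  then show ?case by (auto intro: bounded_bilinear.continuous_on[OF assms])
next
  case (Suc k)
  note d = C_on_SucD[OF Suc.prems(1) Suc.prems(2)] C_on_SucD[OF Suc.prems(1) Suc.prems(3)]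
  show ?case
  proof (rule C_on_SucI)
    fix b :: 'a assume b: "b \<in> Basis"
    have "C_on k S (\<lambda>x. bop (f x) (pdiff b g x) + bop (pdiff b f x) (g x))"
      by (rule C_on_add[OF Suc.prems(1)
            Suc.IH[OF Suc.prems(1) C_on_Suc_imp[OF Suc.prems(1,2)] d(4)[OF b]]
            Suc.IH[OF Suc.prems(1) d(2)[OF b] C_on_Suc_imp[OF Suc.prems(1,3)]]])
    then show "C_on k S (pdiff b (\<lambda>x. bop (f x) (g x)))"
      by (rule C_on_cong[OF Suc.prems(1), rotated]) (simp add: pdiff_bilinear[OF assms] d)
  next
    show "(\<lambda>x. bop (f x) (g x)) differentiable (at x)" if "x \<in> S" for x
      by (rule differentiable_bilinear[OF assms d(1)[OF that] d(3)[OF that]])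
  qed
qed

lemma C_on_compose_linear:
  fixes f :: "'c::euclidean_space \<Rightarrow> 'b::real_normed_vector"
  assumes L: "bounded_linear (L :: 'a::euclidean_space \<Rightarrow> 'c)" and "open S" "open T" "\<And>x. x \<in> S \<Longrightarrow> L x + c \<in> T"
  shows "C_on k T f \<Longrightarrow> C_on k S (\<lambda>x. f (L x + c))"
proof (induction k arbitrary: f)
  case 0
  have "continuous_on S (\<lambda>x. L x + c)" using L by (intro continuous_intros linear_continuous_on)
  then show ?case using 0 assms(4) by (auto intro: continuous_on_compose2)
next
  case (Suc k)
  note d = C_on_SucD[OF assms(3) Suc.prems]
  show ?case
  proof (rule C_on_SucI)
    fix b :: 'a assume b: "b \<in> Basis"
    have "C_on k S (\<lambda>x. \<Sum>b'\<in>Basis. (L b \<bullet> b') *\<^sub>R pdiff b' f (L x + c))"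
      by (intro C_on_sum C_on_bilinear[OF bounded_bilinear_scaleR] Suc.IH C_on_const d assms(2))
    then show "C_on k S (pdiff b (\<lambda>x. f (L x + c)))"
      by (rule C_on_cong[OF assms(2), rotated]) (use d assms(4) in \<open>auto simp: pdiff_compose_linear(2)[OF L]\<close>)
  next
    show "(\<lambda>x. f (L x + c)) differentiable (at x)" if "x \<in> S" for x
      by (rule pdiff_compose_linear(1)[OF L d(1)[OF assms(4)[OF that]]])
  qed
qed

lemma C_on_compose_real:
  fixes h :: "real \<Rightarrow> 'b::real_normed_vector" and g :: "'a::euclidean_space \<Rightarrow> real"
  assumes "open S"
  shows "C_on k UNIV h \<Longrightarrow> C_on k S g \<Longrightarrow> C_on k S (\<lambda>x. h (g x))"
proof (induction k arbitrary: h)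
  case 0
  then show ?case by (auto intro: continuous_on_compose2)
next
  case (Suc k)
  note d = C_on_SucD[OF assms Suc.prems(2)] C_on_SucD[OF open_UNIV Suc.prems(1)]
  show ?case
  proof (rule C_on_SucI)
    fix b :: 'a assume b: "b \<in> Basis"
    have "C_on k S (\<lambda>x. pdiff b g x *\<^sub>R pdiff 1 h (g x))"
      by (rule C_on_bilinear[OF bounded_bilinear_scaleR assms d(2)[OF b]
            Suc.IH[OF d(4) C_on_Suc_imp[OF assms Suc.prems(2)]]]) simp
    then show "C_on k S (pdiff b (\<lambda>x. h (g x)))"
      by (rule C_on_cong[OF assms, rotated]) (use d in \<open>auto simp: pdiff_compose_real(2)\<close>)
  next
    show "(\<lambda>x. h (g x)) differentiable (at x)" if "x \<in> S" for x
      by (rule pdiff_compose_real(1)[OF d(1)[OF that] d(3)]) simp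
  qed
qed

lemma C_on_linear:
  fixes L :: "'a::euclidean_space \<Rightarrow> 'b::real_normed_vector"
  assumes "bounded_linear L"
  shows "C_on k S L"
proof (cases k)
  case 0
  then show ?thesis using assms by (auto intro: linear_continuous_on)
next
  case (Suc j)
  have d: "(L has_derivative L) (at x)" for x using assms by (rule bounded_linear_imp_has_derivative)
  have "pdiff b L = (\<lambda>x. L b)" for b by (rule ext) (rule pdiff_has_derivative[OF d])
  then show ?thesis
    unfolding Suc using d by (intro C_on_SucI) (auto simp add: C_on_const intro: differentiableI)
qed

lemma smooth_onD: "smooth_on S f \<Longrightarrow> C_on k S f"
  by (simp add: smooth_on_def)

lemma smooth_on_imp_continuous_on: "smooth_on S f \<Longrightarrow> continuous_on S f"
  using smooth_onD[of S f 0] by simp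

lemma smooth_on_differentiable:
  assumes "open S" "smooth_on S f" "x \<in> S"
  shows "f differentiable (at x)"
  by (rule C_on_SucD(1)[OF assms(1) smooth_onD[OF assms(2)] assms(3)])

lemma smooth_on_pdiff:
  assumes "open S" "smooth_on S f" "b \<in> Basis"
  shows "smooth_on S (pdiff b f)"
  unfolding smooth_on_def by (intro allI C_on_SucD(2)[OF assms(1) smooth_onD[OF assms(2)] assms(3)])

lemma smooth_on_cong:
  "open S \<Longrightarrow> (\<And>x. x \<in> S \<Longrightarrow> f x = g x) \<Longrightarrow> smooth_on S f \<Longrightarrow> smooth_on S g"
  unfolding smooth_on_def by (metis C_on_cong)

lemma smooth_on_const [simp]: "smooth_on S (\<lambda>x. c)"
  unfolding smooth_on_def by (simp add: C_on_const)

lemma smooth_on_add: "open S \<Longrightarrow> smooth_on S f \<Longrightarrow> smooth_on S g \<Longrightarrow> smooth_on S (\<lambda>x. f x + g x)"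
  unfolding smooth_on_def by (simp add: C_on_add)

lemma smooth_on_sum:
  "open S \<Longrightarrow> (\<And>i. i \<in> I \<Longrightarrow> smooth_on S (f i)) \<Longrightarrow> smooth_on S (\<lambda>x. \<Sum>i\<in>I. f i x)"
  unfolding smooth_on_def by (simp add: C_on_sum)

lemma smooth_on_mult:
  fixes f g :: "'a::euclidean_space \<Rightarrow> 'b::real_normed_algebra"
  shows "open S \<Longrightarrow> smooth_on S f \<Longrightarrow> smooth_on S g \<Longrightarrow> smooth_on S (\<lambda>x. f x * g x)"
  unfolding smooth_on_def by (simp add: C_on_bilinear[OF bounded_bilinear_mult])

lemma smooth_on_scaleR:
  "open S \<Longrightarrow> smooth_on S f \<Longrightarrow> smooth_on S g \<Longrightarrow> smooth_on S (\<lambda>x. f x *\<^sub>R g x)"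
  unfolding smooth_on_def by (simp add: C_on_bilinear[OF bounded_bilinear_scaleR])

lemma smooth_on_inner:
  "open S \<Longrightarrow> smooth_on S f \<Longrightarrow> smooth_on S g \<Longrightarrow> smooth_on S (\<lambda>x. f x \<bullet> g x)"
  unfolding smooth_on_def by (simp add: C_on_bilinear[OF bounded_bilinear_inner])

lemma smooth_on_linear: "bounded_linear L \<Longrightarrow> smooth_on S L"
  unfolding smooth_on_def by (simp add: C_on_linear)

lemma smooth_on_uminus:
  fixes f :: "'a::euclidean_space \<Rightarrow> 'b::real_normed_vector"
  shows "open S \<Longrightarrow> smooth_on S f \<Longrightarrow> smooth_on S (\<lambda>x. - f x)"
  using smooth_on_scaleR[of S "\<lambda>x. -1" f] by simp

lemma smooth_on_diff:
  fixes f :: "'a::euclidean_space \<Rightarrow> 'b::real_normed_vector"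
  shows "open S \<Longrightarrow> smooth_on S f \<Longrightarrow> smooth_on S g \<Longrightarrow> smooth_on S (\<lambda>x. f x - g x)"
  using smooth_on_add[OF _ _ smooth_on_uminus, of S f g] by simp

lemma smooth_on_compose_linear:
  fixes f :: "'c::euclidean_space \<Rightarrow> 'b::real_normed_vector"
  assumes "bounded_linear (L :: 'a::euclidean_space \<Rightarrow> 'c)" "open S" "open T"
    "\<And>x. x \<in> S \<Longrightarrow> L x + c \<in> T" "smooth_on T f"
  shows "smooth_on S (\<lambda>x. f (L x + c))"
  using assms unfolding smooth_on_def by (auto intro: C_on_compose_linear)

lemma smooth_on_compose_linear0:
  fixes f :: "'c::euclidean_space \<Rightarrow> 'b::real_normed_vector"
  assumes "bounded_linear (L :: 'a::euclidean_space \<Rightarrow> 'c)" "open S" "open T"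
    "\<And>x. x \<in> S \<Longrightarrow> L x \<in> T" "smooth_on T f"
  shows "smooth_on S (\<lambda>x. f (L x))"
  using smooth_on_compose_linear[of L S T 0 f] assms by auto

lemma smooth_on_compose_real:
  fixes h :: "real \<Rightarrow> 'b::real_normed_vector" and g :: "'a::euclidean_space \<Rightarrow> real"
  shows "open S \<Longrightarrow> smooth_on UNIV h \<Longrightarrow> smooth_on S g \<Longrightarrow> smooth_on S (\<lambda>x. h (g x))"
  unfolding smooth_on_def by (auto intro: C_on_compose_real)

text \<open>The induction on the order of differentiability runs over all members of the sequence at
  once. Applied to \<open>\<i> ^ n * cis t\<close> it gives the smoothness of
  \<open>cis\<close>.\<close>

lemma smooth_on_real_derivs:
  fixes h :: "nat \<Rightarrow> real \<Rightarrow> 'b::real_normed_vector"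
  assumes "\<And>n t. (h n has_vector_derivative h (Suc n) t) (at t)"
  shows "smooth_on UNIV (h n)"
proof -
  have "pdiff b (h n) = h (Suc n)" if "b \<in> Basis" for b n
    using that pdiff_has_derivative[OF assms[unfolded has_vector_derivative_def]] by auto
  moreover have "h n differentiable (at t)" for n t
    using assms by (metis differentiableI_vector)
  ultimately have "C_on k UNIV (h n)" for k n
  proof (induction k arbitrary: n)
    case 0
    then show ?case by (simp add: continuous_at_imp_continuous_on differentiable_imp_continuous_within)
  next
    case (Suc k)
    then show ?case by (intro C_on_SucI) auto
  qed
  then show ?thesis unfolding smooth_on_def by blast
qed

lemma has_vector_derivative_cis: "(cis has_vector_derivative \<i> * cis t) (at t)"
proof -
  have "((\<lambda>t. exp (\<i> * complex_of_real t)) has_vector_derivative \<i> * exp (\<i> * complex_of_real t)) (at t)"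
    by (auto intro!: derivative_eq_intros)
  then show ?thesis by (simp add: cis_conv_exp[abs_def])
qed

lemma smooth_on_cis:
  fixes g :: "'a::euclidean_space \<Rightarrow> real"
  assumes "open S" "smooth_on S g"
  shows "smooth_on S (\<lambda>x. cis (g x))"
proof -
  have "((\<lambda>t. \<i> ^ n * cis t) has_vector_derivative \<i> ^ Suc n * cis t) (at t)" for n t
    using has_vector_derivative_mult_right[OF has_vector_derivative_cis, of "\<i> ^ n" t]
    by (simp add: mult.commute mult.left_commute)
  from smooth_on_real_derivs[of "\<lambda>n t. \<i> ^ n * cis t" 0, OF this]
  have "smooth_on UNIV cis" by simp
  from smooth_on_compose_real[OF assms(1) this assms(2)] show ?thesis .
qed

lemma differentiable_cis:
  fixes g :: "'a::euclidean_space \<Rightarrow> real"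
  assumes "g differentiable (at x)"
  shows "(\<lambda>x. cis (g x)) differentiable (at x)"
    and "pdiff b (\<lambda>x. cis (g x)) x = \<i> * complex_of_real (pdiff b g x) * cis (g x)"
proof -
  have c: "cis differentiable (at t)" for t using has_vector_derivative_cis by (metis differentiableI_vector)
  show "(\<lambda>x. cis (g x)) differentiable (at x)" by (rule pdiff_compose_real(1)[OF assms c])
  have "pdiff 1 cis t = \<i> * cis t" for t
    using pdiff_has_derivative[OF has_vector_derivative_cis[unfolded has_vector_derivative_def]] by simp
  then show "pdiff b (\<lambda>x. cis (g x)) x = \<i> * complex_of_real (pdiff b g x) * cis (g x)"
    by (simp add: pdiff_compose_real(2)[OF assms c] scaleR_conv_of_real mult_ac)
qed

lemma pdiff_inner_left [simp]:
  "pdiff b (\<lambda>x. x \<bullet> c) x = b \<bullet> c" "pdiff b (\<lambda>x. c \<bullet> x) x = c \<bullet> b"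
  by (auto intro!: pdiff_has_derivative derivative_eq_intros)

lemma pdiff_cis_inner:
  "(\<lambda>x. cis (x \<bullet> c)) differentiable (at x)"
  "pdiff b (\<lambda>x. cis (x \<bullet> c)) x = \<i> * complex_of_real (b \<bullet> c) * cis (x \<bullet> c)"
  "(\<lambda>x. cis (c \<bullet> x)) differentiable (at x)"
  "pdiff b (\<lambda>x. cis (c \<bullet> x)) x = \<i> * complex_of_real (c \<bullet> b) * cis (c \<bullet> x)"
proof -
  have i: "(\<lambda>x. x \<bullet> c) differentiable (at x)" "(\<lambda>x. c \<bullet> x) differentiable (at x)"
    by (auto intro!: derivative_eq_intros simp: differentiable_def)
  show "(\<lambda>x. cis (x \<bullet> c)) differentiable (at x)"
   "pdiff b (\<lambda>x. cis (x \<bullet> c)) x = \<i> * complex_of_real (b \<bullet> c) * cis (x \<bullet> c)"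
   "(\<lambda>x. cis (c \<bullet> x)) differentiable (at x)"
   "pdiff b (\<lambda>x. cis (c \<bullet> x)) x = \<i> * complex_of_real (c \<bullet> b) * cis (c \<bullet> x)"
    using differentiable_cis[OF i(1)] differentiable_cis[OF i(2)] by auto
qed

text \<open>Second differences are symmetric in \<open>a\<close> and \<open>b\<close>; dividing by \<open>t\<^sup>2\<close> gives the symmetry of mixed derivatives.\<close>

lemma second_difference_estimate:
  fixes f :: "'a::euclidean_space \<Rightarrow> 'b::real_normed_vector"
  assumes U: "open U" "x \<in> U" "\<And>y. y \<in> U \<Longrightarrow> f differentiable (at y)"
    and G: "pdiff a f differentiable (at x)" and e: "e > 0"
  shows "\<exists>d>0. \<forall>t. 0 < t \<and> t < d \<longrightarrow>
    norm (f (x + t *\<^sub>R a + t *\<^sub>R b) - f (x + t *\<^sub>R a) - f (x + t *\<^sub>R b) + f x - t\<^sup>2 *\<^sub>R pdiff b (pdiff a f) x) \<le> e * t\<^sup>2"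
proof -
  define G where "G = pdiff a f"
  obtain G' where G': "(G has_derivative G') (at x)" using G unfolding G_def differentiable_def by blast
  interpret G': bounded_linear G' using G' by (rule has_derivative_bounded_linear)
  define D where "D = pdiff b (pdiff a f) x"
  have D: "D = G' b" unfolding D_def G_def[symmetric] by (rule pdiff_has_derivative[OF G'])
  define c where "c = norm a + norm b + 1"
  have c: "c > 0" unfolding c_def by (smt (verit) norm_ge_zero)
  \<comment> \<open>Two linearisation errors of \<open>G\<close>, at points within
    \<open>t * c\<close> of \<open>x\<close>, have to add up to at most
    \<open>e * t\<close>.\<close>
  define \<epsilon> where "\<epsilon> = e / (2 * c)"
  have \<epsilon>: "\<epsilon> > 0" unfolding \<epsilon>_def using e c by simp
  obtain d1 where d1: "d1 > 0" "\<And>y. norm (y - x) < d1 \<Longrightarrow> norm (G y - G x - G' (y - x)) \<le> \<epsilon> * norm (y - x)"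
    using G' \<epsilon> unfolding has_derivative_at_alt by blast
  obtain d2 where d2: "d2 > 0" "ball x d2 \<subseteq> U" using U openE by blast
  define d where "d = min d1 d2 / c"
  have "norm (f (x + t *\<^sub>R a + t *\<^sub>R b) - f (x + t *\<^sub>R a) - f (x + t *\<^sub>R b) + f x - t\<^sup>2 *\<^sub>R D) \<le> e * t\<^sup>2"
    if t: "0 < t" "t < d" for t
  proof -
    have tc: "t * c < min d1 d2" using t c unfolding d_def by (simp add: pos_less_divide_eq)
    have n1: "norm (s *\<^sub>R a + t *\<^sub>R b) \<le> t * c" and n2: "norm (s *\<^sub>R a) \<le> t * c" if "s \<in> {0..t}" for s
    proof -
      have "norm (s *\<^sub>R a) \<le> t * norm a" using that by (simp add: mult_right_mono)
      moreover have "norm (s *\<^sub>R a + t *\<^sub>R b) \<le> norm (s *\<^sub>R a) + t * norm b"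
        using norm_triangle_ineq[of "s *\<^sub>R a" "t *\<^sub>R b"] t by simp
      ultimately show "norm (s *\<^sub>R a + t *\<^sub>R b) \<le> t * c" "norm (s *\<^sub>R a) \<le> t * c"
        using t unfolding c_def by (auto simp: algebra_simps add_increasing2) (smt (verit) mult_nonneg_nonneg norm_ge_zero)
    qed
    have inU: "x + s *\<^sub>R a + t *\<^sub>R b \<in> U" "x + s *\<^sub>R a \<in> U" if "s \<in> {0..t}" for s
    proof -
      have "dist x (x + (s *\<^sub>R a + t *\<^sub>R b)) < d2" "dist x (x + s *\<^sub>R a) < d2"
        using n1[OF that] n2[OF that] tc unfolding dist_norm by (simp_all only: norm_minus_commute[of x]) auto
      then have "x + s *\<^sub>R a + t *\<^sub>R b \<in> ball x d2" "x + s *\<^sub>R a \<in> ball x d2"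
        by (simp_all add: add.assoc)
      then show "x + s *\<^sub>R a + t *\<^sub>R b \<in> U" "x + s *\<^sub>R a \<in> U" using d2 by auto
    qed
    \<comment> \<open>The second difference, corrected by its expected value, is
      \<open>g t - g 0\<close>. The mean value inequality for \<open>g\<close> leaves a first
      difference of \<open>G = pdiff a f\<close>, and for that differentiability of \<open>G\<close>
      at the single point \<open>x\<close> suffices.\<close>
    define g where "g s = f (x + s *\<^sub>R a + t *\<^sub>R b) - f (x + s *\<^sub>R a) - (s * t) *\<^sub>R D" for s
    have fd: "((\<lambda>s. f (y + s *\<^sub>R a)) has_vector_derivative G (y + s *\<^sub>R a)) (at s)"
      if y: "y + s *\<^sub>R a \<in> U" for y s
    proof -
      obtain f' where f': "(f has_derivative f') (at (y + s *\<^sub>R a))"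
        using U(3)[OF y] unfolding differentiable_def by blast
      interpret f': bounded_linear f' using f' by (rule has_derivative_bounded_linear)
      have "((\<lambda>s. y + s *\<^sub>R a) has_derivative (\<lambda>h. h *\<^sub>R a)) (at s)"
        by (auto intro!: derivative_eq_intros)
      from has_derivative_compose[OF this f'] show ?thesis
        unfolding has_vector_derivative_def G_def using pdiff_has_derivative[OF f', of a]
        by (simp add: f'.scaleR)
    qed
    have gd: "(g has_vector_derivative (G (x + s *\<^sub>R a + t *\<^sub>R b) - G (x + s *\<^sub>R a) - t *\<^sub>R D)) (at s within {0..t})"
      if "s \<in> {0..t}" for s
    proof -
      have "((\<lambda>s. f ((x + t *\<^sub>R b) + s *\<^sub>R a)) has_vector_derivative G ((x + t *\<^sub>R b) + s *\<^sub>R a)) (at s)"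
        by (rule fd) (use inU(1)[OF that] in \<open>simp add: ac_simps\<close>)
      then have 1: "((\<lambda>s. f (x + s *\<^sub>R a + t *\<^sub>R b)) has_vector_derivative G (x + s *\<^sub>R a + t *\<^sub>R b)) (at s)"
        by (simp add: ac_simps)
      note 2 = fd[OF inU(2)[OF that]]
      have 3: "((\<lambda>s. (s * t) *\<^sub>R D) has_vector_derivative t *\<^sub>R D) (at s)"
        unfolding has_vector_derivative_def by (auto intro!: derivative_eq_intros)
      show ?thesis unfolding g_def
        by (rule has_vector_derivative_at_within)
          (intro has_vector_derivative_diff 1 2 3)
    qed
    have bd: "norm (G (x + s *\<^sub>R a + t *\<^sub>R b) - G (x + s *\<^sub>R a) - t *\<^sub>R D) \<le> e * t" if "s \<in> {0..t}" for s
    proof -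
      have 1: "norm (G (x + s *\<^sub>R a + t *\<^sub>R b) - G x - G' (s *\<^sub>R a + t *\<^sub>R b)) \<le> \<epsilon> * norm (s *\<^sub>R a + t *\<^sub>R b)"
        using d1(2)[of "x + s *\<^sub>R a + t *\<^sub>R b"] n1[OF that] tc by (simp add: add.assoc)
      have 2: "norm (G (x + s *\<^sub>R a) - G x - G' (s *\<^sub>R a)) \<le> \<epsilon> * norm (s *\<^sub>R a)"
        using d1(2)[of "x + s *\<^sub>R a"] n2[OF that] tc by simp
      have eq: "G (x + s *\<^sub>R a + t *\<^sub>R b) - G (x + s *\<^sub>R a) - t *\<^sub>R D =
        (G (x + s *\<^sub>R a + t *\<^sub>R b) - G x - G' (s *\<^sub>R a + t *\<^sub>R b)) - (G (x + s *\<^sub>R a) - G x - G' (s *\<^sub>R a))"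
        by (simp add: D G'.add G'.scaleR)
      have "norm (G (x + s *\<^sub>R a + t *\<^sub>R b) - G (x + s *\<^sub>R a) - t *\<^sub>R D)
        \<le> \<epsilon> * norm (s *\<^sub>R a + t *\<^sub>R b) + \<epsilon> * norm (s *\<^sub>R a)"
        unfolding eq using norm_triangle_ineq4[of "G (x + s *\<^sub>R a + t *\<^sub>R b) - G x - G' (s *\<^sub>R a + t *\<^sub>R b)" "G (x + s *\<^sub>R a) - G x - G' (s *\<^sub>R a)"] 1 2
        by linarith
      also have "\<dots> \<le> \<epsilon> * (t * c) + \<epsilon> * (t * c)"
        using n1[OF that] n2[OF that] \<epsilon> by (intro add_mono mult_left_mono) auto
      also have "\<dots> = e * t" unfolding \<epsilon>_def using c by (simp add: field_simps)
      finally show ?thesis .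
    qed
    have "norm (g t - g 0) \<le> (e * t) * norm (t - 0)"
    proof (rule differentiable_bound[of "{0..t}" g "\<lambda>s h. h *\<^sub>R (G (x + s *\<^sub>R a + t *\<^sub>R b) - G (x + s *\<^sub>R a) - t *\<^sub>R D)"])
      show "(g has_derivative (\<lambda>h. h *\<^sub>R (G (x + s *\<^sub>R a + t *\<^sub>R b) - G (x + s *\<^sub>R a) - t *\<^sub>R D))) (at s within {0..t})"
        if "s \<in> {0..t}" for s using gd[OF that] unfolding has_vector_derivative_def .
      show "onorm (\<lambda>h::real. h *\<^sub>R (G (x + s *\<^sub>R a + t *\<^sub>R b) - G (x + s *\<^sub>R a) - t *\<^sub>R D)) \<le> e * t"
        if "s \<in> {0..t}" for s
        by (rule onorm_le) (use bd[OF that] in \<open>simp add: mult.commute mult_left_mono\<close>)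
    qed (use t in auto)
    moreover have "g t - g 0 = f (x + t *\<^sub>R a + t *\<^sub>R b) - f (x + t *\<^sub>R a) - f (x + t *\<^sub>R b) + f x - t\<^sup>2 *\<^sub>R D"
      unfolding g_def by (simp add: power2_eq_square)
    ultimately show ?thesis using t by (simp add: power2_eq_square mult.assoc)
  qed
  moreover have "d > 0" unfolding d_def using d1 d2 c by simp
  ultimately show ?thesis unfolding D_def by blast
qed

lemma pdiff_commute:
  fixes f :: "'a::euclidean_space \<Rightarrow> 'b::real_normed_vector"
  assumes U: "open U" "x \<in> U" "\<And>y. y \<in> U \<Longrightarrow> f differentiable (at y)"
    and G: "pdiff a f differentiable (at x)" "pdiff b f differentiable (at x)"
  shows "pdiff b (pdiff a f) x = pdiff a (pdiff b f) x"
proof (rule ccontr)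
  assume ne: "\<not> ?thesis"
  \<comment> \<open>A third of the gap: both mixed derivatives, multiplied by
    \<open>t\<^sup>2\<close>, lie within \<open>e * t\<^sup>2\<close> of the same second difference,
    so the gap \<open>3 * e\<close> would be at most \<open>2 * e\<close>.\<close>
  define e where "e = norm (pdiff b (pdiff a f) x - pdiff a (pdiff b f) x) / 3"
  have e: "e > 0" unfolding e_def using ne by simp
  obtain d1 where d1: "d1 > 0" "\<And>t. 0 < t \<Longrightarrow> t < d1 \<Longrightarrow>
    norm (f (x + t *\<^sub>R a + t *\<^sub>R b) - f (x + t *\<^sub>R a) - f (x + t *\<^sub>R b) + f x - t\<^sup>2 *\<^sub>R pdiff b (pdiff a f) x) \<le> e * t\<^sup>2"
    using second_difference_estimate[OF U G(1) e, of b] by blast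
  obtain d2 where d2: "d2 > 0" "\<And>t. 0 < t \<Longrightarrow> t < d2 \<Longrightarrow>
    norm (f (x + t *\<^sub>R b + t *\<^sub>R a) - f (x + t *\<^sub>R b) - f (x + t *\<^sub>R a) + f x - t\<^sup>2 *\<^sub>R pdiff a (pdiff b f) x) \<le> e * t\<^sup>2"
    using second_difference_estimate[OF U G(2) e, of a] by blast
  define t where "t = min d1 d2 / 2"
  have t: "0 < t" "t < d1" "t < d2" unfolding t_def using d1(1) d2(1) by auto
  define X where "X = f (x + t *\<^sub>R a + t *\<^sub>R b) - f (x + t *\<^sub>R a) - f (x + t *\<^sub>R b) + f x"
  have 1: "norm (X - t\<^sup>2 *\<^sub>R pdiff b (pdiff a f) x) \<le> e * t\<^sup>2"
    unfolding X_def using d1(2) t by blast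
  have 2: "norm (X - t\<^sup>2 *\<^sub>R pdiff a (pdiff b f) x) \<le> e * t\<^sup>2"
    using d2(2)[OF t(1,3)] unfolding X_def by (simp add: algebra_simps)
  define v where "v = pdiff b (pdiff a f) x - pdiff a (pdiff b f) x"
  have veq: "t\<^sup>2 *\<^sub>R v = (X - t\<^sup>2 *\<^sub>R pdiff a (pdiff b f) x) - (X - t\<^sup>2 *\<^sub>R pdiff b (pdiff a f) x)"
    unfolding v_def by (simp add: scaleR_diff_right)
  have "norm (t\<^sup>2 *\<^sub>R v) \<le> 2 * (e * t\<^sup>2)"
    unfolding veq mult_2 by (rule order_trans[OF norm_triangle_ineq4 add_mono[OF 2 1]])
  then have "t\<^sup>2 * (3 * e) \<le> t\<^sup>2 * (2 * e)" unfolding e_def v_def[symmetric] by (simp add: mult_ac)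
  then show False using t e by (simp add: mult_le_cancel_left)
qed

section \<open>Iterated derivatives along words in the basis, and their relation to
  multi-indices\<close>

definition ider :: "'a::euclidean_space list \<Rightarrow> ('a \<Rightarrow> 'b::real_normed_vector) \<Rightarrow> 'a \<Rightarrow> 'b" where
  "ider l f = foldr pdiff l f"

lemma ider_simps [simp]: "ider [] f = f" "ider (b # l) f = pdiff b (ider l f)"
  by (auto simp: ider_def)

lemma ider_append: "ider (l @ l') f = ider l (ider l' f)"
  by (simp add: ider_def)

lemma smooth_on_ider: "open S \<Longrightarrow> smooth_on S f \<Longrightarrow> set l \<subseteq> Basis \<Longrightarrow> smooth_on S (ider l f)"
  by (induction l) (auto intro: smooth_on_pdiff)

lemma ider_cong_open:
  assumes "open S" "\<And>x. x \<in> S \<Longrightarrow> f x = g x"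
  shows "x \<in> S \<Longrightarrow> ider l f x = ider l g x"
proof (induction l arbitrary: x)
  case (Cons b l)
  show ?case unfolding ider_simps by (rule pdiff_cong_open[OF assms(1) Cons.prems Cons.IH])
qed (simp add: assms)

lemma ider_move:
  assumes "open S" "smooth_on S f" "set u \<subseteq> Basis" "b \<in> Basis" "x \<in> S"
  shows "ider u (pdiff b f) x = pdiff b (ider u f) x"
  using assms(3,5)
proof (induction u arbitrary: x)
  case (Cons a u)
  have s: "smooth_on S (ider u f)" using assms Cons.prems by (auto intro: smooth_on_ider)
  have "ider (a # u) (pdiff b f) x = pdiff a (pdiff b (ider u f)) x"
    unfolding ider_simps
    by (rule pdiff_cong_open[OF assms(1) Cons.prems(2)]) (use Cons in auto)
  also have "\<dots> = pdiff b (pdiff a (ider u f)) x"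
    by (rule pdiff_commute[OF assms(1) Cons.prems(2)])
      (use Cons.prems smooth_on_differentiable[OF assms(1)] smooth_on_pdiff[OF assms(1) s] s assms(4) in auto)
  finally show ?case by simp
qed auto

text \<open>The first letter of \<open>l\<close> occurs somewhere in \<open>l'\<close>, and
  \<open>ider_move\<close> pulls it to the front there. The induction hypothesis is needed on all of
  \<open>S\<close>, so that it can be differentiated once more.\<close>

lemma ider_mset:
  assumes "open S"
  shows "smooth_on S f \<Longrightarrow> mset l = mset l' \<Longrightarrow> set l \<subseteq> Basis \<Longrightarrow> x \<in> S \<Longrightarrow> ider l f x = ider l' f x"
proof (induction l arbitrary: l' x)
  case (Cons b l)
  have "b \<in> set l'" using Cons.prems(2) by (metis list.set_intros(1) set_mset_mset)
  then obtain u v where l': "l' = u @ b # v" by (meson split_list)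
  have m: "mset l = mset (u @ v)" using Cons.prems(2) unfolding l' by simp
  have B: "set u \<subseteq> Basis" "set v \<subseteq> Basis" "b \<in> Basis"
    using Cons.prems(3) mset_eq_setD[OF m] by auto
  have "ider l' f x = pdiff b (ider u (ider v f)) x"
    unfolding l' ider_append ider_simps
    by (rule ider_move[OF assms]) (use B Cons.prems assms in \<open>auto intro: smooth_on_ider\<close>)
  also have "\<dots> = pdiff b (ider l f) x"
    by (rule pdiff_cong_open[OF assms Cons.prems(4)])
      (use Cons.IH[OF Cons.prems(1) m] Cons.prems(3) in \<open>auto simp: ider_append\<close>)
  finally show ?case by simp
qed auto

lemma basis_list: "distinct (basis_list :: 'a::euclidean_space list)" "set basis_list = (Basis :: 'a set)"
proof -
  have "\<exists>bs. distinct bs \<and> set bs = (Basis :: 'a set)"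
    using finite_distinct_list[OF finite_Basis] by blast
  from someI_ex[OF this] show "distinct (basis_list :: 'a list)" "set basis_list = (Basis :: 'a set)"
    unfolding basis_list_def by auto
qed

text \<open>The canonical word of a multi-index. Together with \<open>count (mset l)\<close> in the
  other direction it identifies multi-indices with words up to permutation.\<close>

definition mword :: "('a::euclidean_space \<Rightarrow> nat) \<Rightarrow> 'a list" where
  "mword \<alpha> = concat (map (\<lambda>b. replicate (\<alpha> b) b) basis_list)"

lemma mderiv_eq_ider: "mderiv \<alpha> f = ider (mword \<alpha>) f"
proof -
  have r: "(pdiff b ^^ n) g = ider (replicate n b) g" for b :: 'a and n and g :: "'a \<Rightarrow> 'b"
    by (induction n) auto
  have "foldr (\<lambda>b g. (pdiff b ^^ \<alpha> b) g) bs f = ider (concat (map (\<lambda>b. replicate (\<alpha> b) b) bs)) f" for bs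
    by (induction bs) (auto simp: r ider_append)
  then show ?thesis unfolding mderiv_def mword_def .
qed

lemma set_mword: "set (mword \<alpha>) \<subseteq> Basis"
  unfolding mword_def by (auto simp: basis_list(2) split: if_splits)

lemma count_concat_replicate:
  "distinct bs \<Longrightarrow> count (mset (concat (map (\<lambda>b. replicate (\<alpha> b) b) bs))) b = (if b \<in> set bs then \<alpha> b else 0)"
  by (induction bs) auto

lemma count_mword: "\<alpha> \<in> multi_indices \<Longrightarrow> count (mset (mword \<alpha>)) = \<alpha>"
  unfolding mword_def using count_concat_replicate[OF basis_list(1), of \<alpha>]
  by (auto simp: multi_indices_def basis_list(2) fun_eq_iff)

lemma length_mword: "length (mword \<alpha>) = mlen \<alpha>"
proof -
  have "length (mword \<alpha>) = sum_list (map \<alpha> basis_list)"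
    unfolding mword_def by (simp add: length_concat comp_def)
  also have "\<dots> = mlen \<alpha>" unfolding mlen_def basis_list(2)[symmetric]
    by (rule sum_list_distinct_conv_sum_set[OF basis_list(1)])
  finally show ?thesis .
qed

lemma count_list_multi_index: "set l \<subseteq> Basis \<Longrightarrow> count (mset l) \<in> multi_indices"
  by (auto simp: multi_indices_def count_eq_zero_iff)

lemma mset_mword_count: "set l \<subseteq> Basis \<Longrightarrow> mset (mword (count (mset l))) = mset l"
  by (rule multiset_eqI) (simp add: count_mword[OF count_list_multi_index])

lemma ider_eq_mderiv:
  "open S \<Longrightarrow> smooth_on S f \<Longrightarrow> set l \<subseteq> Basis \<Longrightarrow> x \<in> S \<Longrightarrow> ider l f x = mderiv (count (mset l)) f x"
  unfolding mderiv_eq_ider by (rule ider_mset) (auto simp: mset_mword_count)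

subsection \<open>Differentiation under the integral sign\<close>

text \<open>Dominated convergence for difference quotients along sequences. By the mean value
  inequality on the convex ball, a bound for the partial derivatives bounds the quotients too, by a
  multiple of the same \<open>g\<close>.\<close>

lemma has_derivative_integral_dominated:
  fixes F :: "'z::euclidean_space \<Rightarrow> 'e \<Rightarrow> complex"
  assumes r: "r > 0"
    and int: "\<And>z. z \<in> ball z0 r \<Longrightarrow> integrable M (F z)"
    and der: "\<And>z \<eta>. z \<in> ball z0 r \<Longrightarrow> (\<lambda>z. F z \<eta>) differentiable (at z)"
    and pd: "\<And>b z \<eta>. b \<in> Basis \<Longrightarrow> z \<in> ball z0 r \<Longrightarrow> pdiff b (\<lambda>z. F z \<eta>) z = D b z \<eta>"
    and Dm: "\<And>b. b \<in> Basis \<Longrightarrow> D b z0 \<in> borel_measurable M"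
    and dom: "\<And>b z \<eta>. b \<in> Basis \<Longrightarrow> z \<in> ball z0 r \<Longrightarrow> norm (D b z \<eta>) \<le> g \<eta>"
    and g: "integrable M g"
  shows "((\<lambda>z. \<integral>\<eta>. F z \<eta> \<partial>M) has_derivative (\<lambda>h. \<Sum>b\<in>Basis. (h \<bullet> b) *\<^sub>R (\<integral>\<eta>. D b z0 \<eta> \<partial>M))) (at z0)"
proof -
  have z0: "z0 \<in> ball z0 r" using r by simp
  define n where "n = real DIM('z)"
  define L where "L z \<eta> h = (\<Sum>b\<in>Basis. (h \<bullet> b) *\<^sub>R D b z \<eta>)" for z \<eta> h
  have hd: "((\<lambda>z. F z \<eta>) has_derivative L z \<eta>) (at z)" if "z \<in> ball z0 r" for z \<eta>
    using has_derivative_pdiff[OF der[OF that]] pd[OF _ that] unfolding L_def by simp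
  have Lb: "norm (L z \<eta> h) \<le> n * g \<eta> * norm h" if "z \<in> ball z0 r" for z \<eta> h
  proof -
    have "norm (L z \<eta> h) \<le> (\<Sum>b\<in>(Basis::'z set). norm h * g \<eta>)"
      unfolding L_def
      by (rule sum_norm_le) (use dom[OF _ that] in \<open>auto intro!: mult_mono simp: Basis_le_norm\<close>)
    also have "\<dots> = n * g \<eta> * norm h" by (simp add: n_def)
    finally show ?thesis .
  qed
  have Dint: "integrable M (D b z0)" if "b \<in> Basis" for b
    by (rule Bochner_Integration.integrable_bound[OF g Dm[OF that]])
      (rule AE_I2, use dom[OF that z0] in \<open>auto intro: order_trans[OF _ abs_ge_self]\<close>)
  have Lint: "integrable M (\<lambda>\<eta>. L z0 \<eta> h)" for h
    unfolding L_def by (intro Bochner_Integration.integrable_sum integrable_scaleR_right Dint)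
  define I where "I h = (\<Sum>b\<in>Basis. (h \<bullet> b) *\<^sub>R (\<integral>\<eta>. D b z0 \<eta> \<partial>M))" for h
  have I: "I h = (\<integral>\<eta>. L z0 \<eta> h \<partial>M)" for h
    unfolding I_def L_def by (subst Bochner_Integration.integral_sum) (auto intro: integrable_scaleR_right Dint)
  have bl: "bounded_linear I"
    unfolding I_def by (intro bounded_linear_sum bounded_linear_scaleR_const bounded_linear_inner_left)
  have "(\<lambda>h. norm ((\<integral>\<eta>. F (z0 + h) \<eta> \<partial>M) - (\<integral>\<eta>. F z0 \<eta> \<partial>M) - I h) / norm h) \<midarrow>0\<rightarrow> 0"
    unfolding tendsto_at_iff_sequentially
  proof (intro allI impI)
    fix X :: "nat \<Rightarrow> 'z"
    assume X: "\<forall>i. X i \<in> UNIV - {0}" "X \<longlonglongrightarrow> 0"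
    have "\<forall>\<^sub>F i in sequentially. dist (X i) 0 < r" using tendstoD[OF X(2) r] .
    then obtain n0 where n0: "\<And>i. i \<ge> n0 \<Longrightarrow> norm (X i) < r" unfolding eventually_sequentially by auto
    \<comment> \<open>A tail of \<open>X\<close> stays in the ball, where the bounds are available;
      the shift by \<open>n0\<close> is undone at the end.\<close>
    define Y where "Y i = X (i + n0)" for i
    have Y: "Y i \<noteq> 0" "norm (Y i) < r" for i unfolding Y_def using X n0 by auto
    have Y0: "Y \<longlonglongrightarrow> 0" unfolding Y_def by (rule LIMSEQ_ignore_initial_segment[OF X(2)])
    have Yb: "z0 + Y i \<in> ball z0 r" for i using Y[of i] by (simp add: dist_norm)
    define G where "G i \<eta> = (1 / norm (Y i)) *\<^sub>R (F (z0 + Y i) \<eta> - F z0 \<eta> - L z0 \<eta> (Y i))" for i \<eta>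
    have Gi: "integrable M (G i)" for i
      unfolding G_def by (intro integrable_scaleR_right Bochner_Integration.integrable_diff int Yb z0 Lint)
    have Gb: "norm (G i \<eta>) \<le> 2 * n * g \<eta>" for i \<eta>
    proof -
      have "norm (F (z0 + Y i) \<eta> - F z0 \<eta>) \<le> (n * g \<eta>) * norm (z0 + Y i - z0)"
      proof (rule differentiable_bound[of "ball z0 r" "\<lambda>z. F z \<eta>" "\<lambda>z. L z \<eta>"])
        show "((\<lambda>z. F z \<eta>) has_derivative L z \<eta>) (at z within ball z0 r)" if "z \<in> ball z0 r" for z
          using hd[OF that] by (rule has_derivative_at_withinI)
        show "onorm (L z \<eta>) \<le> n * g \<eta>" if "z \<in> ball z0 r" for z
          by (rule onorm_le) (rule Lb[OF that])
      qed (use Yb z0 in auto)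
      then have "norm (F (z0 + Y i) \<eta> - F z0 \<eta> - L z0 \<eta> (Y i)) \<le> n * g \<eta> * norm (Y i) + n * g \<eta> * norm (Y i)"
        using Lb[OF z0, of \<eta> "Y i"] norm_triangle_ineq4[of "F (z0 + Y i) \<eta> - F z0 \<eta>" "L z0 \<eta> (Y i)"]
        by simp
      then have "norm (F (z0 + Y i) \<eta> - F z0 \<eta> - L z0 \<eta> (Y i)) / norm (Y i) \<le> 2 * n * g \<eta>"
        using Y(1)[of i] by (simp add: pos_divide_le_eq)
      moreover have "norm (G i \<eta>) = norm (F (z0 + Y i) \<eta> - F z0 \<eta> - L z0 \<eta> (Y i)) / norm (Y i)"
        unfolding G_def by simp
      ultimately show ?thesis by simp
    qed
    have "(\<lambda>i. \<integral>\<eta>. G i \<eta> \<partial>M) \<longlonglongrightarrow> (\<integral>\<eta>. 0 \<partial>M)"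
    proof (rule integral_dominated_convergence[where w="\<lambda>\<eta>. 2 * n * g \<eta>"])
      show "AE \<eta> in M. (\<lambda>i. G i \<eta>) \<longlonglongrightarrow> 0"
      proof (rule AE_I2)
        fix \<eta>
        have "(\<lambda>h. norm (F (z0 + h) \<eta> - F z0 \<eta> - L z0 \<eta> h) / norm h) \<midarrow>0\<rightarrow> 0"
          using hd[OF z0] unfolding has_derivative_at by blast
        moreover have "\<forall>i. Y i \<in> UNIV - {0}" using Y(1) by auto
        ultimately have "(\<lambda>i. norm (F (z0 + Y i) \<eta> - F z0 \<eta> - L z0 \<eta> (Y i)) / norm (Y i)) \<longlonglongrightarrow> 0"
          unfolding tendsto_at_iff_sequentially using Y0 by (auto simp: comp_def)
        then have "(\<lambda>i. norm (G i \<eta>)) \<longlonglongrightarrow> 0" unfolding G_def by (simp add: divide_inverse mult.commute)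
        then show "(\<lambda>i. G i \<eta>) \<longlonglongrightarrow> 0" by (rule tendsto_norm_zero_cancel)
      qed
    qed (use Gi Gb g in \<open>auto intro: borel_measurable_integrable\<close>)
    then have "(\<lambda>i. norm (\<integral>\<eta>. G i \<eta> \<partial>M)) \<longlonglongrightarrow> 0" using tendsto_norm by fastforce
    moreover have "norm (\<integral>\<eta>. G i \<eta> \<partial>M) =
      norm ((\<integral>\<eta>. F (z0 + Y i) \<eta> \<partial>M) - (\<integral>\<eta>. F z0 \<eta> \<partial>M) - I (Y i)) / norm (Y i)" for i
    proof -
      have "(\<integral>\<eta>. G i \<eta> \<partial>M) = (1 / norm (Y i)) *\<^sub>R ((\<integral>\<eta>. F (z0 + Y i) \<eta> \<partial>M) - (\<integral>\<eta>. F z0 \<eta> \<partial>M) - I (Y i))"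
        unfolding G_def I by (simp add: int[OF Yb] int[OF z0] Lint)
      then show ?thesis by (simp add: divide_inverse mult.commute)
    qed
    ultimately have "(\<lambda>i. norm ((\<integral>\<eta>. F (z0 + X (i + n0)) \<eta> \<partial>M) - (\<integral>\<eta>. F z0 \<eta> \<partial>M) - I (X (i + n0))) / norm (X (i + n0))) \<longlonglongrightarrow> 0"
      unfolding Y_def by simp
    then show "((\<lambda>h. norm ((\<integral>\<eta>. F (z0 + h) \<eta> \<partial>M) - (\<integral>\<eta>. F z0 \<eta> \<partial>M) - I h) / norm h) \<circ> X) \<longlonglongrightarrow> 0"
      unfolding comp_def
      by (rule LIMSEQ_offset[where k = n0 and f = "\<lambda>i. norm ((\<integral>\<eta>. F (z0 + X i) \<eta> \<partial>M) - (\<integral>\<eta>. F z0 \<eta> \<partial>M) - I (X i)) / norm (X i)"])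
  qed
  then show ?thesis unfolding has_derivative_at using bl unfolding I_def by blast
qed

text \<open>The hypotheses of dominated convergence for parameter integrals, packaged so that they
  are stable under sums and can be checked for an integrand and for its partial derivatives
  separately. Majorants on all balls about the origin express local uniformity in
  \<open>z\<close>.\<close>

definition dominated :: "('z::euclidean_space \<Rightarrow> 'e::euclidean_space \<Rightarrow> complex) \<Rightarrow> bool" where
  "dominated F \<longleftrightarrow> continuous_on UNIV (\<lambda>(z, \<eta>). F z \<eta>) \<and>
     (\<forall>R. \<exists>g. integrable lborel g \<and> (\<forall>z \<eta>. norm z \<le> R \<longrightarrow> norm (F z \<eta>) \<le> g \<eta>))"

lemma continuous_on_slice:
  "continuous_on UNIV (\<lambda>(z, \<eta>). F z \<eta>) \<Longrightarrow> continuous_on UNIV (F z)"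
  "continuous_on UNIV (\<lambda>(z, \<eta>). F z \<eta>) \<Longrightarrow> continuous_on UNIV (\<lambda>z. F z \<eta>)"
proof -
  assume c: "continuous_on UNIV (\<lambda>(z, \<eta>). F z \<eta>)"
  have "continuous_on UNIV ((\<lambda>(z, \<eta>). F z \<eta>) \<circ> (\<lambda>\<eta>. (z, \<eta>)))"
    by (rule continuous_on_compose[OF _ continuous_on_subset[OF c]]) (auto intro: continuous_intros)
  then show "continuous_on UNIV (F z)" by (simp add: comp_def)
next
  assume c: "continuous_on UNIV (\<lambda>(z, \<eta>). F z \<eta>)"
  have "continuous_on UNIV ((\<lambda>(z, \<eta>). F z \<eta>) \<circ> (\<lambda>z. (z, \<eta>)))"
    by (rule continuous_on_compose[OF _ continuous_on_subset[OF c]]) (auto intro: continuous_intros)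
  then show "continuous_on UNIV (\<lambda>z. F z \<eta>)" by (simp add: comp_def)
qed

lemma dominatedD:
  assumes "dominated F"
  shows "continuous_on UNIV (\<lambda>(z, \<eta>). F z \<eta>)"
    and "\<exists>g. integrable lborel g \<and> (\<forall>z \<eta>. norm z \<le> R \<longrightarrow> norm (F z \<eta>) \<le> g \<eta>)"
    and "F z \<in> borel_measurable borel" and "integrable lborel (F z)"
proof -
  show c: "continuous_on UNIV (\<lambda>(z, \<eta>). F z \<eta>)"
    and ex: "\<exists>g. integrable lborel g \<and> (\<forall>z \<eta>. norm z \<le> R \<longrightarrow> norm (F z \<eta>) \<le> g \<eta>)" for R
    using assms unfolding dominated_def by blast+
  show m: "F z \<in> borel_measurable borel"
    by (rule borel_measurable_continuous_onI[OF continuous_on_slice(1)[OF c]])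
  obtain g where g: "integrable lborel g" "\<And>z' \<eta>. norm z' \<le> norm z \<Longrightarrow> norm (F z' \<eta>) \<le> g \<eta>"
    using ex[of "norm z"] by blast
  show "integrable lborel (F z)"
    by (rule Bochner_Integration.integrable_bound[OF g(1)])
      (use m g(2)[of z] in \<open>auto intro: order_trans[OF _ abs_ge_self]\<close>)
qed

lemma dominated_add:
  assumes "dominated F" "dominated G"
  shows "dominated (\<lambda>z \<eta>. F z \<eta> + G z \<eta>)"
  unfolding dominated_def
proof (intro conjI allI)
  show "continuous_on UNIV (\<lambda>(z, \<eta>). F z \<eta> + G z \<eta>)"
    using continuous_on_add[OF dominatedD(1)[OF assms(1)] dominatedD(1)[OF assms(2)]]
    by (simp add: split_def)
next
  fix R
  obtain f where f: "integrable lborel f" "\<And>z \<eta>. norm z \<le> R \<Longrightarrow> norm (F z \<eta>) \<le> f \<eta>"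
    using dominatedD(2)[OF assms(1), of R] by blast
  obtain g where g: "integrable lborel g" "\<And>z \<eta>. norm z \<le> R \<Longrightarrow> norm (G z \<eta>) \<le> g \<eta>"
    using dominatedD(2)[OF assms(2), of R] by blast
  have "integrable lborel (\<lambda>\<eta>. f \<eta> + g \<eta>)" using f g by (intro Bochner_Integration.integrable_add)
  moreover have "\<And>z \<eta>. norm z \<le> R \<Longrightarrow> norm (F z \<eta> + G z \<eta>) \<le> f \<eta> + g \<eta>"
    using f(2) g(2) by (meson norm_add_rule_thm norm_triangle_le add_mono)
  ultimately show "\<exists>g. integrable lborel g \<and> (\<forall>z \<eta>. norm z \<le> R \<longrightarrow> norm (F z \<eta> + G z \<eta>) \<le> g \<eta>)"
    by blast
qed

lemma dominated_continuous_integral: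
  fixes F :: "'z::euclidean_space \<Rightarrow> 'e::euclidean_space \<Rightarrow> complex"
  assumes "dominated F"
  shows "continuous_on UNIV (\<lambda>z. \<integral>\<eta>. F z \<eta> \<partial>lborel)"
  unfolding continuous_on_sequentially
proof (intro allI ballI impI)
  fix X :: "nat \<Rightarrow> 'z" and z assume X: "(\<forall>n. X n \<in> UNIV) \<and> X \<longlonglongrightarrow> z"
  then have "Bseq X" by (intro convergent_imp_Bseq) (auto simp: convergent_def)
  then obtain R where R: "\<And>n. norm (X n) \<le> R" unfolding Bseq_def by blast
  obtain g where g: "integrable lborel g" "\<And>z \<eta>. norm z \<le> R \<Longrightarrow> norm (F z \<eta>) \<le> g \<eta>"
    using dominatedD(2)[OF assms, of R] by blast
  have "(\<lambda>n. \<integral>\<eta>. F (X n) \<eta> \<partial>lborel) \<longlonglongrightarrow> (\<integral>\<eta>. F z \<eta> \<partial>lborel)"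
  proof (rule integral_dominated_convergence[OF _ _ g(1)])
    show "AE \<eta> in lborel. (\<lambda>n. F (X n) \<eta>) \<longlonglongrightarrow> F z \<eta>"
    proof (rule AE_I2)
      fix \<eta>
      show "(\<lambda>n. F (X n) \<eta>) \<longlonglongrightarrow> F z \<eta>"
        using continuous_on_slice(2)[OF dominatedD(1)[OF assms], of \<eta>] X
        unfolding continuous_on_sequentially by (auto simp: comp_def)
    qed
  qed (use dominatedD(3)[OF assms] g(2) R in auto)
  then show "((\<lambda>z. \<integral>\<eta>. F z \<eta> \<partial>lborel) \<circ> X) \<longlonglongrightarrow> (\<integral>\<eta>. F z \<eta> \<partial>lborel)" by (simp add: comp_def)
qed

lemma sum_Basis_inner_scaleR:
  fixes c :: "'a::euclidean_space \<Rightarrow> 'b::real_vector"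
  assumes "b \<in> Basis"
  shows "(\<Sum>b'\<in>Basis. (b \<bullet> b') *\<^sub>R c b') = c b"
proof -
  have "(\<Sum>b'\<in>Basis. (b \<bullet> b') *\<^sub>R c b') = (\<Sum>b'\<in>Basis. if b = b' then c b' else 0)"
    by (rule sum.cong) (use assms in \<open>auto simp: inner_Basis\<close>)
  then show ?thesis using assms by simp
qed

lemma dominated_derivative:
  fixes F :: "'z::euclidean_space \<Rightarrow> 'e::euclidean_space \<Rightarrow> complex"
  assumes F: "dominated F" and D: "\<And>b. b \<in> Basis \<Longrightarrow> dominated (D b)"
    and der: "\<And>z \<eta>. (\<lambda>z. F z \<eta>) differentiable (at z)"
    and pd: "\<And>b z \<eta>. b \<in> Basis \<Longrightarrow> pdiff b (\<lambda>z. F z \<eta>) z = D b z \<eta>"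
  shows "(\<lambda>z. \<integral>\<eta>. F z \<eta> \<partial>lborel) differentiable (at z)"
    and "b \<in> Basis \<Longrightarrow> pdiff b (\<lambda>z. \<integral>\<eta>. F z \<eta> \<partial>lborel) z = (\<integral>\<eta>. D b z \<eta> \<partial>lborel)"
proof -
  define R where "R = norm z + 1"
  have "\<forall>b\<in>Basis. \<exists>g. integrable lborel g \<and> (\<forall>z \<eta>. norm z \<le> R \<longrightarrow> norm (D b z \<eta>) \<le> g \<eta>)"
    using dominatedD(2)[OF D] by blast
  then obtain g where g: "\<And>b. b \<in> Basis \<Longrightarrow> integrable lborel (g b)"
    "\<And>b z \<eta>. b \<in> Basis \<Longrightarrow> norm z \<le> R \<Longrightarrow> norm (D b z \<eta>) \<le> g b \<eta>"
    by metis
  have hd: "((\<lambda>z. \<integral>\<eta>. F z \<eta> \<partial>lborel) has_derivative (\<lambda>h. \<Sum>b\<in>Basis. (h \<bullet> b) *\<^sub>R (\<integral>\<eta>. D b z \<eta> \<partial>lborel))) (at z)"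
  proof (rule has_derivative_integral_dominated[where r = 1 and g = "\<lambda>\<eta>. \<Sum>b\<in>Basis. g b \<eta>"])
    show "integrable lborel (\<lambda>\<eta>. \<Sum>b\<in>Basis. g b \<eta>)" using g(1) by (rule Bochner_Integration.integrable_sum)
    fix b w \<eta> assume b: "b \<in> (Basis :: 'z set)" and w: "w \<in> ball z 1"
    have wR: "norm w \<le> R" using w norm_triangle_ineq2[of w z] unfolding R_def by (simp add: dist_norm norm_minus_commute)
    have "norm (D b w \<eta>) \<le> g b \<eta>" by (rule g(2)[OF b wR])
    also have "g b \<eta> \<le> (\<Sum>b\<in>Basis. g b \<eta>)"
      by (rule member_le_sum[OF b]) (use g(2)[OF _ wR] in \<open>auto intro: order_trans[OF norm_ge_zero]\<close>)
    finally show "norm (D b w \<eta>) \<le> (\<Sum>b\<in>Basis. g b \<eta>)" .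
  qed (use der pd dominatedD(3)[OF D] dominatedD(4)[OF F] in auto)
  then show "(\<lambda>z. \<integral>\<eta>. F z \<eta> \<partial>lborel) differentiable (at z)" by (rule differentiableI)
  show "pdiff b (\<lambda>z. \<integral>\<eta>. F z \<eta> \<partial>lborel) z = (\<integral>\<eta>. D b z \<eta> \<partial>lborel)" if "b \<in> Basis"
    using pdiff_has_derivative[OF hd, of b] by (simp add: sum_Basis_inner_scaleR[OF that])
qed

subsection \<open>Bump functions and test functions\<close>

text \<open>The powers of \<open>1 / t\<close> make the family closed under differentiation: the
  derivative of \<open>flat_exp n\<close> is a combination of \<open>flat_exp (n + 2)\<close> and
  \<open>flat_exp (n + 1)\<close>.\<close>

definition flat_exp :: "nat \<Rightarrow> real \<Rightarrow> real" where
  "flat_exp n t = (if t > 0 then (1 / t) ^ n * exp (- (1 / t)) else 0)"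

text \<open>One term of the exponential series at \<open>1 / t\<close>, the one of degree
  \<open>n + 2\<close>, already beats the power \<open>(1 / t) ^ n\<close>. The factor
  \<open>t\<^sup>2\<close> left over makes the difference quotient at the origin tend to
  \<open>0\<close>.\<close>

lemma flat_exp_bound: "\<bar>flat_exp n t\<bar> \<le> fact (n + 2) * t\<^sup>2"
proof (cases "t > 0")
  case True
  define s where "s = 1 / t"
  have s: "s > 0" unfolding s_def using True by simp
  define c :: real where "c = fact (n + 2)"
  have c: "c > 0" unfolding c_def by simp
  have "s ^ (n + 2) / c \<le> exp s"
  proof -
    have "(\<Sum>k\<in>{n + 2}. s ^ k /\<^sub>R fact k) \<le> (\<Sum>k. s ^ k /\<^sub>R fact k)"
      by (rule sum_le_suminf) (use s summable_exp_generic[of s] in auto)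
    then show ?thesis unfolding exp_def c_def by (simp add: divide_inverse mult.commute)
  qed
  then have "s ^ n * s\<^sup>2 \<le> c * exp s" using c by (simp add: pos_divide_le_eq power2_eq_square mult_ac)
  then have "(s ^ n * s\<^sup>2) * exp (- s) \<le> (c * exp s) * exp (- s)" by (rule mult_right_mono) simp
  then have "s ^ n * exp (- s) * s\<^sup>2 \<le> c" by (simp add: exp_minus_inverse mult_ac)
  moreover have "s\<^sup>2 = 1 / t\<^sup>2" by (simp add: s_def power_divide)
  ultimately have "s ^ n * exp (- s) \<le> c * t\<^sup>2" using True by (simp add: pos_divide_le_eq)
  then have "(1 / t) ^ n * exp (- (1 / t)) \<le> fact (n + 2) * t\<^sup>2" unfolding s_def c_def .
  moreover have "0 \<le> (1 / t) ^ n * exp (- (1 / t))" using True by simp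
  ultimately show ?thesis using True unfolding flat_exp_def by (simp del: fact_Suc fact_reduce)
qed (auto simp: flat_exp_def)

lemma flat_exp_has_derivative:
  "(flat_exp n has_real_derivative (flat_exp (n + 2) t - real n * flat_exp (n + 1) t)) (at t)"
proof -
  consider "t > 0" | "t < 0" | "t = 0" by linarith
  then show ?thesis
  proof cases
    case 1
    have d1: "((\<lambda>t. 1 / t) has_real_derivative - ((1 / t)\<^sup>2)) (at t)"
      using 1 by (auto intro!: derivative_eq_intros simp: power2_eq_square)
    have "(1 / t) ^ n * (exp (- (1 / t)) * (- (- ((1 / t)\<^sup>2)))) + real n * (- ((1 / t)\<^sup>2) * (1 / t) ^ (n - Suc 0)) * exp (- (1 / t))
        = flat_exp (n + 2) t - real n * flat_exp (n + 1) t"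
      using 1 by (cases n) (simp_all add: flat_exp_def power2_eq_square algebra_simps)
    with DERIV_mult'[OF DERIV_power[OF d1, of n] DERIV_chain2[OF DERIV_exp DERIV_minus[OF d1]]]
    have "((\<lambda>t. (1 / t) ^ n * exp (- (1 / t))) has_real_derivative (flat_exp (n + 2) t - real n * flat_exp (n + 1) t)) (at t)"
      by simp
    then show ?thesis
      by (rule has_field_derivative_transform_within_open[of _ _ _ "{0<..}"]) (use 1 in \<open>auto simp: flat_exp_def\<close>)
  next
    case 2
    have "((\<lambda>t. 0) has_real_derivative (flat_exp (n + 2) t - real n * flat_exp (n + 1) t)) (at t)"
      using 2 by (simp add: flat_exp_def)
    then show ?thesis
      by (rule has_field_derivative_transform_within_open[of _ _ _ "{..<0}"]) (use 2 in \<open>auto simp: flat_exp_def\<close>)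
  next
    case 3
    have "((\<lambda>h. (flat_exp n (0 + h) - flat_exp n 0) / h) \<longlongrightarrow> 0) (at 0)"
    proof (rule tendsto_0_le[where K = "fact (n + 2)"])
      show "((\<lambda>h. h) \<longlongrightarrow> (0::real)) (at 0)" by (rule tendsto_ident_at)
      show "\<forall>\<^sub>F h in at 0. norm ((flat_exp n (0 + h) - flat_exp n 0) / h) \<le> norm h * fact (n + 2)"
      proof (rule eventually_at_filter[THEN iffD2], rule always_eventually, intro allI impI)
        fix h :: real assume h: "h \<noteq> 0"
        define c :: real where "c = fact (n + 2)"
        have "\<bar>flat_exp n h\<bar> \<le> (\<bar>h\<bar> * c) * \<bar>h\<bar>"
          using flat_exp_bound[of n h] unfolding c_def[symmetric]
          by (metis abs_mult_self_eq mult.assoc mult.commute power2_eq_square)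
        then have "\<bar>flat_exp n h\<bar> / \<bar>h\<bar> \<le> \<bar>h\<bar> * c" using h by (simp add: pos_divide_le_eq)
        then show "norm ((flat_exp n (0 + h) - flat_exp n 0) / h) \<le> norm h * fact (n + 2)"
          unfolding c_def by (simp add: flat_exp_def[of n 0] del: fact_Suc fact_reduce)
      qed
    qed
    then show ?thesis using 3 unfolding DERIV_def by (simp add: flat_exp_def[of _ 0])
  qed
qed

lemma smooth_on_flat_exp: "smooth_on UNIV (flat_exp n)"
proof -
  have pd: "pdiff b (flat_exp n) = (\<lambda>t. flat_exp (n + 2) t + (- real n) * flat_exp (n + 1) t)" if "b \<in> Basis" for b n
    using that pdiff_has_derivative[OF flat_exp_has_derivative[unfolded has_field_derivative_def]] by fastforce
  have d: "flat_exp n differentiable (at t)" for n t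
    using flat_exp_has_derivative[unfolded has_field_derivative_def] by (rule differentiableI)
  have "C_on k UNIV (flat_exp n)" for k n
  proof (induction k arbitrary: n)
    case 0
    then show ?case using d by (simp add: continuous_at_imp_continuous_on differentiable_imp_continuous_within)
  next
    case (Suc k)
    show ?case
    proof (rule C_on_SucI)
      fix b :: real assume "b \<in> Basis"
      then show "C_on k UNIV (pdiff b (flat_exp n))"
        unfolding pd[OF \<open>b \<in> Basis\<close>]
        by (intro C_on_add[OF open_UNIV Suc] C_on_bilinear[OF bounded_bilinear_mult open_UNIV C_on_const Suc])
    qed (rule d)
  qed
  then show ?thesis by (simp add: smooth_on_def)
qed

text \<open>Nesting the flat function gives a smooth step without any division by a sum.\<close>

definition smooth_step :: "real \<Rightarrow> real" where
  "smooth_step t = flat_exp 0 (exp (-1) - flat_exp 0 t) / flat_exp 0 (exp (-1))"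

lemma smooth_step:
  "smooth_on UNIV smooth_step" "t \<le> 0 \<Longrightarrow> smooth_step t = 1" "t \<ge> 1 \<Longrightarrow> smooth_step t = 0"
  "0 \<le> smooth_step t" "smooth_step t \<le> 1"
proof -
  have "smooth_on UNIV (\<lambda>t. (1 / flat_exp 0 (exp (-1))) * flat_exp 0 (exp (-1) - flat_exp 0 t))"
    by (rule smooth_on_mult[OF open_UNIV smooth_on_const smooth_on_compose_real[OF open_UNIV smooth_on_flat_exp
            smooth_on_diff[OF open_UNIV smooth_on_const smooth_on_flat_exp]]])
  then show "smooth_on UNIV smooth_step" by (simp add: smooth_step_def[abs_def])
  have mono: "flat_exp 0 s \<le> flat_exp 0 t" if "s \<le> t" for s t
    using that by (auto simp: flat_exp_def frac_le)
  have p: "flat_exp 0 (exp (-1)) > 0" by (simp add: flat_exp_def)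
  have n: "0 \<le> flat_exp 0 t" for t by (simp add: flat_exp_def)
  show "t \<le> 0 \<Longrightarrow> smooth_step t = 1" using p by (simp add: smooth_step_def flat_exp_def[of 0 t])
  show "0 \<le> smooth_step t" using p n by (simp add: smooth_step_def)
  show "smooth_step t \<le> 1" using p n[of t] mono[of "exp (-1) - flat_exp 0 t" "exp (-1)"] by (simp add: smooth_step_def)
  show "smooth_step t = 0" if "t \<ge> 1"
  proof -
    \<comment> \<open>The constant \<open>exp (-1)\<close> is the value \<open>flat_exp 0 1\<close>,
      so from \<open>t = 1\<close> on the argument of the outer function is nonpositive.\<close>
    have "flat_exp 0 1 \<le> flat_exp 0 t" by (rule mono[OF that])
    then have "exp (-1) - flat_exp 0 t \<le> 0" by (simp add: flat_exp_def[of 0 1])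
    then show ?thesis by (simp add: smooth_step_def flat_exp_def[of 0 "exp (-1) - flat_exp 0 t"])
  qed
qed

text \<open>The squared distance keeps the argument smooth at the centre. The transition of
  \<open>smooth_step\<close> on the unit interval becomes the shell between the radii
  \<open>r\<close> and \<open>sqrt 2 * r\<close>; the strict inequality \<open>sqrt 2 < 2\<close>
  later puts the closed support into the open ball of radius \<open>2 * r\<close>.\<close>

definition bump :: "'a::euclidean_space \<Rightarrow> real \<Rightarrow> 'a \<Rightarrow> complex" where
  "bump z r x = complex_of_real (smooth_step (((x - z) \<bullet> (x - z)) / r\<^sup>2 - 1))"

lemma smooth_on_of_real: "open S \<Longrightarrow> smooth_on S f \<Longrightarrow> smooth_on S (\<lambda>x. complex_of_real (f x))"
  using smooth_on_scaleR[of S f "\<lambda>x. 1 :: complex"] by (simp add: of_real_def)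

lemma bump:
  fixes z :: "'a::euclidean_space"
  assumes r: "r > 0"
  shows "smooth_on UNIV (bump z r)" "norm (x - z) \<le> r \<Longrightarrow> bump z r x = 1"
    "norm (x - z) \<ge> sqrt 2 * r \<Longrightarrow> bump z r x = 0"
    "bump z r x = complex_of_real (Re (bump z r x))" "0 \<le> Re (bump z r x)" "norm (bump z r x) \<le> 1"
proof -
  have s: "smooth_on UNIV (\<lambda>x. x - z)"
    by (intro smooth_on_diff smooth_on_linear bounded_linear_ident open_UNIV smooth_on_const)
  have "smooth_on UNIV (\<lambda>x. (1 / r\<^sup>2) * ((x - z) \<bullet> (x - z)) - 1)"
    by (intro smooth_on_diff smooth_on_mult smooth_on_inner s open_UNIV smooth_on_const)
  from smooth_on_of_real[OF open_UNIV smooth_on_compose_real[OF open_UNIV smooth_step(1) this]]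
  show "smooth_on UNIV (bump z r)" by (simp add: bump_def[abs_def])
  show "bump z r x = 1" if "norm (x - z) \<le> r"
  proof -
    have "(norm (x - z))\<^sup>2 \<le> r\<^sup>2" using that by (simp add: power_mono)
    then have "((x - z) \<bullet> (x - z)) / r\<^sup>2 - 1 \<le> 0" using r by (simp add: power2_norm_eq_inner)
    then show ?thesis by (simp add: bump_def smooth_step(2))
  qed
  show "bump z r x = 0" if "norm (x - z) \<ge> sqrt 2 * r"
  proof -
    have "(sqrt 2 * r)\<^sup>2 \<le> (norm (x - z))\<^sup>2" using that r by (intro power_mono) auto
    then have "2 * r\<^sup>2 \<le> (x - z) \<bullet> (x - z)" by (simp add: power2_norm_eq_inner power_mult_distrib)
    then have "((x - z) \<bullet> (x - z)) / r\<^sup>2 - 1 \<ge> 1" using r by (simp add: field_simps)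
    then show ?thesis by (simp add: bump_def smooth_step(3))
  qed
qed (use smooth_step in \<open>auto simp: bump_def\<close>)

lemma test_functionsI:
  assumes "smooth_on UNIV f" "\<And>x. norm x > R \<Longrightarrow> f x = 0"
  shows "f \<in> test_functions"
proof -
  have "support_on UNIV f \<subseteq> cball 0 R" using assms(2) by (force simp: support_on_def)
  then have "closure (support_on UNIV f) \<subseteq> cball 0 R" by (rule closure_minimal) simp
  then have "bounded (closure (support_on UNIV f))" using bounded_cball bounded_subset by blast
  then show ?thesis using assms(1) by (simp add: test_functions_def compact_eq_bounded_closed)
qed

lemma test_functions_smooth: "f \<in> test_functions \<Longrightarrow> smooth_on UNIV f"
  by (simp add: test_functions_def)

lemma test_functions_continuous: "f \<in> test_functions \<Longrightarrow> continuous_on S f"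
  using continuous_on_subset[OF smooth_on_imp_continuous_on[OF test_functions_smooth] subset_UNIV] .

lemma test_functions_support:
  assumes "f \<in> test_functions"
  obtains R where "R > 0" "\<And>x. norm x > R \<Longrightarrow> f x = 0"
proof -
  have "bounded (closure (support_on UNIV f))"
    using assms by (simp add: test_functions_def compact_imp_bounded)
  then obtain R where R: "R > 0" "\<And>x. x \<in> closure (support_on UNIV f) \<Longrightarrow> norm x \<le> R"
    unfolding bounded_pos by blast
  have "f x = 0" if "norm x > R" for x
  proof (rule ccontr)
    assume "f x \<noteq> 0"
    then have "x \<in> closure (support_on UNIV f)"
      using closure_subset[of "support_on UNIV f"] by (auto simp: support_on_def)
    then show False using R(2) that by fastforce
  qed
  then show ?thesis using that R(1) by blast
qed

lemma test_functions_add: 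
  assumes "f \<in> test_functions" "g \<in> test_functions"
  shows "(\<lambda>x. f x + g x) \<in> test_functions"
proof -
  obtain R where R: "\<And>x. norm x > R \<Longrightarrow> f x = 0" using test_functions_support[OF assms(1)] by metis
  obtain S where S: "\<And>x. norm x > S \<Longrightarrow> g x = 0" using test_functions_support[OF assms(2)] by metis
  show ?thesis
    by (rule test_functionsI[of _ "max R S"])
      (use R S assms in \<open>auto intro: smooth_on_add test_functions_smooth\<close>)
qed

lemma test_functions_mult:
  assumes "f \<in> test_functions" "smooth_on UNIV g"
  shows "(\<lambda>x. f x * g x) \<in> test_functions" "(\<lambda>x. g x * f x) \<in> test_functions"
proof -
  obtain R where R: "\<And>x. norm x > R \<Longrightarrow> f x = 0" using test_functions_support[OF assms(1)] by metis
  show "(\<lambda>x. f x * g x) \<in> test_functions"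
    by (rule test_functionsI[of _ R]) (use R assms in \<open>auto intro: smooth_on_mult test_functions_smooth\<close>)
  then show "(\<lambda>x. g x * f x) \<in> test_functions" by (simp add: mult.commute)
qed

lemma test_functions_cmult: "f \<in> test_functions \<Longrightarrow> (\<lambda>x. c * f x) \<in> test_functions"
  by (rule test_functions_mult(2)) simp_all

lemma test_functions_diff:
  "f \<in> test_functions \<Longrightarrow> g \<in> test_functions \<Longrightarrow> (\<lambda>x. f x - g x) \<in> test_functions"
  using test_functions_add[of f "\<lambda>x. (-1) * g x"] test_functions_cmult[of g "-1"] by simp

lemma zero_test_functions: "(\<lambda>x. 0) \<in> test_functions"
  by (rule test_functionsI[of _ 0]) simp_all

lemma pdiff_eq_0_outside:
  assumes "\<And>x. norm x > R \<Longrightarrow> f x = 0" "norm x > R"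
  shows "pdiff b f x = 0"
proof -
  have "open {x. norm x > R}" by (intro open_Collect_less continuous_intros)
  from pdiff_cong_open[OF this, of x f "\<lambda>x. 0" b] show ?thesis using assms by simp
qed

lemma test_functions_pdiff:
  assumes "f \<in> test_functions" "b \<in> Basis"
  shows "pdiff b f \<in> test_functions"
proof -
  obtain R where R: "\<And>x. norm x > R \<Longrightarrow> f x = 0" using test_functions_support[OF assms(1)] by metis
  show ?thesis
    by (rule test_functionsI[of _ R])
      (use R assms in \<open>auto intro: smooth_on_pdiff test_functions_smooth pdiff_eq_0_outside\<close>)
qed

lemma test_functions_ider: "f \<in> test_functions \<Longrightarrow> set l \<subseteq> Basis \<Longrightarrow> ider l f \<in> test_functions"
  by (induction l) (auto intro: test_functions_pdiff)

lemma integrable_bounded_support: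
  fixes f :: "'a::euclidean_space \<Rightarrow> 'b::{banach, second_countable_topology}"
  assumes "continuous_on UNIV f" "\<And>x. norm x > R \<Longrightarrow> f x = 0"
  shows "integrable lborel f"
proof -
  have "integrable lborel (\<lambda>x. indicator (cball 0 R) x *\<^sub>R f x)"
    by (rule borel_integrable_compact) (auto intro: continuous_on_subset[OF assms(1)])
  moreover have "(\<lambda>x. indicator (cball 0 R) x *\<^sub>R f x) = f"
    using assms(2) by (force simp: fun_eq_iff indicator_def)
  ultimately show ?thesis by simp
qed

lemma test_functions_integrable: "f \<in> test_functions \<Longrightarrow> integrable lborel f"
  by (metis integrable_bounded_support test_functions_continuous test_functions_support)

lemma test_functions_bounded:
  assumes "f \<in> test_functions"
  obtains B where "B > 0" "\<And>x. norm (f x) \<le> B"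
proof -
  obtain R where R: "\<And>x. norm x > R \<Longrightarrow> f x = 0" using test_functions_support[OF assms] by metis
  have "bounded (f ` cball 0 R)"
    by (intro compact_imp_bounded compact_continuous_image test_functions_continuous assms compact_cball)
  then obtain B where B: "B > 0" "\<And>x. x \<in> cball 0 R \<Longrightarrow> norm (f x) \<le> B"
    unfolding bounded_pos by auto
  have "norm (f x) \<le> B" for x
    using B R[of x] by (cases "norm x \<le> R") auto
  then show ?thesis using that B(1) by blast
qed

lemma test_functions_tensor:
  assumes "v \<in> test_functions" "u \<in> test_functions"
  shows "(\<lambda>(x, y). v x * u y) \<in> test_functions"
proof -
  obtain R where R: "\<And>x. norm x > R \<Longrightarrow> v x = 0" using test_functions_support[OF assms(1)] by metis
  obtain S where S: "\<And>x. norm x > S \<Longrightarrow> u x = 0" using test_functions_support[OF assms(2)] by metis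
  have "smooth_on UNIV (\<lambda>z. v (fst z) * u (snd z))"
    by (intro smooth_on_mult smooth_on_compose_linear0[of fst UNIV UNIV] smooth_on_compose_linear0[of snd UNIV UNIV]
        bounded_linear_fst bounded_linear_snd test_functions_smooth assms) auto
  moreover have "v (fst z) * u (snd z) = 0" if "norm z > \<bar>R\<bar> + \<bar>S\<bar>" for z
  proof -
    have "norm z \<le> norm (fst z) + norm (snd z)" using norm_Pair_le[of "fst z" "snd z"] by simp
    then have "norm (fst z) > R \<or> norm (snd z) > S" using that by linarith
    then show ?thesis using R S by auto
  qed
  ultimately have "(\<lambda>z. v (fst z) * u (snd z)) \<in> test_functions" by (rule test_functionsI)
  then show ?thesis by (simp add: split_def)
qed

lemma bump_test:
  fixes z :: "'a::euclidean_space"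
  assumes "r > 0"
  shows "bump z r \<in> test_functions" "closure (support_on UNIV (bump z r)) \<subseteq> ball z (2 * r)"
    "norm (x - z) \<ge> 2 * r \<Longrightarrow> bump z r x = 0"
proof -
  have s2: "sqrt 2 < 2" by (simp add: real_less_lsqrt)
  have "bump z r x = 0" if "norm x > norm z + 2 * r" for x
  proof (rule bump(3)[OF assms])
    have "norm (x - z) > 2 * r" using that norm_triangle_ineq2[of x z] by linarith
    moreover have "sqrt 2 * r < 2 * r" using s2 assms by simp
    ultimately show "norm (x - z) \<ge> sqrt 2 * r" by simp
  qed
  then show "bump z r \<in> test_functions" by (rule test_functionsI[OF bump(1)[OF assms]])
  have "support_on UNIV (bump z r) \<subseteq> cball z (sqrt 2 * r)"
    using bump(3)[OF assms, where z = z] by (force simp: support_on_def dist_norm norm_minus_commute)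
  then have "closure (support_on UNIV (bump z r)) \<subseteq> cball z (sqrt 2 * r)" by (rule closure_minimal) simp
  also have "\<dots> \<subseteq> ball z (2 * r)"
  proof
    fix x assume "x \<in> cball z (sqrt 2 * r)"
    moreover have "sqrt 2 * r < 2 * r" using s2 assms by simp
    ultimately show "x \<in> ball z (2 * r)" by simp
  qed
  finally show "closure (support_on UNIV (bump z r)) \<subseteq> ball z (2 * r)" .
  show "bump z r x = 0" if "norm (x - z) \<ge> 2 * r"
    using bump(3)[OF assms, where z = z] that s2 assms by (meson less_eq_real_def mult_right_mono order_trans)
qed

lemma bump_cutoffs: "bump 0 1 \<in> cutoffs"
proof -
  have "bump 0 1 x = 1" if "x \<in> ball 0 1" for x :: 'a
    using bump(2)[of 1 x 0] that by simp
  moreover have "\<forall>\<^sub>F x in nhds (0::'a). x \<in> ball 0 1"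
    by (rule eventually_nhds_in_open) auto
  ultimately have "\<forall>\<^sub>F x in nhds (0::'a). bump 0 1 x = 1"
    by (auto elim: eventually_mono)
  then show ?thesis using bump_test(1)[of 1 0] by (simp add: cutoffs_def)
qed

text \<open>The fundamental lemma of the calculus of variations. Multiplication by
  \<open>cnj (f x)\<close> makes the real part positive near \<open>x\<close>, and a nonnegative
  bump supported there would give a positive integral.\<close>

lemma test_functions_separate:
  fixes f :: "'a::euclidean_space \<Rightarrow> complex"
  assumes U: "open U" "x \<in> U" and f: "continuous_on UNIV f"
    and 0: "\<And>v. v \<in> test_functions \<Longrightarrow> closure (support_on UNIV v) \<subseteq> U \<Longrightarrow> (LINT y|lborel. f y * v y) = 0"
  shows "f x = 0"
proof (rule ccontr)
  assume fx: "f x \<noteq> 0"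
  define g where "g y = Re (cnj (f x) * f y)" for y
  have gc: "continuous_on UNIV g" unfolding g_def by (intro continuous_intros f)
  have gx: "g x > 0" using fx by (simp add: g_def complex_neq_0 flip: power2_eq_square)
  have "open (U \<inter> g -` {0<..})" by (intro open_Int U open_vimage gc) auto
  moreover have "x \<in> U \<inter> g -` {0<..}" using U gx by simp
  ultimately obtain e where e: "e > 0" "ball x e \<subseteq> U \<inter> g -` {0<..}" using openE by blast
  define r where "r = e / 2"
  have r: "r > 0" unfolding r_def using e by simp
  define v where "v = bump x r"
  have vt: "v \<in> test_functions" unfolding v_def by (rule bump_test(1)[OF r])
  have "closure (support_on UNIV v) \<subseteq> ball x e" using bump_test(2)[OF r, of x] unfolding v_def r_def by simp
  then have "closure (support_on UNIV v) \<subseteq> U" using e by auto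
  note I = 0[OF vt this]
  define w where "w y = Re (v y)" for y
  have vw: "v y = complex_of_real (w y)" for y unfolding w_def v_def by (rule bump(4)[OF r])
  have w0: "w y \<ge> 0" for y unfolding w_def v_def by (rule bump(5)[OF r])
  have gw: "g y * w y \<ge> 0" for y
  proof (cases "y \<in> ball x e")
    case True
    then have "g y > 0" using e by auto
    then show ?thesis using w0[of y] by simp
  next
    case False
    then have "v y = 0" unfolding v_def by (intro bump_test(3)[OF r]) (simp add: r_def dist_norm norm_minus_commute)
    then show ?thesis by (simp add: w_def)
  qed
  have wc: "continuous_on UNIV w" unfolding w_def by (intro continuous_intros test_functions_continuous vt)
  obtain R where R: "\<And>x. norm x > R \<Longrightarrow> v x = 0" using test_functions_support[OF vt] by metis
  have vc: "continuous_on UNIV v" by (rule test_functions_continuous[OF vt])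
  have fvi: "integrable lborel (\<lambda>y. f y * v y)"
    by (rule integrable_bounded_support[of _ R]) (use R in \<open>auto intro!: continuous_intros f vc\<close>)
  have gwi: "integrable lborel (\<lambda>y. g y * w y)"
    by (rule integrable_bounded_support[of _ R]) (use R in \<open>auto intro!: continuous_intros gc vc simp: w_def\<close>)
  have "(LINT y|lborel. g y * w y) = (LINT y|lborel. Re (cnj (f x) * (f y * v y)))"
    by (rule Bochner_Integration.integral_cong) (auto simp: g_def vw algebra_simps)
  also have "\<dots> = Re (LINT y|lborel. cnj (f x) * (f y * v y))"
    by (rule integral_Re) (intro integrable_mult_right fvi)
  also have "\<dots> = 0" using I by simp
  finally have "AE y in lborel. g y * w y = 0"
    using integral_nonneg_eq_0_iff_AE[OF gwi] gw by auto
  then have "AE y in lborel. y \<notin> ball x r"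
  proof (eventually_elim, intro notI)
    fix y assume y: "g y * w y = 0" "y \<in> ball x r"
    then have "w y = 1" using bump(2)[OF r, of y x] by (simp add: w_def v_def dist_norm norm_minus_commute)
    moreover have "y \<in> ball x e" using y r_def r by auto
    then have "g y > 0" using e by auto
    ultimately show False using y by simp
  qed
  then have "ball x r \<in> null_sets lborel"
    using AE_iff_null[of lborel "\<lambda>y. y \<notin> ball x r"] by (simp del: mem_ball)
  then have "negligible (ball x r)" by (simp add: negligible_iff_null_sets null_sets_completionI)
  then show False using open_not_negligible[of "ball x r"] r by auto
qed

subsection \<open>Supports of Schwartz kernels\<close>

lemma distribution_lincomb:
  "distribution K \<Longrightarrow> \<phi> \<in> test_functions \<Longrightarrow> \<psi> \<in> test_functions \<Longrightarrow> K (\<lambda>x. \<phi> x + c * \<psi> x) = K \<phi> + c * K \<psi>"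
  unfolding distribution_def by blast

lemma distribution_0: "distribution K \<Longrightarrow> K (\<lambda>x. 0) = 0"
  using distribution_lincomb[OF _ zero_test_functions zero_test_functions, of K 1] by simp

text \<open>Multiplying successively by \<open>1 - \<beta>\<close> for bump functions \<open>\<beta>\<close> of null sets replaces
  a partition of unity.\<close>

lemma distribution_vanishes_off_support:
  fixes K :: "('a::euclidean_space \<Rightarrow> complex) \<Rightarrow> complex"
  assumes K: "distribution K" and \<phi>: "\<phi> \<in> test_functions"
    and disj: "closure (support_on UNIV \<phi>) \<inter> distr_support K = {}"
  shows "K \<phi> = 0"
proof -
  define C where "C = closure (support_on UNIV \<phi>)"
  have C: "compact C" using \<phi> by (simp add: C_def test_functions_def)
  define null where "null U \<longleftrightarrow> open U \<and> (\<forall>\<phi>\<in>test_functions. closure (support_on UNIV \<phi>) \<subseteq> U \<longrightarrow> K \<phi> = 0)" for U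
  \<comment> \<open>The factor \<open>2\<close> leaves room for a bump that is \<open>1\<close> on
    the ball of radius \<open>r\<close> and has its closed support in the ball of radius
    \<open>2 * r\<close>.\<close>
  have "\<exists>r>0. \<forall>\<psi>\<in>test_functions. closure (support_on UNIV \<psi>) \<subseteq> ball z (2 * r) \<longrightarrow> K \<psi> = 0" if "z \<in> C" for z
  proof -
    have "z \<notin> distr_support K" using disj that by (auto simp: C_def)
    then obtain U where U: "null U" "z \<in> U" unfolding distr_support_def null_def by blast
    then obtain e where "e > 0" "ball z e \<subseteq> U" unfolding null_def using openE by blast
    then show ?thesis using U(1) unfolding null_def by (intro exI[of _ "e / 2"]) auto
  qed
  then obtain r where r: "\<And>z. z \<in> C \<Longrightarrow> r z > 0"
    "\<And>z \<psi>. z \<in> C \<Longrightarrow> \<psi> \<in> test_functions \<Longrightarrow> closure (support_on UNIV \<psi>) \<subseteq> ball z (2 * r z) \<Longrightarrow> K \<psi> = 0"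
    by metis
  have "C \<subseteq> (\<Union>z\<in>C. ball z (r z))" using r(1) by force
  then obtain Z where Z: "Z \<subseteq> C" "finite Z" "C \<subseteq> (\<Union>z\<in>Z. ball z (r z))"
    using compactE_image[OF C, of C "\<lambda>z. ball z (r z)"] by auto
  have "(\<lambda>x. \<phi> x * (\<Prod>z\<in>Z. 1 - bump z (r z) x)) \<in> test_functions \<and> K (\<lambda>x. \<phi> x * (\<Prod>z\<in>Z. 1 - bump z (r z) x)) = K \<phi>"
    using Z(2,1)
  proof (induction Z)
    case empty
    then show ?case using \<phi> by simp
  next
    case (insert z Z)
    define \<psi> where "\<psi> x = \<phi> x * (\<Prod>z\<in>Z. 1 - bump z (r z) x)" for x
    have \<psi>: "\<psi> \<in> test_functions" "K \<psi> = K \<phi>" using insert unfolding \<psi>_def by auto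
    have rz: "r z > 0" and zC: "z \<in> C" using insert.prems r(1) by auto
    define \<beta> where "\<beta> x = \<psi> x * bump z (r z) x" for x
    have \<beta>: "\<beta> \<in> test_functions" unfolding \<beta>_def by (rule test_functions_mult(1)[OF \<psi>(1) bump(1)[OF rz]])
    have "support_on UNIV \<beta> \<subseteq> support_on UNIV (bump z (r z))" by (auto simp: \<beta>_def support_on_def)
    then have "closure (support_on UNIV \<beta>) \<subseteq> ball z (2 * r z)"
      using bump_test(2)[OF rz, of z] closure_mono by blast
    then have "K \<beta> = 0" by (rule r(2)[OF zC \<beta>])
    moreover have eq: "(\<lambda>x. \<phi> x * (\<Prod>z\<in>insert z Z. 1 - bump z (r z) x)) = (\<lambda>x. \<psi> x + (-1) * \<beta> x)"
      unfolding \<beta>_def \<psi>_def using insert by (simp add: algebra_simps)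
    ultimately show ?case
      using distribution_lincomb[OF K \<psi>(1) \<beta>, of "-1"] \<psi>(2) test_functions_add[OF \<psi>(1) test_functions_cmult[OF \<beta>, of "-1"]]
      by simp
  qed
  moreover have "\<phi> x * (\<Prod>z\<in>Z. 1 - bump z (r z) x) = 0" for x
  proof (cases "x \<in> C")
    case True
    then obtain z where z: "z \<in> Z" "x \<in> ball z (r z)" using Z by auto
    then have "bump z (r z) x = 1" using r(1) Z(1) by (intro bump(2)) (auto simp: dist_norm norm_minus_commute)
    then have "(\<Prod>z\<in>Z. 1 - bump z (r z) x) = 0" using z(1) Z(2) by (intro prod_zero) auto
    then show ?thesis by simp
  next
    case False
    then have "x \<notin> support_on UNIV \<phi>" using closure_subset unfolding C_def by blast
    then show ?thesis by (simp add: support_on_def)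
  qed
  ultimately show ?thesis using distribution_0[OF K] by simp
qed

lemma schwartz_kernelD:
  assumes "schwartz_kernel P K"
  shows "distribution K" "u \<in> test_functions \<Longrightarrow> smooth_on UNIV (P u)"
    "u \<in> test_functions \<Longrightarrow> v \<in> test_functions \<Longrightarrow> (LINT x|lborel. P u x * v x) = K (\<lambda>(x, y). v x * u y)"
  using assms unfolding schwartz_kernel_def by blast+

text \<open>Pairing \<open>P u\<close> with functions \<open>v\<close> supported in \<open>U\<close>
  evaluates the kernel on the tensor product of \<open>v\<close> and \<open>u\<close>, whose support
  avoids that of the kernel. Both consequences of proper support are drawn from this.\<close>

lemma schwartz_kernel_zero:
  assumes P: "schwartz_kernel P K" and u: "u \<in> test_functions" and U: "open U" "x \<in> U"
    and disj: "\<And>x y. x \<in> U \<Longrightarrow> y \<in> closure (support_on UNIV u) \<Longrightarrow> (x, y) \<notin> distr_support K"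
  shows "P u x = 0"
proof (rule test_functions_separate[OF U])
  show "continuous_on UNIV (P u)" by (rule smooth_on_imp_continuous_on[OF schwartz_kernelD(2)[OF P u]])
  fix v assume v: "v \<in> test_functions" "closure (support_on UNIV v) \<subseteq> U"
  have "support_on UNIV (\<lambda>(x, y). v x * u y) \<subseteq> closure (support_on UNIV v) \<times> closure (support_on UNIV u)"
    using closure_subset by (fastforce simp: support_on_def)
  then have "closure (support_on UNIV (\<lambda>(x, y). v x * u y)) \<subseteq> closure (support_on UNIV v) \<times> closure (support_on UNIV u)"
    by (rule closure_minimal) (simp add: closed_Times)
  then have "closure (support_on UNIV (\<lambda>(x, y). v x * u y)) \<inter> distr_support K = {}"
    using disj v(2) by fastforce
  then show "(LINT y|lborel. P u y * v y) = 0"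
    using schwartz_kernelD(3)[OF P u v(1)]
      distribution_vanishes_off_support[OF schwartz_kernelD(1)[OF P] test_functions_tensor[OF v(1) u]] by simp
qed

lemma closure_support_subset:
  "closed S \<Longrightarrow> (\<And>x. x \<notin> S \<Longrightarrow> f x = 0) \<Longrightarrow> closure (support_on UNIV f) \<subseteq> S"
  by (rule closure_minimal) (auto simp: support_on_def)

lemma proper_map_bounded_preimage:
  assumes "proper_map (top_of_set S) euclidean f" "compact L"
  obtains R where "R > 0" "\<And>z. z \<in> S \<Longrightarrow> f z \<in> L \<Longrightarrow> norm z \<le> R"
proof -
  have "compactin (top_of_set S) {z \<in> topspace (top_of_set S). f z \<in> L}"
    using assms compactin_proper_map_preimage[OF assms(1), of L] by simp
  then have "bounded {z \<in> S. f z \<in> L}"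
    by (auto simp: compactin_subtopology intro: compact_imp_bounded)
  then obtain R where "R > 0" "\<And>z. z \<in> {z \<in> S. f z \<in> L} \<Longrightarrow> norm z \<le> R"
    unfolding bounded_pos by blast
  then show ?thesis using that by blast
qed

text \<open>Properness of the second projection. One radius \<open>R'\<close> serves all
  \<open>u\<close> supported in the ball of radius \<open>R\<close>, hence all truncated plane waves
  simultaneously.\<close>

lemma properly_supported_bounded_support:
  assumes "properly_supported P"
  obtains R' where "R' > 0" "\<And>u x. u \<in> test_functions \<Longrightarrow> (\<And>y. norm y > R \<Longrightarrow> u y = 0) \<Longrightarrow> norm x > R' \<Longrightarrow> P u x = 0"
proof -
  obtain K where K: "schwartz_kernel P K" "proper_map (top_of_set (distr_support K)) euclidean snd"
    using assms unfolding properly_supported_def by blast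
  obtain R' where R': "R' > 0" "\<And>z. z \<in> distr_support K \<Longrightarrow> snd z \<in> cball 0 R \<Longrightarrow> norm z \<le> R'"
    using proper_map_bounded_preimage[OF K(2) compact_cball] by metis
  have "P u x = 0" if u: "u \<in> test_functions" "\<And>y. norm y > R \<Longrightarrow> u y = 0" and x: "norm x > R'" for u x
  proof (rule schwartz_kernel_zero[OF K(1) u(1), of "{x. norm x > R'}"])
    show "open {x::'a. norm x > R'}" by (intro open_Collect_less continuous_intros)
    fix x' y assume x': "x' \<in> {x::'a. norm x > R'}" and y: "y \<in> closure (support_on UNIV u)"
    have "y \<in> cball 0 R" using y closure_support_subset[of "cball 0 R" u] u(2) by auto
    moreover have "norm (x', y) > R'" using x' norm_fst_le[of x' y] by auto
    ultimately show "(x', y) \<notin> distr_support K" using R'(2)[of "(x', y)"] by auto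
  qed (use x in auto)
  then show ?thesis using that R'(1) by blast
qed

text \<open>Properness of the first projection: near a ball, \<open>P u\<close> is determined by
  \<open>u\<close> on a larger ball.\<close>

lemma properly_supported_local:
  assumes "properly_supported P"
  obtains R' where "R' > 0" "\<And>u x. u \<in> test_functions \<Longrightarrow> (\<And>y. norm y < R' \<Longrightarrow> u y = 0) \<Longrightarrow> norm x < R \<Longrightarrow> P u x = 0"
proof -
  obtain K where K: "schwartz_kernel P K" "proper_map (top_of_set (distr_support K)) euclidean fst"
    using assms unfolding properly_supported_def by blast
  obtain R' where R': "R' > 0" "\<And>z. z \<in> distr_support K \<Longrightarrow> fst z \<in> cball 0 R \<Longrightarrow> norm z \<le> R'"
    using proper_map_bounded_preimage[OF K(2) compact_cball] by metis
  \<comment> \<open>On the closed support of \<open>u\<close> only the weak inequality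
    \<open>norm y \<ge> R' + 1\<close> remains; the margin \<open>1\<close> turns it into the strict
    inequality \<open>norm (x', y) > R'\<close>.\<close>
  have "P u x = 0" if u: "u \<in> test_functions" "\<And>y. norm y < R' + 1 \<Longrightarrow> u y = 0" and x: "norm x < R" for u x
  proof (rule schwartz_kernel_zero[OF K(1) u(1), of "ball 0 R"])
    fix x' y assume x': "x' \<in> ball (0::'a) R" and y: "y \<in> closure (support_on UNIV u)"
    have "closed {y::'a. norm y \<ge> R' + 1}" by (intro closed_Collect_le continuous_intros)
    then have "norm y \<ge> R' + 1" using y closure_support_subset[of "{y. norm y \<ge> R' + 1}" u] u(2) by auto
    then have "norm (x', y) > R'" using norm_snd_le[of y x'] by auto
    then show "(x', y) \<notin> distr_support K" using R'(2)[of "(x', y)"] x' by auto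
  qed (use x in auto)
  then show ?thesis using that[of "R' + 1"] R'(1) by auto
qed

subsection \<open>Weights and Gaussians\<close>

lemma japanese_ge_1: "japanese x \<ge> 1"
  by (simp add: japanese_def)

lemma japanese_pos [simp]: "japanese x > 0" "japanese x \<noteq> 0" "japanese x \<ge> 0"
  using japanese_ge_1[of x] by linarith+

lemma japanese_square: "(japanese x)\<^sup>2 = 1 + (norm x)\<^sup>2"
  by (simp add: japanese_def)

lemma norm_le_japanese: "norm x \<le> japanese x"
  by (rule power2_le_imp_le) (simp_all add: japanese_square)

lemma japanese_le: "japanese x \<le> 1 + norm x"
  by (rule power2_le_imp_le) (simp_all add: japanese_square power2_sum)

lemma japanese_minus [simp]: "japanese (- x) = japanese x"
  by (simp add: japanese_def)

lemma continuous_on_japanese: "continuous_on S f \<Longrightarrow> continuous_on S (\<lambda>x. japanese (f x))"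
  unfolding japanese_def by (intro continuous_intros)

text \<open>Peetre's inequality with exponent one. With the generous constant \<open>2\<close>, the
  difference of the squares is visibly a sum of nonnegative terms.\<close>

lemma japanese_add_le: "japanese (x + y) \<le> 2 * japanese x * japanese y"
proof (rule power2_le_imp_le)
  have "(norm (x + y))\<^sup>2 \<le> (norm x + norm y)\<^sup>2" by (intro power_mono norm_triangle_ineq) simp
  moreover have "4 * (1 + (norm x)\<^sup>2) * (1 + (norm y)\<^sup>2) - (1 + (norm x + norm y)\<^sup>2)
      = 3 + 2 * (norm x)\<^sup>2 + 2 * (norm y)\<^sup>2 + (norm x - norm y)\<^sup>2 + 4 * (norm x * norm y)\<^sup>2"
    by (simp add: power2_eq_square algebra_simps)
  moreover have "0 \<le> 3 + 2 * (norm x)\<^sup>2 + 2 * (norm y)\<^sup>2 + (norm x - norm y)\<^sup>2 + 4 * (norm x * norm y)\<^sup>2"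
    by (intro add_nonneg_nonneg) auto
  ultimately have "1 + (norm (x + y))\<^sup>2 \<le> 4 * (1 + (norm x)\<^sup>2) * (1 + (norm y)\<^sup>2)"
    by linarith
  then show "(japanese (x + y))\<^sup>2 \<le> (2 * japanese x * japanese y)\<^sup>2"
    by (simp add: power_mult_distrib japanese_square)
qed simp

text \<open>Peetre's inequality for exponents of either sign. For negative \<open>s\<close> the
  previous bound is applied to \<open>x = (x + y) + (- y)\<close>, which is why \<open>y\<close>
  carries the exponent \<open>\<bar>s\<bar>\<close>.\<close>

lemma japanese_powr_add_le:
  "japanese (x + y) powr s \<le> 2 powr \<bar>s\<bar> * japanese x powr s * japanese y powr \<bar>s\<bar>"
proof (cases "s \<ge> 0")
  case True
  have "japanese (x + y) powr s \<le> (2 * japanese x * japanese y) powr s"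
    using True by (intro powr_mono2 japanese_add_le) auto
  then show ?thesis using True by (simp add: powr_mult)
next
  case False
  have "japanese x \<le> 2 * japanese (x + y) * japanese y"
    using japanese_add_le[of "x + y" "- y"] by simp
  then have "(2 * japanese (x + y) * japanese y) powr s \<le> japanese x powr s"
    using False by (intro powr_mono2') auto
  then have "2 powr s * japanese (x + y) powr s * japanese y powr s \<le> japanese x powr s"
    by (simp add: powr_mult)
  then have le: "2 powr (-s) * japanese y powr (-s) * (2 powr s * japanese (x + y) powr s * japanese y powr s)
      \<le> 2 powr (-s) * japanese y powr (-s) * japanese x powr s"
    by (intro mult_left_mono) auto
  have "2 powr (-s) * japanese y powr (-s) * (2 powr s * japanese (x + y) powr s * japanese y powr s)
    = japanese (x + y) powr s"
    by (simp add: powr_minus field_simps)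
  from le[unfolded this] show ?thesis using False by (simp add: mult_ac)
qed

lemma japanese_powr_mono: "s \<le> t \<Longrightarrow> japanese x powr s \<le> japanese x powr t"
  by (rule powr_mono[OF _ japanese_ge_1])

lemma integrable_inverse_1_plus_square': "integrable lborel (\<lambda>t::real. inverse (1 + t\<^sup>2))"
  using integrable_inverse_1_plus_square by (simp add: set_integrable_def)

text \<open>Lebesgue measure on \<open>'a\<close> is the image of a product of measures on the line,
  so products of functions of single coordinates reduce to one-dimensional integrals. This serves
  the weight \<open>japanese\<close> and the Gaussian.\<close>

lemma
  fixes f :: "'a::euclidean_space \<Rightarrow> real \<Rightarrow> 'b::{real_normed_field, banach, second_countable_topology}"
  assumes f: "\<And>b. b \<in> Basis \<Longrightarrow> integrable lborel (f b)"
  shows integrable_prod_Basis: "integrable lborel (\<lambda>x. \<Prod>b\<in>Basis. f b (x \<bullet> b))"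
    and integral_prod_Basis: "(LINT x|lborel. (\<Prod>b\<in>Basis. f b (x \<bullet> b))) = (\<Prod>b\<in>Basis. (LINT t|lborel. f b t))"
proof -
  interpret product_sigma_finite "\<lambda>_::'a. lborel :: real measure"
    by standard
  have [measurable]: "f b \<in> borel_measurable borel" if "b \<in> Basis" for b
    using borel_measurable_integrable[OF f[OF that]] by simp
  have fm: "(\<lambda>x. \<Prod>b\<in>Basis. f b (x \<bullet> b)) \<in> borel_measurable borel"
    by (intro borel_measurable_prod) measurable
  have Tm: "(\<lambda>g. \<Sum>b\<in>Basis. g b *\<^sub>R b) \<in> (\<Pi>\<^sub>M b\<in>(Basis::'a set). (lborel::real measure)) \<rightarrow>\<^sub>M borel"
    by measurable
  have eq: "(\<Prod>b\<in>Basis. f b ((\<Sum>b\<in>Basis. g b *\<^sub>R b) \<bullet> b)) = (\<Prod>b\<in>Basis. f b (g b))" for g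
    by (rule prod.cong) (simp_all add: inner_sum_left inner_Basis if_distrib cong: if_cong)
  show "integrable lborel (\<lambda>x. \<Prod>b\<in>Basis. f b (x \<bullet> b))"
    unfolding lborel_eq[where 'a = 'a]
    by (subst integrable_distr_eq[OF Tm fm])
      (simp add: eq product_integrable_prod[OF finite_Basis f])
  show "(LINT x|lborel. (\<Prod>b\<in>Basis. f b (x \<bullet> b))) = (\<Prod>b\<in>Basis. (LINT t|lborel. f b t))"
    unfolding lborel_eq[where 'a = 'a]
    by (subst integral_distr[OF Tm fm])
      (simp add: eq product_integral_prod[OF finite_Basis f])
qed

text \<open>Each \<open>1 + (x \<bullet> b)\<^sup>2\<close> is at most
  \<open>(japanese x)\<^sup>2\<close>, so a product of integrable functions on the line is a
  majorant. This makes \<open>- 2 * DIM('a)\<close> the standard integrable exponent below; it is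
  not sharp, but the Fourier transforms involved decay at any prescribed rate.\<close>

lemma integrable_japanese:
  assumes "s \<le> - 2 * real DIM('a)"
  shows "integrable lborel (\<lambda>x::'a::euclidean_space. japanese x powr s)"
proof -
  have i: "integrable lborel (\<lambda>x::'a. \<Prod>b\<in>Basis. inverse (1 + (x \<bullet> b)\<^sup>2))"
    by (rule integrable_prod_Basis) (rule integrable_inverse_1_plus_square')
  have b: "norm (japanese x powr s) \<le> norm (\<Prod>b\<in>Basis. inverse (1 + (x \<bullet> b)\<^sup>2))" for x :: 'a
  proof -
    have "(\<Prod>b\<in>Basis. 1 + (x \<bullet> b)\<^sup>2) \<le> (\<Prod>b\<in>(Basis::'a set). (japanese x)\<^sup>2)"
      by (rule prod_mono) (auto simp: japanese_square abs_le_square_iff[symmetric] Basis_le_norm)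
    also have "\<dots> = japanese x powr (2 * real DIM('a))"
      using powr_realpow[of "japanese x" "2 * DIM('a)"] by (simp add: power_mult)
    finally have "inverse (japanese x powr (2 * real DIM('a))) \<le> inverse (\<Prod>b\<in>Basis. 1 + (x \<bullet> b)\<^sup>2)"
      by (intro le_imp_inverse_le prod_pos) (auto intro: add_pos_nonneg)
    then have "japanese x powr (- 2 * real DIM('a)) \<le> (\<Prod>b\<in>Basis. inverse (1 + (x \<bullet> b)\<^sup>2))"
      by (simp add: powr_minus prod_inversef[symmetric])
    then show ?thesis using japanese_powr_mono[OF assms, of x] by simp
  qed
  have m: "(\<lambda>x::'a. japanese x powr s) \<in> borel_measurable lborel"
    by (simp, intro borel_measurable_continuous_onI continuous_intros continuous_on_japanese) auto
  show ?thesis by (rule Bochner_Integration.integrable_bound[OF i m AE_I2[OF b]])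
qed

text \<open>The form in which orders of integration are exchanged below: a continuous integrand with
  a product majorant.\<close>

lemma
  fixes F :: "'a::euclidean_space \<Rightarrow> 'b::euclidean_space \<Rightarrow> complex"
  assumes c: "continuous_on UNIV (\<lambda>(x, y). F x y)"
    and f: "integrable lborel f" and g: "integrable lborel g"
    and b: "\<And>x y. norm (F x y) \<le> f x * g y"
  shows integrable_tensor_bound: "integrable lborel (\<lambda>(x, y). F x y)"
    and integral_tensor_bound_iterated: "(LINT z|lborel. (\<lambda>(x, y). F x y) z) = (LINT x|lborel. LINT y|lborel. F x y)"
    and fubini_tensor_bound: "(LINT y|lborel. LINT x|lborel. F x y) = (LINT x|lborel. LINT y|lborel. F x y)"
proof -
  have [measurable]: "f \<in> borel_measurable borel" "g \<in> borel_measurable borel"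
    using f g by (auto dest: borel_measurable_integrable)
  have m: "(\<lambda>(x, y). F x y) \<in> borel_measurable (lborel \<Otimes>\<^sub>M lborel)"
    unfolding lborel_prod using borel_measurable_continuous_onI[OF c] by simp
  have "integrable (lborel \<Otimes>\<^sub>M lborel) (\<lambda>(x, y). f x * g y)"
    by (rule lborel_pair.Fubini_integrable) (use f g in \<open>auto simp: integrable_norm abs_mult\<close>)
  then have i: "integrable (lborel \<Otimes>\<^sub>M lborel) (\<lambda>(x, y). F x y)"
    by (rule Bochner_Integration.integrable_bound[OF _ m])
      (use b in \<open>auto intro!: AE_I2 intro: order_trans[OF _ abs_ge_self]\<close>)
  then show "integrable lborel (\<lambda>(x, y). F x y)" by (simp add: lborel_prod)
  show "(LINT z|lborel. (\<lambda>(x, y). F x y) z) = (LINT x|lborel. LINT y|lborel. F x y)"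
    using lborel_pair.integral_fst'[OF i] by (simp add: lborel_prod)
  show "(LINT y|lborel. LINT x|lborel. F x y) = (LINT x|lborel. LINT y|lborel. F x y)"
    by (rule lborel_pair.Fubini_integral[OF i])
qed

lemma lborel_integral_affine:
  fixes f :: "'a::euclidean_space \<Rightarrow> complex"
  assumes "f \<in> borel_measurable borel" "c \<noteq> 0"
  shows "(LINT x|lborel. f x) = complex_of_real (\<bar>c\<bar> ^ DIM('a)) * (LINT x|lborel. f (t + c *\<^sub>R x))"
  using assms
  by (subst lborel_affine[OF assms(2), of t])
    (simp add: integral_density integral_distr scaleR_conv_of_real)

lemma lborel_integral_shift:
  fixes f :: "'a::euclidean_space \<Rightarrow> complex"
  assumes "f \<in> borel_measurable borel"
  shows "(LINT x|lborel. f (t + x)) = (LINT x|lborel. f x)"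
  using lborel_integral_affine[OF assms, of 1 t] by simp

definition gauss :: "'a::euclidean_space \<Rightarrow> real" where
  "gauss x = exp (- ((norm x)\<^sup>2 / 2))"

lemma gauss_prod: "gauss x = (\<Prod>b\<in>Basis. exp (- ((x \<bullet> b)\<^sup>2 / 2)))"
proof -
  have "(norm x)\<^sup>2 = (\<Sum>b\<in>Basis. (x \<bullet> b)\<^sup>2)"
    unfolding power2_norm_eq_inner by (subst euclidean_inner) (simp add: power2_eq_square)
  then show ?thesis
    unfolding gauss_def by (simp add: exp_sum[symmetric] sum_negf sum_divide_distrib)
qed

text \<open>Up to the normalisation \<open>sqrt (2 * pi)\<close>, the Fourier transform of the
  Gaussian is the characteristic function of the standard normal distribution.\<close>

lemma
  shows integrable_gauss_real: "integrable lborel (\<lambda>t::real. complex_of_real (exp (- (t\<^sup>2 / 2))) * cis (t * s))"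
    and integral_gauss_real: "(LINT t|lborel. complex_of_real (exp (- (t\<^sup>2 / 2))) * cis (t * s)) = complex_of_real (sqrt (2 * pi) * exp (- (s\<^sup>2 / 2)))"
proof -
  have n: "exp (- (t\<^sup>2 / 2)) = sqrt (2 * pi) * std_normal_density t" for t :: real
    by (simp add: std_normal_density_def)
  have cm: "(\<lambda>t::real. cis (t * s)) \<in> borel_measurable borel"
    by (intro borel_measurable_continuous_onI continuous_on_cis continuous_intros)
  have "integrable lborel (\<lambda>t::real. exp (- (t\<^sup>2 / 2)))"
    unfolding n by (intro integrable_mult_right) simp
  then show "integrable lborel (\<lambda>t::real. complex_of_real (exp (- (t\<^sup>2 / 2))) * cis (t * s))"
    by (rule Bochner_Integration.integrable_bound) (use cm in \<open>auto simp: norm_mult\<close>)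
  have "complex_of_real (exp (- (s\<^sup>2 / 2))) = char std_normal_distribution s"
    by (simp add: char_std_normal_distribution)
  also have "\<dots> = (LINT t|lborel. std_normal_density t *\<^sub>R cis (s * t))"
    unfolding char_def using cm by (subst integral_density) (auto simp: cis_conv_exp mult.commute)
  finally have "complex_of_real (sqrt (2 * pi) * exp (- (s\<^sup>2 / 2))) = complex_of_real (sqrt (2 * pi)) * (LINT t|lborel. std_normal_density t *\<^sub>R cis (s * t))"
    by simp
  also have "\<dots> = (LINT t|lborel. complex_of_real (sqrt (2 * pi)) * (std_normal_density t *\<^sub>R cis (s * t)))"
    by (rule integral_mult_right_zero[symmetric])
  also have "\<dots> = (LINT t|lborel. complex_of_real (exp (- (t\<^sup>2 / 2))) * cis (t * s))"
    unfolding n by (rule Bochner_Integration.integral_cong) (simp_all add: scaleR_conv_of_real mult_ac)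
  finally show "(LINT t|lborel. complex_of_real (exp (- (t\<^sup>2 / 2))) * cis (t * s)) = complex_of_real (sqrt (2 * pi) * exp (- (s\<^sup>2 / 2)))"
    by simp
qed

lemma cis_inner_prod: "cis (x \<bullet> z) = (\<Prod>b\<in>Basis. cis ((x \<bullet> b) * (z \<bullet> b)))"
proof -
  have "cis (sum f B) = (\<Prod>b\<in>B. cis (f b))" if "finite B" for f and B :: "'a set"
    using that by (induction B) (auto simp flip: cis_mult)
  then show ?thesis by (subst euclidean_inner) simp
qed

lemma
  fixes z :: "'a::euclidean_space"
  shows integrable_gauss_cis: "integrable lborel (\<lambda>x. complex_of_real (gauss x) * cis (x \<bullet> z))"
    and integral_gauss_cis: "(LINT x|lborel. complex_of_real (gauss x) * cis (x \<bullet> z)) = complex_of_real (sqrt (2 * pi) ^ DIM('a) * gauss z)"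
proof -
  have eq: "complex_of_real (gauss x) * cis (x \<bullet> z) = (\<Prod>b\<in>Basis. (\<lambda>t. complex_of_real (exp (- (t\<^sup>2 / 2))) * cis (t * (z \<bullet> b))) (x \<bullet> b))" for x
    by (simp add: gauss_prod cis_inner_prod prod.distrib)
  show "integrable lborel (\<lambda>x. complex_of_real (gauss x) * cis (x \<bullet> z))"
    unfolding eq by (rule integrable_prod_Basis[OF integrable_gauss_real])
  show "(LINT x|lborel. complex_of_real (gauss x) * cis (x \<bullet> z)) = complex_of_real (sqrt (2 * pi) ^ DIM('a) * gauss z)"
    unfolding eq integral_prod_Basis[OF integrable_gauss_real]
    by (simp add: integral_gauss_real prod.distrib gauss_prod)
qed

text \<open>As \<open>e\<close> tends to \<open>0\<close>, the Gaussian on the left flattens to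
  \<open>1\<close>, while the one on the right concentrates at \<open>w = 0\<close>: this is the
  approximate identity behind Fourier inversion.\<close>

lemma gauss_cis_scaled:
  fixes w :: "'a::euclidean_space"
  assumes "e > 0"
  shows "integrable lborel (\<lambda>\<eta>::'a. gauss (e *\<^sub>R \<eta>))"
    and "complex_of_real (e ^ DIM('a)) * (LINT \<eta>|lborel. complex_of_real (gauss (e *\<^sub>R \<eta>)) * cis (w \<bullet> \<eta>))
      = complex_of_real (sqrt (2 * pi) ^ DIM('a) * gauss ((1 / e) *\<^sub>R w))"
proof -
  have cg: "continuous_on UNIV (gauss :: 'a \<Rightarrow> real)" unfolding gauss_def by (intro continuous_intros) auto
  then have gm [measurable]: "(gauss :: 'a \<Rightarrow> real) \<in> borel_measurable borel" by (rule borel_measurable_continuous_onI)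
  have "integrable lborel (\<lambda>x::'a. complex_of_real (gauss x))" using integrable_gauss_cis[of 0] by simp
  then have "integrable lborel (gauss :: 'a \<Rightarrow> real)" by (simp add: complex_of_real_integrable_eq)
  then have "integrable (density (distr lborel borel (\<lambda>x. 0 + e *\<^sub>R x)) (\<lambda>_. \<bar>e\<bar> ^ DIM('a))) (gauss :: 'a \<Rightarrow> real)"
    using lborel_affine[of e "0::'a"] assms by simp
  then show "integrable lborel (\<lambda>\<eta>::'a. gauss (e *\<^sub>R \<eta>))"
    using assms by (subst (asm) integrable_density) (auto simp: integrable_distr_eq)
  define f where "f \<eta> = complex_of_real (gauss \<eta>) * cis (\<eta> \<bullet> ((1 / e) *\<^sub>R w))" for \<eta>
  have "f \<in> borel_measurable borel" unfolding f_def
    by (intro borel_measurable_continuous_onI continuous_intros continuous_on_cis cg)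
  from lborel_integral_affine[OF this, of e 0] assms
  have "(LINT \<eta>|lborel. f \<eta>) = complex_of_real (e ^ DIM('a)) * (LINT \<eta>|lborel. f (e *\<^sub>R \<eta>))" by simp
  moreover have "(LINT \<eta>|lborel. f (e *\<^sub>R \<eta>)) = (LINT \<eta>|lborel. complex_of_real (gauss (e *\<^sub>R \<eta>)) * cis (w \<bullet> \<eta>))"
    using assms unfolding f_def by (simp add: inner_commute)
  ultimately show "complex_of_real (e ^ DIM('a)) * (LINT \<eta>|lborel. complex_of_real (gauss (e *\<^sub>R \<eta>)) * cis (w \<bullet> \<eta>))
      = complex_of_real (sqrt (2 * pi) ^ DIM('a) * gauss ((1 / e) *\<^sub>R w))"
    unfolding f_def integral_gauss_cis by simp
qed

subsection \<open>The Fourier transform of test functions\<close>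

text \<open>There is no normalising factor here: the whole \<open>(2 * pi) ^ DIM('a)\<close> appears
  in the inversion formula, in agreement with \<open>osc_integral\<close>. Writing
  \<open>cis\<close> for the exponential makes its modulus evident.\<close>

definition ft :: "('a::euclidean_space \<Rightarrow> complex) \<Rightarrow> 'a \<Rightarrow> complex" where
  "ft f \<eta> = (LINT y|lborel. cis (- (y \<bullet> \<eta>)) * f y)"

lemma smooth_on_slice:
  assumes "smooth_on UNIV (\<lambda>(z, y). g z y)"
  shows "smooth_on UNIV (g z)" "smooth_on UNIV (\<lambda>z. g z y)"
proof -
  have l: "bounded_linear (\<lambda>y::'b. (0::'a, y))" "bounded_linear (\<lambda>z::'a. (z, 0::'b))"
    by (intro bounded_linear_Pair bounded_linear_zero bounded_linear_ident)+
  show "smooth_on UNIV (g z)"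
    using smooth_on_compose_linear[OF l(1) open_UNIV open_UNIV _ assms, of "(z, 0)"] by simp
  show "smooth_on UNIV (\<lambda>z. g z y)"
    using smooth_on_compose_linear[OF l(2) open_UNIV open_UNIV _ assms, of "(0, y)"] by simp
qed

text \<open>Since \<open>pdiff\<close> differentiates along a line, a partial derivative on the
  product space is literally one in a single group of variables.\<close>

lemma pdiff_slice:
  "pdiff (b, 0) (\<lambda>(z, y). g z y) (z, y) = pdiff b (\<lambda>z. g z y) z"
  "pdiff (0, c) (\<lambda>(z, y). g z y) (z, y) = pdiff c (g z) y"
  by (simp_all add: pdiff_def)

lemma pdiff_slice':
  "pdiff (b, 0) (\<lambda>(z, y). g z y) = (\<lambda>(z, y). pdiff b (\<lambda>z. g z y) z)"
  "pdiff (0, c) (\<lambda>(z, y). g z y) = (\<lambda>(z, y). pdiff c (g z) y)"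
  by (auto simp: pdiff_slice)

lemma Basis_PairI: "b \<in> Basis \<Longrightarrow> (b, 0) \<in> Basis" "c \<in> Basis \<Longrightarrow> (0, c) \<in> Basis"
  by (auto simp: Basis_prod_def)

lemma Basis_PairE:
  assumes "b \<in> (Basis :: ('a::euclidean_space \<times> 'b::euclidean_space) set)"
  obtains c where "c \<in> Basis" "b = (c, 0)" | c where "c \<in> Basis" "b = (0, c)"
  using assms by (auto simp: Basis_prod_def)

text \<open>The radius is uniform in the parameter \<open>z\<close>, so that one ball carries all
  integrals over \<open>y\<close>, and derivatives in \<open>z\<close> stay in the class.\<close>

definition csmooth :: "('z::euclidean_space \<Rightarrow> 'a::euclidean_space \<Rightarrow> complex) \<Rightarrow> bool" where
  "csmooth g \<longleftrightarrow> smooth_on UNIV (\<lambda>(z, y). g z y) \<and> (\<exists>R. \<forall>z y. norm y > R \<longrightarrow> g z y = 0)"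

lemma csmooth_smooth: "csmooth g \<Longrightarrow> smooth_on UNIV (\<lambda>(z, y). g z y)"
  by (simp add: csmooth_def)

lemma csmooth_slice_test:
  assumes "csmooth g"
  shows "g z \<in> test_functions"
proof -
  obtain R where "\<And>z y. norm y > R \<Longrightarrow> g z y = 0" using assms unfolding csmooth_def by blast
  then show ?thesis using smooth_on_slice(1)[OF csmooth_smooth[OF assms]] by (intro test_functionsI[of _ R])
qed

lemma csmooth_pdiff_left:
  assumes "csmooth g" "b \<in> Basis"
  shows "csmooth (\<lambda>z y. pdiff b (\<lambda>z. g z y) z)"
proof -
  obtain R where R: "\<And>z y. norm y > R \<Longrightarrow> g z y = 0" using assms unfolding csmooth_def by blast
  have "smooth_on UNIV (pdiff (b, 0) (\<lambda>(z, y). g z y))"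
    by (intro smooth_on_pdiff csmooth_smooth assms Basis_PairI open_UNIV)
  then show ?thesis unfolding csmooth_def pdiff_slice'(1)
    using R by (intro conjI exI[of _ R]) auto
qed

lemma csmooth_mult:
  assumes "csmooth g" "smooth_on UNIV (\<lambda>(z, y). h z y)"
  shows "csmooth (\<lambda>z y. h z y * g z y)"
proof -
  obtain R where R: "\<And>z y. norm y > R \<Longrightarrow> g z y = 0" using assms unfolding csmooth_def by blast
  show ?thesis unfolding csmooth_def
    using smooth_on_mult[OF open_UNIV assms(2) csmooth_smooth[OF assms(1)]] R
    by (auto simp: split_def)
qed

lemma csmooth_mult_inner:
  "csmooth g \<Longrightarrow> csmooth (\<lambda>z y. c * complex_of_real (y \<bullet> b) * g z y)"
proof (rule csmooth_mult)
  have "smooth_on UNIV (\<lambda>p. c * complex_of_real (snd p \<bullet> b))"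
    by (intro smooth_on_mult smooth_on_of_real smooth_on_inner smooth_on_linear bounded_linear_snd smooth_on_const open_UNIV)
  then show "smooth_on UNIV (\<lambda>(z, y). c * complex_of_real (y \<bullet> b))" by (simp add: split_def)
qed

text \<open>The support in \<open>y\<close> may grow with \<open>z\<close>, as it does for the
  translates \<open>f (t *\<^sub>R b + y)\<close> used below.\<close>

lemma dominated_bounded_support:
  fixes F :: "'z::euclidean_space \<Rightarrow> 'e::euclidean_space \<Rightarrow> complex"
  assumes c: "continuous_on UNIV (\<lambda>(z, y). F z y)"
    and s: "\<And>R. \<exists>S. \<forall>z y. norm z \<le> R \<longrightarrow> norm y > S \<longrightarrow> F z y = 0"
  shows "dominated F"
  unfolding dominated_def
proof (intro conjI allI c)
  fix R
  obtain S where S: "\<And>z y. norm z \<le> R \<Longrightarrow> norm y > S \<Longrightarrow> F z y = 0" using s by blast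
  have "compact ((\<lambda>(z, y). F z y) ` (cball 0 R \<times> cball 0 S))"
    by (intro compact_continuous_image compact_Times compact_cball continuous_on_subset[OF c]) auto
  then have "bounded ((\<lambda>(z, y). F z y) ` (cball 0 R \<times> cball 0 S))" by (rule compact_imp_bounded)
  then obtain B where B0: "\<And>v. v \<in> (\<lambda>(z, y). F z y) ` (cball 0 R \<times> cball 0 S) \<Longrightarrow> norm v \<le> B" "B > 0"
    unfolding bounded_pos by blast
  have B: "norm (F z y) \<le> B" if "norm z \<le> R" "norm y \<le> S" for z y
    using B0(1)[of "F z y"] that by force
  have "integrable lborel (\<lambda>y::'e. B * indicator (cball 0 S) y)"
    by (intro integrable_mult_right integrable_real_indicator) (simp_all add: emeasure_lborel_cball_finite[unfolded infinity_ennreal_def])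
  moreover have "norm (F z y) \<le> B * indicator (cball 0 S) y" if "norm z \<le> R" for z y
    using S[OF that, of y] B[OF that, of y] by (cases "norm y \<le> S") auto
  ultimately show "\<exists>g. integrable lborel g \<and> (\<forall>z \<eta>. norm z \<le> R \<longrightarrow> norm (F z \<eta>) \<le> g \<eta>)" by blast
qed

lemma csmooth_dominated: "csmooth g \<Longrightarrow> dominated g"
  by (rule dominated_bounded_support) (auto simp: csmooth_def intro: smooth_on_imp_continuous_on)

lemma csmooth_integral:
  assumes g: "csmooth g"
  shows "(\<lambda>z. LINT y|lborel. g z y) differentiable (at z)"
    and "b \<in> Basis \<Longrightarrow> pdiff b (\<lambda>z. LINT y|lborel. g z y) z = (LINT y|lborel. pdiff b (\<lambda>z. g z y) z)"
proof -
  have d: "(\<lambda>z. g z y) differentiable (at z)" for y z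
    by (rule smooth_on_differentiable[OF open_UNIV smooth_on_slice(2)[OF csmooth_smooth[OF g]] UNIV_I])
  note D = dominated_derivative[where D = "\<lambda>b z y. pdiff b (\<lambda>z. g z y) z",
    OF csmooth_dominated[OF g] csmooth_dominated[OF csmooth_pdiff_left[OF g]] d refl]
  show "(\<lambda>z. LINT y|lborel. g z y) differentiable (at z)" by (rule D(1))
  show "b \<in> Basis \<Longrightarrow> pdiff b (\<lambda>z. LINT y|lborel. g z y) z = (LINT y|lborel. pdiff b (\<lambda>z. g z y) z)" by (rule D(2))
qed

text \<open>The integral of the translate \<open>f (t *\<^sub>R b + y)\<close> over \<open>y\<close>
  does not depend on \<open>t\<close>, and differentiating it at \<open>t = 0\<close> under the
  integral sign gives the claim.\<close>

lemma integral_pdiff_test_function: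
  assumes f: "f \<in> test_functions" and b: "b \<in> Basis"
  shows "(LINT y|lborel. pdiff b f y) = 0"
proof -
  obtain R where R: "R > 0" "\<And>x. norm x > R \<Longrightarrow> f x = 0" using test_functions_support[OF f] by metis
  have L: "bounded_linear (\<lambda>t::real. t *\<^sub>R b)" by (rule bounded_linear_scaleR_left)
  have lin: "bounded_linear (\<lambda>p::real \<times> 'a. fst p *\<^sub>R b + snd p)"
    by (intro bounded_linear_add bounded_linear_scaleR_const bounded_linear_fst bounded_linear_snd)
  define g where "g t y = f (t *\<^sub>R b + y)" for t :: real and y
  have gs: "smooth_on UNIV (\<lambda>(t, y). g t y)"
    using smooth_on_compose_linear0[OF lin open_UNIV open_UNIV UNIV_I test_functions_smooth[OF f]]
    by (simp add: g_def split_def)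
  have sup: "g t y = 0" if "\<bar>t\<bar> \<le> S" "norm y > R + S" for t y S
  proof -
    have "norm (t *\<^sub>R b) \<le> S" using that(1) b by simp
    then have "norm (t *\<^sub>R b + y) > R" using that(2) norm_diff_ineq[of y "t *\<^sub>R b"] by (simp add: add.commute)
    then show ?thesis using R by (simp add: g_def)
  qed
  have d: "f differentiable (at x)" for x
    by (rule smooth_on_differentiable[OF open_UNIV test_functions_smooth[OF f] UNIV_I])
  have pd: "pdiff 1 (\<lambda>t. g t y) t = pdiff b f (t *\<^sub>R b + y)" for t y
    unfolding g_def using pdiff_compose_linear(2)[OF L d, of 1 y t] sum_Basis_inner_scaleR[OF b] by simp
  have D0: "dominated g"
    by (rule dominated_bounded_support[OF smooth_on_imp_continuous_on[OF gs]])
      (use sup in \<open>auto intro!: exI[of _ "R + _"]\<close>)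
  have "smooth_on UNIV (pdiff (1, 0) (\<lambda>(t, y). g t y))"
    by (rule smooth_on_pdiff[OF open_UNIV gs Basis_PairI(1)]) simp
  then have c1: "continuous_on UNIV (\<lambda>(t, y). pdiff 1 (\<lambda>t. g t y) t)"
    unfolding pdiff_slice'(1) by (rule smooth_on_imp_continuous_on)
  have sup1: "pdiff 1 (\<lambda>t. g t y) t = 0" if "\<bar>t\<bar> \<le> S" "norm y > R + S" for t y S
  proof -
    have "norm (t *\<^sub>R b) \<le> S" using that(1) b by simp
    then have "norm (t *\<^sub>R b + y) > R" using that(2) norm_diff_ineq[of y "t *\<^sub>R b"] by (simp add: add.commute)
    then show ?thesis unfolding pd using R(2) by (rule pdiff_eq_0_outside[rotated])
  qed
  have D1: "dominated (\<lambda>t y. pdiff 1 (\<lambda>t. g t y) t)"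
    by (rule dominated_bounded_support[OF c1])
      (use sup1 in \<open>auto intro!: exI[of _ "R + _"]\<close>)
  have "pdiff 1 (\<lambda>t. LINT y|lborel. g t y) 0 = (LINT y|lborel. pdiff 1 (\<lambda>t. g t y) 0)"
    by (rule dominated_derivative(2)[where D = "\<lambda>b t y. pdiff b (\<lambda>t. g t y) t", OF D0])
      (use D1 smooth_on_differentiable[OF open_UNIV smooth_on_slice(2)[OF gs] UNIV_I] in auto)
  moreover have "(LINT y|lborel. g t y) = (LINT y|lborel. f y)" for t
    unfolding g_def using test_functions_integrable[OF f]
    by (intro lborel_integral_shift) (auto dest: borel_measurable_integrable)
  ultimately show ?thesis by (simp add: pd)
qed

lemma smooth_on_cis_inner_const: "smooth_on UNIV (\<lambda>y. cis (- (y \<bullet> \<eta>)))"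
  by (intro smooth_on_cis smooth_on_uminus smooth_on_inner smooth_on_linear bounded_linear_ident smooth_on_const open_UNIV)

lemma ft_integrand_test: "f \<in> test_functions \<Longrightarrow> (\<lambda>y. cis (- (y \<bullet> \<eta>)) * f y) \<in> test_functions"
  by (rule test_functions_mult(2)[OF _ smooth_on_cis_inner_const])

lemma ft_integrable: "f \<in> test_functions \<Longrightarrow> integrable lborel (\<lambda>y. cis (- (y \<bullet> \<eta>)) * f y)"
  by (intro test_functions_integrable ft_integrand_test)

lemma ft_diff: "f \<in> test_functions \<Longrightarrow> g \<in> test_functions \<Longrightarrow> ft (\<lambda>y. f y - g y) \<eta> = ft f \<eta> - ft g \<eta>"
  unfolding ft_def by (simp add: right_diff_distrib ft_integrable)

lemma ft_sum: "(\<And>i. i \<in> I \<Longrightarrow> f i \<in> test_functions) \<Longrightarrow> ft (\<lambda>y. \<Sum>i\<in>I. f i y) \<eta> = (\<Sum>i\<in>I. ft (f i) \<eta>)"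
  unfolding ft_def by (simp add: sum_distrib_left ft_integrable)

lemma ft_cmult: "ft (\<lambda>y. c * f y) \<eta> = c * ft f \<eta>"
proof -
  have "cis (- (y \<bullet> \<eta>)) * (c * f y) = c * (cis (- (y \<bullet> \<eta>)) * f y)" for y by simp
  then show ?thesis unfolding ft_def by (simp only: integral_mult_right_zero)
qed

lemma ft_cis_mult: "ft (\<lambda>y. cis (y \<bullet> \<xi>) * f y) \<eta> = ft f (\<eta> - \<xi>)"
  unfolding ft_def by (rule Bochner_Integration.integral_cong)
    (simp_all add: mult.assoc[symmetric] cis_mult inner_diff_right)

lemma ft_pdiff:
  assumes f: "f \<in> test_functions" and b: "b \<in> Basis"
  shows "ft (pdiff b f) \<eta> = \<i> * complex_of_real (\<eta> \<bullet> b) * ft f \<eta>"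
proof -
  have d: "f differentiable (at x)" for x
    by (rule smooth_on_differentiable[OF open_UNIV test_functions_smooth[OF f] UNIV_I])
  have pd: "pdiff b (\<lambda>y. cis (- (y \<bullet> \<eta>)) * f y) y =
      cis (- (y \<bullet> \<eta>)) * pdiff b f y - \<i> * complex_of_real (\<eta> \<bullet> b) * (cis (- (y \<bullet> \<eta>)) * f y)" for y
    using pdiff_mult[OF pdiff_cis_inner(1)[of "- \<eta>" y] d, of b] pdiff_cis_inner(2)[of b "- \<eta>" y]
    by (simp add: inner_commute)
  have "0 = (LINT y|lborel. pdiff b (\<lambda>y. cis (- (y \<bullet> \<eta>)) * f y) y)"
    by (rule integral_pdiff_test_function[symmetric, OF ft_integrand_test[OF f] b])
  also have "\<dots> = ft (pdiff b f) \<eta> - \<i> * complex_of_real (\<eta> \<bullet> b) * ft f \<eta>"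
    unfolding pd ft_def
    by (simp only: Bochner_Integration.integral_diff ft_integrable f test_functions_pdiff b
        integrable_mult_right integral_mult_right_zero)
  finally show ?thesis by simp
qed

lemma ft_ider:
  assumes f: "f \<in> test_functions"
  shows "set l \<subseteq> Basis \<Longrightarrow> ft (ider l f) \<eta> = \<i> ^ length l * complex_of_real (\<Prod>b\<leftarrow>l. \<eta> \<bullet> b) * ft f \<eta>"
  by (induction l) (simp_all add: ft_pdiff test_functions_ider[OF f])

lemma ider_add:
  assumes "open S" "smooth_on S f" "smooth_on S g"
  shows "set l \<subseteq> Basis \<Longrightarrow> x \<in> S \<Longrightarrow> ider l (\<lambda>x. f x + g x) x = ider l f x + ider l g x"
proof (induction l arbitrary: x)
  case (Cons b l)
  have "ider (b # l) (\<lambda>x. f x + g x) x = pdiff b (\<lambda>x. ider l f x + ider l g x) x"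
    unfolding ider_simps by (rule pdiff_cong_open[OF assms(1) Cons.prems(2)]) (use Cons in auto)
  also have "\<dots> = ider (b # l) f x + ider (b # l) g x"
    unfolding ider_simps using Cons.prems
    by (intro pdiff_add smooth_on_differentiable[OF assms(1)] smooth_on_ider assms) auto
  finally show ?case .
qed simp

lemma ider_const_0: "ider l (\<lambda>x. 0) = (\<lambda>x. 0)"
proof (induction l)
  case (Cons b l)
  show ?case unfolding ider_simps Cons by (rule ext) simp
qed simp

lemma ider_sum:
  assumes "open S" "\<And>i. i \<in> I \<Longrightarrow> smooth_on S (f i)" "set l \<subseteq> Basis" "x \<in> S"
  shows "ider l (\<lambda>x. \<Sum>i\<in>I. f i x) x = (\<Sum>i\<in>I. ider l (f i) x)"
  using assms(2)
proof (induction I rule: infinite_finite_induct)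
  case (insert i I)
  have "ider l (\<lambda>x. f i x + (\<Sum>i\<in>I. f i x)) x = ider l (f i) x + ider l (\<lambda>x. \<Sum>i\<in>I. f i x) x"
    by (rule ider_add[OF assms(1) _ _ assms(3,4)]) (use insert in \<open>auto intro: smooth_on_sum assms(1)\<close>)
  then show ?case using insert by simp
qed (simp_all add: ider_const_0)

lemma ider_cmult:
  fixes f :: "'a::euclidean_space \<Rightarrow> 'b::real_normed_algebra"
  assumes "open S" "smooth_on S f"
  shows "set l \<subseteq> Basis \<Longrightarrow> x \<in> S \<Longrightarrow> ider l (\<lambda>x. c * f x) x = c * ider l f x"
proof (induction l arbitrary: x)
  case (Cons b l)
  have "ider (b # l) (\<lambda>x. c * f x) x = pdiff b (\<lambda>x. c * ider l f x) x"
    unfolding ider_simps by (rule pdiff_cong_open[OF assms(1) Cons.prems(2)]) (use Cons in auto)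
  also have "\<dots> = c * ider (b # l) f x"
    unfolding ider_simps using Cons.prems
    by (intro pdiff_cmult smooth_on_differentiable[OF assms(1)] smooth_on_ider assms) auto
  finally show ?case .
qed simp

text \<open>The operator \<open>1 - \<Delta>\<close>, whose Fourier multiplier is exactly
  \<open>(japanese \<eta>)\<^sup>2\<close>.\<close>

definition bessel :: "('a::euclidean_space \<Rightarrow> complex) \<Rightarrow> 'a \<Rightarrow> complex" where
  "bessel f x = f x + (-1) * (\<Sum>b\<in>Basis. pdiff b (pdiff b f) x)"

lemma bessel_test:
  assumes "f \<in> test_functions"
  shows "bessel f \<in> test_functions"
    and "(\<And>x. norm x > R \<Longrightarrow> f x = 0) \<Longrightarrow> norm x > R \<Longrightarrow> bessel f x = 0"
    and "ft (bessel f) \<eta> = complex_of_real ((japanese \<eta>)\<^sup>2) * ft f \<eta>"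
    and "set l \<subseteq> Basis \<Longrightarrow> ider l (bessel f) x = ider l f x + (-1) * (\<Sum>b\<in>Basis. ider (l @ [b, b]) f x)"
proof -
  have t2: "pdiff b (pdiff b f) \<in> test_functions" if "b \<in> Basis" for b
    by (intro test_functions_pdiff that assms)
  have s: "smooth_on UNIV f" "\<And>b. b \<in> Basis \<Longrightarrow> smooth_on UNIV (pdiff b (pdiff b f))"
    using assms t2 by (auto intro: test_functions_smooth)
  have ss: "smooth_on UNIV (\<lambda>x. \<Sum>b\<in>Basis. pdiff b (pdiff b f) x)" by (intro smooth_on_sum s open_UNIV)
  have st: "(\<lambda>x. \<Sum>b\<in>Basis. pdiff b (pdiff b f) x) \<in> test_functions"
  proof -
    obtain R where R: "\<And>x. norm x > R \<Longrightarrow> f x = 0" using test_functions_support[OF assms] by metis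
    show ?thesis by (rule test_functionsI[OF ss, of R]) (intro sum.neutral ballI pdiff_eq_0_outside[where R = R and f = "pdiff _ f"] pdiff_eq_0_outside[OF R])
  qed
  show "bessel f \<in> test_functions"
    unfolding bessel_def[abs_def] by (intro test_functions_add assms test_functions_cmult st)
  show "bessel f x = 0" if "\<And>x. norm x > R \<Longrightarrow> f x = 0" "norm x > R"
  proof -
    have "pdiff b (pdiff b f) x = 0" for b
      by (intro pdiff_eq_0_outside[where R = R and f = "pdiff _ f"] pdiff_eq_0_outside[OF that(1)] that(2))
    then show ?thesis using that by (simp add: bessel_def)
  qed
  have ii: "\<i> * complex_of_real t * (\<i> * complex_of_real t * z) = - complex_of_real (t\<^sup>2) * z" for t z
    by (simp add: power2_eq_square algebra_simps)
  have nn: "(norm \<eta>)\<^sup>2 = (\<Sum>b\<in>Basis. (\<eta> \<bullet> b)\<^sup>2)"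
    unfolding power2_norm_eq_inner by (subst euclidean_inner) (simp add: power2_eq_square)
  have "ft (bessel f) \<eta> = ft (\<lambda>x. f x - (\<Sum>b\<in>Basis. pdiff b (pdiff b f) x)) \<eta>"
    by (simp add: bessel_def[abs_def])
  also have "\<dots> = ft f \<eta> - (\<Sum>b\<in>Basis. ft (pdiff b (pdiff b f)) \<eta>)"
    by (simp add: ft_diff assms st ft_sum t2)
  also have "(\<Sum>b\<in>Basis. ft (pdiff b (pdiff b f)) \<eta>) = (\<Sum>b\<in>Basis. - complex_of_real ((\<eta> \<bullet> b)\<^sup>2) * ft f \<eta>)"
    by (rule sum.cong[OF refl]) (simp only: ft_pdiff test_functions_pdiff assms ii)
  also have "ft f \<eta> - \<dots> = complex_of_real ((japanese \<eta>)\<^sup>2) * ft f \<eta>"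
    unfolding japanese_square nn by (simp add: sum_negf sum_distrib_left algebra_simps)
  finally show "ft (bessel f) \<eta> = complex_of_real ((japanese \<eta>)\<^sup>2) * ft f \<eta>" .
  assume l: "set l \<subseteq> Basis"
  have "ider l (bessel f) x = ider l f x + ider l (\<lambda>x. (-1) * (\<Sum>b\<in>Basis. pdiff b (pdiff b f) x)) x"
    unfolding bessel_def[abs_def]
    by (rule ider_add[OF open_UNIV s(1) smooth_on_mult[OF open_UNIV smooth_on_const ss] l UNIV_I])
  also have "ider l (\<lambda>x. (-1) * (\<Sum>b\<in>Basis. pdiff b (pdiff b f) x)) x = (-1) * (\<Sum>b\<in>Basis. ider l (pdiff b (pdiff b f)) x)"
    by (simp only: ider_cmult[OF open_UNIV ss l UNIV_I] ider_sum[OF open_UNIV s(2) l UNIV_I])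
  finally show "ider l (bessel f) x = ider l f x + (-1) * (\<Sum>b\<in>Basis. ider (l @ [b, b]) f x)"
    by (simp add: ider_append)
qed

text \<open>Each application of \<open>1 - \<Delta>\<close> gains two powers of decay and costs two
  derivatives. The constant \<open>B\<close> depends on \<open>R\<close> and \<open>M\<close> only
  and the bound is linear in \<open>S\<close>; this uniformity is what permits its use for families
  of functions.\<close>

lemma ft_decay:
  fixes R :: real
  shows "\<exists>B\<ge>0. \<forall>f S \<eta>. f \<in> (test_functions :: ('a::euclidean_space \<Rightarrow> complex) set) \<longrightarrow> (\<forall>y. norm y > R \<longrightarrow> f y = 0) \<longrightarrow>
    (\<forall>l y. set l \<subseteq> Basis \<longrightarrow> length l \<le> 2 * M \<longrightarrow> norm (ider l f y) \<le> S) \<longrightarrow>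
    norm (ft f \<eta>) \<le> B * S * japanese \<eta> powr (- 2 * real M)"
proof (induction M)
  case 0
  define B where "B = measure lborel (cball (0::'a) R)"
  have "norm (ft f \<eta>) \<le> B * S * japanese \<eta> powr (- 2 * real 0)"
    if f: "f \<in> test_functions" "\<And>y. norm y > R \<Longrightarrow> f y = 0" and S: "\<And>y. norm (f y) \<le> S"
    for f :: "'a \<Rightarrow> complex" and S \<eta>
  proof -
    have "norm (ft f \<eta>) \<le> (LINT y|lborel. norm (cis (- (y \<bullet> \<eta>)) * f y))"
      unfolding ft_def by (rule integral_norm_bound)
    also have "\<dots> \<le> (LINT y|lborel. S * indicator (cball (0::'a) R) y)"
    proof (rule Bochner_Integration.integral_mono)
      show "integrable lborel (\<lambda>y. norm (cis (- (y \<bullet> \<eta>)) * f y))"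
        by (intro integrable_norm ft_integrable f)
      show "integrable lborel (\<lambda>y::'a. S * indicator (cball 0 R) y)"
        by (intro integrable_mult_right integrable_real_indicator) (simp_all add: emeasure_lborel_cball_finite[unfolded infinity_ennreal_def])
      show "norm (cis (- (y \<bullet> \<eta>)) * f y) \<le> S * indicator (cball 0 R) y" for y
        using f(2)[of y] S[of y] by (cases "norm y \<le> R") (auto simp: norm_mult)
    qed
    also have "\<dots> = B * S" by (simp add: B_def)
    finally show ?thesis by simp
  qed
  moreover have "B \<ge> 0" by (simp add: B_def)
  ultimately show ?case by (intro exI[of _ B]) (metis bot.extremum ider_simps(1) le0 list.set(1) list.size(3))
next
  case (Suc M)
  then obtain B where B: "B \<ge> 0" and IH: "\<And>f S \<eta>. f \<in> (test_functions :: ('a \<Rightarrow> complex) set) \<Longrightarrow> (\<And>y. norm y > R \<Longrightarrow> f y = 0) \<Longrightarrow>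
    (\<And>l y. set l \<subseteq> Basis \<Longrightarrow> length l \<le> 2 * M \<Longrightarrow> norm (ider l f y) \<le> S) \<Longrightarrow>
    norm (ft f \<eta>) \<le> B * S * japanese \<eta> powr (- 2 * real M)"
    by blast
  define n where "n = real DIM('a)"
  have "norm (ft f \<eta>) \<le> (B * (1 + n)) * S * japanese \<eta> powr (- 2 * real (Suc M))"
    if f: "f \<in> test_functions" "\<And>y. norm y > R \<Longrightarrow> f y = 0"
      and S: "\<And>l y. set l \<subseteq> Basis \<Longrightarrow> length l \<le> 2 * Suc M \<Longrightarrow> norm (ider l f y) \<le> S"
    for f :: "'a \<Rightarrow> complex" and S \<eta>
  proof -
    \<comment> \<open>The operator \<open>1 - \<Delta>\<close> is a signed sum of
      \<open>1 + n\<close> derivatives, hence the factor.\<close>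
    have le: "norm (ider l (bessel f) y) \<le> (1 + n) * S" if l: "set l \<subseteq> Basis" "length l \<le> 2 * M" for l y
    proof -
      have "norm (ider l (bessel f) y) \<le> norm (ider l f y) + norm (\<Sum>b\<in>Basis. ider (l @ [b, b]) f y)"
        unfolding bessel_test(4)[OF f(1) l(1)] using norm_triangle_ineq4 by simp
      also have "norm (\<Sum>b\<in>Basis. ider (l @ [b, b]) f y) \<le> (\<Sum>b\<in>(Basis::'a set). S)"
        by (rule sum_norm_le) (use l in \<open>auto intro!: S\<close>)
      also have "norm (ider l f y) \<le> S" using l by (intro S) auto
      finally show ?thesis by (simp add: n_def algebra_simps)
    qed
    have "norm (ft (bessel f) \<eta>) \<le> B * ((1 + n) * S) * japanese \<eta> powr (- 2 * real M)"
      by (rule IH[OF bessel_test(1)[OF f(1)] bessel_test(2)[OF f(1) f(2)] le])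
    then have "(japanese \<eta>)\<^sup>2 * norm (ft f \<eta>) \<le> B * ((1 + n) * S) * japanese \<eta> powr (- 2 * real M)"
      unfolding bessel_test(3)[OF f(1)] by (simp add: norm_mult norm_power)
    then have le2: "japanese \<eta> powr (-2) * ((japanese \<eta>)\<^sup>2 * norm (ft f \<eta>))
        \<le> japanese \<eta> powr (-2) * (B * ((1 + n) * S) * japanese \<eta> powr (- 2 * real M))"
      by (rule mult_left_mono) simp
    have e1: "japanese \<eta> powr (-2) * (japanese \<eta>)\<^sup>2 = 1"
      by (simp add: powr_minus powr_numeral)
    have e2: "japanese \<eta> powr (-2) * japanese \<eta> powr (- 2 * real M) = japanese \<eta> powr (- 2 * real (Suc M))"
      by (simp flip: powr_add)
    have "norm (ft f \<eta>) = japanese \<eta> powr (-2) * ((japanese \<eta>)\<^sup>2 * norm (ft f \<eta>))"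
      unfolding mult.assoc[symmetric] e1 by simp
    also note le2
    also have "japanese \<eta> powr (-2) * (B * ((1 + n) * S) * japanese \<eta> powr (- 2 * real M))
        = (B * (1 + n)) * S * (japanese \<eta> powr (-2) * japanese \<eta> powr (- 2 * real M))"
      by (simp only: mult_ac)
    finally show ?thesis unfolding e2 .
  qed
  moreover have "B * (1 + n) \<ge> 0" using B by (simp add: n_def)
  ultimately show ?case by blast
qed

section \<open>Fourier inversion for test functions\<close>

lemma continuous_on_gauss: "continuous_on S h \<Longrightarrow> continuous_on S (\<lambda>x. gauss (h x))"
  unfolding gauss_def by (intro continuous_intros) auto

text \<open>The inversion integral is damped by a Gaussian of width \<open>1 / e k\<close>. Without
  the damping it converges by assumption, so the damped integrals tend to it; with the damping
  Fubini applies and gives an average of \<open>f\<close> that concentrates at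
  \<open>x\<close>.\<close>

lemma fourier_inversion:
  fixes f :: "'a::euclidean_space \<Rightarrow> complex"
  assumes f: "f \<in> test_functions" and fi: "integrable lborel (ft f)"
  shows "(LINT \<eta>|lborel. cis (x \<bullet> \<eta>) * ft f \<eta>) = complex_of_real ((2 * pi) ^ DIM('a)) * f x"
proof -
  have fc: "continuous_on UNIV f" by (rule test_functions_continuous[OF f])
  have fm: "f \<in> borel_measurable borel" by (rule borel_measurable_continuous_onI[OF fc])
  obtain B where B: "\<And>y. norm (f y) \<le> B" using test_functions_bounded[OF f] by blast
  note gc = continuous_on_gauss
  have g1: "0 \<le> gauss \<eta>" "gauss \<eta> \<le> 1" for \<eta> :: 'a unfolding gauss_def by auto
  have gi: "integrable lborel (\<lambda>z::'a. complex_of_real (gauss z))" using integrable_gauss_cis[of 0] by simp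
  define e :: "nat \<Rightarrow> real" where "e k = 1 / real (Suc k)" for k
  have e: "e k > 0" for k by (simp add: e_def)
  have e0: "e \<longlonglongrightarrow> 0" unfolding e_def by (rule LIMSEQ_inverse_real_of_nat[unfolded inverse_eq_divide])
  define J where "J k = (LINT \<eta>|lborel. complex_of_real (gauss (e k *\<^sub>R \<eta>)) * (cis (x \<bullet> \<eta>) * ft f \<eta>))" for k
  have cm: "(\<lambda>\<eta>. cis (x \<bullet> \<eta>)) \<in> borel_measurable borel"
    by (intro borel_measurable_continuous_onI continuous_on_cis continuous_intros)
  have gm: "(\<lambda>\<eta>::'a. gauss (c *\<^sub>R \<eta>)) \<in> borel_measurable borel" for c
    by (intro borel_measurable_continuous_onI gc continuous_intros)
  have [measurable]: "(gauss :: 'a \<Rightarrow> real) \<in> borel_measurable borel" using gm[of 1] by simp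
  note fm [measurable]
  have ftm: "ft f \<in> borel_measurable borel" using borel_measurable_integrable[OF fi] by simp
  have J1: "J \<longlonglongrightarrow> (LINT \<eta>|lborel. cis (x \<bullet> \<eta>) * ft f \<eta>)"
    unfolding J_def
  proof (rule integral_dominated_convergence[where w = "\<lambda>\<eta>. norm (ft f \<eta>)"])
    show "AE \<eta> in lborel. (\<lambda>k. complex_of_real (gauss (e k *\<^sub>R \<eta>)) * (cis (x \<bullet> \<eta>) * ft f \<eta>)) \<longlonglongrightarrow> cis (x \<bullet> \<eta>) * ft f \<eta>"
    proof (rule AE_I2)
      fix \<eta> :: 'a
      have "(\<lambda>k. exp (- ((norm (e k *\<^sub>R \<eta>))\<^sup>2 / 2))) \<longlonglongrightarrow> exp (- ((norm ((0::real) *\<^sub>R \<eta>))\<^sup>2 / 2))"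
        by (intro tendsto_intros e0) auto
      then have "(\<lambda>k. gauss (e k *\<^sub>R \<eta>)) \<longlonglongrightarrow> 1" by (simp add: gauss_def)
      then have "(\<lambda>k. complex_of_real (gauss (e k *\<^sub>R \<eta>)) * (cis (x \<bullet> \<eta>) * ft f \<eta>)) \<longlonglongrightarrow> complex_of_real 1 * (cis (x \<bullet> \<eta>) * ft f \<eta>)"
        by (intro tendsto_intros)
      then show "(\<lambda>k. complex_of_real (gauss (e k *\<^sub>R \<eta>)) * (cis (x \<bullet> \<eta>) * ft f \<eta>)) \<longlonglongrightarrow> cis (x \<bullet> \<eta>) * ft f \<eta>" by simp
    qed
    show "AE \<eta> in lborel. norm (complex_of_real (gauss (e k *\<^sub>R \<eta>)) * (cis (x \<bullet> \<eta>) * ft f \<eta>)) \<le> norm (ft f \<eta>)" for k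
      by (rule AE_I2) (use g1 in \<open>auto simp: norm_mult intro!: mult_left_le_one_le\<close>)
  qed (use cm gm ftm fi in \<open>auto intro!: borel_measurable_times\<close>)
  have J2: "J k = complex_of_real (sqrt (2 * pi) ^ DIM('a)) * (LINT z|lborel. f (x + e k *\<^sub>R z) * complex_of_real (gauss z))" for k
  proof -
    define G where "G \<eta> y = complex_of_real (gauss (e k *\<^sub>R \<eta>)) * cis ((x - y) \<bullet> \<eta>) * f y" for \<eta> y
    have Gc: "continuous_on UNIV (\<lambda>(\<eta>, y). G \<eta> y)"
      unfolding G_def split_def by (intro continuous_intros continuous_on_cis gc continuous_on_compose2[OF fc]) auto
    have "J k = (LINT \<eta>|lborel. LINT y|lborel. G \<eta> y)"
      unfolding J_def
    proof (rule Bochner_Integration.integral_cong[OF refl])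
      fix \<eta>
      have "cis ((x - y) \<bullet> \<eta>) = cis (x \<bullet> \<eta>) * cis (- (y \<bullet> \<eta>))" for y by (simp add: cis_mult inner_diff_left)
      then have "G \<eta> y = (complex_of_real (gauss (e k *\<^sub>R \<eta>)) * cis (x \<bullet> \<eta>)) * (cis (- (y \<bullet> \<eta>)) * f y)" for y
        by (simp add: G_def mult_ac)
      then show "complex_of_real (gauss (e k *\<^sub>R \<eta>)) * (cis (x \<bullet> \<eta>) * ft f \<eta>) = (LINT y|lborel. G \<eta> y)"
        by (simp only: ft_def integral_mult_right_zero mult.assoc)
    qed
    also have "\<dots> = (LINT y|lborel. LINT \<eta>|lborel. G \<eta> y)"
    proof (rule fubini_tensor_bound[symmetric, OF Gc gauss_cis_scaled(1)[OF e]])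
      show "integrable lborel (\<lambda>y. norm (f y))" by (intro integrable_norm test_functions_integrable f)
      show "norm (G \<eta> y) \<le> gauss (e k *\<^sub>R \<eta>) * norm (f y)" for \<eta> y using g1 by (simp add: G_def norm_mult)
    qed
    also have "\<dots> = (LINT y|lborel. f y * complex_of_real (sqrt (2 * pi) ^ DIM('a) * gauss ((1 / e k) *\<^sub>R (x - y)) / e k ^ DIM('a)))"
    proof (rule Bochner_Integration.integral_cong[OF refl])
      fix y
      have "(LINT \<eta>|lborel. G \<eta> y) = (LINT \<eta>|lborel. complex_of_real (gauss (e k *\<^sub>R \<eta>)) * cis ((x - y) \<bullet> \<eta>)) * f y"
        unfolding G_def by (rule integral_mult_left_zero)
      then show "(LINT \<eta>|lborel. G \<eta> y) = f y * complex_of_real (sqrt (2 * pi) ^ DIM('a) * gauss ((1 / e k) *\<^sub>R (x - y)) / e k ^ DIM('a))"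
        using gauss_cis_scaled(2)[OF e[of k], of "x - y"] e[of k]
        by (simp add: field_simps)
    qed
    \<comment> \<open>Substituting \<open>y = x + e k *\<^sub>R z\<close> frees the Gaussian from
      \<open>k\<close> and moves \<open>k\<close> into the argument of \<open>f\<close>, where
      continuity at \<open>x\<close> applies.\<close>
    also have "\<dots> = complex_of_real (e k ^ DIM('a)) * (LINT z|lborel. f (x + e k *\<^sub>R z) *
        complex_of_real (sqrt (2 * pi) ^ DIM('a) * gauss ((1 / e k) *\<^sub>R (x - (x + e k *\<^sub>R z))) / e k ^ DIM('a)))"
      using e[of k] lborel_integral_affine[of "\<lambda>y. f y * complex_of_real (sqrt (2 * pi) ^ DIM('a) * gauss ((1 / e k) *\<^sub>R (x - y)) / e k ^ DIM('a))" "e k" x]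
      by (simp add: borel_measurable_continuous_onI continuous_intros fc gc)
    also have "\<dots> = (LINT z|lborel. complex_of_real (e k ^ DIM('a)) * (f (x + e k *\<^sub>R z) *
        complex_of_real (sqrt (2 * pi) ^ DIM('a) * gauss ((1 / e k) *\<^sub>R (x - (x + e k *\<^sub>R z))) / e k ^ DIM('a))))"
      by (rule integral_mult_right_zero[symmetric])
    also have "\<dots> = (LINT z|lborel. complex_of_real (sqrt (2 * pi) ^ DIM('a)) * (f (x + e k *\<^sub>R z) * complex_of_real (gauss z)))"
      using e[of k] by (intro Bochner_Integration.integral_cong) (auto simp: gauss_def)
    also have "\<dots> = complex_of_real (sqrt (2 * pi) ^ DIM('a)) * (LINT z|lborel. f (x + e k *\<^sub>R z) * complex_of_real (gauss z))"
      by (rule integral_mult_right_zero)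
    finally show ?thesis .
  qed
  have L1: "(\<lambda>k. LINT z|lborel. f (x + e k *\<^sub>R z) * complex_of_real (gauss z)) \<longlonglongrightarrow> (LINT z|lborel. f x * complex_of_real (gauss (z::'a)))"
  proof (rule integral_dominated_convergence[where w = "\<lambda>z::'a. B * gauss z"])
    show "AE z in lborel. (\<lambda>k. f (x + e k *\<^sub>R z) * complex_of_real (gauss z)) \<longlonglongrightarrow> f x * complex_of_real (gauss z)"
    proof (rule AE_I2)
      fix z
      have "(\<lambda>k. x + e k *\<^sub>R z) \<longlonglongrightarrow> x + 0 *\<^sub>R z" by (intro tendsto_intros e0)
      moreover have "isCont f (x + 0 *\<^sub>R z)" using fc by (simp add: continuous_on_eq_continuous_at)
      ultimately have "(\<lambda>k. f (x + e k *\<^sub>R z)) \<longlonglongrightarrow> f (x + 0 *\<^sub>R z)" by (rule isCont_tendsto_compose[rotated])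
      then show "(\<lambda>k. f (x + e k *\<^sub>R z) * complex_of_real (gauss z)) \<longlonglongrightarrow> f x * complex_of_real (gauss z)"
        by (intro tendsto_intros) simp
    qed
    show "integrable lborel (\<lambda>z::'a. B * gauss z)" using gi by (simp add: complex_of_real_integrable_eq)
    show "AE z in lborel. norm (f (x + e k *\<^sub>R z) * complex_of_real (gauss z)) \<le> B * gauss z" for k
      by (rule AE_I2) (use g1 B in \<open>auto simp: norm_mult intro!: mult_right_mono\<close>)
    show "(\<lambda>z::'a. f x * complex_of_real (gauss z)) \<in> borel_measurable lborel" by measurable
    show "(\<lambda>z. f (x + e k *\<^sub>R z) * complex_of_real (gauss z)) \<in> borel_measurable lborel" for k
      by measurable
  qed
  have "(LINT z|lborel. complex_of_real (gauss (z::'a))) = complex_of_real (sqrt (2 * pi) ^ DIM('a))"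
    using integral_gauss_cis[of "0::'a"] by (simp add: gauss_def[of "0::'a"] del: integral_complex_of_real)
  then have L2: "(LINT z|lborel. f x * complex_of_real (gauss (z::'a))) = complex_of_real (sqrt (2 * pi) ^ DIM('a)) * f x"
    using integral_mult_right_zero[of lborel "f x" "\<lambda>z::'a. complex_of_real (gauss z)"] by (simp only: mult.commute[of "f x"])
  have "J \<longlonglongrightarrow> complex_of_real (sqrt (2 * pi) ^ DIM('a)) * (complex_of_real (sqrt (2 * pi) ^ DIM('a)) * f x)"
    unfolding J2 by (rule tendsto_mult[OF tendsto_const L1[unfolded L2]])
  from LIMSEQ_unique[OF J1 this]
  have "(LINT \<eta>|lborel. cis (x \<bullet> \<eta>) * ft f \<eta>) = complex_of_real (sqrt (2 * pi) ^ DIM('a) * sqrt (2 * pi) ^ DIM('a)) * f x"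
    by (simp only: of_real_mult mult.assoc)
  moreover have "sqrt (2 * pi) ^ DIM('a) * sqrt (2 * pi) ^ DIM('a) = (2 * pi) ^ DIM('a)"
    unfolding power_mult_distrib[symmetric] by simp
  ultimately show ?thesis by simp
qed

subsection \<open>Symbol classes\<close>

text \<open>Local symbol classes. Unlike in the definition of symbols, derivatives are taken one at a time
  and in any order, which makes inductive arguments possible.\<close>

primrec symb :: "nat \<Rightarrow> real \<Rightarrow> 'x::euclidean_space set \<Rightarrow> ('x \<Rightarrow> 'k::euclidean_space \<Rightarrow> complex) \<Rightarrow> bool" where
  "symb 0 m U a \<longleftrightarrow> continuous_on (U \<times> UNIV) (\<lambda>(x, \<theta>). a x \<theta>) \<and>
     (\<forall>K. compact K \<longrightarrow> K \<subseteq> U \<longrightarrow> (\<exists>C. \<forall>x\<in>K. \<forall>\<theta>. cmod (a x \<theta>) \<le> C * japanese \<theta> powr m))"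
| "symb (Suc k) m U a \<longleftrightarrow>
     (\<forall>K. compact K \<longrightarrow> K \<subseteq> U \<longrightarrow> (\<exists>C. \<forall>x\<in>K. \<forall>\<theta>. cmod (a x \<theta>) \<le> C * japanese \<theta> powr m)) \<and>
     (\<forall>x\<in>U. \<forall>\<theta>. (\<lambda>(x, \<theta>). a x \<theta>) differentiable (at (x, \<theta>))) \<and>
     (\<forall>b\<in>Basis. symb k m U (\<lambda>x \<theta>. pdiff b (\<lambda>x. a x \<theta>) x)) \<and>
     (\<forall>b\<in>Basis. symb k (m - 1) U (\<lambda>x. pdiff b (a x)))"

declare symb.simps [simp del]

definition lsym :: "'x::euclidean_space set \<Rightarrow> real \<Rightarrow> ('x \<Rightarrow> 'k::euclidean_space \<Rightarrow> complex) set" where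
  "lsym U m = {a. \<forall>k. symb k m U a}"

lemma symb_0D:
  assumes "symb 0 m U a"
  shows "continuous_on (U \<times> UNIV) (\<lambda>(x, \<theta>). a x \<theta>)"
    and "compact K \<Longrightarrow> K \<subseteq> U \<Longrightarrow> \<exists>C. \<forall>x\<in>K. \<forall>\<theta>. cmod (a x \<theta>) \<le> C * japanese \<theta> powr m"
  using assms by (auto simp: symb.simps)

lemma symb_0I:
  assumes "continuous_on (U \<times> UNIV) (\<lambda>(x, \<theta>). a x \<theta>)"
    "\<And>K. compact K \<Longrightarrow> K \<subseteq> U \<Longrightarrow> \<exists>C. \<forall>x\<in>K. \<forall>\<theta>. cmod (a x \<theta>) \<le> C * japanese \<theta> powr m"
  shows "symb 0 m U a"
  using assms by (auto simp: symb.simps)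

lemma symb_SucD:
  assumes "symb (Suc k) m U a"
  shows "symb 0 m U a" "x \<in> U \<Longrightarrow> (\<lambda>(x, \<theta>). a x \<theta>) differentiable (at (x, \<theta>))"
    "b \<in> Basis \<Longrightarrow> symb k m U (\<lambda>x \<theta>. pdiff b (\<lambda>x. a x \<theta>) x)"
    "c \<in> Basis \<Longrightarrow> symb k (m - 1) U (\<lambda>x. pdiff c (a x))"
proof -
  have "(\<lambda>(x, \<theta>). a x \<theta>) differentiable_on (U \<times> UNIV)"
    unfolding differentiable_on_def using assms by (auto simp: symb.simps(2) intro: differentiable_at_withinI)
  then have "continuous_on (U \<times> UNIV) (\<lambda>(x, \<theta>). a x \<theta>)" by (rule differentiable_imp_continuous_on)
  then show "symb 0 m U a" using assms by (simp add: symb.simps)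
qed (use assms in \<open>auto simp: symb.simps(2)\<close>)

lemma symb_SucI:
  assumes "\<And>x \<theta>. x \<in> U \<Longrightarrow> (\<lambda>(x, \<theta>). a x \<theta>) differentiable (at (x, \<theta>))"
    "\<And>K. compact K \<Longrightarrow> K \<subseteq> U \<Longrightarrow> \<exists>C. \<forall>x\<in>K. \<forall>\<theta>. cmod (a x \<theta>) \<le> C * japanese \<theta> powr m"
    "\<And>b. b \<in> Basis \<Longrightarrow> symb k m U (\<lambda>x \<theta>. pdiff b (\<lambda>x. a x \<theta>) x)"
    "\<And>c. c \<in> Basis \<Longrightarrow> symb k (m - 1) U (\<lambda>x. pdiff c (a x))"
  shows "symb (Suc k) m U a"
  using assms by (simp add: symb.simps(2))

lemma symb_Suc_imp: "symb (Suc k) m U a \<Longrightarrow> symb k m U a"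
proof (induction k arbitrary: m a)
  case (Suc k)
  show ?case
    by (rule symb_SucI[OF symb_SucD(2)[OF Suc.prems] symb_0D(2)[OF symb_SucD(1)[OF Suc.prems]]
        Suc.IH[OF symb_SucD(3)[OF Suc.prems]] Suc.IH[OF symb_SucD(4)[OF Suc.prems]]])
qed (rule symb_SucD(1))

lemma differentiable_slice:
  fixes a :: "'a::euclidean_space \<Rightarrow> 'b::euclidean_space \<Rightarrow> complex"
  assumes "(\<lambda>(x, \<theta>). a x \<theta>) differentiable (at (x, \<theta>))"
  shows "(\<lambda>x. a x \<theta>) differentiable (at x)" "a x differentiable (at \<theta>)"
proof -
  have l: "bounded_linear (\<lambda>y::'b. (0::'a, y))" "bounded_linear (\<lambda>z::'a. (z, 0::'b))"
    by (intro bounded_linear_Pair bounded_linear_zero bounded_linear_ident)+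
  show "a x differentiable (at \<theta>)"
    using pdiff_compose_linear(1)[OF l(1), of "\<lambda>(x, \<theta>). a x \<theta>" \<theta> "(x, 0)"] assms by simp
  show "(\<lambda>x. a x \<theta>) differentiable (at x)"
    using pdiff_compose_linear(1)[OF l(2), of "\<lambda>(x, \<theta>). a x \<theta>" x "(0, \<theta>)"] assms by simp
qed

lemma symb_cong:
  assumes "open U"
  shows "(\<And>x \<theta>. x \<in> U \<Longrightarrow> a x \<theta> = a' x \<theta>) \<Longrightarrow> symb k m U a \<Longrightarrow> symb k m U a'"
proof (induction k arbitrary: m a a')
  case 0
  show ?case
  proof (rule symb_0I)
    have "continuous_on (U \<times> UNIV) (\<lambda>(x, \<theta>). a x \<theta>)" by (rule symb_0D(1)[OF 0(2)])
    then show "continuous_on (U \<times> UNIV) (\<lambda>(x, \<theta>). a' x \<theta>)"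
      by (rule continuous_on_cong[OF refl, THEN iffD1, rotated]) (use 0(1) in auto)
    fix K assume K: "compact K" "K \<subseteq> U"
    show "\<exists>C. \<forall>x\<in>K. \<forall>\<theta>. cmod (a' x \<theta>) \<le> C * japanese \<theta> powr m"
      using symb_0D(2)[OF 0(2) K] 0(1) K(2) by (simp add: subset_iff)
  qed
next
  case (Suc k)
  have o: "open (U \<times> (UNIV :: 'b set))" using assms by (simp add: open_Times)
  show ?case
  proof (rule symb_SucI)
    fix x \<theta> assume x: "x \<in> U"
    obtain D where "((\<lambda>(x, \<theta>). a x \<theta>) has_derivative D) (at (x, \<theta>))"
      using symb_SucD(2)[OF Suc.prems(2) x] unfolding differentiable_def by blast
    then have "((\<lambda>(x, \<theta>). a' x \<theta>) has_derivative D) (at (x, \<theta>))"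
      by (rule has_derivative_transform_within_open[OF _ o]) (use x Suc.prems(1) in auto)
    then show "(\<lambda>(x, \<theta>). a' x \<theta>) differentiable (at (x, \<theta>))" by (rule differentiableI)
  next
    fix K assume K: "compact K" "K \<subseteq> U"
    show "\<exists>C. \<forall>x\<in>K. \<forall>\<theta>. cmod (a' x \<theta>) \<le> C * japanese \<theta> powr m"
      using symb_0D(2)[OF symb_SucD(1)[OF Suc.prems(2)] K] Suc.prems(1) K(2) by (simp add: subset_iff)
  next
    fix b :: 'a assume b: "b \<in> Basis"
    show "symb k m U (\<lambda>x \<theta>. pdiff b (\<lambda>x. a' x \<theta>) x)"
      by (rule Suc.IH[OF _ symb_SucD(3)[OF Suc.prems(2) b]])
        (rule pdiff_cong_open[OF assms _ Suc.prems(1)])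
  next
    fix b :: 'b assume b: "b \<in> Basis"
    show "symb k (m - 1) U (\<lambda>x. pdiff b (a' x))"
      by (rule Suc.IH[OF _ symb_SucD(4)[OF Suc.prems(2) b]])
        (rule pdiff_cong_open[OF open_UNIV UNIV_I Suc.prems(1)])
  qed
qed

lemma symb_mono: "m \<le> m' \<Longrightarrow> symb k m U a \<Longrightarrow> symb k m' U a"
proof (induction k arbitrary: m m' a)
  case (0 m m' a)
  show ?case
  proof (rule symb_0I[OF symb_0D(1)[OF 0(2)]])
    fix K assume "compact K" "K \<subseteq> U"
    from symb_0D(2)[OF 0(2) this] obtain C where C: "\<And>x \<theta>. x \<in> K \<Longrightarrow> cmod (a x \<theta>) \<le> C * japanese \<theta> powr m" by blast
    have "cmod (a x \<theta>) \<le> \<bar>C\<bar> * japanese \<theta> powr m'" if "x \<in> K" for x \<theta>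
      by (rule order_trans[OF C[OF that]]) (intro mult_mono japanese_powr_mono 0 abs_ge_self; simp)
    then show "\<exists>C. \<forall>x\<in>K. \<forall>\<theta>. cmod (a x \<theta>) \<le> C * japanese \<theta> powr m'" by blast
  qed
next
  case (Suc k m m' a)
  have 0: "symb 0 m' U a"
  proof (rule symb_0I[OF symb_0D(1)[OF symb_SucD(1)[OF Suc.prems(2)]]])
    fix K assume "compact K" "K \<subseteq> U"
    from symb_0D(2)[OF symb_SucD(1)[OF Suc.prems(2)] this]
    obtain C where C: "\<And>x \<theta>. x \<in> K \<Longrightarrow> cmod (a x \<theta>) \<le> C * japanese \<theta> powr m" by blast
    have "cmod (a x \<theta>) \<le> \<bar>C\<bar> * japanese \<theta> powr m'" if "x \<in> K" for x \<theta>
      by (rule order_trans[OF C[OF that]]) (intro mult_mono japanese_powr_mono Suc.prems abs_ge_self; simp)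
    then show "\<exists>C. \<forall>x\<in>K. \<forall>\<theta>. cmod (a x \<theta>) \<le> C * japanese \<theta> powr m'" by blast
  qed
  show ?case
    by (rule symb_SucI[OF symb_SucD(2)[OF Suc.prems(2)] symb_0D(2)[OF 0]
        Suc.IH[OF Suc.prems(1) symb_SucD(3)[OF Suc.prems(2)]]
        Suc.IH[OF _ symb_SucD(4)[OF Suc.prems(2)]]]) (use Suc.prems(1) in auto)
qed

lemma symb_subset: "V \<subseteq> U \<Longrightarrow> symb k m U a \<Longrightarrow> symb k m V a"
proof (induction k arbitrary: m a)
  case 0
  show ?case
    by (rule symb_0I[OF continuous_on_subset[OF symb_0D(1)[OF 0(2)]] symb_0D(2)[OF 0(2)]]) (use 0(1) in auto)
next
  case (Suc k)
  show ?case
    by (rule symb_SucI[OF symb_SucD(2)[OF Suc.prems(2)] symb_0D(2)[OF symb_SucD(1)[OF Suc.prems(2)]]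
        Suc.IH[OF Suc.prems(1) symb_SucD(3)[OF Suc.prems(2)]]
        Suc.IH[OF Suc.prems(1) symb_SucD(4)[OF Suc.prems(2)]]]) (use Suc.prems(1) in auto)
qed

lemma symb_add:
  assumes "open U"
  shows "symb k m U a \<Longrightarrow> symb k m U b \<Longrightarrow> symb k m U (\<lambda>x \<theta>. a x \<theta> + b x \<theta>)"
proof (induction k arbitrary: m a b)
  case 0
  show ?case
  proof (rule symb_0I)
    show "continuous_on (U \<times> UNIV) (\<lambda>(x, \<theta>). a x \<theta> + b x \<theta>)"
      using continuous_on_add[OF symb_0D(1)[OF 0(1)] symb_0D(1)[OF 0(2)]] by (simp add: split_def)
    fix K assume K: "compact K" "K \<subseteq> U"
    from symb_0D(2)[OF 0(1) K] symb_0D(2)[OF 0(2) K]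
    obtain C D where C: "\<And>x \<theta>. x \<in> K \<Longrightarrow> cmod (a x \<theta>) \<le> C * japanese \<theta> powr m"
      and D: "\<And>x \<theta>. x \<in> K \<Longrightarrow> cmod (b x \<theta>) \<le> D * japanese \<theta> powr m" by blast
    have "cmod (a x \<theta> + b x \<theta>) \<le> (C + D) * japanese \<theta> powr m" if "x \<in> K" for x \<theta>
      using C[OF that, of \<theta>] D[OF that, of \<theta>] norm_triangle_ineq[of "a x \<theta>" "b x \<theta>"] by (simp add: distrib_right)
    then show "\<exists>C. \<forall>x\<in>K. \<forall>\<theta>. cmod (a x \<theta> + b x \<theta>) \<le> C * japanese \<theta> powr m" by blast
  qed
next
  case (Suc k)
  note d = symb_SucD(2)[OF Suc.prems(1)] symb_SucD(2)[OF Suc.prems(2)]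
  show ?case
  proof (rule symb_SucI)
    fix x \<theta> assume x: "x \<in> U"
    show "(\<lambda>(x, \<theta>). a x \<theta> + b x \<theta>) differentiable (at (x, \<theta>))"
      using differentiable_add[OF d(1)[OF x] d(2)[OF x]] by (simp add: split_def)
  next
    fix K assume K: "compact K" "K \<subseteq> U"
    from symb_0D(2)[OF symb_SucD(1)[OF Suc.prems(1)] K] symb_0D(2)[OF symb_SucD(1)[OF Suc.prems(2)] K]
    obtain C D where C: "\<And>x \<theta>. x \<in> K \<Longrightarrow> cmod (a x \<theta>) \<le> C * japanese \<theta> powr m"
      and D: "\<And>x \<theta>. x \<in> K \<Longrightarrow> cmod (b x \<theta>) \<le> D * japanese \<theta> powr m" by blast
    have "cmod (a x \<theta> + b x \<theta>) \<le> (C + D) * japanese \<theta> powr m" if "x \<in> K" for x \<theta>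
      using C[OF that, of \<theta>] D[OF that, of \<theta>] norm_triangle_ineq[of "a x \<theta>" "b x \<theta>"] by (simp add: distrib_right)
    then show "\<exists>C. \<forall>x\<in>K. \<forall>\<theta>. cmod (a x \<theta> + b x \<theta>) \<le> C * japanese \<theta> powr m" by blast
  next
    fix c :: 'a assume c: "c \<in> Basis"
    show "symb k m U (\<lambda>x \<theta>. pdiff c (\<lambda>x. a x \<theta> + b x \<theta>) x)"
      by (rule symb_cong[OF assms _ Suc.IH[OF symb_SucD(3)[OF Suc.prems(1) c] symb_SucD(3)[OF Suc.prems(2) c]]])
        (rule pdiff_add[symmetric]; rule differentiable_slice, erule d)
  next
    fix c :: 'b assume c: "c \<in> Basis"
    show "symb k (m - 1) U (\<lambda>x. pdiff c (\<lambda>\<theta>. a x \<theta> + b x \<theta>))"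
      by (rule symb_cong[OF assms _ Suc.IH[OF symb_SucD(4)[OF Suc.prems(1) c] symb_SucD(4)[OF Suc.prems(2) c]]])
        (rule pdiff_add[symmetric]; rule differentiable_slice, erule d)
  qed
qed

lemma symb_mult:
  assumes "open U"
  shows "symb k m U a \<Longrightarrow> symb k m' U b \<Longrightarrow> symb k (m + m') U (\<lambda>x \<theta>. a x \<theta> * b x \<theta>)"
proof (induction k arbitrary: m m' a b)
  have bd: "\<exists>C. \<forall>x\<in>K. \<forall>\<theta>. cmod (a x \<theta> * b x \<theta>) \<le> C * japanese \<theta> powr (m + m')"
    if "symb 0 m U a" "symb 0 m' U b" "compact K" "K \<subseteq> U" for K m m' and a b :: "'a \<Rightarrow> 'b \<Rightarrow> complex"
  proof -
    from symb_0D(2)[OF that(1,3,4)] symb_0D(2)[OF that(2,3,4)]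
    obtain C D where C: "\<And>x \<theta>. x \<in> K \<Longrightarrow> cmod (a x \<theta>) \<le> C * japanese \<theta> powr m"
      and D: "\<And>x \<theta>. x \<in> K \<Longrightarrow> cmod (b x \<theta>) \<le> D * japanese \<theta> powr m'" by blast
    have "cmod (a x \<theta> * b x \<theta>) \<le> (C * D) * japanese \<theta> powr (m + m')" if "x \<in> K" for x \<theta>
    proof -
      have "cmod (a x \<theta> * b x \<theta>) \<le> (C * japanese \<theta> powr m) * (D * japanese \<theta> powr m')"
        unfolding norm_mult
        by (rule mult_mono[OF C[OF that] D[OF that] order_trans[OF norm_ge_zero C[OF that]] norm_ge_zero])
      then show ?thesis by (simp add: powr_add mult_ac)
    qed
    then show ?thesis by blast
  qed
  {
    case 0
    show ?case
    proof (rule symb_0I)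
      show "continuous_on (U \<times> UNIV) (\<lambda>(x, \<theta>). a x \<theta> * b x \<theta>)"
        using continuous_on_mult[OF symb_0D(1)[OF 0(1)] symb_0D(1)[OF 0(2)]] by (simp add: split_def)
    qed (rule bd[OF 0])
  next
    case (Suc k)
    note d = symb_SucD(2)[OF Suc.prems(1)] symb_SucD(2)[OF Suc.prems(2)]
    show ?case
    proof (rule symb_SucI)
      fix x \<theta> assume x: "x \<in> U"
      show "(\<lambda>(x, \<theta>). a x \<theta> * b x \<theta>) differentiable (at (x, \<theta>))"
        using differentiable_mult[OF d(1)[OF x] d(2)[OF x]] by (simp add: split_def)
    next
      fix c :: 'a assume c: "c \<in> Basis"
      show "symb k (m + m') U (\<lambda>x \<theta>. pdiff c (\<lambda>x. a x \<theta> * b x \<theta>) x)"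
        by (rule symb_cong[OF assms _ symb_add[OF assms
            Suc.IH[OF symb_Suc_imp[OF Suc.prems(1)] symb_SucD(3)[OF Suc.prems(2) c]]
            Suc.IH[OF symb_SucD(3)[OF Suc.prems(1) c] symb_Suc_imp[OF Suc.prems(2)]]]])
          (rule pdiff_mult[symmetric]; rule differentiable_slice, erule d)
    next
      fix c :: 'b assume c: "c \<in> Basis"
      have 1: "symb k (m + m' - 1) U (\<lambda>x \<theta>. a x \<theta> * pdiff c (b x) \<theta>)"
        using Suc.IH[OF symb_Suc_imp[OF Suc.prems(1)] symb_SucD(4)[OF Suc.prems(2) c]] by (simp add: algebra_simps)
      have 2: "symb k (m + m' - 1) U (\<lambda>x \<theta>. pdiff c (a x) \<theta> * b x \<theta>)"
        using Suc.IH[OF symb_SucD(4)[OF Suc.prems(1) c] symb_Suc_imp[OF Suc.prems(2)]] by (simp add: algebra_simps)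
      show "symb k (m + m' - 1) U (\<lambda>x. pdiff c (\<lambda>\<theta>. a x \<theta> * b x \<theta>))"
        by (rule symb_cong[OF assms _ symb_add[OF assms 1 2]])
          (rule pdiff_mult[symmetric]; rule differentiable_slice, erule d)
    qed (rule bd[OF symb_SucD(1)[OF Suc.prems(1)] symb_SucD(1)[OF Suc.prems(2)]])
  }
qed

lemma symb_0: "symb k m U (\<lambda>x \<theta>. 0)"
proof (induction k arbitrary: m)
  case 0
  show ?case by (rule symb_0I) (auto intro: exI[of _ 0])
next
  case (Suc k)
  have z: "(\<lambda>x::'a. pdiff c (\<lambda>\<theta>::'b. 0 :: complex)) = (\<lambda>x \<theta>. 0)" "(\<lambda>x (\<theta>::'b). pdiff b (\<lambda>x::'a. 0 :: complex) x) = (\<lambda>x \<theta>. 0)" for b c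
    by (intro ext pdiff_const)+
  show ?case
    by (rule symb_SucI) (auto simp: z Suc split_def intro: exI[of _ 0])
qed

lemma symb_left:
  assumes "open U"
  shows "C_on k U f \<Longrightarrow> symb k 0 U (\<lambda>x \<theta>. f x)"
proof (induction k arbitrary: f)
  have bd: "\<exists>C. \<forall>x\<in>K. \<forall>\<theta>. cmod (f x) \<le> C * japanese \<theta> powr 0"
    if "continuous_on U f" "compact K" "K \<subseteq> U" for K and f :: "'a \<Rightarrow> complex"
  proof -
    have "bounded (f ` K)"
      by (intro compact_imp_bounded compact_continuous_image continuous_on_subset[OF that(1,3)] that(2))
    then obtain C where "\<forall>x\<in>K. cmod (f x) \<le> C" unfolding bounded_iff by auto
    then show ?thesis by (intro exI[of _ C]) auto
  qed
  {
    case 0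
    then have c: "continuous_on U f" by simp
    have "continuous_on (U \<times> UNIV) (\<lambda>p. f (fst p))"
      by (rule continuous_on_compose2[OF c]) (auto intro: continuous_intros)
    then show ?case by (intro symb_0I bd[OF c]) (simp_all add: split_def)
  next
    case (Suc k)
    have c: "continuous_on U f"
      using Suc.prems by (auto simp: C_on.simps(2) intro: differentiable_imp_continuous_on)
    show ?case
    proof (rule symb_SucI)
      fix x :: 'a and \<theta> :: 'b assume x: "x \<in> U"
      show "(\<lambda>(x, \<theta>::'b). f x) differentiable (at (x, \<theta>))"
        using pdiff_compose_linear(1)[OF bounded_linear_fst, of f "(x, \<theta>)" 0] C_on_SucD(1)[OF assms Suc.prems x]
        by (simp add: split_def)
    next
      fix b :: 'a assume "b \<in> Basis"
      then show "symb k 0 U (\<lambda>x (\<theta>::'b). pdiff b f x)"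
        by (intro Suc.IH C_on_SucD(2)[OF assms Suc.prems])
    next
      fix b :: 'b
      have "(\<lambda>x. pdiff b (\<lambda>\<theta>::'b. f x)) = (\<lambda>x \<theta>. 0)" by (intro ext pdiff_const)
      then show "symb k (0 - 1) U (\<lambda>x. pdiff b (\<lambda>\<theta>::'b. f x))" by (simp only: symb_0)
    qed (rule bd[OF c])
  }
qed

lemma symb_C_on:
  assumes "open U"
  shows "symb k m U a \<Longrightarrow> C_on k (U \<times> UNIV) (\<lambda>(x, \<theta>). a x \<theta>)"
proof (induction k arbitrary: m a)
  case 0
  then show ?case using symb_0D(1) by auto
next
  case (Suc k)
  show ?case
  proof (rule C_on_SucI)
    fix b :: "'a \<times> 'b" assume "b \<in> Basis"
    then show "C_on k (U \<times> UNIV) (pdiff b (\<lambda>(x, \<theta>). a x \<theta>))"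
    proof (cases rule: Basis_PairE)
      case (1 c)
      show ?thesis unfolding 1(2) pdiff_slice'(1) by (rule Suc.IH[OF symb_SucD(3)[OF Suc.prems 1(1)]])
    next
      case (2 c)
      show ?thesis unfolding 2(2) pdiff_slice'(2) by (rule Suc.IH[OF symb_SucD(4)[OF Suc.prems 2(1)]])
    qed
  qed (use symb_SucD(2)[OF Suc.prems] in auto)
qed

text \<open>Every condition in \<open>symb\<close> concerns a point or a compact set of base points,
  hence a single ball of the exhaustion. This is what allows symbols known on balls to be
  glued.\<close>

lemma symb_exhaust:
  assumes "\<And>N::nat. symb k m (ball 0 (real N)) a"
  shows "symb k m UNIV a"
proof -
  have ex: "\<exists>N::nat. K \<subseteq> ball 0 (real N)" if K: "compact K" for K :: "'a set"
  proof -
    obtain B where "\<And>x. x \<in> K \<Longrightarrow> norm x \<le> B" using compact_imp_bounded[OF K] unfolding bounded_iff by blast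
    moreover obtain N :: nat where "B < real N" using reals_Archimedean2 by blast
    ultimately show ?thesis by (intro exI[of _ N]) force
  qed
  show ?thesis using assms
  proof (induction k arbitrary: m a)
    case (0 m a)
    show ?case
    proof (rule symb_0I)
      have "isCont (\<lambda>(x, \<theta>). a x \<theta>) p" for p
      proof -
        obtain N :: nat where N: "norm (fst p) < real N" using reals_Archimedean2 by blast
        have "open (ball 0 (real N) \<times> (UNIV :: 'b set))" by (intro open_Times) auto
        from continuous_on_eq_continuous_at[THEN iffD1, OF this symb_0D(1)[OF 0[of N]], THEN bspec, of p] N
        show ?thesis by (auto simp: mem_Times_iff)
      qed
      then show "continuous_on (UNIV \<times> UNIV) (\<lambda>(x, \<theta>). a x \<theta>)" by (simp add: continuous_at_imp_continuous_on)
      show "\<exists>C. \<forall>x\<in>K. \<forall>\<theta>. cmod (a x \<theta>) \<le> C * japanese \<theta> powr m" if "compact K" for K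
        using ex[OF that] symb_0D(2)[OF 0 that] by blast
    qed
  next
    case (Suc k m a)
    show ?case
    proof (rule symb_SucI)
      fix x :: 'a and \<theta> :: 'b
      obtain N :: nat where "norm x < real N" using reals_Archimedean2 by blast
      then show "(\<lambda>(x, \<theta>). a x \<theta>) differentiable (at (x, \<theta>))" using symb_SucD(2)[OF Suc.prems[of N], of x] by simp
    next
      show "\<exists>C. \<forall>x\<in>K. \<forall>\<theta>. cmod (a x \<theta>) \<le> C * japanese \<theta> powr m" if "compact K" for K
        using ex[OF that] symb_0D(2)[OF symb_SucD(1)[OF Suc.prems] that] by blast
    qed (rule Suc.IH, erule symb_SucD[OF Suc.prems])+
  qed
qed

text \<open>On a bounded range of \<open>\<theta>\<close> all weights are comparable, so compactness
  gives every order, and differentiation does not enlarge the support. It is used for the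
  discrepancies that cutoffs near \<open>\<xi> = 0\<close> produce.\<close>

lemma symb_smooth_bounded_support:
  assumes "open U"
  shows "smooth_on (U \<times> UNIV) (\<lambda>(x, \<theta>). a x \<theta>) \<Longrightarrow> (\<And>x \<theta>. x \<in> U \<Longrightarrow> norm \<theta> > R \<Longrightarrow> a x \<theta> = 0) \<Longrightarrow> symb k m U a"
proof (induction k arbitrary: m a)
  have o: "open (U \<times> (UNIV :: 'b set))" using assms by (simp add: open_Times)
  have bd: "\<exists>C. \<forall>x\<in>K. \<forall>\<theta>. cmod (a x \<theta>) \<le> C * japanese \<theta> powr m"
    if s: "smooth_on (U \<times> UNIV) (\<lambda>(x, \<theta>). a x \<theta>)" and R: "\<And>x \<theta>. x \<in> U \<Longrightarrow> norm \<theta> > R \<Longrightarrow> a x \<theta> = 0"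
      and K: "compact K" "K \<subseteq> U" for K m and a :: "'a \<Rightarrow> 'b \<Rightarrow> complex"
  proof -
    have "compact ((\<lambda>(x, \<theta>). a x \<theta> * complex_of_real (japanese \<theta> powr (-m))) ` (K \<times> cball 0 R))"
    proof (rule compact_continuous_image[OF _ compact_Times[OF K(1) compact_cball]])
      have "continuous_on (K \<times> cball 0 R) (\<lambda>(x, \<theta>). a x \<theta>)"
        by (rule continuous_on_subset[OF smooth_on_imp_continuous_on[OF s]]) (use K in auto)
      moreover have "continuous_on (K \<times> cball 0 R) (\<lambda>p::'a \<times> 'b. complex_of_real (japanese (snd p) powr (-m)))"
        by (intro continuous_intros continuous_on_japanese) auto
      ultimately show "continuous_on (K \<times> cball 0 R) (\<lambda>(x, \<theta>). a x \<theta> * complex_of_real (japanese \<theta> powr (-m)))"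
        using continuous_on_mult by (fastforce simp: split_def)
    qed
    from compact_imp_bounded[OF this, unfolded bounded_pos]
    obtain B where B: "B > 0" "\<And>v. v \<in> (\<lambda>(x, \<theta>). a x \<theta> * complex_of_real (japanese \<theta> powr (-m))) ` (K \<times> cball 0 R) \<Longrightarrow> cmod v \<le> B"
      by (elim exE conjE) blast
    have "cmod (a x \<theta>) \<le> B * japanese \<theta> powr m" if "x \<in> K" for x \<theta>
    proof (cases "norm \<theta> \<le> R")
      case True
      have "(x, \<theta>) \<in> K \<times> cball 0 R" using True that by simp
      from B(2)[OF imageI[OF this]]
      have "cmod (a x \<theta>) * japanese \<theta> powr (-m) \<le> B" by (simp add: norm_mult)
      then show ?thesis by (simp add: powr_minus field_simps)
    next
      case False
      then show ?thesis using R[of x \<theta>] that K B by auto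
    qed
    then show ?thesis by blast
  qed
  {
    case (0 m a)
    show ?case by (rule symb_0I[OF smooth_on_imp_continuous_on[OF 0(1)] bd[OF 0]])
  next
    case (Suc k m a)
    show ?case
    proof (rule symb_SucI[OF _ bd[OF Suc.prems]])
      fix x :: 'a and \<theta> :: 'b assume x: "x \<in> U"
      show "(\<lambda>(x, \<theta>). a x \<theta>) differentiable (at (x, \<theta>))"
        by (rule smooth_on_differentiable[OF o Suc.prems(1)]) (use x in auto)
    next
      fix b :: 'a assume b: "b \<in> Basis"
      show "symb k m U (\<lambda>x \<theta>. pdiff b (\<lambda>x. a x \<theta>) x)"
      proof (rule Suc.IH)
        show "smooth_on (U \<times> UNIV) (\<lambda>(x, \<theta>). pdiff b (\<lambda>x. a x \<theta>) x)"
          unfolding pdiff_slice'(1)[symmetric] by (rule smooth_on_pdiff[OF o Suc.prems(1) Basis_PairI(1)[OF b]])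
        show "pdiff b (\<lambda>x. a x \<theta>) x = 0" if "x \<in> U" "norm \<theta> > R" for x \<theta>
          using pdiff_cong_open[OF assms that(1) Suc.prems(2)[OF _ that(2)], of "\<lambda>x. x" b] by simp
      qed
    next
      fix b :: 'b assume b: "b \<in> Basis"
      show "symb k (m - 1) U (\<lambda>x. pdiff b (a x))"
      proof (rule Suc.IH)
        show "smooth_on (U \<times> UNIV) (\<lambda>(x, \<theta>). pdiff b (a x) \<theta>)"
          unfolding pdiff_slice'(2)[symmetric] by (rule smooth_on_pdiff[OF o Suc.prems(1) Basis_PairI(2)[OF b]])
        show "pdiff b (a x) \<theta> = 0" if "x \<in> U" "norm \<theta> > R" for x \<theta>
          by (rule pdiff_eq_0_outside[OF Suc.prems(2)[OF that(1)] that(2)])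
      qed
    qed
  }
qed

lemma lsymI: "(\<And>k. symb k m U a) \<Longrightarrow> a \<in> lsym U m"
  by (simp add: lsym_def)

lemma lsymD: "a \<in> lsym U m \<Longrightarrow> symb k m U a"
  by (simp add: lsym_def)

lemma lsym_bound:
  "a \<in> lsym U m \<Longrightarrow> compact K \<Longrightarrow> K \<subseteq> U \<Longrightarrow> \<exists>C. \<forall>x\<in>K. \<forall>\<theta>. cmod (a x \<theta>) \<le> C * japanese \<theta> powr m"
  by (rule symb_0D(2)[OF lsymD])

lemma lsym_pdiff_left: "a \<in> lsym U m \<Longrightarrow> b \<in> Basis \<Longrightarrow> (\<lambda>x \<theta>. pdiff b (\<lambda>x. a x \<theta>) x) \<in> lsym U m"
  by (rule lsymI) (rule symb_SucD(3)[OF lsymD])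

lemma lsym_pdiff_right: "a \<in> lsym U m \<Longrightarrow> b \<in> Basis \<Longrightarrow> (\<lambda>x. pdiff b (a x)) \<in> lsym U (m - 1)"
  by (rule lsymI) (rule symb_SucD(4)[OF lsymD])

lemma lsym_cong: "open U \<Longrightarrow> (\<And>x \<theta>. x \<in> U \<Longrightarrow> a x \<theta> = a' x \<theta>) \<Longrightarrow> a \<in> lsym U m \<Longrightarrow> a' \<in> lsym U m"
  by (rule lsymI) (rule symb_cong[OF _ _ lsymD])

lemma lsym_mono: "m \<le> m' \<Longrightarrow> a \<in> lsym U m \<Longrightarrow> a \<in> lsym U m'"
  by (rule lsymI) (rule symb_mono[OF _ lsymD])

lemma lsym_subset: "V \<subseteq> U \<Longrightarrow> a \<in> lsym U m \<Longrightarrow> a \<in> lsym V m"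
  by (rule lsymI) (rule symb_subset[OF _ lsymD])

lemma lsym_add: "open U \<Longrightarrow> a \<in> lsym U m \<Longrightarrow> b \<in> lsym U m \<Longrightarrow> (\<lambda>x \<theta>. a x \<theta> + b x \<theta>) \<in> lsym U m"
  by (rule lsymI) (rule symb_add[OF _ lsymD lsymD])

lemma lsym_mult: "open U \<Longrightarrow> a \<in> lsym U m \<Longrightarrow> b \<in> lsym U m' \<Longrightarrow> (\<lambda>x \<theta>. a x \<theta> * b x \<theta>) \<in> lsym U (m + m')"
  by (rule lsymI) (rule symb_mult[OF _ lsymD lsymD])

lemma lsym_0: "(\<lambda>x \<theta>. 0) \<in> lsym U m"
  by (rule lsymI) (rule symb_0)

lemma lsym_left: "open U \<Longrightarrow> smooth_on U f \<Longrightarrow> (\<lambda>x \<theta>. f x) \<in> lsym U 0"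
  by (rule lsymI) (rule symb_left[OF _ smooth_onD])

lemma lsym_cmult:
  assumes "open U" "a \<in> lsym U m"
  shows "(\<lambda>x \<theta>. c * a x \<theta>) \<in> lsym U m"
  using lsym_mult[OF assms(1) lsym_left[OF assms(1) smooth_on_const] assms(2), of c] by simp

lemma lsym_diff:
  assumes "open U" "a \<in> lsym U m" "b \<in> lsym U m"
  shows "(\<lambda>x \<theta>. a x \<theta> - b x \<theta>) \<in> lsym U m"
  using lsym_add[OF assms(1,2) lsym_cmult[OF assms(1,3), of "-1"]] by simp

lemma lsym_sum:
  assumes "open U" "\<And>i. i \<in> I \<Longrightarrow> a i \<in> lsym U m"
  shows "(\<lambda>x \<theta>. \<Sum>i\<in>I. a i x \<theta>) \<in> lsym U m"
  using assms(2)
proof (induction I rule: infinite_finite_induct)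
  case (insert i I)
  have "(\<lambda>x \<theta>. a i x \<theta> + (\<Sum>i\<in>I. a i x \<theta>)) \<in> lsym U m"
    by (rule lsym_add[OF assms(1)]) (use insert in auto)
  then show ?case using insert by simp
qed (simp_all add: lsym_0)

lemma lsym_smooth: "open U \<Longrightarrow> a \<in> lsym U m \<Longrightarrow> smooth_on (U \<times> UNIV) (\<lambda>(x, \<theta>). a x \<theta>)"
  unfolding smooth_on_def by (intro allI symb_C_on lsymD)

lemma lsym_smooth_UNIV: "a \<in> lsym UNIV m \<Longrightarrow> smooth_on UNIV (\<lambda>(x, \<theta>). a x \<theta>)"
  using lsym_smooth[OF open_UNIV] by simp

lemma lsym_exhaust: "(\<And>N::nat. a \<in> lsym (ball 0 (real N)) m) \<Longrightarrow> a \<in> lsym UNIV m"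
  by (rule lsymI) (rule symb_exhaust, rule lsymD)

lemma lsym_smooth_bounded_support:
  "open U \<Longrightarrow> smooth_on (U \<times> UNIV) (\<lambda>(x, \<theta>). a x \<theta>) \<Longrightarrow> (\<And>x \<theta>. x \<in> U \<Longrightarrow> norm \<theta> > R \<Longrightarrow> a x \<theta> = 0) \<Longrightarrow> a \<in> lsym U m"
  by (rule lsymI) (rule symb_smooth_bounded_support)

lemma lsym_ider_left: "a \<in> lsym U m \<Longrightarrow> set l \<subseteq> Basis \<Longrightarrow> (\<lambda>x \<theta>. ider l (\<lambda>x. a x \<theta>) x) \<in> lsym U m"
proof (induction l)
  case (Cons b l)
  then show ?case using lsym_pdiff_left[of "\<lambda>x \<theta>. ider l (\<lambda>x. a x \<theta>) x" U m b] by simp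
qed simp

lemma lsym_ider_right: "a \<in> lsym U m \<Longrightarrow> set l \<subseteq> Basis \<Longrightarrow> (\<lambda>x. ider l (a x)) \<in> lsym U (m - real (length l))"
proof (induction l)
  case (Cons b l)
  then show ?case using lsym_pdiff_right[of "\<lambda>x. ider l (a x)" U "m - real (length l)" b] by (simp add: algebra_simps)
qed simp

lemma ider_slice_right: "ider (map (Pair 0) l) (\<lambda>(x, \<theta>). a x \<theta>) = (\<lambda>(x, \<theta>). ider l (a x) \<theta>)"
  by (induction l) (simp_all add: pdiff_slice'(2))

lemma ider_slice_left: "ider (map (\<lambda>b. (b, 0)) l) (\<lambda>(x, \<theta>). a x \<theta>) = (\<lambda>(x, \<theta>). ider l (\<lambda>x. a x \<theta>) x)"
  by (induction l) (simp_all add: pdiff_slice'(1))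

lemma set_Pair_Basis: "set l \<subseteq> Basis \<Longrightarrow> set (map (Pair 0) l) \<subseteq> Basis" "set l' \<subseteq> Basis \<Longrightarrow> set (map (\<lambda>b. (b, 0)) l') \<subseteq> Basis"
  using Basis_PairI by auto

text \<open>Derivatives in the two groups of variables commute because both are derivatives of one
  smooth function on the product space, where \<open>ider_move\<close> applies.\<close>

lemma pdiff_ider_left_right:
  assumes "open V" "smooth_on V (\<lambda>(x, \<theta>). a x \<theta>)" "set l \<subseteq> Basis" "c \<in> Basis" "(x, \<theta>) \<in> V"
  shows "pdiff c (\<lambda>\<theta>. ider l (\<lambda>x. a x \<theta>) x) \<theta> = ider l (\<lambda>x. pdiff c (a x) \<theta>) x"
  using ider_move[OF assms(1,2) set_Pair_Basis(2)[OF assms(3)] Basis_PairI(2)[OF assms(4)] assms(5)]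
  by (simp add: pdiff_slice'(2) ider_slice_left)

lemma pdiff_ider_right_left:
  assumes "open V" "smooth_on V (\<lambda>(x, \<theta>). a x \<theta>)" "set l \<subseteq> Basis" "c \<in> Basis" "(x, \<theta>) \<in> V"
  shows "pdiff c (\<lambda>x. ider l (a x) \<theta>) x = ider l (\<lambda>\<theta>. pdiff c (\<lambda>x. a x \<theta>) x) \<theta>"
  using ider_move[OF assms(1,2) set_Pair_Basis(1)[OF assms(3)] Basis_PairI(1)[OF assms(4)] assms(5)]
  by (simp add: pdiff_slice'(1) ider_slice_right)

lemma norm_Dderiv: "cmod (Dderiv \<alpha> f x) = cmod (ider (mword \<alpha>) f x)"
  by (simp add: Dderiv_def mderiv_eq_ider norm_mult norm_power)

lemma norm_Dderiv2:
  assumes "smooth_on UNIV (\<lambda>(x, \<theta>). a x \<theta>)"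
  shows "cmod (Dderiv \<alpha> (\<lambda>x. Dderiv \<beta> (a x) \<theta>) x) = cmod (ider (mword \<alpha>) (\<lambda>x. ider (mword \<beta>) (a x) \<theta>) x)"
proof -
  have "smooth_on UNIV (\<lambda>(x, \<theta>). ider (mword \<beta>) (a x) \<theta>)"
    unfolding ider_slice_right[symmetric] by (rule smooth_on_ider[OF open_UNIV assms set_Pair_Basis(1)[OF set_mword]])
  from smooth_on_slice(2)[OF this] show ?thesis
    unfolding norm_Dderiv unfolding Dderiv_def mderiv_eq_ider
    by (subst ider_cmult[OF open_UNIV _ set_mword]) (simp_all add: norm_mult norm_power)
qed

text \<open>In \<open>symbols\<close> the derivatives in \<open>\<theta>\<close> are taken first and
  the order of directions is fixed. A further derivative in \<open>\<theta>\<close> is therefore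
  moved past the word \<open>ll\<close> and joins \<open>lr\<close>, and the induction runs over all
  pairs of words.\<close>

lemma symbols_eq_lsym: "symbols m = lsym UNIV m"
proof (intro equalityI subsetI)
  fix a :: "'a \<Rightarrow> 'b \<Rightarrow> complex" assume a: "a \<in> symbols m"
  define F where "F = (\<lambda>(x, \<theta>). a x \<theta>)"
  have F: "smooth_on UNIV F" using a unfolding symbols_def F_def by auto
  have sr: "smooth_on UNIV (\<lambda>(x, \<theta>). ider l (a x) \<theta>)" if "set l \<subseteq> Basis" for l
    unfolding ider_slice_right[symmetric] using that by (intro smooth_on_ider open_UNIV F[unfolded F_def] set_Pair_Basis)
  have "symb k (m - real (length lr)) UNIV (\<lambda>x \<theta>. ider ll (\<lambda>x. ider lr (a x) \<theta>) x)"
    if "set ll \<subseteq> Basis" "set lr \<subseteq> Basis" for k ll lr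
    using that
  proof (induction k arbitrary: ll lr)
    have s: "smooth_on UNIV (\<lambda>(x, \<theta>). ider ll (\<lambda>x. ider lr (a x) \<theta>) x)"
      if "set ll \<subseteq> Basis" "set lr \<subseteq> Basis" for ll lr
      unfolding ider_slice_left[symmetric] using that by (intro smooth_on_ider open_UNIV sr set_Pair_Basis)
    have bd: "\<exists>C. \<forall>x\<in>K. \<forall>\<theta>. cmod (ider ll (\<lambda>x. ider lr (a x) \<theta>) x) \<le> C * japanese \<theta> powr (m - real (length lr))"
      if l: "set ll \<subseteq> Basis" "set lr \<subseteq> Basis" and K: "compact K" for ll lr K
    proof -
      define \<alpha> \<beta> where "\<alpha> = count (mset ll)" and "\<beta> = count (mset lr)"
      have \<alpha>\<beta>: "\<alpha> \<in> multi_indices" "\<beta> \<in> multi_indices"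
        unfolding \<alpha>_def \<beta>_def using l by (auto intro: count_list_multi_index)
      have len: "mlen \<beta> = length lr"
        unfolding length_mword[symmetric] \<beta>_def by (metis l(2) mset_mword_count size_mset)
      have "\<forall>\<alpha>\<in>multi_indices. \<forall>\<beta>\<in>multi_indices. \<forall>K. compact K \<longrightarrow>
        (\<exists>C. \<forall>x\<in>K. \<forall>\<theta>. cmod (Dderiv \<alpha> (\<lambda>x. Dderiv \<beta> (a x) \<theta>) x) \<le> C * japanese \<theta> powr (m - real (mlen \<beta>)))"
        using a unfolding symbols_def mem_Collect_eq by (rule conjunct2)
      note this[THEN bspec, OF \<alpha>\<beta>(1), THEN bspec, OF \<alpha>\<beta>(2), THEN spec, of K, THEN mp, OF K]
      then obtain C where C: "\<And>x \<theta>. x \<in> K \<Longrightarrow> cmod (Dderiv \<alpha> (\<lambda>x. Dderiv \<beta> (a x) \<theta>) x) \<le> C * japanese \<theta> powr (m - real (mlen \<beta>))"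
        by blast
      have "ider ll (\<lambda>x. ider lr (a x) \<theta>) x = ider (mword \<alpha>) (\<lambda>x. ider (mword \<beta>) (a x) \<theta>) x" for x \<theta>
      proof -
        have "ider lr (a x) \<theta> = ider (mword \<beta>) (a x) \<theta>" for x
          by (rule ider_mset[OF open_UNIV smooth_on_slice(1)[OF F[unfolded F_def]] _ l(2) UNIV_I])
            (simp add: \<beta>_def mset_mword_count[OF l(2)])
        then show ?thesis
          by (simp, intro ider_mset[OF open_UNIV smooth_on_slice(2)[OF sr[OF set_mword]] _ l(1) UNIV_I])
            (simp add: \<alpha>_def mset_mword_count[OF l(1)])
      qed
      then show ?thesis using C unfolding norm_Dderiv2[OF F[unfolded F_def]] len by (intro exI[of _ C]) simp
    qed
    {
      case 0
      show ?case by (rule symb_0I) (use smooth_on_imp_continuous_on[OF s[OF 0]] bd[OF 0] in auto)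
    next
      case (Suc k)
      show ?case
      proof (rule symb_SucI)
        fix x :: 'a and \<theta> :: 'b
        show "(\<lambda>(x, \<theta>). ider ll (\<lambda>x. ider lr (a x) \<theta>) x) differentiable (at (x, \<theta>))"
          by (rule smooth_on_differentiable[OF open_UNIV s[OF Suc.prems] UNIV_I])
      next
        fix b :: 'a assume "b \<in> Basis"
        then show "symb k (m - real (length lr)) UNIV (\<lambda>x \<theta>. pdiff b (ider ll (\<lambda>x. ider lr (a x) \<theta>)) x)"
          using Suc.IH[of "b # ll" lr] Suc.prems by simp
      next
        fix c :: 'b assume c: "c \<in> Basis"
        have "symb k (m - real (length lr) - 1) UNIV (\<lambda>x \<theta>. ider ll (\<lambda>x. pdiff c (ider lr (a x)) \<theta>) x)"
          using Suc.IH[of ll "c # lr"] Suc.prems c by (simp add: algebra_simps)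
        then show "symb k (m - real (length lr) - 1) UNIV (\<lambda>x. pdiff c (\<lambda>\<theta>. ider ll (\<lambda>x. ider lr (a x) \<theta>) x))"
          by (rule symb_cong[OF open_UNIV, rotated])
            (rule pdiff_ider_left_right[OF open_UNIV sr[OF Suc.prems(2)] Suc.prems(1) c UNIV_I, symmetric])
      qed (rule bd[OF Suc.prems])
    }
  qed
  from this[of "[]" "[]"] show "a \<in> lsym UNIV m" by (intro lsymI) simp
next
  fix a :: "'a \<Rightarrow> 'b \<Rightarrow> complex" assume a: "a \<in> lsym UNIV m"
  note s = lsym_smooth_UNIV[OF a]
  show "a \<in> symbols m"
    unfolding symbols_def mem_Collect_eq norm_Dderiv2[OF s]
    using lsym_bound[OF lsym_ider_left[OF lsym_ider_right[OF a set_mword] set_mword]] s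
    by (simp add: length_mword)
qed

lemma ider_eq_0_outside: "(\<And>x. norm x > R \<Longrightarrow> f x = 0) \<Longrightarrow> norm x > R \<Longrightarrow> ider l f x = 0"
proof (induction l arbitrary: x)
  case (Cons b l)
  show ?case unfolding ider_simps by (rule pdiff_eq_0_outside[OF Cons.IH[OF Cons.prems(1)] Cons.prems(2)])
qed simp

text \<open>Sums over words in the basis avoid factorials in product rules; every multi-index \<open>\<alpha>\<close> of length \<open>k\<close>
  is represented by \<open>k!/\<alpha>!\<close> words of length \<open>k\<close>.\<close>

definition words :: "nat \<Rightarrow> 'a::euclidean_space list set" where
  "words k = {l. set l \<subseteq> Basis \<and> length l = k}"

lemma finite_words: "finite (words k)"
  unfolding words_def by (rule finite_lists_length_eq) simp

lemma card_words: "card (words k :: 'a::euclidean_space list set) = DIM('a) ^ k"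
  unfolding words_def by (rule card_lists_length_eq) simp

lemma words_0: "words 0 = {[]}"
  by (auto simp: words_def)

lemma wordsD: "l \<in> words k \<Longrightarrow> set l \<subseteq> Basis" "l \<in> words k \<Longrightarrow> length l = k"
  by (auto simp: words_def)

lemma sum_words_Suc:
  fixes f :: "'a::euclidean_space list \<Rightarrow> 'b::comm_monoid_add"
  shows "(\<Sum>l\<in>words (Suc k). f l) = (\<Sum>l\<in>words k. \<Sum>b\<in>Basis. f (b # l))"
proof -
  have eq: "words (Suc k) = (\<lambda>p. snd p # fst p) ` (words k \<times> Basis)"
    by (force simp: words_def length_Suc_conv image_iff)
  have inj: "inj_on (\<lambda>p. snd p # fst p) (words k \<times> (Basis :: 'a set))" by (auto simp: inj_on_def)
  show ?thesis
    unfolding eq sum.reindex[OF inj] by (simp add: sum.cartesian_product split_def comp_def)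
qed

section \<open>Fourier transforms of families with uniformly compact support\<close>

lemma ft_family:
  fixes g :: "'z::euclidean_space \<Rightarrow> 'a::euclidean_space \<Rightarrow> complex"
  assumes g: "csmooth g"
  shows "(\<lambda>(z, \<eta>). ft (g z) \<eta>) differentiable (at p)"
    and "b \<in> Basis \<Longrightarrow> pdiff b (\<lambda>z. ft (g z) \<eta>) z = ft (\<lambda>y. pdiff b (\<lambda>z. g z y) z) \<eta>"
    and "c \<in> Basis \<Longrightarrow> pdiff c (ft (g z)) \<eta> = ft (\<lambda>y. - \<i> * complex_of_real (y \<bullet> c) * g z y) \<eta>"
proof -
  \<comment> \<open>With the frequency counted among the parameters the integrand is again a
    \<open>csmooth\<close> family, so derivatives in \<open>z\<close> and in \<open>\<eta>\<close>
    come from one and the same differentiation under the integral sign.\<close>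
  define F where "F p y = cis (- (y \<bullet> snd p)) * g (fst p) y" for p :: "'z \<times> 'a" and y
  obtain R where R: "\<And>z y. norm y > R \<Longrightarrow> g z y = 0" using g unfolding csmooth_def by blast
  have "smooth_on UNIV (\<lambda>q::('z \<times> 'a) \<times> 'a. cis (- (snd q \<bullet> snd (fst q))))"
    by (intro smooth_on_cis smooth_on_uminus smooth_on_inner smooth_on_linear open_UNIV bounded_linear_snd
        bounded_linear_compose[OF bounded_linear_snd bounded_linear_fst])
  moreover have "smooth_on UNIV (\<lambda>q::('z \<times> 'a) \<times> 'a. (\<lambda>(z, y). g z y) (fst (fst q), snd q))"
    by (rule smooth_on_compose_linear0[OF _ open_UNIV open_UNIV UNIV_I csmooth_smooth[OF g]])
      (intro bounded_linear_Pair bounded_linear_snd bounded_linear_compose[OF bounded_linear_fst bounded_linear_fst])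
  ultimately have "smooth_on UNIV (\<lambda>(p, y). F p y)"
    unfolding F_def split_def fst_conv snd_conv by (rule smooth_on_mult[OF open_UNIV])
  then have F: "csmooth F" using R unfolding csmooth_def F_def by auto
  have eq: "(\<lambda>p. LINT y|lborel. F p y) = (\<lambda>(z, \<eta>). ft (g z) \<eta>)"
    by (auto simp: F_def ft_def fun_eq_iff)
  show "(\<lambda>(z, \<eta>). ft (g z) \<eta>) differentiable (at p)" using csmooth_integral(1)[OF F, of p] unfolding eq .
  have dg: "(\<lambda>z. g z y) differentiable (at z)" for y z
    by (rule smooth_on_differentiable[OF open_UNIV smooth_on_slice(2)[OF csmooth_smooth[OF g]] UNIV_I])
  show "pdiff b (\<lambda>z. ft (g z) \<eta>) z = ft (\<lambda>y. pdiff b (\<lambda>z. g z y) z) \<eta>" if b: "b \<in> Basis"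
  proof -
    have "pdiff b (\<lambda>z. ft (g z) \<eta>) z = pdiff (b, 0) (\<lambda>(z, \<eta>). ft (g z) \<eta>) (z, \<eta>)" by (simp add: pdiff_slice)
    also have "\<dots> = (LINT y|lborel. pdiff (b, 0) (\<lambda>p. F p y) (z, \<eta>))"
      unfolding eq[symmetric] by (rule csmooth_integral(2)[OF F Basis_PairI(1)[OF b]])
    also have "\<dots> = ft (\<lambda>y. pdiff b (\<lambda>z. g z y) z) \<eta>"
      unfolding ft_def
    proof (rule Bochner_Integration.integral_cong[OF refl])
      fix y
      have "pdiff (b, 0) (\<lambda>p. F p y) (z, \<eta>) = pdiff b (\<lambda>z. cis (- (y \<bullet> \<eta>)) * g z y) z"
        using pdiff_slice(1)[of b "\<lambda>z \<eta>. F (z, \<eta>) y" z \<eta>] by (simp add: F_def split_def)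
      then show "pdiff (b, 0) (\<lambda>p. F p y) (z, \<eta>) = cis (- (y \<bullet> \<eta>)) * pdiff b (\<lambda>z. g z y) z"
        by (simp only: pdiff_cmult[OF dg])
    qed
    finally show ?thesis .
  qed
  show "pdiff c (ft (g z)) \<eta> = ft (\<lambda>y. - \<i> * complex_of_real (y \<bullet> c) * g z y) \<eta>" if c: "c \<in> Basis"
  proof -
    have "pdiff c (ft (g z)) \<eta> = pdiff (0, c) (\<lambda>(z, \<eta>). ft (g z) \<eta>) (z, \<eta>)" by (simp add: pdiff_slice)
    also have "\<dots> = (LINT y|lborel. pdiff (0, c) (\<lambda>p. F p y) (z, \<eta>))"
      unfolding eq[symmetric] by (rule csmooth_integral(2)[OF F Basis_PairI(2)[OF c]])
    also have "\<dots> = ft (\<lambda>y. - \<i> * complex_of_real (y \<bullet> c) * g z y) \<eta>"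
      unfolding ft_def
    proof (rule Bochner_Integration.integral_cong[OF refl])
      fix y
      have "pdiff (0, c) (\<lambda>p. F p y) (z, \<eta>) = pdiff c (\<lambda>\<eta>. g z y * cis ((- y) \<bullet> \<eta>)) \<eta>"
        using pdiff_slice(2)[of c "\<lambda>z \<eta>. F (z, \<eta>) y" z \<eta>] by (simp add: F_def split_def mult.commute)
      also have "\<dots> = g z y * (\<i> * complex_of_real ((- y) \<bullet> c) * cis ((- y) \<bullet> \<eta>))"
        by (simp only: pdiff_cmult[OF pdiff_cis_inner(3)] pdiff_cis_inner(4))
      finally show "pdiff (0, c) (\<lambda>p. F p y) (z, \<eta>) = cis (- (y \<bullet> \<eta>)) * (- \<i> * complex_of_real (y \<bullet> c) * g z y)"
        by simp
    qed
    finally show ?thesis .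
  qed
qed

lemma ft_family_continuous: "csmooth g \<Longrightarrow> continuous_on UNIV (\<lambda>(z, \<eta>). ft (g z) \<eta>)"
  by (intro continuous_at_imp_continuous_on ballI differentiable_imp_continuous_within ft_family(1))

text \<open>Both kinds of derivative lead to families of the same type, so it suffices to bound the
  transform itself, and \<open>ft_decay\<close> does so for every order \<open>m\<close>. This is
  the source of the smoothing symbols.\<close>

lemma ft_lsym:
  fixes g :: "'x::euclidean_space \<Rightarrow> 'a::euclidean_space \<Rightarrow> complex"
  assumes "csmooth g"
  shows "(\<lambda>x. ft (g x)) \<in> lsym UNIV m"
proof -
  have bd: "\<exists>C. \<forall>x\<in>K. \<forall>\<eta>. cmod (ft (g x) \<eta>) \<le> C * japanese \<eta> powr m"
    if g: "csmooth g" and K: "compact K" for g :: "'x \<Rightarrow> 'a \<Rightarrow> complex" and K m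
  proof -
    obtain R where R: "\<And>z y. norm y > R \<Longrightarrow> g z y = 0" using g unfolding csmooth_def by blast
    \<comment> \<open>Then \<open>- 2 * real M \<le> m\<close>, so \<open>2 * M\<close> derivatives
      give the required decay.\<close>
    define M where "M = nat \<lceil>\<bar>m\<bar>\<rceil>"
    define W where "W = {l. set l \<subseteq> (Basis :: 'a set) \<and> length l \<le> 2 * M}"
    have W: "finite W" unfolding W_def by (rule finite_lists_length_le) simp
    have "\<exists>S. \<forall>x\<in>K. \<forall>y. cmod (ider l (g x) y) \<le> S" if l: "l \<in> W" for l
    proof -
      have "smooth_on UNIV (\<lambda>(x, y). ider l (g x) y)"
        unfolding ider_slice_right[symmetric] using l
        by (intro smooth_on_ider open_UNIV csmooth_smooth[OF g] set_Pair_Basis) (simp add: W_def)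
      then have "compact ((\<lambda>(x, y). ider l (g x) y) ` (K \<times> cball 0 R))"
        by (intro compact_continuous_image compact_Times K compact_cball continuous_on_subset[OF smooth_on_imp_continuous_on]) auto
      from compact_imp_bounded[OF this, unfolded bounded_pos]
      obtain B where B: "B > 0" "\<And>v. v \<in> (\<lambda>(x, y). ider l (g x) y) ` (K \<times> cball 0 R) \<Longrightarrow> cmod v \<le> B"
        by (elim exE conjE) blast
      have "cmod (ider l (g x) y) \<le> B" if x: "x \<in> K" for x y
      proof (cases "norm y \<le> R")
        case True
        then have "(x, y) \<in> K \<times> cball 0 R" using x by simp
        from B(2)[OF imageI[OF this]] show ?thesis by simp
      next
        case False
        then have "ider l (g x) y = 0" by (intro ider_eq_0_outside[OF R]) auto
        then show ?thesis using B(1) by simp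
      qed
      then show ?thesis by blast
    qed
    then obtain S where S: "\<And>l x y. l \<in> W \<Longrightarrow> x \<in> K \<Longrightarrow> cmod (ider l (g x) y) \<le> S l" by metis
    define T where "T = (\<Sum>l\<in>W. \<bar>S l\<bar>)"
    have T: "cmod (ider l (g x) y) \<le> T" if "set l \<subseteq> Basis" "length l \<le> 2 * M" "x \<in> K" for l x y
    proof -
      have l: "l \<in> W" using that by (simp add: W_def)
      have "cmod (ider l (g x) y) \<le> \<bar>S l\<bar>" using S[OF l that(3), of y] by simp
      also have "\<bar>S l\<bar> \<le> T" unfolding T_def by (rule member_le_sum[OF l _ W]) simp
      finally show ?thesis .
    qed
    obtain B where B: "B \<ge> 0" "\<And>f S \<eta>. f \<in> test_functions \<Longrightarrow> (\<And>y. norm y > R \<Longrightarrow> f y = 0) \<Longrightarrow>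
      (\<And>l y. set l \<subseteq> Basis \<Longrightarrow> length l \<le> 2 * M \<Longrightarrow> norm (ider l f y) \<le> S) \<Longrightarrow>
      norm (ft f \<eta>) \<le> B * S * japanese (\<eta>::'a) powr (- 2 * real M)"
      using ft_decay[of R M, where 'a = 'a] by blast
    have "cmod (ft (g x) \<eta>) \<le> (B * T) * japanese \<eta> powr m" if x: "x \<in> K" for x \<eta>
    proof -
      have "cmod (ft (g x) \<eta>) \<le> B * T * japanese \<eta> powr (- 2 * real M)"
        by (rule B(2)[OF csmooth_slice_test[OF g] R T[OF _ _ x]])
      also have "\<dots> \<le> (B * T) * japanese \<eta> powr m"
      proof (rule mult_left_mono)
        have "- 2 * real M \<le> m" unfolding M_def by linarith
        then show "japanese \<eta> powr (- 2 * real M) \<le> japanese \<eta> powr m" by (rule japanese_powr_mono)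
        show "0 \<le> B * T" using B(1) by (simp add: T_def sum_nonneg)
      qed
      finally show ?thesis .
    qed
    then show ?thesis by blast
  qed
  have "symb k m UNIV (\<lambda>x. ft (g x))" for k using assms
  proof (induction k arbitrary: m g)
    case 0
    show ?case by (rule symb_0I) (use ft_family_continuous[OF 0] bd[OF 0] in auto)
  next
    case (Suc k)
    show ?case
    proof (rule symb_SucI[OF ft_family(1)[OF Suc.prems] bd[OF Suc.prems]])
      fix b :: 'x assume b: "b \<in> Basis"
      show "symb k m UNIV (\<lambda>x \<theta>. pdiff b (\<lambda>x. ft (g x) \<theta>) x)"
        unfolding ft_family(2)[OF Suc.prems b] by (rule Suc.IH[OF csmooth_pdiff_left[OF Suc.prems b]])
    next
      fix c :: 'a assume c: "c \<in> Basis"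
      have "(\<lambda>x. pdiff c (ft (g x))) = (\<lambda>x. ft (\<lambda>y. - \<i> * complex_of_real (y \<bullet> c) * g x y))"
        by (intro ext ft_family(3)[OF Suc.prems c])
      then show "symb k (m - 1) UNIV (\<lambda>x. pdiff c (ft (g x)))"
        using Suc.IH[OF csmooth_mult_inner[OF Suc.prems, of "- \<i>" c]] by simp
    qed
  qed
  then show ?thesis by (rule lsymI)
qed

text \<open>Symbols supported over one ball of base points, uniformly in the frequency. This is what
  lets the Fourier transform in the base variable be taken with \<open>\<xi>\<close> as a
  parameter.\<close>

definition csym :: "real \<Rightarrow> ('a::euclidean_space \<Rightarrow> 'k::euclidean_space \<Rightarrow> complex) \<Rightarrow> bool" where
  "csym m w \<longleftrightarrow> w \<in> lsym UNIV m \<and> (\<exists>R. \<forall>y \<xi>. norm y > R \<longrightarrow> w y \<xi> = 0)"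

lemma csym_lsym: "csym m w \<Longrightarrow> w \<in> lsym UNIV m"
  by (simp add: csym_def)

lemma csym_csmooth:
  fixes w :: "'a::euclidean_space \<Rightarrow> 'k::euclidean_space \<Rightarrow> complex"
  assumes "csym m w"
  shows "csmooth (\<lambda>\<xi> y. w y \<xi>)"
proof -
  have "bounded_linear (\<lambda>p::'k \<times> 'a. (snd p, fst p))"
    by (intro bounded_linear_Pair bounded_linear_fst bounded_linear_snd)
  from smooth_on_compose_linear0[OF this open_UNIV open_UNIV UNIV_I lsym_smooth_UNIV[OF csym_lsym[OF assms]]]
  show ?thesis using assms unfolding csmooth_def csym_def by (auto simp: split_def)
qed

lemma csym_test: "csym m w \<Longrightarrow> (\<lambda>y. w y \<xi>) \<in> test_functions"
  by (rule csmooth_slice_test[OF csym_csmooth])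

lemma csym_pdiff_left:
  assumes "csym m w" "b \<in> Basis"
  shows "csym m (\<lambda>y \<xi>. pdiff b (\<lambda>y. w y \<xi>) y)"
proof -
  obtain R where R: "\<And>y \<xi>. norm y > R \<Longrightarrow> w y \<xi> = 0" using assms(1) unfolding csym_def by blast
  have "pdiff b (\<lambda>y. w y \<xi>) y = 0" if "norm y > R" for y \<xi> by (rule pdiff_eq_0_outside[OF R that])
  then show ?thesis using lsym_pdiff_left[OF csym_lsym[OF assms(1)] assms(2)] unfolding csym_def by blast
qed

lemma csym_pdiff_right:
  assumes "csym m w" "b \<in> Basis"
  shows "csym (m - 1) (\<lambda>y. pdiff b (w y))"
proof -
  obtain R where R: "\<And>y \<xi>. norm y > R \<Longrightarrow> w y \<xi> = 0" using assms(1) unfolding csym_def by blast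
  have "pdiff b (w y) \<xi> = 0" if "norm y > R" for y \<xi>
  proof -
    have "w y = (\<lambda>\<xi>. 0)" using R[OF that] by (simp add: fun_eq_iff)
    then show ?thesis by (simp only: pdiff_const)
  qed
  then show ?thesis using lsym_pdiff_right[OF csym_lsym[OF assms(1)] assms(2)] unfolding csym_def by blast
qed

text \<open>Derivatives in the base variable do not change the order in \<open>\<xi>\<close>, and
  \<open>ft_decay\<close> is linear in the bound on them. So growth of order \<open>m\<close> in
  \<open>\<xi>\<close> and arbitrary decay in \<open>\<eta>\<close> decouple.\<close>

lemma csym_ft_decay:
  fixes w :: "'a::euclidean_space \<Rightarrow> 'k::euclidean_space \<Rightarrow> complex"
  assumes w: "csym m w"
  obtains C where "C \<ge> 0" "\<And>\<xi> \<eta>. cmod (ft (\<lambda>y. w y \<xi>) \<eta>) \<le> C * japanese \<xi> powr m * japanese \<eta> powr s"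
proof -
  obtain R where R: "\<And>y \<xi>. norm y > R \<Longrightarrow> w y \<xi> = 0" using w unfolding csym_def by blast
  define M where "M = nat \<lceil>\<bar>s\<bar>\<rceil>"
  define W where "W = {l. set l \<subseteq> (Basis :: 'a set) \<and> length l \<le> 2 * M}"
  have W: "finite W" unfolding W_def by (rule finite_lists_length_le) simp
  have "\<exists>S. \<forall>y\<in>cball 0 R. \<forall>\<xi>. cmod (ider l (\<lambda>y. w y \<xi>) y) \<le> S * japanese \<xi> powr m" if "l \<in> W" for l
    using that by (intro lsym_bound[OF lsym_ider_left[OF csym_lsym[OF w]]]) (auto simp: W_def)
  then obtain S where S: "\<And>l y \<xi>. l \<in> W \<Longrightarrow> y \<in> cball 0 R \<Longrightarrow> cmod (ider l (\<lambda>y. w y \<xi>) y) \<le> S l * japanese \<xi> powr m" by metis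
  define T where "T = (\<Sum>l\<in>W. \<bar>S l\<bar>)"
  have T: "cmod (ider l (\<lambda>y. w y \<xi>) y) \<le> T * japanese \<xi> powr m" if "set l \<subseteq> Basis" "length l \<le> 2 * M" for l y \<xi>
  proof (cases "norm y \<le> R")
    case True
    have l: "l \<in> W" using that by (simp add: W_def)
    have "cmod (ider l (\<lambda>y. w y \<xi>) y) \<le> S l * japanese \<xi> powr m" using True by (intro S[OF l]) simp
    also have "S l \<le> T" unfolding T_def by (rule order_trans[OF abs_ge_self member_le_sum[OF l _ W]]) simp
    finally show ?thesis by (simp add: mult_right_mono)
  next
    case False
    then have "ider l (\<lambda>y. w y \<xi>) y = 0" by (intro ider_eq_0_outside[OF R]) auto
    then show ?thesis by (simp add: T_def sum_nonneg)
  qed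
  obtain B where B: "B \<ge> 0" "\<And>f S \<eta>. f \<in> test_functions \<Longrightarrow> (\<And>y. norm y > R \<Longrightarrow> f y = 0) \<Longrightarrow>
    (\<And>l y. set l \<subseteq> Basis \<Longrightarrow> length l \<le> 2 * M \<Longrightarrow> norm (ider l f y) \<le> S) \<Longrightarrow>
    norm (ft f \<eta>) \<le> B * S * japanese (\<eta>::'a) powr (- 2 * real M)"
    using ft_decay[of R M, where 'a = 'a] by blast
  have T0: "T \<ge> 0" by (simp add: T_def sum_nonneg)
  have "cmod (ft (\<lambda>y. w y \<xi>) \<eta>) \<le> (B * T) * japanese \<xi> powr m * japanese \<eta> powr s" for \<xi> \<eta>
  proof -
    have "cmod (ft (\<lambda>y. w y \<xi>) \<eta>) \<le> B * (T * japanese \<xi> powr m) * japanese \<eta> powr (- 2 * real M)"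
      by (rule B(2)[OF csym_test[OF w] R T])
    also have "\<dots> \<le> B * (T * japanese \<xi> powr m) * japanese \<eta> powr s"
    proof (rule mult_left_mono)
      have "- 2 * real M \<le> s" unfolding M_def by linarith
      then show "japanese \<eta> powr (- 2 * real M) \<le> japanese \<eta> powr s" by (rule japanese_powr_mono)
      show "0 \<le> B * (T * japanese \<xi> powr m)" using B(1) T0 by simp
    qed
    finally show ?thesis by (simp add: mult.assoc)
  qed
  then show ?thesis using that B(1) T0 by (meson mult_nonneg_nonneg)
qed

text \<open>A test function is a compactly supported symbol of order \<open>0\<close> that is
  constant in its frequency variable, so this is a case of \<open>csym_ft_decay\<close>.\<close>

lemma integrable_ft_test:
  fixes f :: "'a::euclidean_space \<Rightarrow> complex"
  assumes f: "f \<in> test_functions"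
  shows "integrable lborel (ft f)"
    and "\<exists>C\<ge>0. \<forall>\<eta>. cmod (ft f \<eta>) \<le> C * japanese \<eta> powr s"
    and "continuous_on UNIV (ft f)"
proof -
  have c: "csym 0 (\<lambda>y (\<xi>::'a). f y)"
    using lsym_left[OF open_UNIV test_functions_smooth[OF f], where 'b = 'a] test_functions_support[OF f]
    unfolding csym_def by metis
  obtain C where C: "C \<ge> 0" "\<And>\<xi>::'a. \<And>\<eta>. cmod (ft f \<eta>) \<le> C * japanese \<xi> powr 0 * japanese \<eta> powr s"
    using csym_ft_decay[OF c, of s] by blast
  then show "\<exists>C\<ge>0. \<forall>\<eta>. cmod (ft f \<eta>) \<le> C * japanese \<eta> powr s" by auto
  obtain D where D: "\<And>\<xi>::'a. \<And>\<eta>. cmod (ft f \<eta>) \<le> D * japanese \<xi> powr 0 * japanese \<eta> powr (- 2 * real DIM('a))"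
    using csym_ft_decay[OF c, of "- 2 * real DIM('a)"] by blast
  show cc: "continuous_on UNIV (ft f)"
    using continuous_on_slice(1)[OF ft_family_continuous[OF csym_csmooth[OF c]]] .
  have m: "ft f \<in> borel_measurable lborel" using borel_measurable_continuous_onI[OF cc] by simp
  have i: "integrable lborel (\<lambda>\<eta>::'a. D * japanese \<eta> powr (- 2 * real DIM('a)))"
    by (intro integrable_mult_right integrable_japanese) simp
  show "integrable lborel (ft f)"
    by (rule Bochner_Integration.integrable_bound[OF i m])
      (rule AE_I2, use D in \<open>auto intro: order_trans[OF _ abs_ge_self]\<close>)
qed

subsection \<open>Composition of symbols and its asymptotic expansion\<close>

text \<open>Writing \<open>e_\<xi>(x) = exp(i\<langle>x, \<xi>\<rangle>)\<close>, the function \<open>comp_symbol p w x \<xi>\<close> is the value at \<open>x\<close> of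
  \<open>e_\<xi>^(-1) Op(p)(e_\<xi> w(\<sqdot>, \<xi>))\<close>, that is, the symbol of \<open>Op(p) Op(w)\<close>.\<close>

definition comp_integrand where
  "comp_integrand p w x \<xi> \<eta> = cis (x \<bullet> \<eta>) * p x (\<xi> + \<eta>) * ft (\<lambda>y. w y \<xi>) \<eta>"

definition comp_symbol ::
  "('a::euclidean_space \<Rightarrow> 'a \<Rightarrow> complex) \<Rightarrow> ('a \<Rightarrow> 'a \<Rightarrow> complex) \<Rightarrow> 'a \<Rightarrow> 'a \<Rightarrow> complex" where
  "comp_symbol p w x \<xi> = complex_of_real (1 / (2 * pi) ^ DIM('a)) * (LINT \<eta>|lborel. comp_integrand p w x \<xi> \<eta>)"

lemma comp_integrand_bound:
  fixes p w :: "'a::euclidean_space \<Rightarrow> 'a \<Rightarrow> complex"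
  assumes p: "p \<in> lsym UNIV m" and w: "csym m' w" and K: "compact K"
  obtains C where "C \<ge> 0" "\<And>x \<xi> \<eta>. x \<in> K \<Longrightarrow>
    cmod (comp_integrand p w x \<xi> \<eta>) \<le> C * japanese \<xi> powr (m + m') * japanese \<eta> powr (- 2 * real DIM('a))"
proof -
  obtain A where A: "\<And>x \<theta>. x \<in> K \<Longrightarrow> cmod (p x \<theta>) \<le> A * japanese \<theta> powr m"
    using lsym_bound[OF p K] by blast
  \<comment> \<open>The exponent pays for the factor
    \<open>japanese \<eta> powr \<bar>m\<bar>\<close> from Peetre's inequality and leaves an
    integrable weight.\<close>
  obtain B where B: "B \<ge> 0" "\<And>\<xi> \<eta>. cmod (ft (\<lambda>y. w y \<xi>) \<eta>) \<le> B * japanese \<xi> powr m' * japanese \<eta> powr (- 2 * real DIM('a) - \<bar>m\<bar>)"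
    using csym_ft_decay[OF w] by blast
  define A' where "A' = \<bar>A\<bar> * 2 powr \<bar>m\<bar>"
  have "cmod (comp_integrand p w x \<xi> \<eta>) \<le> (A' * B) * japanese \<xi> powr (m + m') * japanese \<eta> powr (- 2 * real DIM('a))"
    if x: "x \<in> K" for x \<xi> \<eta>
  proof -
    have "cmod (p x (\<xi> + \<eta>)) \<le> \<bar>A\<bar> * japanese (\<xi> + \<eta>) powr m"
      by (rule order_trans[OF A[OF x]]) (simp add: mult_right_mono)
    also have "\<dots> \<le> \<bar>A\<bar> * (2 powr \<bar>m\<bar> * japanese \<xi> powr m * japanese \<eta> powr \<bar>m\<bar>)"
      by (intro mult_left_mono japanese_powr_add_le) simp
    finally have 1: "cmod (p x (\<xi> + \<eta>)) \<le> A' * japanese \<xi> powr m * japanese \<eta> powr \<bar>m\<bar>"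
      by (simp add: A'_def mult.assoc)
    have "cmod (comp_integrand p w x \<xi> \<eta>) = cmod (p x (\<xi> + \<eta>)) * cmod (ft (\<lambda>y. w y \<xi>) \<eta>)"
      by (simp add: comp_integrand_def norm_mult)
    also have "\<dots> \<le> (A' * japanese \<xi> powr m * japanese \<eta> powr \<bar>m\<bar>) *
        (B * japanese \<xi> powr m' * japanese \<eta> powr (- 2 * real DIM('a) - \<bar>m\<bar>))"
      by (rule mult_mono[OF 1 B(2) order_trans[OF norm_ge_zero 1] norm_ge_zero])
    also have "\<dots> = (A' * B) * (japanese \<xi> powr m * japanese \<xi> powr m') *
        (japanese \<eta> powr \<bar>m\<bar> * japanese \<eta> powr (- 2 * real DIM('a) - \<bar>m\<bar>))"
      by (simp only: mult_ac)
    finally show ?thesis by (simp flip: powr_add)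
  qed
  then show ?thesis using that[of "A' * B"] B(1) by (simp add: A'_def)
qed

lemma japanese_powr_le: "norm \<xi> \<le> R \<Longrightarrow> japanese \<xi> powr s \<le> (1 + R) powr \<bar>s\<bar>"
proof -
  assume "norm \<xi> \<le> R"
  then have "japanese \<xi> \<le> 1 + R" using japanese_le[of \<xi>] by linarith
  then have "japanese \<xi> powr \<bar>s\<bar> \<le> (1 + R) powr \<bar>s\<bar>" by (intro powr_mono2) auto
  then show ?thesis using japanese_powr_mono[of s "\<bar>s\<bar>" \<xi>] by linarith
qed

lemma comp_integrand_dominated:
  fixes p w :: "'a::euclidean_space \<Rightarrow> 'a \<Rightarrow> complex"
  assumes p: "p \<in> lsym UNIV m" and w: "csym m' w"
  shows "dominated (\<lambda>(x, \<xi>). comp_integrand p w x \<xi>)"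
  unfolding dominated_def
proof (intro conjI allI)
  have pc: "continuous_on UNIV (\<lambda>(x, \<theta>). p x \<theta>)" by (rule smooth_on_imp_continuous_on[OF lsym_smooth_UNIV[OF p]])
  have "continuous_on UNIV (\<lambda>q::('a \<times> 'a) \<times> 'a. cis (fst (fst q) \<bullet> snd q))"
    by (intro continuous_on_cis continuous_intros)
  moreover have "continuous_on UNIV (\<lambda>q::('a \<times> 'a) \<times> 'a. (\<lambda>(x, \<theta>). p x \<theta>) (fst (fst q), snd (fst q) + snd q))"
    by (rule continuous_on_compose2[OF pc]) (auto intro!: continuous_intros)
  moreover have "continuous_on UNIV (\<lambda>q::('a \<times> 'a) \<times> 'a. (\<lambda>(\<xi>, \<eta>). ft (\<lambda>y. w y \<xi>) \<eta>) (snd (fst q), snd q))"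
    by (rule continuous_on_compose2[OF ft_family_continuous[OF csym_csmooth[OF w]]]) (auto intro!: continuous_intros)
  ultimately show "continuous_on UNIV (\<lambda>(z, \<eta>). (case z of (x, \<xi>) \<Rightarrow> comp_integrand p w x \<xi>) \<eta>)"
    unfolding comp_integrand_def split_def fst_conv snd_conv by (intro continuous_on_mult)
  fix R :: real
  obtain C where C: "C \<ge> 0" "\<And>x \<xi> \<eta>. x \<in> cball 0 R \<Longrightarrow>
    cmod (comp_integrand p w x \<xi> \<eta>) \<le> C * japanese \<xi> powr (m + m') * japanese \<eta> powr (- 2 * real DIM('a))"
    using comp_integrand_bound[OF p w compact_cball] by metis
  have "norm ((case z of (x, \<xi>) \<Rightarrow> comp_integrand p w x \<xi>) \<eta>) \<le> (C * (1 + R) powr \<bar>m + m'\<bar>) * japanese \<eta> powr (- 2 * real DIM('a))"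
    if z: "norm z \<le> R" for z \<eta>
  proof -
    obtain x \<xi> where z': "z = (x, \<xi>)" by fastforce
    have n: "norm x \<le> R" "norm \<xi> \<le> R" using z norm_fst_le[of x \<xi>] norm_snd_le[of \<xi> x] unfolding z' by linarith+
    have "cmod (comp_integrand p w x \<xi> \<eta>) \<le> C * japanese \<xi> powr (m + m') * japanese \<eta> powr (- 2 * real DIM('a))"
      using n by (intro C) simp
    also have "\<dots> \<le> C * (1 + R) powr \<bar>m + m'\<bar> * japanese \<eta> powr (- 2 * real DIM('a))"
      using C(1) by (intro mult_right_mono mult_left_mono japanese_powr_le n) auto
    finally show ?thesis by (simp add: z')
  qed
  moreover have "integrable lborel (\<lambda>\<eta>::'a. (C * (1 + R) powr \<bar>m + m'\<bar>) * japanese \<eta> powr (- 2 * real DIM('a)))"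
    by (intro integrable_mult_right integrable_japanese) simp
  ultimately show "\<exists>g. integrable lborel g \<and> (\<forall>z \<eta>. norm z \<le> R \<longrightarrow> norm ((case z of (x, \<xi>) \<Rightarrow> comp_integrand p w x \<xi>) \<eta>) \<le> g \<eta>)"
    by blast
qed

lemma pdiff_shift:
  fixes f :: "'a::euclidean_space \<Rightarrow> 'b::real_normed_vector"
  assumes "f differentiable (at (x + c))" "b \<in> Basis"
  shows "(\<lambda>x. f (x + c)) differentiable (at x)" "pdiff b (\<lambda>x. f (x + c)) x = pdiff b f (x + c)"
  using pdiff_compose_linear[OF bounded_linear_ident assms(1)] sum_Basis_inner_scaleR[OF assms(2)] by auto

text \<open>The product rule in \<open>x\<close> is not evident, as \<open>x\<close> occurs in
  \<open>p\<close> and in the phase but not in the transform of \<open>w\<close>. The phase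
  contributes \<open>\<i> * (\<eta> \<bullet> b)\<close>, and by \<open>ft_pdiff\<close> this is the
  multiplier that differentiates \<open>w\<close>.\<close>

lemma comp_integrand_pdiff:
  fixes p w :: "'a::euclidean_space \<Rightarrow> 'a \<Rightarrow> complex"
  assumes p: "p \<in> lsym UNIV m" and w: "csym m' w"
  shows "(\<lambda>(x, \<xi>). comp_integrand p w x \<xi> \<eta>) differentiable (at z)"
    and "b \<in> Basis \<Longrightarrow> pdiff b (\<lambda>x. comp_integrand p w x \<xi> \<eta>) x =
      comp_integrand (\<lambda>x \<xi>. pdiff b (\<lambda>x. p x \<xi>) x) w x \<xi> \<eta> + comp_integrand p (\<lambda>x \<xi>. pdiff b (\<lambda>x. w x \<xi>) x) x \<xi> \<eta>"
    and "b \<in> Basis \<Longrightarrow> pdiff b (\<lambda>\<xi>. comp_integrand p w x \<xi> \<eta>) \<xi> =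
      comp_integrand (\<lambda>x. pdiff b (p x)) w x \<xi> \<eta> + comp_integrand p (\<lambda>x. pdiff b (w x)) x \<xi> \<eta>"
proof -
  note ps = lsym_smooth_UNIV[OF p]
  have c1: "(\<lambda>z. cis (fst z \<bullet> \<eta>)) differentiable (at z)" for z :: "'a \<times> 'a"
    using pdiff_compose_linear(1)[OF bounded_linear_fst, of "\<lambda>x. cis (x \<bullet> \<eta>)" z 0, OF pdiff_cis_inner(1)] by simp
  have c2: "(\<lambda>z. p (fst z) (snd z + \<eta>)) differentiable (at z)" for z
    using pdiff_compose_linear(1)[OF bounded_linear_ident, of "\<lambda>(x, \<theta>). p x \<theta>" z "(0, \<eta>)"]
      smooth_on_differentiable[OF open_UNIV ps UNIV_I] by (simp add: split_def)
  have f1: "(\<lambda>\<xi>. ft (\<lambda>y. w y \<xi>) \<eta>) differentiable (at \<xi>)" for \<xi>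
    by (rule differentiable_slice(1)[OF ft_family(1)[OF csym_csmooth[OF w]]])
  have c3: "(\<lambda>z. ft (\<lambda>y. w y (snd z)) \<eta>) differentiable (at z)" for z :: "'a \<times> 'a"
    using pdiff_compose_linear(1)[OF bounded_linear_snd, of "\<lambda>\<xi>. ft (\<lambda>y. w y \<xi>) \<eta>" z 0] f1 by simp
  show "(\<lambda>(x, \<xi>). comp_integrand p w x \<xi> \<eta>) differentiable (at z)"
    unfolding comp_integrand_def split_def by (intro differentiable_mult c1 c2 c3)
  have px: "(\<lambda>x. p x \<theta>) differentiable (at x)" "p x differentiable (at \<theta>)" for x \<theta>
    by (rule differentiable_slice[OF smooth_on_differentiable[OF open_UNIV ps UNIV_I]])+
  show "pdiff b (\<lambda>x. comp_integrand p w x \<xi> \<eta>) x =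
      comp_integrand (\<lambda>x \<xi>. pdiff b (\<lambda>x. p x \<xi>) x) w x \<xi> \<eta> + comp_integrand p (\<lambda>x \<xi>. pdiff b (\<lambda>x. w x \<xi>) x) x \<xi> \<eta>"
    if b: "b \<in> Basis"
  proof -
    have "pdiff b (\<lambda>x. comp_integrand p w x \<xi> \<eta>) x = pdiff b (\<lambda>x. ft (\<lambda>y. w y \<xi>) \<eta> * (cis (x \<bullet> \<eta>) * p x (\<xi> + \<eta>))) x"
      by (simp add: comp_integrand_def mult_ac)
    also have "\<dots> = ft (\<lambda>y. w y \<xi>) \<eta> * (cis (x \<bullet> \<eta>) * pdiff b (\<lambda>x. p x (\<xi> + \<eta>)) x + \<i> * complex_of_real (b \<bullet> \<eta>) * cis (x \<bullet> \<eta>) * p x (\<xi> + \<eta>))"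
      by (simp only: pdiff_cmult[OF differentiable_mult[OF pdiff_cis_inner(1) px(1)]] pdiff_mult[OF pdiff_cis_inner(1) px(1)] pdiff_cis_inner(2))
    finally show ?thesis
      by (simp add: comp_integrand_def ft_pdiff[OF csym_test[OF w] b] inner_commute[of b] algebra_simps)
  qed
  show "pdiff b (\<lambda>\<xi>. comp_integrand p w x \<xi> \<eta>) \<xi> =
      comp_integrand (\<lambda>x. pdiff b (p x)) w x \<xi> \<eta> + comp_integrand p (\<lambda>x. pdiff b (w x)) x \<xi> \<eta>"
    if b: "b \<in> Basis"
  proof -
    have "pdiff b (\<lambda>\<xi>. comp_integrand p w x \<xi> \<eta>) \<xi> = pdiff b (\<lambda>\<xi>. cis (x \<bullet> \<eta>) * (p x (\<xi> + \<eta>) * ft (\<lambda>y. w y \<xi>) \<eta>)) \<xi>"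
      by (simp add: comp_integrand_def mult_ac)
    also have "\<dots> = cis (x \<bullet> \<eta>) * (p x (\<xi> + \<eta>) * ft (\<lambda>y. pdiff b (w y) \<xi>) \<eta> + pdiff b (p x) (\<xi> + \<eta>) * ft (\<lambda>y. w y \<xi>) \<eta>)"
      by (simp only: pdiff_cmult[OF differentiable_mult[OF pdiff_shift(1)[OF px(2) b] f1]]
          pdiff_mult[OF pdiff_shift(1)[OF px(2) b] f1] pdiff_shift(2)[OF px(2) b] ft_family(2)[OF csym_csmooth[OF w] b])
    finally show ?thesis by (simp add: comp_integrand_def algebra_simps)
  qed
qed

text \<open>The partial derivatives of the integrand are sums of integrands of the same form, hence
  dominated by the estimate already made.\<close>

lemma comp_symbol_pdiff:
  fixes p w :: "'a::euclidean_space \<Rightarrow> 'a \<Rightarrow> complex"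
  assumes p: "p \<in> lsym UNIV m" and w: "csym m' w"
  shows "(\<lambda>(x, \<xi>). comp_symbol p w x \<xi>) differentiable (at z)"
    and "b \<in> Basis \<Longrightarrow> pdiff b (\<lambda>x. comp_symbol p w x \<xi>) x =
      comp_symbol (\<lambda>x \<xi>. pdiff b (\<lambda>x. p x \<xi>) x) w x \<xi> + comp_symbol p (\<lambda>x \<xi>. pdiff b (\<lambda>x. w x \<xi>) x) x \<xi>"
    and "b \<in> Basis \<Longrightarrow> pdiff b (comp_symbol p w x) \<xi> =
      comp_symbol (\<lambda>x. pdiff b (p x)) w x \<xi> + comp_symbol p (\<lambda>x. pdiff b (w x)) x \<xi>"
proof -
  define F where "F = (\<lambda>(x, \<xi>). comp_integrand p w x \<xi>)"
  have F: "dominated F" unfolding F_def by (rule comp_integrand_dominated[OF p w])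
  have Fd: "(\<lambda>z. F z \<eta>) differentiable (at z)" for z \<eta>
    using comp_integrand_pdiff(1)[OF p w, of \<eta> z] by (simp add: F_def split_def)
  have pdx: "pdiff (b, 0) (\<lambda>z. F z \<eta>) (x, \<xi>) =
      comp_integrand (\<lambda>x \<xi>. pdiff b (\<lambda>x. p x \<xi>) x) w x \<xi> \<eta> + comp_integrand p (\<lambda>x \<xi>. pdiff b (\<lambda>x. w x \<xi>) x) x \<xi> \<eta>"
    if "b \<in> Basis" for b x \<xi> \<eta>
    using comp_integrand_pdiff(2)[OF p w that, of \<xi> \<eta> x] pdiff_slice(1)[of b "\<lambda>x \<xi>. comp_integrand p w x \<xi> \<eta>" x \<xi>]
    by (simp add: F_def split_def)
  have pdxi: "pdiff (0, b) (\<lambda>z. F z \<eta>) (x, \<xi>) =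
      comp_integrand (\<lambda>x. pdiff b (p x)) w x \<xi> \<eta> + comp_integrand p (\<lambda>x. pdiff b (w x)) x \<xi> \<eta>"
    if "b \<in> Basis" for b x \<xi> \<eta>
    using comp_integrand_pdiff(3)[OF p w that, of x \<eta> \<xi>] pdiff_slice(2)[of b "\<lambda>x \<xi>. comp_integrand p w x \<xi> \<eta>" x \<xi>]
    by (simp add: F_def split_def)
  note d1 = comp_integrand_dominated[OF lsym_pdiff_left[OF p] w] comp_integrand_dominated[OF p csym_pdiff_left[OF w]]
  note d2 = comp_integrand_dominated[OF lsym_pdiff_right[OF p] w] comp_integrand_dominated[OF p csym_pdiff_right[OF w]]
  have D: "dominated (\<lambda>z \<eta>. pdiff c (\<lambda>z. F z \<eta>) z)" if "c \<in> Basis" for c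
    using that
  proof (cases rule: Basis_PairE)
    case (1 b)
    have "(\<lambda>z \<eta>. pdiff c (\<lambda>z. F z \<eta>) z) = (\<lambda>z \<eta>. (case z of (x, \<xi>) \<Rightarrow> comp_integrand (\<lambda>x \<xi>. pdiff b (\<lambda>x. p x \<xi>) x) w x \<xi>) \<eta>
        + (case z of (x, \<xi>) \<Rightarrow> comp_integrand p (\<lambda>x \<xi>. pdiff b (\<lambda>x. w x \<xi>) x) x \<xi>) \<eta>)"
      unfolding 1(2) using pdx[OF 1(1)] by (auto simp: fun_eq_iff)
    then show ?thesis using dominated_add[OF d1(1)[OF 1(1)] d1(2)[OF 1(1)]] by simp
  next
    case (2 b)
    have "(\<lambda>z \<eta>. pdiff c (\<lambda>z. F z \<eta>) z) = (\<lambda>z \<eta>. (case z of (x, \<xi>) \<Rightarrow> comp_integrand (\<lambda>x. pdiff b (p x)) w x \<xi>) \<eta>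
        + (case z of (x, \<xi>) \<Rightarrow> comp_integrand p (\<lambda>x. pdiff b (w x)) x \<xi>) \<eta>)"
      unfolding 2(2) using pdxi[OF 2(1)] by (auto simp: fun_eq_iff)
    then show ?thesis using dominated_add[OF d2(1)[OF 2(1)] d2(2)[OF 2(1)]] by simp
  qed
  define c where "c = complex_of_real (1 / (2 * pi) ^ DIM('a))"
  have I1: "(\<lambda>z. LINT \<eta>|lborel. F z \<eta>) differentiable (at z)" for z
    by (rule dominated_derivative(1)[where D = "\<lambda>b z \<eta>. pdiff b (\<lambda>z. F z \<eta>) z", OF F D Fd refl])
  have I2: "pdiff b (\<lambda>z. LINT \<eta>|lborel. F z \<eta>) z = (LINT \<eta>|lborel. pdiff b (\<lambda>z. F z \<eta>) z)" if "b \<in> Basis" for b z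
    by (rule dominated_derivative(2)[where D = "\<lambda>b z \<eta>. pdiff b (\<lambda>z. F z \<eta>) z", OF F D Fd refl that])
  have eq: "(\<lambda>(x, \<xi>). comp_symbol p w x \<xi>) = (\<lambda>z. c * (LINT \<eta>|lborel. F z \<eta>))"
    by (auto simp: fun_eq_iff comp_symbol_def c_def F_def)
  show "(\<lambda>(x, \<xi>). comp_symbol p w x \<xi>) differentiable (at z)"
    unfolding eq by (intro differentiable_mult differentiable_const I1)
  have int: "integrable lborel (comp_integrand p' w' x \<xi>)" if "dominated (\<lambda>(x, \<xi>). comp_integrand p' w' x \<xi>)" for p' w' x \<xi>
    using dominatedD(4)[OF that, of "(x, \<xi>)"] by simp
  show "pdiff b (\<lambda>x. comp_symbol p w x \<xi>) x =
      comp_symbol (\<lambda>x \<xi>. pdiff b (\<lambda>x. p x \<xi>) x) w x \<xi> + comp_symbol p (\<lambda>x \<xi>. pdiff b (\<lambda>x. w x \<xi>) x) x \<xi>"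
    if b: "b \<in> Basis"
  proof -
    have "pdiff b (\<lambda>x. comp_symbol p w x \<xi>) x = pdiff (b, 0) (\<lambda>z. c * (LINT \<eta>|lborel. F z \<eta>)) (x, \<xi>)"
      unfolding eq[symmetric] by (simp add: pdiff_slice)
    also have "\<dots> = c * (LINT \<eta>|lborel. pdiff (b, 0) (\<lambda>z. F z \<eta>) (x, \<xi>))"
      by (simp only: pdiff_cmult[OF I1] I2[OF Basis_PairI(1)[OF b]])
    also have "\<dots> = comp_symbol (\<lambda>x \<xi>. pdiff b (\<lambda>x. p x \<xi>) x) w x \<xi> + comp_symbol p (\<lambda>x \<xi>. pdiff b (\<lambda>x. w x \<xi>) x) x \<xi>"
      unfolding pdx[OF b] comp_symbol_def c_def[symmetric]
      by (simp only: Bochner_Integration.integral_add[OF int[OF d1(1)[OF b]] int[OF d1(2)[OF b]]] distrib_left)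
    finally show ?thesis .
  qed
  show "pdiff b (comp_symbol p w x) \<xi> =
      comp_symbol (\<lambda>x. pdiff b (p x)) w x \<xi> + comp_symbol p (\<lambda>x. pdiff b (w x)) x \<xi>"
    if b: "b \<in> Basis"
  proof -
    have "pdiff b (comp_symbol p w x) \<xi> = pdiff (0, b) (\<lambda>z. c * (LINT \<eta>|lborel. F z \<eta>)) (x, \<xi>)"
      unfolding eq[symmetric] by (simp add: pdiff_slice)
    also have "\<dots> = c * (LINT \<eta>|lborel. pdiff (0, b) (\<lambda>z. F z \<eta>) (x, \<xi>))"
      by (simp only: pdiff_cmult[OF I1] I2[OF Basis_PairI(2)[OF b]])
    also have "\<dots> = comp_symbol (\<lambda>x. pdiff b (p x)) w x \<xi> + comp_symbol p (\<lambda>x. pdiff b (w x)) x \<xi>"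
      unfolding pdxi[OF b] comp_symbol_def c_def[symmetric]
      by (simp only: Bochner_Integration.integral_add[OF int[OF d2(1)[OF b]] int[OF d2(2)[OF b]]] distrib_left)
    finally show ?thesis .
  qed
qed

text \<open>A bilinear expression satisfying the product rule is a symbol as soon as it is bounded like one,
  since the bound applies to every term produced by the product rule.\<close>

lemma leibniz_lsym:
  fixes \<Phi> :: "('a::euclidean_space \<Rightarrow> 'a \<Rightarrow> complex) \<Rightarrow> ('a \<Rightarrow> 'a \<Rightarrow> complex) \<Rightarrow> 'a \<Rightarrow> 'a \<Rightarrow> complex"
  assumes D: "\<And>p w m m' z. p \<in> lsym UNIV m \<Longrightarrow> csym m' w \<Longrightarrow> (\<lambda>(x, \<xi>). \<Phi> p w x \<xi>) differentiable (at z)"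
    and dx: "\<And>p w m m' b x \<xi>. p \<in> lsym UNIV m \<Longrightarrow> csym m' w \<Longrightarrow> b \<in> Basis \<Longrightarrow>
      pdiff b (\<lambda>x. \<Phi> p w x \<xi>) x = \<Phi> (\<lambda>x \<xi>. pdiff b (\<lambda>x. p x \<xi>) x) w x \<xi> + \<Phi> p (\<lambda>x \<xi>. pdiff b (\<lambda>x. w x \<xi>) x) x \<xi>"
    and dxi: "\<And>p w m m' b x \<xi>. p \<in> lsym UNIV m \<Longrightarrow> csym m' w \<Longrightarrow> b \<in> Basis \<Longrightarrow>
      pdiff b (\<Phi> p w x) \<xi> = \<Phi> (\<lambda>x. pdiff b (p x)) w x \<xi> + \<Phi> p (\<lambda>x. pdiff b (w x)) x \<xi>"
    and bd: "\<And>p w m m' K. p \<in> lsym UNIV m \<Longrightarrow> csym m' w \<Longrightarrow> compact K \<Longrightarrow>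
      \<exists>C. \<forall>x\<in>K. \<forall>\<xi>. cmod (\<Phi> p w x \<xi>) \<le> C * japanese \<xi> powr (m + m' + c)"
    and p: "p \<in> lsym UNIV m" and w: "csym m' w"
  shows "\<Phi> p w \<in> lsym UNIV (m + m' + c)"
proof -
  have "symb k (m + m' + c) UNIV (\<Phi> p w)" for k using p w
  proof (induction k arbitrary: m m' p w)
    case (0 m m' p w)
    have "continuous_on UNIV (\<lambda>(x, \<xi>). \<Phi> p w x \<xi>)"
      by (intro continuous_at_imp_continuous_on ballI differentiable_imp_continuous_within D[OF 0])
    then show ?case by (intro symb_0I) (use bd[OF 0] in auto)
  next
    case (Suc k m m' p w)
    note p = Suc.prems(1) and w = Suc.prems(2)
    show ?case
    proof (rule symb_SucI[OF D[OF p w] bd[OF p w]])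
      fix b :: 'a assume b: "b \<in> Basis"
      show "symb k (m + m' + c) UNIV (\<lambda>x \<xi>. pdiff b (\<lambda>x. \<Phi> p w x \<xi>) x)"
        unfolding dx[OF p w b]
        by (rule symb_add[OF open_UNIV Suc.IH[OF lsym_pdiff_left[OF p b] w] Suc.IH[OF p csym_pdiff_left[OF w b]]])
    next
      fix b :: 'a assume b: "b \<in> Basis"
      have eq: "(\<lambda>x. pdiff b (\<Phi> p w x)) = (\<lambda>x \<xi>. \<Phi> (\<lambda>x. pdiff b (p x)) w x \<xi> + \<Phi> p (\<lambda>x. pdiff b (w x)) x \<xi>)"
        by (intro ext dxi[OF p w b])
      have 1: "symb k (m + m' + c - 1) UNIV (\<Phi> (\<lambda>x. pdiff b (p x)) w)"
        using Suc.IH[OF lsym_pdiff_right[OF p b] w] by (simp add: algebra_simps)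
      have 2: "symb k (m + m' + c - 1) UNIV (\<Phi> p (\<lambda>x. pdiff b (w x)))"
        using Suc.IH[OF p csym_pdiff_right[OF w b]] by (simp add: algebra_simps)
      show "symb k (m + m' + c - 1) UNIV (\<lambda>x. pdiff b (\<Phi> p w x))"
        unfolding eq by (rule symb_add[OF open_UNIV 1 2])
    qed
  qed
  then show ?thesis by (rule lsymI)
qed

lemma norm_integral_japanese_bound:
  fixes G :: "'a::euclidean_space \<Rightarrow> complex"
  assumes "integrable lborel G" "\<And>\<eta>. cmod (G \<eta>) \<le> A * japanese \<eta> powr (- 2 * real DIM('a))"
  shows "cmod (LINT \<eta>|lborel. G \<eta>) \<le> A * (LINT \<eta>|lborel. japanese (\<eta>::'a) powr (- 2 * real DIM('a)))"
proof -
  have "cmod (LINT \<eta>|lborel. G \<eta>) \<le> (LINT \<eta>|lborel. cmod (G \<eta>))" by (rule integral_norm_bound)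
  also have "\<dots> \<le> (LINT \<eta>|lborel. A * japanese (\<eta>::'a) powr (- 2 * real DIM('a)))"
    by (rule Bochner_Integration.integral_mono)
      (use assms in \<open>auto intro: integrable_norm integrable_mult_right integrable_japanese\<close>)
  finally show ?thesis by simp
qed

text \<open>The summand \<open>0\<close> gives the bound the shape expected by
  \<open>leibniz_lsym\<close>, with shift \<open>c = 0\<close>.\<close>

lemma comp_symbol_bound:
  fixes p w :: "'a::euclidean_space \<Rightarrow> 'a \<Rightarrow> complex"
  assumes p: "p \<in> lsym UNIV m" and w: "csym m' w" and K: "compact K"
  shows "\<exists>C. \<forall>x\<in>K. \<forall>\<xi>. cmod (comp_symbol p w x \<xi>) \<le> C * japanese \<xi> powr (m + m' + 0)"
proof -
  obtain C where C: "C \<ge> 0" "\<And>x \<xi> \<eta>. x \<in> K \<Longrightarrow>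
    cmod (comp_integrand p w x \<xi> \<eta>) \<le> C * japanese \<xi> powr (m + m') * japanese \<eta> powr (- 2 * real DIM('a))"
    using comp_integrand_bound[OF p w K] by blast
  define J where "J = (LINT \<eta>|lborel. japanese (\<eta>::'a) powr (- 2 * real DIM('a)))"
  define c where "c = 1 / (2 * pi) ^ DIM('a)"
  have "cmod (comp_symbol p w x \<xi>) \<le> (c * C * J) * japanese \<xi> powr (m + m' + 0)" if x: "x \<in> K" for x \<xi>
  proof -
    have i: "integrable lborel (comp_integrand p w x \<xi>)"
      using dominatedD(4)[OF comp_integrand_dominated[OF p w], of "(x, \<xi>)"] by simp
    have "cmod (comp_symbol p w x \<xi>) = c * cmod (LINT \<eta>|lborel. comp_integrand p w x \<xi> \<eta>)"
      unfolding comp_symbol_def c_def by (simp add: norm_mult norm_divide norm_power)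
    also have "\<dots> \<le> c * ((C * japanese \<xi> powr (m + m')) * J)"
      unfolding J_def by (intro mult_left_mono norm_integral_japanese_bound i C(2) x) (simp add: c_def)
    finally show ?thesis by (simp add: mult_ac)
  qed
  then show ?thesis by blast
qed

lemma comp_symbol_lsym:
  assumes "p \<in> lsym UNIV m" "csym m' w"
  shows "comp_symbol p w \<in> lsym UNIV (m + m')"
  using leibniz_lsym[where \<Phi> = comp_symbol and c = 0, OF comp_symbol_pdiff comp_symbol_bound assms] by simp

text \<open>By Fourier inversion \<open>comp_term k\<close> is what the Taylor term of degree \<open>k\<close> of \<open>p x (\<xi> + \<eta>)\<close> in \<open>\<eta>\<close>
  contributes to \<open>comp_symbol\<close>; Peetre's inequality and the decay of the Fourier transform of \<open>w\<close> control
  the rest.\<close>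

definition comp_term :: "nat \<Rightarrow> ('a::euclidean_space \<Rightarrow> 'a \<Rightarrow> complex) \<Rightarrow> ('a \<Rightarrow> 'a \<Rightarrow> complex) \<Rightarrow> 'a \<Rightarrow> 'a \<Rightarrow> complex" where
  "comp_term k p w x \<xi> = (- \<i>) ^ k / fact k * (\<Sum>l\<in>words k. ider l (p x) \<xi> * ider l (\<lambda>x. w x \<xi>) x)"

definition comp_remainder :: "nat \<Rightarrow> ('a::euclidean_space \<Rightarrow> 'a \<Rightarrow> complex) \<Rightarrow> ('a \<Rightarrow> 'a \<Rightarrow> complex) \<Rightarrow> 'a \<Rightarrow> 'a \<Rightarrow> complex" where
  "comp_remainder N p w x \<xi> = comp_symbol p w x \<xi> - (\<Sum>k<N. comp_term k p w x \<xi>)"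

text \<open>A further derivative commutes with those along \<open>l\<close> and meets just a product
  of two factors; since all words of length \<open>k\<close> carry the same weight, the coefficients
  are unchanged.\<close>

lemma comp_term_pdiff:
  fixes p w :: "'a::euclidean_space \<Rightarrow> 'a \<Rightarrow> complex"
  assumes p: "p \<in> lsym UNIV m" and w: "w \<in> lsym UNIV m'"
  shows "(\<lambda>(x, \<xi>). comp_term k p w x \<xi>) differentiable (at z)"
    and "b \<in> Basis \<Longrightarrow> pdiff b (\<lambda>x. comp_term k p w x \<xi>) x =
      comp_term k (\<lambda>x \<xi>. pdiff b (\<lambda>x. p x \<xi>) x) w x \<xi> + comp_term k p (\<lambda>x \<xi>. pdiff b (\<lambda>x. w x \<xi>) x) x \<xi>"
    and "b \<in> Basis \<Longrightarrow> pdiff b (comp_term k p w x) \<xi> =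
      comp_term k (\<lambda>x. pdiff b (p x)) w x \<xi> + comp_term k p (\<lambda>x. pdiff b (w x)) x \<xi>"
proof -
  note P = lsym_ider_right[OF p wordsD(1)] and Wl = lsym_ider_left[OF w wordsD(1)]
  note sP = lsym_smooth_UNIV[OF P] and sW = lsym_smooth_UNIV[OF Wl]
  note dP = smooth_on_differentiable[OF open_UNIV sP UNIV_I] and dW = smooth_on_differentiable[OF open_UNIV sW UNIV_I]
  note dP' = differentiable_slice[OF dP] and dW' = differentiable_slice[OF dW]
  have d: "(\<lambda>(x, \<xi>). \<Sum>l\<in>words k. ider l (p x) \<xi> * ider l (\<lambda>x. w x \<xi>) x) differentiable (at z)" for z
    unfolding split_def
    by (intro differentiable_sum ballI finite_words)
      (intro differentiable_mult dP[unfolded split_def] dW[unfolded split_def])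
  show "(\<lambda>(x, \<xi>). comp_term k p w x \<xi>) differentiable (at z)"
    unfolding comp_term_def split_def by (intro differentiable_mult differentiable_const d[unfolded split_def])
  show "pdiff b (\<lambda>x. comp_term k p w x \<xi>) x =
      comp_term k (\<lambda>x \<xi>. pdiff b (\<lambda>x. p x \<xi>) x) w x \<xi> + comp_term k p (\<lambda>x \<xi>. pdiff b (\<lambda>x. w x \<xi>) x) x \<xi>"
    if b: "b \<in> Basis"
  proof -
    have "pdiff b (\<lambda>x. comp_term k p w x \<xi>) x = (- \<i>) ^ k / fact k * pdiff b (\<lambda>x. \<Sum>l\<in>words k. ider l (p x) \<xi> * ider l (\<lambda>x. w x \<xi>) x) x"
      unfolding comp_term_def by (rule pdiff_cmult[OF differentiable_slice(1)[OF d]])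
    also have "pdiff b (\<lambda>x. \<Sum>l\<in>words k. ider l (p x) \<xi> * ider l (\<lambda>x. w x \<xi>) x) x =
      (\<Sum>l\<in>words k. pdiff b (\<lambda>x. ider l (p x) \<xi> * ider l (\<lambda>x. w x \<xi>) x) x)"
      by (rule pdiff_sum) (rule differentiable_mult[OF dP'(1) dW'(1)])
    also have "\<dots> = (\<Sum>l\<in>words k. ider l (\<lambda>\<xi>. pdiff b (\<lambda>x. p x \<xi>) x) \<xi> * ider l (\<lambda>x. w x \<xi>) x
        + ider l (p x) \<xi> * ider l (\<lambda>x. pdiff b (\<lambda>x. w x \<xi>) x) x)"
    proof (rule sum.cong[OF refl])
      fix l :: "'a list" assume l: "l \<in> words k"
      have 1: "pdiff b (\<lambda>x. ider l (p x) \<xi>) x = ider l (\<lambda>\<xi>. pdiff b (\<lambda>x. p x \<xi>) x) \<xi>"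
        by (rule pdiff_ider_right_left[OF open_UNIV lsym_smooth_UNIV[OF p] wordsD(1)[OF l] b UNIV_I])
      have 2: "pdiff b (ider l (\<lambda>x. w x \<xi>)) x = ider l (\<lambda>x. pdiff b (\<lambda>x. w x \<xi>) x) x"
        by (rule ider_move[OF open_UNIV smooth_on_slice(2)[OF lsym_smooth_UNIV[OF w]] wordsD(1)[OF l] b UNIV_I, symmetric])
      show "pdiff b (\<lambda>x. ider l (p x) \<xi> * ider l (\<lambda>x. w x \<xi>) x) x = ider l (\<lambda>\<xi>. pdiff b (\<lambda>x. p x \<xi>) x) \<xi> * ider l (\<lambda>x. w x \<xi>) x
        + ider l (p x) \<xi> * ider l (\<lambda>x. pdiff b (\<lambda>x. w x \<xi>) x) x"
        by (simp only: pdiff_mult[OF dP'(1)[OF l] dW'(1)[OF l]] 1 2 add.commute)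
    qed
    finally show ?thesis by (simp add: comp_term_def sum.distrib distrib_left)
  qed
  show "pdiff b (comp_term k p w x) \<xi> =
      comp_term k (\<lambda>x. pdiff b (p x)) w x \<xi> + comp_term k p (\<lambda>x. pdiff b (w x)) x \<xi>"
    if b: "b \<in> Basis"
  proof -
    have "pdiff b (comp_term k p w x) \<xi> = (- \<i>) ^ k / fact k * pdiff b (\<lambda>\<xi>. \<Sum>l\<in>words k. ider l (p x) \<xi> * ider l (\<lambda>x. w x \<xi>) x) \<xi>"
      unfolding comp_term_def[abs_def] by (rule pdiff_cmult[OF differentiable_slice(2)[OF d]])
    also have "pdiff b (\<lambda>\<xi>. \<Sum>l\<in>words k. ider l (p x) \<xi> * ider l (\<lambda>x. w x \<xi>) x) \<xi> =
      (\<Sum>l\<in>words k. pdiff b (\<lambda>\<xi>. ider l (p x) \<xi> * ider l (\<lambda>x. w x \<xi>) x) \<xi>)"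
      by (rule pdiff_sum) (rule differentiable_mult[OF dP'(2) dW'(2)])
    also have "\<dots> = (\<Sum>l\<in>words k. ider l (pdiff b (p x)) \<xi> * ider l (\<lambda>x. w x \<xi>) x
        + ider l (p x) \<xi> * ider l (\<lambda>x. pdiff b (w x) \<xi>) x)"
    proof (rule sum.cong[OF refl])
      fix l :: "'a list" assume l: "l \<in> words k"
      have 1: "pdiff b (ider l (p x)) \<xi> = ider l (pdiff b (p x)) \<xi>"
        by (rule ider_move[OF open_UNIV smooth_on_slice(1)[OF lsym_smooth_UNIV[OF p]] wordsD(1)[OF l] b UNIV_I, symmetric])
      have 2: "pdiff b (\<lambda>\<xi>. ider l (\<lambda>x. w x \<xi>) x) \<xi> = ider l (\<lambda>x. pdiff b (w x) \<xi>) x"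
        by (rule pdiff_ider_left_right[OF open_UNIV lsym_smooth_UNIV[OF w] wordsD(1)[OF l] b UNIV_I])
      show "pdiff b (\<lambda>\<xi>. ider l (p x) \<xi> * ider l (\<lambda>x. w x \<xi>) x) \<xi> = ider l (pdiff b (p x)) \<xi> * ider l (\<lambda>x. w x \<xi>) x
        + ider l (p x) \<xi> * ider l (\<lambda>x. pdiff b (w x) \<xi>) x"
        by (simp only: pdiff_mult[OF dP'(2)[OF l] dW'(2)[OF l]] 1 2 add.commute)
    qed
    finally show ?thesis by (simp add: comp_term_def[abs_def] sum.distrib distrib_left)
  qed
qed

lemma comp_remainder_pdiff:
  fixes p w :: "'a::euclidean_space \<Rightarrow> 'a \<Rightarrow> complex"
  assumes p: "p \<in> lsym UNIV m" and w: "csym m' w"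
  shows "(\<lambda>(x, \<xi>). comp_remainder N p w x \<xi>) differentiable (at z)"
    and "b \<in> Basis \<Longrightarrow> pdiff b (\<lambda>x. comp_remainder N p w x \<xi>) x =
      comp_remainder N (\<lambda>x \<xi>. pdiff b (\<lambda>x. p x \<xi>) x) w x \<xi> + comp_remainder N p (\<lambda>x \<xi>. pdiff b (\<lambda>x. w x \<xi>) x) x \<xi>"
    and "b \<in> Basis \<Longrightarrow> pdiff b (comp_remainder N p w x) \<xi> =
      comp_remainder N (\<lambda>x. pdiff b (p x)) w x \<xi> + comp_remainder N p (\<lambda>x. pdiff b (w x)) x \<xi>"
proof -
  note T = comp_term_pdiff[OF p csym_lsym[OF w]] and S = comp_symbol_pdiff[OF p w]
  have dT: "(\<lambda>(x, \<xi>). \<Sum>k<N. comp_term k p w x \<xi>) differentiable (at z)" for z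
    unfolding split_def by (intro differentiable_sum ballI finite_lessThan T(1)[unfolded split_def])
  show "(\<lambda>(x, \<xi>). comp_remainder N p w x \<xi>) differentiable (at z)"
    unfolding comp_remainder_def split_def
    by (intro differentiable_diff S(1)[unfolded split_def] dT[unfolded split_def])
  show "pdiff b (\<lambda>x. comp_remainder N p w x \<xi>) x =
      comp_remainder N (\<lambda>x \<xi>. pdiff b (\<lambda>x. p x \<xi>) x) w x \<xi> + comp_remainder N p (\<lambda>x \<xi>. pdiff b (\<lambda>x. w x \<xi>) x) x \<xi>"
    if b: "b \<in> Basis"
  proof -
    have "pdiff b (\<lambda>x. comp_remainder N p w x \<xi>) x = pdiff b (\<lambda>x. comp_symbol p w x \<xi>) x - (\<Sum>k<N. pdiff b (\<lambda>x. comp_term k p w x \<xi>) x)"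
      unfolding comp_remainder_def
      by (simp only: pdiff_diff[OF differentiable_slice(1)[OF S(1)] differentiable_slice(1)[OF dT]]
          pdiff_sum[OF differentiable_slice(1)[OF T(1)]])
    then show ?thesis unfolding S(2)[OF b] T(2)[OF b] by (simp add: comp_remainder_def sum.distrib)
  qed
  show "pdiff b (comp_remainder N p w x) \<xi> =
      comp_remainder N (\<lambda>x. pdiff b (p x)) w x \<xi> + comp_remainder N p (\<lambda>x. pdiff b (w x)) x \<xi>"
    if b: "b \<in> Basis"
  proof -
    have "pdiff b (comp_remainder N p w x) \<xi> = pdiff b (comp_symbol p w x) \<xi> - (\<Sum>k<N. pdiff b (comp_term k p w x) \<xi>)"
      unfolding comp_remainder_def[abs_def]
      by (simp only: pdiff_diff[OF differentiable_slice(2)[OF S(1)] differentiable_slice(2)[OF dT]]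
          pdiff_sum[OF differentiable_slice(2)[OF T(1)]])
    then show ?thesis unfolding S(3)[OF b] T(3)[OF b] by (simp add: comp_remainder_def sum.distrib)
  qed
qed

lemma norm_prod_inner_le:
  assumes "l \<in> words k"
  shows "\<bar>\<Prod>b\<leftarrow>l. \<eta> \<bullet> b\<bar> \<le> norm \<eta> ^ k"
proof -
  have "\<bar>\<Prod>b\<leftarrow>l. \<eta> \<bullet> b\<bar> \<le> norm \<eta> ^ length l" if "set l \<subseteq> Basis"
    using that by (induction l) (auto simp: abs_mult intro!: mult_mono Basis_le_norm)
  then show ?thesis using assms by (simp add: words_def)
qed

text \<open>Taylor's formula with integral remainder in the variable \<open>t\<close>, along the
  segment from \<open>\<xi>\<close> to \<open>\<xi> + \<eta>\<close>. Each differentiation in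
  \<open>t\<close> prefixes one letter to the words, by \<open>sum_words_Suc\<close>, and the number
  of words of length \<open>N\<close> supplies the constant.\<close>

lemma multivariate_taylor_bound:
  fixes f :: "'a::euclidean_space \<Rightarrow> complex"
  assumes f: "smooth_on UNIV f" and N: "N > 0"
    and B: "\<And>t l. 0 \<le> t \<Longrightarrow> t \<le> 1 \<Longrightarrow> l \<in> words N \<Longrightarrow> cmod (ider l f (\<xi> + t *\<^sub>R \<eta>)) \<le> B"
  shows "cmod (f (\<xi> + \<eta>) - (\<Sum>k<N. (1 / fact k) * (\<Sum>l\<in>words k. complex_of_real (\<Prod>b\<leftarrow>l. \<eta> \<bullet> b) * ider l f \<xi>)))
    \<le> real DIM('a) ^ N * (norm \<eta> ^ N * B)"
proof -
  define Df where "Df k t = (\<Sum>l\<in>words k. complex_of_real (\<Prod>b\<leftarrow>l. \<eta> \<bullet> b) * ider l f (\<xi> + t *\<^sub>R \<eta>))" for k and t :: real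
  have vd: "((\<lambda>t. ider l f (\<xi> + t *\<^sub>R \<eta>)) has_vector_derivative (\<Sum>b\<in>Basis. complex_of_real (\<eta> \<bullet> b) * ider (b # l) f (\<xi> + t *\<^sub>R \<eta>))) (at t)"
    if "l \<in> words k" for l k t
  proof -
    have d: "ider l f differentiable (at (\<xi> + t *\<^sub>R \<eta>))"
      using wordsD(1)[OF that] by (intro smooth_on_differentiable[OF open_UNIV smooth_on_ider[OF open_UNIV f]] UNIV_I)
    have e: "((\<lambda>t. \<xi> + t *\<^sub>R \<eta>) has_derivative (\<lambda>h. h *\<^sub>R \<eta>)) (at t)" by (auto intro!: derivative_eq_intros)
    have "((\<lambda>t. ider l f (\<xi> + t *\<^sub>R \<eta>)) has_derivative (\<lambda>h. \<Sum>b\<in>Basis. ((h *\<^sub>R \<eta>) \<bullet> b) *\<^sub>R pdiff b (ider l f) (\<xi> + t *\<^sub>R \<eta>))) (at t)"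
      by (rule has_derivative_compose[OF e has_derivative_pdiff[OF d]])
    then show ?thesis
      unfolding has_vector_derivative_def
      by (simp add: scaleR_conv_of_real mult.assoc sum_distrib_left)
  qed
  have Dfd: "(Df k has_vector_derivative Df (Suc k) t) (at t within {0..1})" for k t
  proof -
    have "(Df k has_vector_derivative (\<Sum>l\<in>words k. complex_of_real (\<Prod>b\<leftarrow>l. \<eta> \<bullet> b) * (\<Sum>b\<in>Basis. complex_of_real (\<eta> \<bullet> b) * ider (b # l) f (\<xi> + t *\<^sub>R \<eta>)))) (at t)"
      unfolding Df_def by (intro has_vector_derivative_sum has_vector_derivative_mult_right vd)
    also have "(\<Sum>l\<in>words k. complex_of_real (\<Prod>b\<leftarrow>l. \<eta> \<bullet> b) * (\<Sum>b\<in>Basis. complex_of_real (\<eta> \<bullet> b) * ider (b # l) f (\<xi> + t *\<^sub>R \<eta>))) = Df (Suc k) t"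
      unfolding Df_def sum_words_Suc by (simp add: sum_distrib_left mult_ac)
    finally show ?thesis by (rule has_vector_derivative_at_within)
  qed
  have Df0: "Df 0 = (\<lambda>t. f (\<xi> + t *\<^sub>R \<eta>))" unfolding Df_def words_0 by simp
  have hi: "((\<lambda>x. ((1 - x) ^ (N - 1) / fact (N - 1)) *\<^sub>R Df N x) has_integral
      f (\<xi> + 1 *\<^sub>R \<eta>) - (\<Sum>i<N. ((1 - 0) ^ i / fact i) *\<^sub>R Df i 0)) {0..1::real}"
    by (rule Taylor_has_integral[where f = "\<lambda>t. f (\<xi> + t *\<^sub>R \<eta>)" and Df = Df]) (use N Df0 Dfd in auto)
  have bnd: "cmod (((1 - t) ^ (N - 1) / fact (N - 1)) *\<^sub>R Df N t) \<le> real DIM('a) ^ N * (norm \<eta> ^ N * B)"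
    if t: "t \<in> {0..1}" for t
  proof -
    have "cmod (Df N t) \<le> (\<Sum>l\<in>(words N :: 'a list set). norm \<eta> ^ N * B)"
      unfolding Df_def
    proof (rule sum_norm_le)
      fix l :: "'a list" assume l: "l \<in> words N"
      show "cmod (complex_of_real (\<Prod>b\<leftarrow>l. \<eta> \<bullet> b) * ider l f (\<xi> + t *\<^sub>R \<eta>)) \<le> norm \<eta> ^ N * B"
        unfolding norm_mult norm_of_real
        by (intro mult_mono norm_prod_inner_le[OF l] B l) (use t in auto)
    qed
    also have "\<dots> = real DIM('a) ^ N * (norm \<eta> ^ N * B)" by (simp add: card_words)
    finally have 1: "cmod (Df N t) \<le> real DIM('a) ^ N * (norm \<eta> ^ N * B)" .
    have "\<bar>(1 - t) ^ (N - 1) / fact (N - 1)\<bar> \<le> 1"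
    proof -
      have "(1 - t) ^ (N - 1) \<le> 1" using t by (intro power_le_one) auto
      moreover have "(1::real) \<le> fact (N - 1)" by (rule fact_ge_1)
      ultimately have "(1 - t) ^ (N - 1) \<le> fact (N - 1)" by (rule order_trans)
      then show ?thesis using t by (simp add: abs_divide divide_le_eq)
    qed
    then have "cmod (((1 - t) ^ (N - 1) / fact (N - 1)) *\<^sub>R Df N t) \<le> 1 * cmod (Df N t)"
      unfolding norm_scaleR by (rule mult_right_mono) simp
    then show ?thesis using 1 by simp
  qed
  \<comment> \<open>The sign of \<open>B\<close> is not among the assumptions; nonnegativity of the
    bound is read off at \<open>t = 0\<close>.\<close>
  have "0 \<le> real DIM('a) ^ N * (norm \<eta> ^ N * B)" using bnd[of 0] by (rule order_trans[OF norm_ge_zero]) simp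
  from has_integral_bound_real[OF this finite.emptyI hi] bnd
  have "cmod (f (\<xi> + 1 *\<^sub>R \<eta>) - (\<Sum>i<N. ((1 - 0) ^ i / fact i) *\<^sub>R Df i 0)) \<le> real DIM('a) ^ N * (norm \<eta> ^ N * B)"
    by simp
  moreover have "((1 - 0) ^ i / fact i) *\<^sub>R Df i 0 = (1 / fact i) * (\<Sum>l\<in>words i. complex_of_real (\<Prod>b\<leftarrow>l. \<eta> \<bullet> b) * ider l f \<xi>)" for i
    unfolding Df_def by (simp add: scaleR_conv_of_real)
  ultimately show ?thesis by simp
qed

lemma comp_remainder_bound:
  fixes p w :: "'a::euclidean_space \<Rightarrow> 'a \<Rightarrow> complex"
  assumes p: "p \<in> lsym UNIV m" and w: "csym m' w" and K: "compact K"
  shows "\<exists>C. \<forall>x\<in>K. \<forall>\<xi>. cmod (comp_remainder N p w x \<xi>) \<le> C * japanese \<xi> powr (m + m' + (- real N))"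
proof (cases "N = 0")
  case True
  then show ?thesis using comp_symbol_bound[OF p w K] by (simp add: comp_remainder_def)
next
  case False
  then have N: "N > 0" by simp
  define n where "n = real DIM('a)"
  \<comment> \<open>The order of the derivatives of \<open>p\<close> along words of length
    \<open>N\<close>: the gain in the remainder comes from here.\<close>
  define s where "s = m - real N"
  have "\<exists>A. \<forall>x\<in>K. \<forall>\<xi>. cmod (ider l (p x) \<xi>) \<le> A * japanese \<xi> powr s" if "l \<in> words N" for l
    using lsym_bound[OF lsym_ider_right[OF p wordsD(1)[OF that]] K subset_UNIV] wordsD(2)[OF that] by (simp add: s_def)
  then obtain A where A: "\<And>l x \<xi>. l \<in> words N \<Longrightarrow> x \<in> K \<Longrightarrow> cmod (ider l (p x) \<xi>) \<le> A l * japanese \<xi> powr s" by metis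
  define T where "T = (\<Sum>l\<in>words N. \<bar>A l\<bar>)"
  have T0: "T \<ge> 0" by (simp add: T_def sum_nonneg)
  have T: "cmod (ider l (p x) \<xi>) \<le> T * japanese \<xi> powr s" if "l \<in> words N" "x \<in> K" for l x \<xi>
  proof -
    have "A l \<le> T" unfolding T_def by (rule order_trans[OF abs_ge_self member_le_sum[OF that(1) _ finite_words]]) simp
    then show ?thesis using A[OF that, of \<xi>] by (meson japanese_pos mult_right_mono order_trans powr_ge_zero)
  qed
  define E where "E x \<xi> \<eta> = p x (\<xi> + \<eta>) - (\<Sum>k<N. (1 / fact k) * (\<Sum>l\<in>words k. complex_of_real (\<Prod>b\<leftarrow>l. \<eta> \<bullet> b) * ider l (p x) \<xi>))" for x \<xi> \<eta>
  define A' where "A' = n ^ N * (T * 2 powr \<bar>s\<bar>)"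
  have A'0: "A' \<ge> 0" using T0 by (simp add: A'_def n_def)
  have Eb: "cmod (E x \<xi> \<eta>) \<le> A' * japanese \<xi> powr s * japanese \<eta> powr (real N + \<bar>s\<bar>)" if x: "x \<in> K" for x \<xi> \<eta>
  proof -
    \<comment> \<open>Peetre's inequality at the intermediate points: the bound with
      \<open>t *\<^sub>R \<eta>\<close> is weakened to one with \<open>\<eta>\<close>, uniformly
      along the segment.\<close>
    have "cmod (ider l (p x) (\<xi> + t *\<^sub>R \<eta>)) \<le> T * (2 powr \<bar>s\<bar> * japanese \<xi> powr s * japanese \<eta> powr \<bar>s\<bar>)"
      if "0 \<le> t" "t \<le> 1" "l \<in> words N" for t l
    proof -
      have "norm (t *\<^sub>R \<eta>) \<le> norm \<eta>" using that by (simp add: mult_left_le_one_le)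
      then have "japanese (t *\<^sub>R \<eta>) \<le> japanese \<eta>" by (simp add: japanese_def)
      then have j: "japanese (t *\<^sub>R \<eta>) powr \<bar>s\<bar> \<le> japanese \<eta> powr \<bar>s\<bar>" by (intro powr_mono2) auto
      have "cmod (ider l (p x) (\<xi> + t *\<^sub>R \<eta>)) \<le> T * japanese (\<xi> + t *\<^sub>R \<eta>) powr s" by (rule T[OF that(3) x])
      also have "\<dots> \<le> T * (2 powr \<bar>s\<bar> * japanese \<xi> powr s * japanese (t *\<^sub>R \<eta>) powr \<bar>s\<bar>)"
        by (intro mult_left_mono japanese_powr_add_le T0)
      also have "\<dots> \<le> T * (2 powr \<bar>s\<bar> * japanese \<xi> powr s * japanese \<eta> powr \<bar>s\<bar>)"
        by (intro mult_left_mono j T0) simp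
      finally show ?thesis .
    qed
    then have "cmod (E x \<xi> \<eta>) \<le> n ^ N * (norm \<eta> ^ N * (T * (2 powr \<bar>s\<bar> * japanese \<xi> powr s * japanese \<eta> powr \<bar>s\<bar>)))"
      unfolding E_def n_def
      by (rule multivariate_taylor_bound[OF smooth_on_slice(1)[OF lsym_smooth_UNIV[OF p]] N])
    also have "\<dots> \<le> n ^ N * (japanese \<eta> powr real N * (T * (2 powr \<bar>s\<bar> * japanese \<xi> powr s * japanese \<eta> powr \<bar>s\<bar>)))"
    proof (intro mult_left_mono mult_right_mono)
      have "norm \<eta> ^ N \<le> japanese \<eta> ^ N" by (intro power_mono norm_le_japanese) simp
      then show "norm \<eta> ^ N \<le> japanese \<eta> powr real N" by (simp add: powr_realpow)
    qed (use T0 in \<open>auto simp: n_def\<close>)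
    finally show ?thesis by (simp add: A'_def powr_add mult_ac)
  qed
  \<comment> \<open>The extra decay compensates the factor \<open>norm \<eta> ^ N\<close> of the
    Taylor remainder and the \<open>\<bar>s\<bar>\<close> from Peetre's inequality;
    \<open>- 2 * n\<close> is left for integrability.\<close>
  obtain B where B: "B \<ge> 0" "\<And>\<xi> \<eta>. cmod (ft (\<lambda>y. w y \<xi>) \<eta>) \<le> B * japanese \<xi> powr m' * japanese \<eta> powr (- 2 * n - (real N + \<bar>s\<bar>))"
    using csym_ft_decay[OF w] by blast
  define c where "c = complex_of_real (1 / (2 * pi) ^ DIM('a))"
  define J where "J = (LINT \<eta>|lborel. japanese (\<eta>::'a) powr (- 2 * n))"
  have "cmod (comp_remainder N p w x \<xi>) \<le> (cmod c * A' * B * J) * japanese \<xi> powr (m + m' + (- real N))"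
    if x: "x \<in> K" for x \<xi>
  proof -
    define f where "f = (\<lambda>y. w y \<xi>)"
    have f: "f \<in> test_functions" unfolding f_def by (rule csym_test[OF w])
    \<comment> \<open>A Taylor term in two guises. As a multiple of the transform of
      \<open>ider l f\<close> it is integrated by Fourier inversion, in \<open>Gint\<close>; as a
      monomial in \<open>\<eta>\<close> times \<open>ft f\<close> it is subtracted under the
      integral sign, in \<open>Geq\<close>.\<close>
    define G where "G k l \<eta> = (1 / fact k * ider l (p x) \<xi> * (- \<i>) ^ k) * (cis (x \<bullet> \<eta>) * ft (ider l f) \<eta>)" for k and l :: "'a list" and \<eta>
    have cont: "continuous_on UNIV (\<lambda>\<eta>. cis (x \<bullet> \<eta>))" by (intro continuous_on_cis continuous_intros)
    have ci: "integrable lborel (\<lambda>\<eta>. cis (x \<bullet> \<eta>) * ft g \<eta>)" if g: "g \<in> test_functions" for g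
    proof (rule Bochner_Integration.integrable_bound[OF integrable_ft_test(1)[OF g]])
      show "(\<lambda>\<eta>. cis (x \<bullet> \<eta>) * ft g \<eta>) \<in> borel_measurable lborel"
        using borel_measurable_continuous_onI[OF continuous_on_mult[OF cont integrable_ft_test(3)[OF g]]] by simp
    qed (simp add: norm_mult)
    have tl: "ider l f \<in> test_functions" if "l \<in> words k" for l k
      by (rule test_functions_ider[OF f wordsD(1)[OF that]])
    have Gi: "integrable lborel (G k l)" if "l \<in> words k" for k l
      unfolding G_def by (intro integrable_mult_right ci tl[OF that])
    have Gint: "c * (LINT \<eta>|lborel. G k l \<eta>) = (- \<i>) ^ k / fact k * (ider l (p x) \<xi> * ider l f x)" if l: "l \<in> words k" for k l
    proof -
      have "(LINT \<eta>|lborel. G k l \<eta>) = (1 / fact k * ider l (p x) \<xi> * (- \<i>) ^ k) * (complex_of_real ((2 * pi) ^ DIM('a)) * ider l f x)"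
        unfolding G_def by (subst integral_mult_right_zero) (simp only: fourier_inversion[OF tl[OF l] integrable_ft_test(1)[OF tl[OF l]]])
      then show ?thesis by (simp add: c_def)
    qed
    have Geq: "G k l \<eta> = cis (x \<bullet> \<eta>) * ((1 / fact k) * (complex_of_real (\<Prod>b\<leftarrow>l. \<eta> \<bullet> b) * ider l (p x) \<xi>)) * ft f \<eta>"
      if l: "l \<in> words k" for k l \<eta>
    proof -
      have "(- \<i>) ^ k * \<i> ^ k = 1" by (simp flip: power_mult_distrib)
      then have "(- \<i>) ^ k * ft (ider l f) \<eta> = complex_of_real (\<Prod>b\<leftarrow>l. \<eta> \<bullet> b) * ft f \<eta>"
        unfolding ft_ider[OF f wordsD(1)[OF l]] wordsD(2)[OF l] mult.assoc[symmetric] by simp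
      moreover have "G k l \<eta> = (1 / fact k * ider l (p x) \<xi> * cis (x \<bullet> \<eta>)) * ((- \<i>) ^ k * ft (ider l f) \<eta>)"
        by (simp add: G_def mult_ac)
      ultimately show ?thesis by (simp add: mult_ac)
    qed
    have i0: "integrable lborel (comp_integrand p w x \<xi>)"
      using dominatedD(4)[OF comp_integrand_dominated[OF p w], of "(x, \<xi>)"] by simp
    have iS: "integrable lborel (\<lambda>\<eta>. \<Sum>k<N. \<Sum>l\<in>words k. G k l \<eta>)"
      by (intro Bochner_Integration.integrable_sum Gi)
    have "(\<Sum>k<N. comp_term k p w x \<xi>) = c * (LINT \<eta>|lborel. (\<Sum>k<N. \<Sum>l\<in>words k. G k l \<eta>))"
      by (simp add: Bochner_Integration.integral_sum Gi Bochner_Integration.integrable_sum sum_distrib_left Gint comp_term_def f_def)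
    then have "comp_remainder N p w x \<xi> = c * (LINT \<eta>|lborel. comp_integrand p w x \<xi> \<eta> - (\<Sum>k<N. \<Sum>l\<in>words k. G k l \<eta>))"
      unfolding comp_remainder_def comp_symbol_def c_def[symmetric] Bochner_Integration.integral_diff[OF i0 iS] right_diff_distrib
      by simp
    moreover have "comp_integrand p w x \<xi> \<eta> - (\<Sum>k<N. \<Sum>l\<in>words k. G k l \<eta>) = cis (x \<bullet> \<eta>) * E x \<xi> \<eta> * ft f \<eta>" for \<eta>
    proof -
      have "(\<Sum>k<N. \<Sum>l\<in>words k. G k l \<eta>) =
        (\<Sum>k<N. \<Sum>l\<in>words k. cis (x \<bullet> \<eta>) * ((1 / fact k) * (complex_of_real (\<Prod>b\<leftarrow>l. \<eta> \<bullet> b) * ider l (p x) \<xi>)) * ft f \<eta>)"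
        by (intro sum.cong refl Geq)
      also have "\<dots> = cis (x \<bullet> \<eta>) * (\<Sum>k<N. (1 / fact k) * (\<Sum>l\<in>words k. complex_of_real (\<Prod>b\<leftarrow>l. \<eta> \<bullet> b) * ider l (p x) \<xi>)) * ft f \<eta>"
        by (simp only: sum_distrib_left sum_distrib_right)
      finally show ?thesis by (simp add: comp_integrand_def E_def f_def left_diff_distrib right_diff_distrib)
    qed
    ultimately have eq: "comp_remainder N p w x \<xi> = c * (LINT \<eta>|lborel. cis (x \<bullet> \<eta>) * E x \<xi> \<eta> * ft f \<eta>)"
      and iE: "integrable lborel (\<lambda>\<eta>. cis (x \<bullet> \<eta>) * E x \<xi> \<eta> * ft f \<eta>)"
      using Bochner_Integration.integrable_diff[OF i0 iS] by simp_all
    have "cmod (cis (x \<bullet> \<eta>) * E x \<xi> \<eta> * ft f \<eta>) \<le> (A' * B * japanese \<xi> powr (m + m' + (- real N))) * japanese \<eta> powr (- 2 * real DIM('a))" for \<eta>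
    proof -
      have "cmod (cis (x \<bullet> \<eta>) * E x \<xi> \<eta> * ft f \<eta>) = cmod (E x \<xi> \<eta>) * cmod (ft f \<eta>)" by (simp add: norm_mult)
      also have "\<dots> \<le> (A' * japanese \<xi> powr s * japanese \<eta> powr (real N + \<bar>s\<bar>)) *
          (B * japanese \<xi> powr m' * japanese \<eta> powr (- 2 * n - (real N + \<bar>s\<bar>)))"
        unfolding f_def by (rule mult_mono[OF Eb[OF x] B(2) order_trans[OF norm_ge_zero Eb[OF x]] norm_ge_zero])
      also have "\<dots> = (A' * B) * (japanese \<xi> powr s * japanese \<xi> powr m') *
          (japanese \<eta> powr (real N + \<bar>s\<bar>) * japanese \<eta> powr (- 2 * n - (real N + \<bar>s\<bar>)))"
        by (simp only: mult_ac)
      also have "\<dots> = (A' * B * japanese \<xi> powr (m + m' + (- real N))) * japanese \<eta> powr (- 2 * real DIM('a))"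
        unfolding powr_add[symmetric] by (simp add: s_def n_def algebra_simps)
      finally show ?thesis .
    qed
    from norm_integral_japanese_bound[OF iE this]
    have "cmod (comp_remainder N p w x \<xi>) \<le> cmod c * ((A' * B * japanese \<xi> powr (m + m' + (- real N))) * J)"
      unfolding eq norm_mult J_def n_def by (rule mult_left_mono) simp
    then show ?thesis by (simp only: mult_ac)
  qed
  then show ?thesis by blast
qed

lemma comp_remainder_lsym:
  assumes "p \<in> lsym UNIV m" "csym m' w"
  shows "comp_remainder N p w \<in> lsym UNIV (m + m' - real N)"
  using leibniz_lsym[where \<Phi> = "comp_remainder N" and c = "- real N", OF comp_remainder_pdiff comp_remainder_bound assms] by simp

lemma csym_test_function:
  fixes u :: "'a::euclidean_space \<Rightarrow> complex"
  assumes "u \<in> test_functions"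
  shows "csym 0 (\<lambda>y (\<xi>::'k::euclidean_space). u y)"
  using lsym_left[OF open_UNIV test_functions_smooth[OF assms], where 'b = 'k] test_functions_support[OF assms]
  unfolding csym_def by metis

subsection \<open>Quantization and Schwartz kernels\<close>

text \<open>The usual quantization \<open>Op_eq\<close>, viewed as a \<open>comp_symbol\<close> so that the results on the latter apply.\<close>

definition Op :: "('a::euclidean_space \<Rightarrow> 'a \<Rightarrow> complex) \<Rightarrow> ('a \<Rightarrow> complex) \<Rightarrow> 'a \<Rightarrow> complex" where
  "Op p u x = comp_symbol p (\<lambda>y \<xi>. u y) x 0"

lemma Op_eq:
  fixes p :: "'a::euclidean_space \<Rightarrow> 'a \<Rightarrow> complex"
  shows "Op p u x = complex_of_real (1 / (2 * pi) ^ DIM('a)) * (LINT \<xi>|lborel. cis (x \<bullet> \<xi>) * p x \<xi> * ft u \<xi>)"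
  by (simp add: Op_def comp_symbol_def comp_integrand_def[abs_def])

lemma Op_integrable:
  assumes "p \<in> lsym UNIV m" "u \<in> test_functions"
  shows "integrable lborel (\<lambda>\<xi>. cis (x \<bullet> \<xi>) * p x \<xi> * ft u \<xi>)"
  using dominatedD(4)[OF comp_integrand_dominated[OF assms(1) csym_test_function[OF assms(2)]], of "(x, 0)"]
  by (simp add: comp_integrand_def[abs_def])

lemma Op_smooth:
  assumes "p \<in> lsym UNIV m" "u \<in> test_functions"
  shows "smooth_on UNIV (Op p u)"
  using smooth_on_slice(2)[OF lsym_smooth_UNIV[OF comp_symbol_lsym[OF assms(1) csym_test_function[OF assms(2)]]], of 0]
  by (simp add: Op_def[abs_def])

lemma Op_add_symbol:
  assumes "p \<in> lsym UNIV m" "q \<in> lsym UNIV m'" "u \<in> test_functions"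
  shows "Op (\<lambda>x \<xi>. p x \<xi> + q x \<xi>) u x = Op p u x + Op q u x"
proof -
  have "cis (x \<bullet> \<xi>) * (p x \<xi> + q x \<xi>) * ft u \<xi> = cis (x \<bullet> \<xi>) * p x \<xi> * ft u \<xi> + cis (x \<bullet> \<xi>) * q x \<xi> * ft u \<xi>" for \<xi>
    by (simp add: algebra_simps)
  then show ?thesis unfolding Op_eq
    by (simp only: Bochner_Integration.integral_add[OF Op_integrable[OF assms(1,3)] Op_integrable[OF assms(2,3)]] distrib_left)
qed

lemma Op_diff:
  assumes "p \<in> lsym UNIV m" "u \<in> test_functions" "v \<in> test_functions"
  shows "Op p (\<lambda>y. u y - v y) x = Op p u x - Op p v x"
proof -
  have "cis (x \<bullet> \<xi>) * p x \<xi> * ft (\<lambda>y. u y - v y) \<xi> = cis (x \<bullet> \<xi>) * p x \<xi> * ft u \<xi> - cis (x \<bullet> \<xi>) * p x \<xi> * ft v \<xi>" for \<xi>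
    by (simp add: ft_diff[OF assms(2,3)] right_diff_distrib)
  then show ?thesis unfolding Op_eq
    by (simp only: Bochner_Integration.integral_diff[OF Op_integrable[OF assms(1,2)] Op_integrable[OF assms(1,3)]] right_diff_distrib)
qed

text \<open>Multiplication operators are the quantizations of symbols that do not depend on
  \<open>\<xi>\<close>. In this way truncation by a cutoff becomes an instance of
  \<open>Op_compose\<close>.\<close>

lemma Op_left:
  assumes u: "u \<in> test_functions"
  shows "Op (\<lambda>y \<xi>. f y) u x = f x * u x"
proof -
  have "(LINT \<xi>|lborel. cis (x \<bullet> \<xi>) * f x * ft u \<xi>) = (LINT \<xi>|lborel. f x * (cis (x \<bullet> \<xi>) * ft u \<xi>))"
    by (simp only: mult_ac)
  also have "\<dots> = f x * (complex_of_real ((2 * pi) ^ DIM('a)) * u x)"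
    by (simp only: integral_mult_right_zero fourier_inversion[OF u integrable_ft_test(1)[OF u]])
  finally show ?thesis unfolding Op_eq by simp
qed

lemma continuous_on_symbol_slice: "p \<in> lsym UNIV m \<Longrightarrow> continuous_on UNIV (p x)"
  by (rule continuous_on_slice(1)[OF smooth_on_imp_continuous_on[OF lsym_smooth_UNIV]])

text \<open>Multiplication by a plane wave shifts the Fourier transform by \<open>\<xi>\<close>;
  translating the integral back splits the wave off. This computes both the action on plane waves
  and the composition of quantizations.\<close>

lemma shifted_comp_integral:
  fixes p w :: "'a::euclidean_space \<Rightarrow> 'a \<Rightarrow> complex"
  assumes p: "p \<in> lsym UNIV m" and w: "csym m' w"
  shows "(LINT \<eta>|lborel. cis (x \<bullet> \<eta>) * p x \<eta> * ft (\<lambda>y. w y \<xi>) (\<eta> - \<xi>)) =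
    cis (x \<bullet> \<xi>) * (LINT \<eta>|lborel. comp_integrand p w x \<xi> \<eta>)"
proof -
  define f where "f \<eta> = cis (x \<bullet> \<eta>) * p x \<eta> * ft (\<lambda>y. w y \<xi>) (\<eta> - \<xi>)" for \<eta>
  have "continuous_on UNIV f" unfolding f_def
    by (intro continuous_on_mult continuous_on_cis continuous_intros continuous_on_symbol_slice[OF p]
        continuous_on_compose2[OF integrable_ft_test(3)[OF csym_test[OF w]]]) auto
  then have "(LINT \<eta>|lborel. f (\<xi> + \<eta>)) = (LINT \<eta>|lborel. f \<eta>)"
    by (intro lborel_integral_shift borel_measurable_continuous_onI)
  moreover have "f (\<xi> + \<eta>) = cis (x \<bullet> \<xi>) * comp_integrand p w x \<xi> \<eta>" for \<eta>
    by (simp add: f_def comp_integrand_def inner_add_right cis_mult[symmetric])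
  ultimately show ?thesis unfolding f_def by simp
qed

lemma Op_plane_wave:
  fixes p w :: "'a::euclidean_space \<Rightarrow> 'a \<Rightarrow> complex"
  assumes p: "p \<in> lsym UNIV m" and w: "csym m' w"
  shows "Op p (\<lambda>y. cis (y \<bullet> \<xi>) * w y \<xi>) x = cis (x \<bullet> \<xi>) * comp_symbol p w x \<xi>"
  unfolding Op_eq ft_cis_mult shifted_comp_integral[OF p w] comp_symbol_def by simp

lemma integrable_scaled_indicator_cball: "integrable lborel (\<lambda>y::'a::euclidean_space. A * indicator (cball 0 R) y :: real)"
  by (intro integrable_mult_right integrable_real_indicator) (simp_all add: emeasure_lborel_cball_finite[unfolded infinity_ennreal_def])

text \<open>The support of \<open>w\<close> bounds the range of \<open>y\<close>, and the decay of
  \<open>ft u\<close> beats the growth of \<open>w\<close> of order \<open>m\<close>; so the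
  integrals may be exchanged, and the inner one is a shifted transform of \<open>w\<close>.\<close>

lemma ft_Op:
  fixes w :: "'a::euclidean_space \<Rightarrow> 'a \<Rightarrow> complex"
  assumes w: "csym m w" and u: "u \<in> test_functions"
  shows "ft (Op w u) \<eta> = complex_of_real (1 / (2 * pi) ^ DIM('a)) * (LINT \<xi>|lborel. ft u \<xi> * ft (\<lambda>y. w y \<xi>) (\<eta> - \<xi>))"
proof -
  obtain R where R: "\<And>y \<xi>. norm y > R \<Longrightarrow> w y \<xi> = 0" using w unfolding csym_def by blast
  obtain A where A: "\<And>y \<xi>. y \<in> cball 0 R \<Longrightarrow> cmod (w y \<xi>) \<le> A * japanese \<xi> powr m"
    using lsym_bound[OF csym_lsym[OF w] compact_cball[of 0 R]] by blast
  obtain D where D: "D \<ge> 0" "\<And>\<xi>. cmod (ft u \<xi>) \<le> D * japanese \<xi> powr (- 2 * real DIM('a) - m)"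
    using integrable_ft_test(2)[OF u] by blast
  define c where "c = complex_of_real (1 / (2 * pi) ^ DIM('a))"
  define F where "F y \<xi> = cis (- (y \<bullet> \<eta>)) * (cis (y \<bullet> \<xi>) * w y \<xi> * ft u \<xi>)" for y \<xi>
  have Fc: "continuous_on UNIV (\<lambda>(y, \<xi>). F y \<xi>)"
    unfolding F_def split_def
    by (intro continuous_on_mult continuous_on_cis continuous_intros
        smooth_on_imp_continuous_on[OF lsym_smooth_UNIV[OF csym_lsym[OF w]], unfolded split_def]
        continuous_on_compose2[OF integrable_ft_test(3)[OF u]]) auto
  have Fb: "norm (F y \<xi>) \<le> (\<bar>A\<bar> * indicator (cball 0 R) y) * (D * japanese \<xi> powr (- 2 * real DIM('a)))" for y \<xi>
  proof (cases "norm y \<le> R")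
    case True
    have "norm (F y \<xi>) = cmod (w y \<xi>) * cmod (ft u \<xi>)" by (simp add: F_def norm_mult)
    also have "\<dots> \<le> (\<bar>A\<bar> * japanese \<xi> powr m) * (D * japanese \<xi> powr (- 2 * real DIM('a) - m))"
      by (intro mult_mono D(2) order_trans[OF A] mult_right_mono) (use True in auto)
    also have "\<dots> = \<bar>A\<bar> * D * (japanese \<xi> powr m * japanese \<xi> powr (- 2 * real DIM('a) - m))" by (simp only: mult_ac)
    finally show ?thesis using True by (simp flip: powr_add add: mult.assoc)
  next
    case False
    then show ?thesis using R[of y \<xi>] by (simp add: F_def)
  qed
  note fub = fubini_tensor_bound[OF Fc integrable_scaled_indicator_cball _ Fb]
  have "ft (Op w u) \<eta> = (LINT y|lborel. c * (LINT \<xi>|lborel. F y \<xi>))"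
    unfolding ft_def[of "Op w u"] Op_eq[of w u] c_def[symmetric]
    by (rule Bochner_Integration.integral_cong[OF refl]) (simp add: F_def)
  also have "\<dots> = c * (LINT y|lborel. LINT \<xi>|lborel. F y \<xi>)" by (rule integral_mult_right_zero)
  also have "(LINT y|lborel. LINT \<xi>|lborel. F y \<xi>) = (LINT \<xi>|lborel. LINT y|lborel. F y \<xi>)"
    by (rule fub[symmetric]) (intro integrable_mult_right integrable_japanese; simp)
  also have "\<dots> = (LINT \<xi>|lborel. ft u \<xi> * ft (\<lambda>y. w y \<xi>) (\<eta> - \<xi>))"
  proof (rule Bochner_Integration.integral_cong[OF refl])
    fix \<xi>
    have "F y \<xi> = ft u \<xi> * (cis (- (y \<bullet> (\<eta> - \<xi>))) * w y \<xi>)" for y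
    proof -
      have "cis (- (y \<bullet> (\<eta> - \<xi>))) = cis (- (y \<bullet> \<eta>)) * cis (y \<bullet> \<xi>)" by (simp add: cis_mult inner_diff_right)
      then show ?thesis by (simp add: F_def mult_ac)
    qed
    then show "(LINT y|lborel. F y \<xi>) = ft u \<xi> * ft (\<lambda>y. w y \<xi>) (\<eta> - \<xi>)"
      unfolding ft_def[of "\<lambda>y. w y \<xi>"] by (simp only: integral_mult_right_zero)
  qed
  finally show ?thesis by (simp add: c_def)
qed

text \<open>The transform of \<open>w\<close> decays in \<open>\<eta> - \<xi>\<close>, but the
  majorant for Fubini must be a product. Peetre's inequality trades this for decay in
  \<open>\<eta>\<close> and growth of order \<open>\<bar>s\<bar>\<close> in
  \<open>\<xi>\<close>.\<close>

lemma Op_compose: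
  fixes p w :: "'a::euclidean_space \<Rightarrow> 'a \<Rightarrow> complex"
  assumes p: "p \<in> lsym UNIV m" and w: "csym m' w" and u: "u \<in> test_functions"
  shows "Op p (Op w u) x = Op (comp_symbol p w) u x"
proof -
  define n where "n = 2 * real DIM('a)"
  define s where "s = - n - m"
  obtain A where A: "\<And>\<eta>. cmod (p x \<eta>) \<le> A * japanese \<eta> powr m"
    using lsym_bound[OF p, of "{x}"] by auto
  obtain B where B: "B \<ge> 0" "\<And>\<xi> \<eta>. cmod (ft (\<lambda>y. w y \<xi>) \<eta>) \<le> B * japanese \<xi> powr m' * japanese \<eta> powr s"
    using csym_ft_decay[OF w] by blast
  \<comment> \<open>The decay of \<open>ft u\<close> absorbs the order \<open>m'\<close> of
    \<open>w\<close> and the growth \<open>\<bar>s\<bar>\<close> from Peetre's inequality, and keeps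
    an integrable weight.\<close>
  obtain D where D: "D \<ge> 0" "\<And>\<xi>. cmod (ft u \<xi>) \<le> D * japanese \<xi> powr (- n - m' - \<bar>s\<bar>)"
    using integrable_ft_test(2)[OF u] by blast
  define c where "c = complex_of_real (1 / (2 * pi) ^ DIM('a))"
  define F where "F \<eta> \<xi> = cis (x \<bullet> \<eta>) * p x \<eta> * (ft u \<xi> * ft (\<lambda>y. w y \<xi>) (\<eta> - \<xi>))" for \<eta> \<xi>
  have "continuous_on UNIV (\<lambda>q::'a \<times> 'a. (\<lambda>(\<xi>, \<eta>). ft (\<lambda>y. w y \<xi>) \<eta>) (snd q, fst q - snd q))"
    by (rule continuous_on_compose2[OF ft_family_continuous[OF csym_csmooth[OF w]]]) (auto intro!: continuous_intros)
  then have Fc: "continuous_on UNIV (\<lambda>(\<eta>, \<xi>). F \<eta> \<xi>)"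
    unfolding F_def split_def fst_conv snd_conv
    by (intro continuous_on_mult continuous_on_cis continuous_intros
        continuous_on_compose2[OF integrable_ft_test(3)[OF u]] continuous_on_compose2[OF continuous_on_symbol_slice[OF p]]) auto
  have Fb: "norm (F \<eta> \<xi>) \<le> (\<bar>A\<bar> * B * 2 powr \<bar>s\<bar> * japanese \<eta> powr (- n)) * (D * japanese \<xi> powr (- n))" for \<eta> \<xi>
  proof -
    have 1: "cmod (p x \<eta>) \<le> \<bar>A\<bar> * japanese \<eta> powr m" by (rule order_trans[OF A]) (simp add: mult_right_mono)
    have "cmod (ft (\<lambda>y. w y \<xi>) (\<eta> - \<xi>)) \<le> B * japanese \<xi> powr m' * japanese (\<eta> + (- \<xi>)) powr s"
      using B(2)[of \<xi> "\<eta> - \<xi>"] by simp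
    also have "\<dots> \<le> B * japanese \<xi> powr m' * (2 powr \<bar>s\<bar> * japanese \<eta> powr s * japanese (- \<xi>) powr \<bar>s\<bar>)"
      using B(1) by (intro mult_left_mono japanese_powr_add_le) simp
    finally have 2: "cmod (ft (\<lambda>y. w y \<xi>) (\<eta> - \<xi>)) \<le> B * japanese \<xi> powr m' * (2 powr \<bar>s\<bar> * japanese \<eta> powr s * japanese \<xi> powr \<bar>s\<bar>)"
      by simp
    have "norm (F \<eta> \<xi>) = cmod (p x \<eta>) * (cmod (ft u \<xi>) * cmod (ft (\<lambda>y. w y \<xi>) (\<eta> - \<xi>)))"
      by (simp add: F_def norm_mult)
    also have "\<dots> \<le> (\<bar>A\<bar> * japanese \<eta> powr m) * ((D * japanese \<xi> powr (- n - m' - \<bar>s\<bar>)) *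
        (B * japanese \<xi> powr m' * (2 powr \<bar>s\<bar> * japanese \<eta> powr s * japanese \<xi> powr \<bar>s\<bar>)))"
      using D(1) by (intro mult_mono 1 2 D(2)) auto
    also have "\<dots> = (\<bar>A\<bar> * B * 2 powr \<bar>s\<bar> * (japanese \<eta> powr m * japanese \<eta> powr s)) *
        (D * (japanese \<xi> powr (- n - m' - \<bar>s\<bar>) * japanese \<xi> powr m' * japanese \<xi> powr \<bar>s\<bar>))"
      by (simp only: mult_ac)
    also have "\<dots> = (\<bar>A\<bar> * B * 2 powr \<bar>s\<bar> * japanese \<eta> powr (- n)) * (D * japanese \<xi> powr (- n))"
      by (simp add: s_def flip: powr_add)
    finally show ?thesis .
  qed
  have J: "integrable lborel (\<lambda>\<eta>::'a. japanese \<eta> powr (- n))" by (rule integrable_japanese) (simp add: n_def)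
  note fub = fubini_tensor_bound[OF Fc integrable_mult_right[OF J] integrable_mult_right[OF J] Fb]
  have F: "cis (x \<bullet> \<eta>) * p x \<eta> * (c * (LINT \<xi>|lborel. ft u \<xi> * ft (\<lambda>y. w y \<xi>) (\<eta> - \<xi>))) = c * (LINT \<xi>|lborel. F \<eta> \<xi>)" for \<eta>
    unfolding F_def integral_mult_right_zero by (simp only: mult_ac)
  have "Op p (Op w u) x = c * (LINT \<eta>|lborel. c * (LINT \<xi>|lborel. F \<eta> \<xi>))"
    unfolding Op_eq[of p] ft_Op[OF w u] c_def[symmetric] F ..
  also have "\<dots> = c * (c * (LINT \<eta>|lborel. LINT \<xi>|lborel. F \<eta> \<xi>))" by (simp only: integral_mult_right_zero)
  also have "(LINT \<eta>|lborel. LINT \<xi>|lborel. F \<eta> \<xi>) = (LINT \<xi>|lborel. LINT \<eta>|lborel. F \<eta> \<xi>)"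
    by (rule fub[symmetric])
  also have "c * (LINT \<xi>|lborel. LINT \<eta>|lborel. F \<eta> \<xi>) = (LINT \<xi>|lborel. c * (LINT \<eta>|lborel. F \<eta> \<xi>))"
    by (rule integral_mult_right_zero[symmetric])
  also have "\<dots> = (LINT \<xi>|lborel. cis (x \<bullet> \<xi>) * comp_symbol p w x \<xi> * ft u \<xi>)"
  proof (rule Bochner_Integration.integral_cong[OF refl])
    fix \<xi>
    have "F \<eta> \<xi> = ft u \<xi> * (cis (x \<bullet> \<eta>) * p x \<eta> * ft (\<lambda>y. w y \<xi>) (\<eta> - \<xi>))" for \<eta>
      by (simp add: F_def mult_ac)
    then have "(LINT \<eta>|lborel. F \<eta> \<xi>) = ft u \<xi> * (cis (x \<bullet> \<xi>) * (LINT \<eta>|lborel. comp_integrand p w x \<xi> \<eta>))"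
      by (simp only: integral_mult_right_zero shifted_comp_integral[OF p w])
    then show "c * (LINT \<eta>|lborel. F \<eta> \<xi>) = cis (x \<bullet> \<xi>) * comp_symbol p w x \<xi> * ft u \<xi>"
      unfolding comp_symbol_def c_def[symmetric] by (simp only: mult_ac)
  qed
  finally show ?thesis unfolding Op_eq[of "comp_symbol p w"] c_def[symmetric] .
qed

text \<open>Boundedness of the support in each variable separately makes a product of two indicators
  a majorant.\<close>

lemma
  fixes F :: "'a::euclidean_space \<Rightarrow> 'b::euclidean_space \<Rightarrow> complex"
  assumes c: "continuous_on UNIV (\<lambda>(x, y). F x y)"
    and s: "\<And>x y. norm x > R \<Longrightarrow> F x y = 0" "\<And>x y. norm y > S \<Longrightarrow> F x y = 0"
  shows integrable_bounded_support_Pair: "integrable lborel (\<lambda>(x, y). F x y)"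
    and integral_bounded_support_iterated: "(LINT z|lborel. (\<lambda>(x, y). F x y) z) = (LINT x|lborel. LINT y|lborel. F x y)"
    and fubini_bounded_support: "(LINT y|lborel. LINT x|lborel. F x y) = (LINT x|lborel. LINT y|lborel. F x y)"
proof -
  have "compact ((\<lambda>(x, y). F x y) ` (cball 0 R \<times> cball 0 S))"
    by (intro compact_continuous_image compact_Times compact_cball continuous_on_subset[OF c]) auto
  from compact_imp_bounded[OF this, unfolded bounded_pos]
  obtain B where B: "B > 0" "\<And>v. v \<in> (\<lambda>(x, y). F x y) ` (cball 0 R \<times> cball 0 S) \<Longrightarrow> cmod v \<le> B"
    by (elim exE conjE) blast
  have b: "cmod (F x y) \<le> (B * indicator (cball 0 R) x) * (1 * indicator (cball 0 S) y)" for x y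
  proof (cases "norm x \<le> R \<and> norm y \<le> S")
    case True
    then have "(x, y) \<in> cball 0 R \<times> cball 0 S" by simp
    from B(2)[OF imageI[OF this]] show ?thesis using True by simp
  next
    case False
    then have "F x y = 0" using s(1)[of x y] s(2)[of y x] by auto
    then show ?thesis using B(1) by simp
  qed
  note i = integrable_scaled_indicator_cball
  show "integrable lborel (\<lambda>(x, y). F x y)" by (rule integrable_tensor_bound[OF c i i b])
  show "(LINT z|lborel. (\<lambda>(x, y). F x y) z) = (LINT x|lborel. LINT y|lborel. F x y)"
    by (rule integral_tensor_bound_iterated[OF c i i b])
  show "(LINT y|lborel. LINT x|lborel. F x y) = (LINT x|lborel. LINT y|lborel. F x y)"
    by (rule fubini_tensor_bound[OF c i i b])
qed

section \<open>Kernels of quantized symbols as distributions and as oscillatory integrals\<close>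

lemma finite_multi_indices_le: "finite {\<alpha> :: 'a::euclidean_space \<Rightarrow> nat. \<alpha> \<in> multi_indices \<and> mlen \<alpha> \<le> N}"
proof -
  have "{\<alpha> :: 'a \<Rightarrow> nat. \<alpha> \<in> multi_indices \<and> mlen \<alpha> \<le> N} \<subseteq> (\<lambda>l. count (mset l)) ` {l. set l \<subseteq> Basis \<and> length l \<le> N}"
  proof
    fix \<alpha> :: "'a \<Rightarrow> nat" assume "\<alpha> \<in> {\<alpha>. \<alpha> \<in> multi_indices \<and> mlen \<alpha> \<le> N}"
    then show "\<alpha> \<in> (\<lambda>l. count (mset l)) ` {l. set l \<subseteq> Basis \<and> length l \<le> N}"
      using count_mword[of \<alpha>] set_mword[of \<alpha>] length_mword[of \<alpha>] by (intro image_eqI[of _ _ "mword \<alpha>"]) auto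
  qed
  then show ?thesis by (rule finite_subset) (intro finite_imageI finite_lists_length_le finite_Basis)
qed

lemma mlen_count: "set l \<subseteq> Basis \<Longrightarrow> mlen (count (mset l)) = length l"
  unfolding length_mword[symmetric] by (metis mset_mword_count size_mset)

definition test_norm :: "nat \<Rightarrow> ('a::euclidean_space \<Rightarrow> complex) \<Rightarrow> real" where
  "test_norm N \<phi> = (\<Sum>\<alpha> | \<alpha> \<in> multi_indices \<and> mlen \<alpha> \<le> N. SUP x. cmod (mderiv \<alpha> \<phi> x))"

lemma ider_le_test_norm:
  assumes \<phi>: "\<phi> \<in> test_functions" and l: "set l \<subseteq> Basis" "length l \<le> N"
  shows "cmod (ider l \<phi> x) \<le> test_norm N \<phi>"
proof -
  \<comment> \<open>A real supremum bounds its members only if the range is bounded above.\<close>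
  have bdd: "bdd_above (range (\<lambda>x. cmod (mderiv \<alpha> \<phi> x)))" for \<alpha>
  proof -
    obtain B where "\<And>x. cmod (mderiv \<alpha> \<phi> x) \<le> B"
      using test_functions_bounded[OF test_functions_ider[OF \<phi> set_mword]] unfolding mderiv_eq_ider by metis
    then show ?thesis by (intro bdd_aboveI2)
  qed
  have le: "cmod (mderiv \<alpha> \<phi> x) \<le> (SUP x. cmod (mderiv \<alpha> \<phi> x))" for \<alpha> x
    by (rule cSUP_upper[OF UNIV_I bdd])
  define \<beta> where "\<beta> = count (mset l)"
  have "cmod (ider l \<phi> x) = cmod (mderiv \<beta> \<phi> x)"
    unfolding \<beta>_def using ider_eq_mderiv[OF open_UNIV test_functions_smooth[OF \<phi>] l(1) UNIV_I] by simp
  also note le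
  also have "(SUP x. cmod (mderiv \<beta> \<phi> x)) \<le> test_norm N \<phi>"
    unfolding test_norm_def
  proof (rule member_le_sum)
    show "\<beta> \<in> {\<alpha> \<in> multi_indices. mlen \<alpha> \<le> N}"
      using l by (simp add: \<beta>_def count_list_multi_index mlen_count)
    show "0 \<le> (SUP x. cmod (mderiv \<alpha> \<phi> x))" for \<alpha> by (rule order_trans[OF norm_ge_zero le])
  qed (rule finite_multi_indices_le)
  finally show ?thesis .
qed

lemma csmooth_test_Pair:
  assumes "\<phi> \<in> test_functions"
  shows "csmooth (\<lambda>x y. \<phi> (x, y))"
proof -
  obtain R where R: "\<And>z. norm z > R \<Longrightarrow> \<phi> z = 0" using test_functions_support[OF assms] by metis
  have "\<phi> (x, y) = 0" if "norm y > R" for x y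
    by (rule R) (use that norm_snd_le[of y x] in linarith)
  then show ?thesis unfolding csmooth_def using test_functions_smooth[OF assms] by auto
qed

text \<open>The integrand left when \<open>y\<close> is integrated out first, for an amplitude that
  does not depend on \<open>y\<close>. That integration turns the test function into a Fourier
  transform, rapidly decreasing in \<open>\<xi>\<close>, so the remaining integral converges
  absolutely.\<close>

definition kernel_integrand where
  "kernel_integrand r \<phi> x \<xi> = cis (x \<bullet> \<xi>) * r x \<xi> * ft (\<lambda>y. \<phi> (x, y)) \<xi>"

definition Op_kernel :: "('a::euclidean_space \<Rightarrow> 'a \<Rightarrow> complex) \<Rightarrow> ('a \<times> 'a \<Rightarrow> complex) \<Rightarrow> complex" where
  "Op_kernel r \<phi> = complex_of_real (1 / (2 * pi) ^ DIM('a)) *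
     (LINT z|lborel. (\<lambda>(x, \<xi>). kernel_integrand r \<phi> x \<xi>) z)"

lemma kernel_integrand_eq_0:
  assumes "\<And>z. norm z > R \<Longrightarrow> \<phi> z = 0" "norm x > R"
  shows "kernel_integrand r \<phi> x \<xi> = 0"
proof -
  have "(\<lambda>y. \<phi> (x, y)) = (\<lambda>y. 0)"
  proof
    fix y show "\<phi> (x, y) = 0" by (rule assms(1)) (use assms(2) norm_fst_le[of x y] in linarith)
  qed
  then show ?thesis by (simp add: kernel_integrand_def ft_def)
qed

lemma kernel_integrand_continuous:
  assumes r: "r \<in> lsym UNIV m" and \<phi>: "\<phi> \<in> test_functions"
  shows "continuous_on UNIV (\<lambda>(x, \<xi>). kernel_integrand r \<phi> x \<xi>)"
  unfolding kernel_integrand_def split_def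
  by (intro continuous_on_mult continuous_on_cis continuous_intros
      smooth_on_imp_continuous_on[OF lsym_smooth_UNIV[OF r], unfolded split_def]
      ft_family_continuous[OF csmooth_test_Pair[OF \<phi>], unfolded split_def])

text \<open>\<open>A\<close> and \<open>N\<close> depend on \<open>r\<close> and \<open>R\<close>
  but not on \<open>\<phi>\<close>. Hence the same estimate gives integrability for each test
  function and the seminorm bound that a distribution requires.\<close>

lemma kernel_integrand_bound:
  fixes r :: "'a::euclidean_space \<Rightarrow> 'a \<Rightarrow> complex"
  assumes r: "r \<in> lsym UNIV m"
  obtains A N where "A \<ge> 0"
    "\<And>\<phi> x \<xi>. \<phi> \<in> test_functions \<Longrightarrow> (\<And>z. norm z > R \<Longrightarrow> \<phi> z = 0) \<Longrightarrow>
      cmod (kernel_integrand r \<phi> x \<xi>) \<le> (1 * indicator (cball 0 R) x) * (A * test_norm N \<phi> * japanese \<xi> powr (- 2 * real DIM('a)))"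
proof -
  \<comment> \<open>Enough derivatives of the test function to beat the growth of \<open>r\<close>
    and to leave an integrable weight.\<close>
  define M where "M = nat \<lceil>2 * real DIM('a) + \<bar>m\<bar>\<rceil>"
  obtain A where A: "\<And>x \<xi>. x \<in> cball 0 R \<Longrightarrow> cmod (r x \<xi>) \<le> A * japanese \<xi> powr m"
    using lsym_bound[OF r compact_cball[of 0 R]] by blast
  obtain B where B: "B \<ge> 0" "\<And>f S \<eta>. f \<in> test_functions \<Longrightarrow> (\<And>y. norm y > R \<Longrightarrow> f y = 0) \<Longrightarrow>
    (\<And>l y. set l \<subseteq> Basis \<Longrightarrow> length l \<le> 2 * M \<Longrightarrow> norm (ider l f y) \<le> S) \<Longrightarrow>
    norm (ft f \<eta>) \<le> B * S * japanese (\<eta>::'a) powr (- 2 * real M)"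
    using ft_decay[of R M, where 'a = 'a] by blast
  have "cmod (kernel_integrand r \<phi> x \<xi>) \<le> (1 * indicator (cball 0 R) x) * ((\<bar>A\<bar> * B) * test_norm (2 * M) \<phi> * japanese \<xi> powr (- 2 * real DIM('a)))"
    if \<phi>: "\<phi> \<in> test_functions" "\<And>z. norm z > R \<Longrightarrow> \<phi> z = 0" for \<phi> x \<xi>
  proof (cases "norm x \<le> R")
    case True
    define S where "S = test_norm (2 * M) \<phi>"
    have S: "cmod (ider l \<phi> z) \<le> S" if "set l \<subseteq> Basis" "length l \<le> 2 * M" for l z
      unfolding S_def by (rule ider_le_test_norm[OF \<phi>(1) that])
    have S0: "S \<ge> 0" using order_trans[OF norm_ge_zero S[of "[]" undefined]] by simp
    have "cmod (ft (\<lambda>y. \<phi> (x, y)) \<xi>) \<le> B * S * japanese \<xi> powr (- 2 * real M)"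
    proof (rule B(2)[OF csmooth_slice_test[OF csmooth_test_Pair[OF \<phi>(1)]]])
      show "\<phi> (x, y) = 0" if "norm y > R" for y
        by (rule \<phi>(2)) (use that norm_snd_le[of y x] in linarith)
      show "cmod (ider l (\<lambda>y. \<phi> (x, y)) y) \<le> S" if "set l \<subseteq> Basis" "length l \<le> 2 * M" for l y
        using S[of "map (Pair 0) l" "(x, y)"] set_Pair_Basis(1)[OF that(1)] that(2)
          ider_slice_right[of l "\<lambda>x y. \<phi> (x, y)"] by simp
    qed
    moreover have "cmod (r x \<xi>) \<le> \<bar>A\<bar> * japanese \<xi> powr m"
      using True by (intro order_trans[OF A] mult_right_mono) auto
    ultimately have "cmod (r x \<xi>) * cmod (ft (\<lambda>y. \<phi> (x, y)) \<xi>) \<le> (\<bar>A\<bar> * japanese \<xi> powr m) * (B * S * japanese \<xi> powr (- 2 * real M))"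
      by (intro mult_mono) auto
    also have "\<dots> = (\<bar>A\<bar> * B * S) * japanese \<xi> powr (m - 2 * real M)" by (simp add: powr_diff powr_minus field_simps)
    also have "\<dots> \<le> (\<bar>A\<bar> * B * S) * japanese \<xi> powr (- 2 * real DIM('a))"
    proof (rule mult_left_mono)
      have "m - 2 * real M \<le> - 2 * real DIM('a)" unfolding M_def by linarith
      then show "japanese \<xi> powr (m - 2 * real M) \<le> japanese \<xi> powr (- 2 * real DIM('a))" by (rule japanese_powr_mono)
      show "0 \<le> \<bar>A\<bar> * B * S" using B(1) S0 by simp
    qed
    finally show ?thesis using True by (simp add: kernel_integrand_def norm_mult S_def)
  next
    case False
    then have "kernel_integrand r \<phi> x \<xi> = 0" by (intro kernel_integrand_eq_0[OF \<phi>(2)]) auto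
    then show ?thesis using False by simp
  qed
  then show ?thesis using that[of "\<bar>A\<bar> * B" "2 * M"] B(1) by simp
qed

lemma kernel_integrand_tensor_bound:
  fixes r :: "'a::euclidean_space \<Rightarrow> 'a \<Rightarrow> complex"
  assumes r: "r \<in> lsym UNIV m" and \<phi>: "\<phi> \<in> test_functions"
  shows "integrable lborel (\<lambda>(x, \<xi>). kernel_integrand r \<phi> x \<xi>)"
    and "(LINT z|lborel. (\<lambda>(x, \<xi>). kernel_integrand r \<phi> x \<xi>) z) = (LINT x|lborel. LINT \<xi>|lborel. kernel_integrand r \<phi> x \<xi>)"
proof -
  obtain R where R: "\<And>z. norm z > R \<Longrightarrow> \<phi> z = 0" using test_functions_support[OF \<phi>] by metis
  obtain A N where AN: "A \<ge> 0" "\<And>\<phi> x \<xi>. \<phi> \<in> test_functions \<Longrightarrow> (\<And>z. norm z > R \<Longrightarrow> \<phi> z = 0) \<Longrightarrow>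
      cmod (kernel_integrand r \<phi> x \<xi>) \<le> (1 * indicator (cball 0 R) x) * (A * test_norm N \<phi> * japanese \<xi> powr (- 2 * real DIM('a)))"
    using kernel_integrand_bound[OF r, of R] by metis
  have J: "integrable lborel (\<lambda>\<xi>::'a. A * test_norm N \<phi> * japanese \<xi> powr (- 2 * real DIM('a)))"
    by (intro integrable_mult_right integrable_japanese) simp
  note c = kernel_integrand_continuous[OF r \<phi>]
  show "integrable lborel (\<lambda>(x, \<xi>). kernel_integrand r \<phi> x \<xi>)"
    by (rule integrable_tensor_bound[OF c integrable_scaled_indicator_cball J AN(2)[OF \<phi> R]])
  show "(LINT z|lborel. (\<lambda>(x, \<xi>). kernel_integrand r \<phi> x \<xi>) z) = (LINT x|lborel. LINT \<xi>|lborel. kernel_integrand r \<phi> x \<xi>)"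
    by (rule integral_tensor_bound_iterated[OF c integrable_scaled_indicator_cball J AN(2)[OF \<phi> R]])
qed

lemma distribution_Op_kernel:
  fixes r :: "'a::euclidean_space \<Rightarrow> 'a \<Rightarrow> complex"
  assumes r: "r \<in> lsym UNIV m"
  shows "distribution (Op_kernel r)"
  unfolding distribution_def
proof (intro conjI ballI allI impI)
  fix \<phi> \<psi> :: "'a \<times> 'a \<Rightarrow> complex" and c assume \<phi>: "\<phi> \<in> test_functions" and \<psi>: "\<psi> \<in> test_functions"
  have "kernel_integrand r (\<lambda>z. \<phi> z + c * \<psi> z) x \<xi> = kernel_integrand r \<phi> x \<xi> + c * kernel_integrand r \<psi> x \<xi>" for x \<xi>
  proof -
    have t: "(\<lambda>y. \<phi> (x, y)) \<in> test_functions" "(\<lambda>y. (- c) * \<psi> (x, y)) \<in> test_functions"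
      by (rule csmooth_slice_test[OF csmooth_test_Pair[OF \<phi>]]
          test_functions_cmult[OF csmooth_slice_test[OF csmooth_test_Pair[OF \<psi>]]])+
    have "ft (\<lambda>y. \<phi> (x, y) + c * \<psi> (x, y)) \<xi> = ft (\<lambda>y. \<phi> (x, y)) \<xi> + c * ft (\<lambda>y. \<psi> (x, y)) \<xi>"
      using ft_diff[OF t, of \<xi>] ft_cmult[of "- c" "\<lambda>y. \<psi> (x, y)" \<xi>] by simp
    then show ?thesis by (simp add: kernel_integrand_def algebra_simps)
  qed
  then have eq: "(\<lambda>(x, \<xi>). kernel_integrand r (\<lambda>z. \<phi> z + c * \<psi> z) x \<xi>) =
      (\<lambda>z. (\<lambda>(x, \<xi>). kernel_integrand r \<phi> x \<xi>) z + c * (\<lambda>(x, \<xi>). kernel_integrand r \<psi> x \<xi>) z)"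
    by (auto simp: fun_eq_iff)
  show "Op_kernel r (\<lambda>x. \<phi> x + c * \<psi> x) = Op_kernel r \<phi> + c * Op_kernel r \<psi>"
    unfolding Op_kernel_def eq
      Bochner_Integration.integral_add[OF kernel_integrand_tensor_bound(1)[OF r \<phi>] integrable_mult_right[OF kernel_integrand_tensor_bound(1)[OF r \<psi>]]]
      integral_mult_right_zero
    by (simp only: distrib_left mult_ac)
next
  fix C :: "('a \<times> 'a) set" assume C: "compact C"
  from compact_imp_bounded[OF C, unfolded bounded_iff]
  obtain R where R: "\<And>z. z \<in> C \<Longrightarrow> norm z \<le> R" by blast
  obtain A N where AN: "A \<ge> 0" "\<And>\<phi> x \<xi>. \<phi> \<in> test_functions \<Longrightarrow> (\<And>z. norm z > R \<Longrightarrow> \<phi> z = 0) \<Longrightarrow>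
      cmod (kernel_integrand r \<phi> x \<xi>) \<le> (1 * indicator (cball 0 R) x) * (A * test_norm N \<phi> * japanese \<xi> powr (- 2 * real DIM('a)))"
    using kernel_integrand_bound[OF r, of R] by metis
  define I :: real where "I = (LINT z|lborel. (\<lambda>(x, \<xi>). indicator (cball (0::'a) R) x * japanese (\<xi>::'a) powr (- 2 * real DIM('a))) z)"
  define c where "c = complex_of_real (1 / (2 * pi) ^ DIM('a))"
  have "cmod (Op_kernel r \<phi>) \<le> (cmod c * A * I) * test_norm N \<phi>"
    if \<phi>: "\<phi> \<in> test_functions" and s: "support_on UNIV \<phi> \<subseteq> C" for \<phi>
  proof -
    have z: "\<phi> z = 0" if "norm z > R" for z
      using R[of z] s that by (force simp: support_on_def)
    have b: "cmod ((\<lambda>(x, \<xi>). kernel_integrand r \<phi> x \<xi>) z) \<le> (A * test_norm N \<phi>) * (\<lambda>(x, \<xi>). indicator (cball (0::'a) R) x * japanese (\<xi>::'a) powr (- 2 * real DIM('a))) z" for z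
      using AN(2)[OF \<phi> z, of "fst z" "snd z"] by (simp add: split_def mult_ac)
    have i: "integrable lborel (\<lambda>z. (\<lambda>(x, \<xi>). indicator (cball (0::'a) R) x * japanese (\<xi>::'a) powr (- 2 * real DIM('a))) z)"
    proof -
      have "integrable (lborel \<Otimes>\<^sub>M lborel) (\<lambda>(x, \<xi>). indicator (cball (0::'a) R) x * japanese (\<xi>::'a) powr (- 2 * real DIM('a)))"
      proof (rule lborel_pair.Fubini_integrable)
        show "(\<lambda>(x, \<xi>). indicat_real (cball (0::'a) R) x * japanese (\<xi>::'a) powr (- 2 * real DIM('a))) \<in> borel_measurable (lborel \<Otimes>\<^sub>M lborel)"
        proof -
          have m1: "(indicator (cball 0 R) :: 'a \<Rightarrow> real) \<in> borel_measurable lborel"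
            by (rule borel_measurable_indicator) simp
          have m2: "(\<lambda>\<xi>::'a. japanese \<xi> powr (- 2 * real DIM('a))) \<in> borel_measurable lborel"
            by (rule borel_measurable_integrable[OF integrable_japanese]) simp
          show ?thesis unfolding split_def
            by (intro borel_measurable_times measurable_compose[OF measurable_fst m1] measurable_compose[OF measurable_snd m2])
        qed
        show "integrable lborel (\<lambda>x. LINT y|lborel. norm ((\<lambda>(x, \<xi>). indicator (cball (0::'a) R) x * japanese (\<xi>::'a) powr (- 2 * real DIM('a))) (x, y)))"
          using integrable_scaled_indicator_cball[of "LINT y|lborel. japanese (y::'a) powr (- 2 * real DIM('a))" R]
          by (simp add: abs_mult mult.commute)
        show "AE x in lborel. integrable lborel (\<lambda>y. (\<lambda>(x, \<xi>). indicator (cball (0::'a) R) x * japanese (\<xi>::'a) powr (- 2 * real DIM('a))) (x, y))"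
          unfolding prod.case by (intro AE_I2 integrable_mult_right integrable_japanese) simp
      qed
      then show ?thesis by (simp add: lborel_prod)
    qed
    have "cmod (LINT z|lborel. (\<lambda>(x, \<xi>). kernel_integrand r \<phi> x \<xi>) z) \<le> (LINT z|lborel. cmod ((\<lambda>(x, \<xi>). kernel_integrand r \<phi> x \<xi>) z))"
      by (rule integral_norm_bound)
    also have "\<dots> \<le> (LINT z|lborel. (A * test_norm N \<phi>) * (\<lambda>(x, \<xi>). indicator (cball (0::'a) R) x * japanese (\<xi>::'a) powr (- 2 * real DIM('a))) z)"
      by (rule Bochner_Integration.integral_mono[OF integrable_norm[OF kernel_integrand_tensor_bound(1)[OF r \<phi>]] integrable_mult_right[OF i] b])
    also have "\<dots> = (A * test_norm N \<phi>) * I" unfolding I_def by (rule integral_mult_right_zero)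
    finally have "cmod (Op_kernel r \<phi>) \<le> cmod c * ((A * test_norm N \<phi>) * I)"
      unfolding Op_kernel_def c_def norm_mult by (rule mult_left_mono) simp
    then show ?thesis by (simp only: mult_ac)
  qed
  then show "\<exists>N B. \<forall>\<phi>\<in>test_functions. support_on UNIV \<phi> \<subseteq> C \<longrightarrow>
        cmod (Op_kernel r \<phi>) \<le> B * (\<Sum>\<alpha> | \<alpha> \<in> multi_indices \<and> mlen \<alpha> \<le> N. SUP x. cmod (mderiv \<alpha> \<phi> x))"
    unfolding test_norm_def by blast
qed

text \<open>For fixed \<open>e > 0\<close> the cutoff makes the integrand compactly supported in all
  variables, so the integration over \<open>y\<close> may be moved innermost, where it produces the
  Fourier transform.\<close>

lemma regularized_integral:
  fixes r :: "'a::euclidean_space \<Rightarrow> 'a \<Rightarrow> complex"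
  assumes r: "r \<in> lsym UNIV m" and \<phi>: "\<phi> \<in> test_functions" and \<rho>: "\<rho> \<in> test_functions" and e: "e > 0"
  shows "(LINT q|lborel. (\<lambda>((x, y), \<xi>). \<rho> (e *\<^sub>R \<xi>) * exp (\<i> * complex_of_real ((x - y) \<bullet> \<xi>)) * (case (x, y) of (x, y) \<Rightarrow> r x) \<xi> * \<phi> (x, y)) q)
    = (LINT z|lborel. (\<lambda>(x, \<xi>). \<rho> (e *\<^sub>R \<xi>) * kernel_integrand r \<phi> x \<xi>) z)"
proof -
  obtain R where R: "\<And>z. norm z > R \<Longrightarrow> \<phi> z = 0" using test_functions_support[OF \<phi>] by metis
  obtain S where S: "\<And>\<xi>. norm \<xi> > S \<Longrightarrow> \<rho> \<xi> = 0" using test_functions_support[OF \<rho>] by metis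
  have S': "\<rho> (e *\<^sub>R \<xi>) = 0" if "norm \<xi> > S / e" for \<xi>
    using S[of "e *\<^sub>R \<xi>"] that e by (simp add: pos_divide_less_eq mult.commute)
  have R1: "\<phi> (x, y) = 0" if "norm x > R" for x y by (rule R) (use that norm_fst_le[of x y] in linarith)
  have R2: "\<phi> (x, y) = 0" if "norm y > R" for x y by (rule R) (use that norm_snd_le[of y x] in linarith)
  define G where "G p \<xi> = \<rho> (e *\<^sub>R \<xi>) * cis ((fst p - snd p) \<bullet> \<xi>) * r (fst p) \<xi> * \<phi> p" for p \<xi>
  have rc: "continuous_on UNIV (\<lambda>(x, \<xi>). r x \<xi>)" by (rule smooth_on_imp_continuous_on[OF lsym_smooth_UNIV[OF r]])
  have "continuous_on UNIV (\<lambda>q::('a \<times> 'a) \<times> 'a. (\<lambda>(x, \<xi>). r x \<xi>) (fst (fst q), snd q))"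
    by (rule continuous_on_compose2[OF rc]) (auto intro!: continuous_intros)
  then have Gc: "continuous_on UNIV (\<lambda>(p, \<xi>). G p \<xi>)"
    unfolding G_def split_def fst_conv snd_conv
    by (intro continuous_on_mult continuous_on_cis continuous_intros
        continuous_on_compose2[OF test_functions_continuous[OF \<rho>, of UNIV]] continuous_on_compose2[OF test_functions_continuous[OF \<phi>, of UNIV]]) auto
  have Gc': "continuous_on UNIV (\<lambda>(x, y). G (x, y) \<xi>)" for \<xi>
    using continuous_on_slice(2)[OF Gc, of \<xi>] by (simp add: split_def)
  have G0: "G p \<xi> = 0" if "norm p > R" for p \<xi> using R[OF that] by (simp add: G_def)
  have G1: "G p \<xi> = 0" if "norm \<xi> > S / e" for p \<xi> using S'[OF that] by (simp add: G_def)
  define H where "H x \<xi> = \<rho> (e *\<^sub>R \<xi>) * kernel_integrand r \<phi> x \<xi>" for x \<xi>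
  have Hc: "continuous_on UNIV (\<lambda>(x, \<xi>). H x \<xi>)"
    using kernel_integrand_continuous[OF r \<phi>] unfolding H_def split_def
    by (intro continuous_on_mult continuous_on_compose2[OF test_functions_continuous[OF \<rho>, of UNIV]] continuous_intros) auto
  have H0: "H x \<xi> = 0" if "norm x > R" for x \<xi> using kernel_integrand_eq_0[OF R that] by (simp add: H_def)
  have H1: "H x \<xi> = 0" if "norm \<xi> > S / e" for x \<xi> using S'[OF that] by (simp add: H_def)
  have "(LINT q|lborel. (\<lambda>((x, y), \<xi>). \<rho> (e *\<^sub>R \<xi>) * exp (\<i> * complex_of_real ((x - y) \<bullet> \<xi>)) * (case (x, y) of (x, y) \<Rightarrow> r x) \<xi> * \<phi> (x, y)) q)
      = (LINT q|lborel. (\<lambda>(p, \<xi>). G p \<xi>) q)"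
    by (rule Bochner_Integration.integral_cong[OF refl]) (auto simp: G_def cis_conv_exp)
  also have "\<dots> = (LINT p|lborel. LINT \<xi>|lborel. G p \<xi>)"
    by (rule integral_bounded_support_iterated[OF Gc G0 G1])
  also have "\<dots> = (LINT \<xi>|lborel. LINT p|lborel. G p \<xi>)"
    by (rule fubini_bounded_support[OF Gc G0 G1, symmetric])
  also have "\<dots> = (LINT \<xi>|lborel. LINT x|lborel. H x \<xi>)"
  proof (rule Bochner_Integration.integral_cong[OF refl])
    fix \<xi>
    have "(LINT p|lborel. G p \<xi>) = (LINT p|lborel. (\<lambda>(x, y). G (x, y) \<xi>) p)" by simp
    also have "\<dots> = (LINT x|lborel. LINT y|lborel. G (x, y) \<xi>)"
      by (rule integral_bounded_support_iterated[OF Gc', where R = R and S = R]) (simp_all add: G_def R1 R2)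
    also have "\<dots> = (LINT x|lborel. H x \<xi>)"
    proof (rule Bochner_Integration.integral_cong[OF refl])
      fix x
      have "cis ((x - y) \<bullet> \<xi>) = cis (x \<bullet> \<xi>) * cis (- (y \<bullet> \<xi>))" for y by (simp add: cis_mult inner_diff_left)
      then have "G (x, y) \<xi> = (\<rho> (e *\<^sub>R \<xi>) * cis (x \<bullet> \<xi>) * r x \<xi>) * (cis (- (y \<bullet> \<xi>)) * \<phi> (x, y))" for y
        by (simp add: G_def mult_ac)
      then have "(LINT y|lborel. G (x, y) \<xi>) = (\<rho> (e *\<^sub>R \<xi>) * cis (x \<bullet> \<xi>) * r x \<xi>) * ft (\<lambda>y. \<phi> (x, y)) \<xi>"
        by (simp only: integral_mult_right_zero ft_def)
      then show "(LINT y|lborel. G (x, y) \<xi>) = H x \<xi>" by (simp add: H_def kernel_integrand_def mult_ac)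
    qed
    finally show "(LINT p|lborel. G p \<xi>) = (LINT x|lborel. H x \<xi>)" .
  qed
  also have "\<dots> = (LINT x|lborel. LINT \<xi>|lborel. H x \<xi>)"
    by (rule fubini_bounded_support[OF Hc H0 H1])
  also have "\<dots> = (LINT z|lborel. (\<lambda>(x, \<xi>). H x \<xi>) z)"
    by (rule integral_bounded_support_iterated[OF Hc H0 H1, symmetric])
  finally show ?thesis unfolding H_def .
qed

text \<open>Once \<open>y\<close> has been integrated out, the integrand is integrable even without
  the cutoff, so the limit is one of dominated convergence. It is the same for all cutoffs because
  they are bounded, continuous and equal to \<open>1\<close> at the origin.\<close>

lemma osc_integral_Op_kernel:
  fixes r :: "'a::euclidean_space \<Rightarrow> 'a \<Rightarrow> complex"
  assumes r: "r \<in> lsym UNIV m"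
  shows "osc_integral (\<lambda>(x, y). r x) (Op_kernel r)"
  unfolding osc_integral_def
proof (intro ballI)
  fix \<phi> :: "'a \<times> 'a \<Rightarrow> complex" and \<rho> :: "'a \<Rightarrow> complex"
  assume \<phi>: "\<phi> \<in> test_functions" and "\<rho> \<in> cutoffs"
  then have \<rho>: "\<rho> \<in> test_functions" and ev: "\<forall>\<^sub>F x in nhds 0. \<rho> x = 1" by (auto simp: cutoffs_def)
  have \<rho>0: "\<rho> 0 = 1" by (rule eventually_nhds_x_imp_x[OF ev])
  obtain B where B: "B > 0" "\<And>\<xi>. cmod (\<rho> \<xi>) \<le> B" using test_functions_bounded[OF \<rho>] by blast
  define F where "F = (\<lambda>(x, \<xi>). kernel_integrand r \<phi> x \<xi>)"
  have Fi: "integrable lborel F" unfolding F_def by (rule kernel_integrand_tensor_bound(1)[OF r \<phi>])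
  have Fc: "continuous_on UNIV F" unfolding F_def by (rule kernel_integrand_continuous[OF r \<phi>])
  have \<rho>c: "continuous_on UNIV (\<lambda>z::'a \<times> 'a. \<rho> (e *\<^sub>R snd z))" for e
    by (intro continuous_on_compose2[OF test_functions_continuous[OF \<rho>, of UNIV]] continuous_intros) auto
  show "((\<lambda>\<epsilon>. complex_of_real (1 / (2 * pi) ^ DIM('a)) *
        integral\<^sup>L lborel (\<lambda>((x, y), \<xi>).
           \<rho> (\<epsilon> *\<^sub>R \<xi>) * exp (\<i> * complex_of_real ((x - y) \<bullet> \<xi>)) * (case (x, y) of (x, y) \<Rightarrow> r x) \<xi> * \<phi> (x, y)))
      \<longlongrightarrow> Op_kernel r \<phi>) (at_right 0)"
  proof (rule tendsto_at_right_sequentially[of 0 1])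
    fix X :: "nat \<Rightarrow> real" assume X: "\<And>n. 0 < X n" "X \<longlonglongrightarrow> 0"
    have "(\<lambda>n. LINT z|lborel. \<rho> (X n *\<^sub>R snd z) * F z) \<longlonglongrightarrow> (LINT z|lborel. F z)"
    proof (rule integral_dominated_convergence[where w = "\<lambda>z. B * norm (F z)"])
      show "F \<in> borel_measurable lborel" using borel_measurable_continuous_onI[OF Fc] by simp
      show "(\<lambda>z. \<rho> (X n *\<^sub>R snd z) * F z) \<in> borel_measurable lborel" for n
        using borel_measurable_continuous_onI[OF continuous_on_mult[OF \<rho>c Fc]] by simp
      show "integrable lborel (\<lambda>z. B * norm (F z))" by (intro integrable_mult_right integrable_norm Fi)
      show "AE z in lborel. (\<lambda>n. \<rho> (X n *\<^sub>R snd z) * F z) \<longlonglongrightarrow> F z"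
      proof (rule AE_I2)
        fix z :: "'a \<times> 'a"
        have "(\<lambda>n. X n *\<^sub>R snd z) \<longlonglongrightarrow> 0 *\<^sub>R snd z" by (intro tendsto_intros X(2))
        moreover have "isCont \<rho> (0 *\<^sub>R snd z)"
          using test_functions_continuous[OF \<rho>, of UNIV] by (simp add: continuous_on_eq_continuous_at)
        ultimately have "(\<lambda>n. \<rho> (X n *\<^sub>R snd z)) \<longlonglongrightarrow> \<rho> (0 *\<^sub>R snd z)" by (rule isCont_tendsto_compose[rotated])
        then have "(\<lambda>n. \<rho> (X n *\<^sub>R snd z) * F z) \<longlonglongrightarrow> \<rho> (0 *\<^sub>R snd z) * F z" by (rule tendsto_mult_right)
        then show "(\<lambda>n. \<rho> (X n *\<^sub>R snd z) * F z) \<longlonglongrightarrow> F z" by (simp add: \<rho>0)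
      qed
      show "AE z in lborel. norm (\<rho> (X n *\<^sub>R snd z) * F z) \<le> B * norm (F z)" for n
        by (rule AE_I2) (simp add: norm_mult mult_right_mono B(2))
    qed
    then have lim: "(\<lambda>n. complex_of_real (1 / (2 * pi) ^ DIM('a)) * (LINT z|lborel. \<rho> (X n *\<^sub>R snd z) * F z)) \<longlonglongrightarrow> Op_kernel r \<phi>"
      unfolding Op_kernel_def F_def by (rule tendsto_mult_left)
    have eq: "integral\<^sup>L lborel (\<lambda>((x, y), \<xi>).
           \<rho> (X n *\<^sub>R \<xi>) * exp (\<i> * complex_of_real ((x - y) \<bullet> \<xi>)) * (case (x, y) of (x, y) \<Rightarrow> r x) \<xi> * \<phi> (x, y))
        = (LINT z|lborel. \<rho> (X n *\<^sub>R snd z) * F z)" for n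
      using regularized_integral[OF r \<phi> \<rho> X(1)] by (simp add: F_def split_def)
    show "(\<lambda>n. complex_of_real (1 / (2 * pi) ^ DIM('a)) *
        integral\<^sup>L lborel (\<lambda>((x, y), \<xi>).
           \<rho> (X n *\<^sub>R \<xi>) * exp (\<i> * complex_of_real ((x - y) \<bullet> \<xi>)) * (case (x, y) of (x, y) \<Rightarrow> r x) \<xi> * \<phi> (x, y)))
      \<longlonglongrightarrow> Op_kernel r \<phi>"
      unfolding eq by (rule lim)
  qed simp
qed

text \<open>Limits are unique; that a cutoff exists at all, so that \<open>osc_integral\<close> is
  not vacuous, is \<open>bump_cutoffs\<close>.\<close>

lemma osc_integral_unique:
  assumes "osc_integral a K" "osc_integral a K'" "\<phi> \<in> test_functions"
  shows "K \<phi> = K' \<phi>"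
  using assms bump_cutoffs unfolding osc_integral_def
  by (meson tendsto_unique trivial_limit_at_right_real)

lemma Op_kernel_tensor:
  fixes r :: "'a::euclidean_space \<Rightarrow> 'a \<Rightarrow> complex"
  assumes r: "r \<in> lsym UNIV m" and u: "u \<in> test_functions" and v: "v \<in> test_functions"
  shows "Op_kernel r (\<lambda>(x, y). v x * u y) = (LINT x|lborel. Op r u x * v x)"
proof -
  define c where "c = complex_of_real (1 / (2 * pi) ^ DIM('a))"
  have "kernel_integrand r (\<lambda>(x, y). v x * u y) x \<xi> = v x * (cis (x \<bullet> \<xi>) * r x \<xi> * ft u \<xi>)" for x \<xi>
    unfolding kernel_integrand_def prod.case ft_cmult by (simp only: mult_ac)
  then have "(LINT \<xi>|lborel. kernel_integrand r (\<lambda>(x, y). v x * u y) x \<xi>) = v x * (LINT \<xi>|lborel. cis (x \<bullet> \<xi>) * r x \<xi> * ft u \<xi>)" for x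
    by (simp only: integral_mult_right_zero)
  then have "Op_kernel r (\<lambda>(x, y). v x * u y) = (LINT x|lborel. c * (v x * (LINT \<xi>|lborel. cis (x \<bullet> \<xi>) * r x \<xi> * ft u \<xi>)))"
    unfolding Op_kernel_def kernel_integrand_tensor_bound(2)[OF r test_functions_tensor[OF v u]] c_def[symmetric]
    by (simp only: integral_mult_right_zero)
  also have "\<dots> = (LINT x|lborel. Op r u x * v x)"
    by (rule Bochner_Integration.integral_cong[OF refl]) (simp only: Op_eq c_def mult_ac)
  finally show ?thesis .
qed

lemma schwartz_kernel_Op:
  fixes P :: "('a::euclidean_space \<Rightarrow> complex) \<Rightarrow> 'a \<Rightarrow> complex"
  assumes r: "r \<in> lsym UNIV m" and P: "\<And>u x. u \<in> test_functions \<Longrightarrow> P u x = Op r u x"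
  shows "schwartz_kernel P (Op_kernel r)"
  unfolding schwartz_kernel_def
proof (intro conjI ballI)
  show "distribution (Op_kernel r)" by (rule distribution_Op_kernel[OF r])
  fix u :: "'a \<Rightarrow> complex" assume u: "u \<in> test_functions"
  have eq: "P u = Op r u" using P[OF u] by (rule ext)
  show "smooth_on UNIV (P u)" unfolding eq by (rule Op_smooth[OF r u])
  fix v :: "'a \<Rightarrow> complex" assume v: "v \<in> test_functions"
  show "(LINT x|lborel. P u x * v x) = Op_kernel r (\<lambda>(x, y). v x * u y)"
    unfolding eq Op_kernel_tensor[OF r u v] ..
qed

section \<open>Operators given by a left symbol modulo a smooth kernel\<close>

lemma csmooth_kernel:
  assumes k: "smooth_on UNIV k" and u: "u \<in> test_functions"
  shows "csmooth (\<lambda>x y. k (x, y) * u y)"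
proof -
  obtain S where S: "\<And>y. norm y > S \<Longrightarrow> u y = 0" using test_functions_support[OF u] by metis
  have "smooth_on UNIV (\<lambda>z. k z * u (snd z))"
    by (intro smooth_on_mult open_UNIV k smooth_on_compose_linear0[OF bounded_linear_snd open_UNIV open_UNIV UNIV_I] test_functions_smooth[OF u])
  then show ?thesis using S unfolding csmooth_def by (auto simp: split_def)
qed

text \<open>The kernel gives this identity only after pairing with test functions \<open>v\<close>;
  as both sides are continuous in \<open>x\<close>, \<open>test_functions_separate\<close> makes it
  pointwise.\<close>

lemma total_left_symbol_representation:
  fixes P :: "('a::euclidean_space \<Rightarrow> complex) \<Rightarrow> 'a \<Rightarrow> complex"
  assumes "total_left_symbol m P p"
  obtains k where "p \<in> lsym UNIV m" "smooth_on UNIV k"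
    "\<And>u x. u \<in> test_functions \<Longrightarrow> P u x = Op p u x + (LINT y|lborel. k (x, y) * u y)"
proof -
  obtain K k where p: "p \<in> lsym UNIV m" and K: "osc_integral (\<lambda>(x, y). p x) K" and k: "smooth_on UNIV k"
    and P: "schwartz_kernel P (\<lambda>\<phi>. K \<phi> + (LINT z|lborel. k z * \<phi> z))"
    using assms unfolding total_left_symbol_def symbols_eq_lsym by blast
  have "P u x = Op p u x + (LINT y|lborel. k (x, y) * u y)" if u: "u \<in> test_functions" for u x
  proof -
    define T where "T x = (LINT y|lborel. k (x, y) * u y)" for x
    have ku: "csmooth (\<lambda>x y. k (x, y) * u y)" by (rule csmooth_kernel[OF k u])
    have Tc: "continuous_on UNIV T" unfolding T_def by (rule dominated_continuous_integral[OF csmooth_dominated[OF ku]])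
    have Oc: "continuous_on UNIV (Op p u)" by (rule smooth_on_imp_continuous_on[OF Op_smooth[OF p u]])
    have Pc: "continuous_on UNIV (P u)" by (rule smooth_on_imp_continuous_on[OF schwartz_kernelD(2)[OF P u]])
    have "P u x - (Op p u x + T x) = 0"
    proof (rule test_functions_separate[where f = "\<lambda>x. P u x - (Op p u x + T x)", OF open_UNIV UNIV_I])
      show "continuous_on UNIV (\<lambda>x. P u x - (Op p u x + T x))" by (intro continuous_intros Pc Oc Tc)
      fix v :: "'a \<Rightarrow> complex" assume v: "v \<in> test_functions"
      obtain R where R: "\<And>x. norm x > R \<Longrightarrow> v x = 0" using test_functions_support[OF v] by metis
      obtain S where S: "\<And>y. norm y > S \<Longrightarrow> u y = 0" using test_functions_support[OF u] by metis
      have vc: "continuous_on UNIV v" by (rule test_functions_continuous[OF v])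
      have i: "integrable lborel (\<lambda>x. g x * v x)" if "continuous_on UNIV g" for g
        by (rule integrable_bounded_support[of _ R]) (use R in \<open>auto intro!: continuous_intros that vc\<close>)
      have "(LINT z|lborel. k z * (\<lambda>(x, y). v x * u y) z) = (LINT z|lborel. (\<lambda>(x, y). v x * (k (x, y) * u y)) z)"
        by (rule Bochner_Integration.integral_cong[OF refl]) (simp add: split_def)
      also have "\<dots> = (LINT x|lborel. LINT y|lborel. v x * (k (x, y) * u y))"
      proof (rule integral_bounded_support_iterated[of _ R S])
        have "continuous_on UNIV (\<lambda>z. v (fst z) * (\<lambda>(x, y). k (x, y) * u y) z)"
          by (intro continuous_on_mult smooth_on_imp_continuous_on[OF csmooth_smooth[OF ku]]
              continuous_on_compose2[OF vc] continuous_intros) auto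
        then show "continuous_on UNIV (\<lambda>(x, y). v x * (k (x, y) * u y))" by (simp add: split_def)
      qed (simp_all add: R S)
      also have "\<dots> = (LINT x|lborel. T x * v x)"
        unfolding T_def integral_mult_right_zero by (simp only: mult.commute)
      finally have "(LINT x|lborel. P u x * v x) = (LINT x|lborel. Op p u x * v x) + (LINT x|lborel. T x * v x)"
        using schwartz_kernelD(3)[OF P u v] osc_integral_unique[OF K osc_integral_Op_kernel[OF p] test_functions_tensor[OF v u]]
          Op_kernel_tensor[OF p u v] by simp
      moreover have "(LINT x|lborel. (P u x - (Op p u x + T x)) * v x)
          = (LINT x|lborel. P u x * v x) - ((LINT x|lborel. Op p u x * v x) + (LINT x|lborel. T x * v x))"
        unfolding left_diff_distrib distrib_right
        by (simp only: Bochner_Integration.integral_diff[OF i[OF Pc] Bochner_Integration.integrable_add[OF i[OF Oc] i[OF Tc]]]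
            Bochner_Integration.integral_add[OF i[OF Oc] i[OF Tc]])
      ultimately show "(LINT x|lborel. (P u x - (Op p u x + T x)) * v x) = 0" by simp
    qed
    then show ?thesis by (simp add: T_def)
  qed
  then show ?thesis using that p k by blast
qed

text \<open>The Fourier multiplier \<open>ft h\<close> is convolution with \<open>h\<close>. Letting
  \<open>h\<close> depend on the point \<open>x\<close> at which the result is evaluated, one gets
  the symbol of a smooth kernel.\<close>

lemma convolution_Op:
  fixes h u :: "'a::euclidean_space \<Rightarrow> complex"
  assumes h: "h \<in> test_functions" and u: "u \<in> test_functions"
  shows "complex_of_real (1 / (2 * pi) ^ DIM('a)) * (LINT \<xi>|lborel. cis (x \<bullet> \<xi>) * ft h \<xi> * ft u \<xi>) = (LINT z|lborel. h z * u (x - z))"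
proof -
  define F where "F \<xi> z = cis ((x - z) \<bullet> \<xi>) * h z * ft u \<xi>" for \<xi> z
  have Fc: "continuous_on UNIV (\<lambda>(\<xi>, z). F \<xi> z)"
    unfolding F_def split_def
    by (intro continuous_on_mult continuous_on_cis continuous_intros
        continuous_on_compose2[OF test_functions_continuous[OF h, of UNIV]] continuous_on_compose2[OF integrable_ft_test(3)[OF u]]) auto
  have cz: "cis ((x - z) \<bullet> \<xi>) = cis (x \<bullet> \<xi>) * cis (- (z \<bullet> \<xi>))" for z \<xi> by (simp add: cis_mult inner_diff_left)
  have "(LINT \<xi>|lborel. cis (x \<bullet> \<xi>) * ft h \<xi> * ft u \<xi>) = (LINT \<xi>|lborel. LINT z|lborel. F \<xi> z)"
  proof (rule Bochner_Integration.integral_cong[OF refl])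
    fix \<xi>
    have "F \<xi> z = (cis (x \<bullet> \<xi>) * ft u \<xi>) * (cis (- (z \<bullet> \<xi>)) * h z)" for z by (simp add: F_def cz mult_ac)
    then have "(LINT z|lborel. F \<xi> z) = (cis (x \<bullet> \<xi>) * ft u \<xi>) * ft h \<xi>"
      by (simp only: integral_mult_right_zero ft_def[of h])
    then show "cis (x \<bullet> \<xi>) * ft h \<xi> * ft u \<xi> = (LINT z|lborel. F \<xi> z)" by (simp only: mult_ac)
  qed
  also have "\<dots> = (LINT z|lborel. LINT \<xi>|lborel. F \<xi> z)"
  proof (rule fubini_tensor_bound[symmetric, OF Fc])
    show "integrable lborel (\<lambda>\<xi>. cmod (ft u \<xi>))" "integrable lborel (\<lambda>z. cmod (h z))"
      by (intro integrable_norm integrable_ft_test(1) test_functions_integrable h u)+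
  qed (simp add: F_def norm_mult)
  also have "\<dots> = (LINT z|lborel. complex_of_real ((2 * pi) ^ DIM('a)) * (h z * u (x - z)))"
  proof (rule Bochner_Integration.integral_cong[OF refl])
    fix z
    have "F \<xi> z = h z * (cis ((x - z) \<bullet> \<xi>) * ft u \<xi>)" for \<xi> by (simp add: F_def)
    then have "(LINT \<xi>|lborel. F \<xi> z) = h z * (complex_of_real ((2 * pi) ^ DIM('a)) * u (x - z))"
      by (simp only: integral_mult_right_zero fourier_inversion[OF u integrable_ft_test(1)[OF u]])
    then show "(LINT \<xi>|lborel. F \<xi> z) = complex_of_real ((2 * pi) ^ DIM('a)) * (h z * u (x - z))" by (simp only: mult_ac)
  qed
  finally show ?thesis by (simp only: integral_mult_right_zero) simp
qed

text \<open>Cut off outside a ball, the kernel is \<open>g(x, x - y)\<close> with \<open>g\<close> smooth and compactly supported in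
  its second argument, so its symbol is the Fourier transform of \<open>g(x, \<sqdot>)\<close>.\<close>

lemma smooth_kernel_local_symbol:
  fixes k :: "'a::euclidean_space \<times> 'a \<Rightarrow> complex"
  assumes k: "smooth_on UNIV k" and R: "R > 0"
  obtains \<sigma> where "\<And>M. \<sigma> \<in> lsym UNIV M"
    "\<And>u x. u \<in> test_functions \<Longrightarrow> (\<And>y. norm y > R \<Longrightarrow> u y = 0) \<Longrightarrow> norm x \<le> R \<Longrightarrow>
      (LINT y|lborel. k (x, y) * u y) = Op \<sigma> u x"
proof -
  define \<beta> where "\<beta> = (bump 0 R :: 'a \<Rightarrow> complex)"
  have \<beta>1: "\<beta> x = 1" if "norm x \<le> R" for x unfolding \<beta>_def using that by (intro bump(2)[OF R]) simp
  have \<beta>0: "\<beta> x = 0" if "norm x \<ge> 2 * R" for x unfolding \<beta>_def using that by (intro bump_test(3)[OF R]) simp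
  have \<beta>s: "smooth_on UNIV \<beta>" unfolding \<beta>_def by (rule bump(1)[OF R])
  \<comment> \<open>Only together do the two cutoffs confine \<open>z = x - (x - z)\<close> to a
    ball uniformly in \<open>x\<close>. Both are \<open>1\<close> when \<open>x\<close> and
    \<open>y = x - z\<close> lie in the ball of radius \<open>R\<close>.\<close>
  define g where "g x z = \<beta> x * k (x, x - z) * \<beta> (x - z)" for x z
  have l1: "bounded_linear (\<lambda>p::'a \<times> 'a. fst p - snd p)" and l2: "bounded_linear (\<lambda>p::'a \<times> 'a. (fst p, fst p - snd p))"
    by (intro bounded_linear_Pair bounded_linear_sub bounded_linear_fst bounded_linear_snd)+
  have "smooth_on UNIV (\<lambda>p. \<beta> (fst p) * k (fst p, fst p - snd p) * \<beta> (fst p - snd p))"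
    by (intro smooth_on_mult open_UNIV smooth_on_compose_linear0[OF bounded_linear_fst open_UNIV open_UNIV UNIV_I \<beta>s]
        smooth_on_compose_linear0[OF l1 open_UNIV open_UNIV UNIV_I \<beta>s] smooth_on_compose_linear0[OF l2 open_UNIV open_UNIV UNIV_I k])
  moreover have "g x z = 0" if "norm z > 4 * R" for x z
  proof -
    have "norm z \<le> norm x + norm (x - z)" using norm_triangle_ineq4[of x "x - z"] by simp
    then have "norm x \<ge> 2 * R \<or> norm (x - z) \<ge> 2 * R" using that by linarith
    then show ?thesis using \<beta>0 by (auto simp: g_def)
  qed
  ultimately have g: "csmooth g" unfolding csmooth_def g_def[abs_def] split_def by auto
  have "(LINT y|lborel. k (x, y) * u y) = Op (\<lambda>x. ft (g x)) u x"
    if u: "u \<in> test_functions" "\<And>y. norm y > R \<Longrightarrow> u y = 0" and x: "norm x \<le> R" for u x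
  proof -
    have "continuous_on UNIV (\<lambda>y. k (x, y) * u y)"
      by (rule continuous_on_slice(1)[OF smooth_on_imp_continuous_on[OF csmooth_smooth[OF csmooth_kernel[OF k u(1)]]]])
    from lborel_integral_affine[OF borel_measurable_continuous_onI[OF this], of "-1" x]
    have "(LINT y|lborel. k (x, y) * u y) = (LINT z|lborel. k (x, x - z) * u (x - z))" by simp
    also have "\<dots> = (LINT z|lborel. g x z * u (x - z))"
    proof (rule Bochner_Integration.integral_cong[OF refl])
      fix z show "k (x, x - z) * u (x - z) = g x z * u (x - z)"
        using u(2)[of "x - z"] \<beta>1[OF x] \<beta>1[of "x - z"] by (cases "norm (x - z) \<le> R") (auto simp: g_def)
    qed
    also have "\<dots> = Op (\<lambda>x. ft (g x)) u x"
      unfolding Op_eq convolution_Op[OF csmooth_slice_test[OF g] u(1)] ..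
    finally show ?thesis .
  qed
  then show ?thesis using that[of "\<lambda>x. ft (g x)"] ft_lsym[OF g] by blast
qed

text \<open>The correction of the symbol depends on \<open>R\<close> but has order
  \<open>-\<infinity>\<close>, so it does not affect asymptotic expansions; in exchange
  \<open>P\<close> is an exact quantization for arguments and points in the ball.\<close>

lemma local_symbol_representation:
  fixes P :: "('a::euclidean_space \<Rightarrow> complex) \<Rightarrow> 'a \<Rightarrow> complex"
  assumes P: "total_left_symbol m P p" and R: "R > 0"
  obtains p' where "p' \<in> lsym UNIV m" "\<And>M. (\<lambda>x \<xi>. p' x \<xi> - p x \<xi>) \<in> lsym UNIV M"
    "\<And>u x. u \<in> test_functions \<Longrightarrow> (\<And>y. norm y > R \<Longrightarrow> u y = 0) \<Longrightarrow> norm x \<le> R \<Longrightarrow> P u x = Op p' u x"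
proof -
  obtain k where p: "p \<in> lsym UNIV m" and k: "smooth_on UNIV k"
    and rep: "\<And>u x. u \<in> test_functions \<Longrightarrow> P u x = Op p u x + (LINT y|lborel. k (x, y) * u y)"
    proof (rule total_left_symbol_representation[OF P], goal_cases)
      case (1 z)
      show ?case by (rule that; fact 1)
    qed
  obtain \<sigma> where \<sigma>: "\<And>M. \<sigma> \<in> lsym UNIV M"
    "\<And>u x. u \<in> test_functions \<Longrightarrow> (\<And>y. norm y > R \<Longrightarrow> u y = 0) \<Longrightarrow> norm x \<le> R \<Longrightarrow>
      (LINT y|lborel. k (x, y) * u y) = Op \<sigma> u x"
    proof (rule smooth_kernel_local_symbol[OF k R], goal_cases)
      case (1 z)
      show ?case by (rule that; fact 1)
    qed
  have "P u x = Op (\<lambda>x \<xi>. p x \<xi> + \<sigma> x \<xi>) u x"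
    if "u \<in> test_functions" "\<And>y. norm y > R \<Longrightarrow> u y = 0" "norm x \<le> R" for u x
    using rep[OF that(1)] \<sigma>(2)[OF that] Op_add_symbol[OF p \<sigma>(1) that(1)] by simp
  then show ?thesis
    using that[of "\<lambda>x \<xi>. p x \<xi> + \<sigma> x \<xi>"] lsym_add[OF open_UNIV p \<sigma>(1)] \<sigma>(1) by simp
qed

text \<open>Operators are arbitrary maps between functions; their additivity on test functions has
  to be derived from the kernel, by way of the integral representation.\<close>

lemma total_left_symbol_diff:
  fixes P :: "('a::euclidean_space \<Rightarrow> complex) \<Rightarrow> 'a \<Rightarrow> complex"
  assumes P: "total_left_symbol m P p" and u: "u \<in> test_functions" and v: "v \<in> test_functions"
  shows "P (\<lambda>y. u y - v y) x = P u x - P v x"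
proof -
  obtain k where p: "p \<in> lsym UNIV m" and k: "smooth_on UNIV k"
    and rep: "\<And>u x. u \<in> test_functions \<Longrightarrow> P u x = Op p u x + (LINT y|lborel. k (x, y) * u y)"
    proof (rule total_left_symbol_representation[OF P], goal_cases)
      case (1 z)
      show ?case by (rule that; fact 1)
    qed
  have i: "integrable lborel (\<lambda>y. k (x, y) * w y)" if "w \<in> test_functions" for w
    by (rule dominatedD(4)[OF csmooth_dominated[OF csmooth_kernel[OF k that]]])
  show ?thesis
    unfolding rep[OF u] rep[OF v] rep[OF test_functions_diff[OF u v]] Op_diff[OF p u v] right_diff_distrib
      Bochner_Integration.integral_diff[OF i[OF u] i[OF v]] by simp
qed

subsection \<open>Composition of properly supported operators\<close>

lemma Op_mult_left: "Op (\<lambda>x \<xi>. f x * a x \<xi>) u x = f x * Op a u x"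
proof -
  have "cis (x \<bullet> \<xi>) * (f x * a x \<xi>) * ft u \<xi> = f x * (cis (x \<bullet> \<xi>) * a x \<xi> * ft u \<xi>)" for \<xi> by simp
  then show ?thesis unfolding Op_eq by (simp only: integral_mult_right_zero mult.left_commute)
qed

text \<open>Of the two groups of \<open>k\<close> derivatives only those in \<open>\<xi>\<close>,
  which fall on \<open>p\<close>, lower the order.\<close>

lemma comp_term_lsym:
  fixes p w :: "'a::euclidean_space \<Rightarrow> 'a \<Rightarrow> complex"
  assumes "open U" "p \<in> lsym U m" "w \<in> lsym U m'"
  shows "comp_term k p w \<in> lsym U (m + m' - real k)"
proof -
  have "(\<lambda>x \<xi>. ider l (p x) \<xi> * ider l (\<lambda>x. w x \<xi>) x) \<in> lsym U (m + m' - real k)" if "l \<in> words k" for l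
    using lsym_mult[OF assms(1) lsym_ider_right[OF assms(2) wordsD(1)[OF that]] lsym_ider_left[OF assms(3) wordsD(1)[OF that]]]
    by (simp add: wordsD(2)[OF that] algebra_simps)
  then show ?thesis
    unfolding comp_term_def[abs_def] by (intro lsym_cmult lsym_sum assms(1))
qed

lemma smooth_on_slice_open:
  assumes "open V" "smooth_on (V \<times> UNIV) (\<lambda>(x, \<theta>). a x \<theta>)"
  shows "x \<in> V \<Longrightarrow> smooth_on UNIV (a x)" "smooth_on V (\<lambda>x. a x \<theta>)"
proof -
  have o: "open (V \<times> (UNIV :: 'b set))" using assms(1) by (simp add: open_Times)
  have l: "bounded_linear (\<lambda>y::'b. (0::'a, y))" "bounded_linear (\<lambda>z::'a. (z, 0::'b))"
    by (intro bounded_linear_Pair bounded_linear_zero bounded_linear_ident)+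
  show "smooth_on UNIV (a x)" if "x \<in> V"
    using smooth_on_compose_linear[OF l(1) open_UNIV o _ assms(2), of "(x, 0)"] that by simp
  show "smooth_on V (\<lambda>x. a x \<theta>)"
    using smooth_on_compose_linear[OF l(2) assms(1) o _ assms(2), of "(0, \<theta>)"] by simp
qed

lemma comp_term_sum_left:
  assumes U: "open U" "x \<in> U" and a: "\<And>j. j \<in> J \<Longrightarrow> a j \<in> lsym U (m j)"
  shows "comp_term k (\<lambda>x \<xi>. \<Sum>j\<in>J. a j x \<xi>) w x \<xi> = (\<Sum>j\<in>J. comp_term k (a j) w x \<xi>)"
proof -
  have "ider l (\<lambda>\<xi>. \<Sum>j\<in>J. a j x \<xi>) \<xi> = (\<Sum>j\<in>J. ider l (a j x) \<xi>)" if "l \<in> words k" for l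
    by (rule ider_sum[OF open_UNIV smooth_on_slice_open(1)[OF U(1) lsym_smooth[OF U(1) a] U(2)] wordsD(1)[OF that] UNIV_I])
  then have "comp_term k (\<lambda>x \<xi>. \<Sum>j\<in>J. a j x \<xi>) w x \<xi>
      = (- \<i>) ^ k / fact k * (\<Sum>l\<in>words k. \<Sum>j\<in>J. ider l (a j x) \<xi> * ider l (\<lambda>x. w x \<xi>) x)"
    by (simp add: comp_term_def sum_distrib_right)
  also have "\<dots> = (\<Sum>j\<in>J. comp_term k (a j) w x \<xi>)"
    unfolding comp_term_def sum.swap[of _ J] by (rule sum_distrib_left)
  finally show ?thesis .
qed

lemma comp_term_sum_right:
  assumes U: "open U" "x \<in> U" and a: "\<And>j. j \<in> J \<Longrightarrow> a j \<in> lsym U (m j)"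
  shows "comp_term k p (\<lambda>x \<xi>. \<Sum>j\<in>J. a j x \<xi>) x \<xi> = (\<Sum>j\<in>J. comp_term k p (a j) x \<xi>)"
proof -
  have "ider l (\<lambda>x. \<Sum>j\<in>J. a j x \<xi>) x = (\<Sum>j\<in>J. ider l (\<lambda>x. a j x \<xi>) x)" if "l \<in> words k" for l
    by (rule ider_sum[OF U(1) smooth_on_slice_open(2)[OF U(1) lsym_smooth[OF U(1) a]] wordsD(1)[OF that] U(2)])
  then have "comp_term k p (\<lambda>x \<xi>. \<Sum>j\<in>J. a j x \<xi>) x \<xi>
      = (- \<i>) ^ k / fact k * (\<Sum>l\<in>words k. \<Sum>j\<in>J. ider l (p x) \<xi> * ider l (\<lambda>x. a j x \<xi>) x)"
    by (simp add: comp_term_def sum_distrib_left[of "ider _ _ _"])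
  also have "\<dots> = (\<Sum>j\<in>J. comp_term k p (a j) x \<xi>)"
    unfolding comp_term_def sum.swap[of _ J] by (rule sum_distrib_left)
  finally show ?thesis .
qed

lemma comp_term_cong_right:
  assumes "open U" "x \<in> U" "\<And>x. x \<in> U \<Longrightarrow> w x \<xi> = w' x \<xi>"
  shows "comp_term k p w x \<xi> = comp_term k p w' x \<xi>"
  unfolding comp_term_def using ider_cong_open[OF assms(1,3,2)] by simp

text \<open>The telescoping \<open>p' w' - p w = (p' - p) w' + p (w' - w)\<close>, carried over to
  \<open>comp_term\<close>: the differences have every order, hence so do both terms.\<close>

lemma comp_term_perturb:
  fixes p p' w w' :: "'a::euclidean_space \<Rightarrow> 'a \<Rightarrow> complex"
  assumes U: "open U" and p: "p \<in> lsym U m" and w': "w' \<in> lsym U m'"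
    and dp: "\<And>M. (\<lambda>x \<xi>. p' x \<xi> - p x \<xi>) \<in> lsym U M" and dw: "\<And>M. (\<lambda>x \<xi>. w' x \<xi> - w x \<xi>) \<in> lsym U M"
    and w: "w \<in> lsym U m'"
  shows "(\<lambda>x \<xi>. comp_term k p' w' x \<xi> - comp_term k p w x \<xi>) \<in> lsym U M"
proof -
  define dp where "dp x \<xi> = p' x \<xi> - p x \<xi>" for x \<xi>
  define dw where "dw x \<xi> = w' x \<xi> - w x \<xi>" for x \<xi>
  have dpl: "dp \<in> lsym U M" and dwl: "dw \<in> lsym U M" for M
    using assms(4)[of M] assms(5)[of M] unfolding dp_def[abs_def] dw_def[abs_def] by auto
  have 1: "comp_term k dp w' \<in> lsym U M"
    using comp_term_lsym[OF U dpl[of "M + real k - m'"] w', of k] by simp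
  have 2: "comp_term k p dw \<in> lsym U M"
    using comp_term_lsym[OF U p dwl[of "M + real k - m"], of k] by simp
  \<comment> \<open>Sums over the two truth values turn the additivity lemmas for finite families
    into additivity for two summands.\<close>
  define a where "a b = (if b then p else dp)" for b
  define c where "c b = (if b then w else dw)" for b
  have al: "a b \<in> lsym U m" for b using p dpl by (simp add: a_def)
  have cl: "c b \<in> lsym U m'" for b using w dwl by (simp add: c_def)
  have "comp_term k dp w' x \<xi> + comp_term k p dw x \<xi> = comp_term k p' w' x \<xi> - comp_term k p w x \<xi>" if x: "x \<in> U" for x \<xi>
  proof -
    have "p' = (\<lambda>x \<xi>. \<Sum>b\<in>UNIV. a b x \<xi>)" by (simp add: UNIV_bool a_def dp_def fun_eq_iff)
    then have e1: "comp_term k p' w' x \<xi> = comp_term k dp w' x \<xi> + comp_term k p w' x \<xi>"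
      using comp_term_sum_left[OF U x, where a = a and m = "\<lambda>_. m" and J = UNIV and k = k and w = w' and \<xi> = \<xi>, OF al] by (simp add: UNIV_bool a_def)
    have "w' = (\<lambda>x \<xi>. \<Sum>b\<in>UNIV. c b x \<xi>)" by (simp add: UNIV_bool c_def dw_def fun_eq_iff)
    then have e2: "comp_term k p w' x \<xi> = comp_term k p dw x \<xi> + comp_term k p w x \<xi>"
      using comp_term_sum_right[OF U x, where a = c and m = "\<lambda>_. m'" and J = UNIV and k = k and p = p and \<xi> = \<xi>, OF cl] by (simp add: UNIV_bool c_def)
    show ?thesis using e1 e2 by simp
  qed
  from lsym_cong[OF U this lsym_add[OF U 1 2]] show ?thesis .
qed

text \<open>Testing with plane waves, cut off outside a ball, recovers the symbol on that ball.\<close>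

lemma comp_symbol_cutoff:
  fixes p :: "'a::euclidean_space \<Rightarrow> 'a \<Rightarrow> complex"
  assumes p: "p \<in> lsym UNIV m" and R: "R > 0"
  shows "(\<lambda>x \<xi>. comp_symbol p (\<lambda>y \<xi>. bump 0 R y) x \<xi> - p x \<xi>) \<in> lsym (ball 0 R) M"
proof -
  define w where "w = (\<lambda>(y::'a) (\<xi>::'a). bump 0 R y)"
  have w: "csym 0 w" unfolding w_def by (rule csym_test_function[OF bump_test(1)[OF R]])
  \<comment> \<open>Chosen such that \<open>m - real N \<le> M\<close>; the successor ensures that
    the term \<open>k = 0\<close> belongs to the sum.\<close>
  define N where "N = Suc (nat \<lceil>m - M\<rceil>)"
  have "m + 0 - real N \<le> M" unfolding N_def by linarith
  then have "comp_remainder N p w \<in> lsym UNIV M" by (rule lsym_mono[OF _ comp_remainder_lsym[OF p w]])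
  then have rem: "comp_remainder N p w \<in> lsym (ball 0 R) M" by (rule lsym_subset[rotated]) simp
  have "comp_remainder N p w x \<xi> = comp_symbol p w x \<xi> - p x \<xi>" if x: "x \<in> ball 0 R" for x \<xi>
  proof -
    have "comp_term k p w x \<xi> = (if k = 0 then p x \<xi> else 0)" for k
    proof -
      have b1: "bump 0 R y = 1" if "y \<in> ball 0 R" for y :: 'a using that by (intro bump(2)[OF R]) simp
      \<comment> \<open>On the open ball the cutoff is constant, so all terms with derivatives
        vanish and the expansion reduces to \<open>p\<close>.\<close>
      have "comp_term k p w x \<xi> = comp_term k p (\<lambda>y \<xi>. 1) x \<xi>"
        by (rule comp_term_cong_right[OF open_ball x]) (simp add: w_def b1)
      also have "\<dots> = (if k = 0 then p x \<xi> else 0)"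
      proof (cases k)
        case 0
        then show ?thesis by (simp add: comp_term_def words_0)
      next
        case (Suc j)
        have "ider l (\<lambda>y::'a. 1::complex) = (\<lambda>y. 0)" if "length l = Suc j" for l and j
          using that
        proof (induction l arbitrary: j)
          case (Cons b l)
          have eq: "ider l (\<lambda>y::'a. 1::complex) = (\<lambda>y. if l = [] then 1 else 0)"
            using Cons.IH[of "length l - 1"] by (cases l) auto
          show ?case unfolding ider_simps eq by (rule ext) (rule pdiff_const)
        qed simp
        then show ?thesis using Suc by (simp add: comp_term_def wordsD(2))
      qed
      finally show ?thesis .
    qed
    then have "(\<Sum>k<N. comp_term k p w x \<xi>) = p x \<xi>" by (simp add: N_def sum.lessThan_Suc_shift)
    then show ?thesis by (simp add: comp_remainder_def)
  qed
  from lsym_cong[OF open_ball this rem] show ?thesis by (simp add: w_def)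
qed

text \<open>Gives \<open>P (Q u)\<close> a meaning, as the values of an operator are specified on
  test functions only.\<close>

lemma properly_supported_test:
  fixes Q :: "('a::euclidean_space \<Rightarrow> complex) \<Rightarrow> 'a \<Rightarrow> complex"
  assumes "properly_supported Q" "u \<in> test_functions"
  shows "Q u \<in> test_functions"
proof -
  obtain R where R: "\<And>y. norm y > R \<Longrightarrow> u y = 0" using test_functions_support[OF assms(2)] by metis
  obtain R' where R': "R' > 0" "\<And>u x. u \<in> test_functions \<Longrightarrow> (\<And>y. norm y > R \<Longrightarrow> u y = 0) \<Longrightarrow> norm x > R' \<Longrightarrow> Q u x = 0"
    proof (rule properly_supported_bounded_support[OF assms(1), where R = R], goal_cases)
      case (1 z)
      show ?case by (rule that; fact 1)
    qed
  have "\<And>x. norm x > R' \<Longrightarrow> Q u x = 0" by (rule R'(2)[OF assms(2) R])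
  moreover have "smooth_on UNIV (Q u)"
    using assms unfolding properly_supported_def by (blast intro: schwartz_kernelD(2))
  ultimately show ?thesis by (rule test_functionsI[rotated])
qed

text \<open>Here \<open>Q\<close> maps the truncated plane wave \<open>e_\<xi> \<chi>\<close> to \<open>e_\<xi> w(\<sqdot>, \<xi>)\<close>, and \<open>P\<close> maps this to \<open>e_\<xi> r(\<sqdot>, \<xi>)\<close>,
  with \<open>w\<close> and \<open>r\<close> both of the form \<open>comp_symbol\<close>.\<close>

lemma composition_local:
  fixes P Q :: "('a::euclidean_space \<Rightarrow> complex) \<Rightarrow> 'a \<Rightarrow> complex"
  assumes P: "total_left_symbol m P p" and Q: "total_left_symbol m' Q q"
    and Qs: "properly_supported Q" and N: "0 < N" "N \<le> R"
    and loc: "\<And>u x. u \<in> test_functions \<Longrightarrow> (\<And>y. norm y < R \<Longrightarrow> u y = 0) \<Longrightarrow> norm x < N \<Longrightarrow> P (Q u) x = 0"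
  obtains r where "r \<in> lsym UNIV (m + m')"
    "\<And>x \<xi>. norm x < N \<Longrightarrow> cis (x \<bullet> \<xi>) * r x \<xi> = P (Q (\<lambda>y. cis (y \<bullet> \<xi>) * bump 0 R y)) x"
    "\<And>u x. u \<in> test_functions \<Longrightarrow> norm x < N \<Longrightarrow> P (Q u) x = Op r u x"
    "\<And>K. (\<lambda>x \<xi>. r x \<xi> - (\<Sum>k<K. comp_term k p q x \<xi>)) \<in> lsym (ball 0 N) (m + m' - real K)"
proof -
  have R: "R > 0" using N by simp
  define cut where "cut = (bump 0 R :: 'a \<Rightarrow> complex)"
  have cut_test: "cut \<in> test_functions" unfolding cut_def by (rule bump_test(1)[OF R])
  have cut1: "cut y = 1" if "norm y \<le> R" for y unfolding cut_def using that by (intro bump(2)[OF R]) simp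
  have cut0: "cut y = 0" if "norm y > 2 * R" for y unfolding cut_def using that by (intro bump_test(3)[OF R]) simp
  obtain R4 where R4: "R4 > 0" "\<And>u x. u \<in> test_functions \<Longrightarrow> (\<And>y. norm y > 2 * R \<Longrightarrow> u y = 0) \<Longrightarrow> norm x > R4 \<Longrightarrow> Q u x = 0"
    proof (rule properly_supported_bounded_support[OF Qs, where R = "2 * R"], goal_cases)
      case (1 z)
      show ?case by (rule that; fact 1)
    qed
  \<comment> \<open>\<open>R4\<close> bounds the support of \<open>Q v\<close> for every truncated
    \<open>v\<close>, \<open>2 * R\<close> bounds that of \<open>v\<close> itself, and
    \<open>N\<close> is the radius of the ball on which the result is read off.\<close>
  define S where "S = max R4 (max (2 * R) N)"
  have S: "S > 0" "R4 \<le> S" "2 * R \<le> S" "N \<le> S" using R4 by (auto simp: S_def)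
  \<comment> \<open>The factor \<open>\<psi>\<close> makes the intermediate symbol \<open>w\<close>
    compactly supported. It does not change \<open>Q v\<close>, which vanishes beyond
    \<open>R4\<close>.\<close>
  define \<psi> where "\<psi> = (bump 0 S :: 'a \<Rightarrow> complex)"
  have \<psi>1: "\<psi> y = 1" if "norm y \<le> S" for y unfolding \<psi>_def using that by (intro bump(2)[OF S(1)]) simp
  have \<psi>0: "\<psi> y = 0" if "norm y > 2 * S" for y unfolding \<psi>_def using that by (intro bump_test(3)[OF S(1)]) simp
  have S2: "2 * S > 0" using S by simp
  obtain p' where p': "p' \<in> lsym UNIV m" "\<And>M. (\<lambda>x \<xi>. p' x \<xi> - p x \<xi>) \<in> lsym UNIV M"
    "\<And>u x. u \<in> test_functions \<Longrightarrow> (\<And>y. norm y > 2 * S \<Longrightarrow> u y = 0) \<Longrightarrow> norm x \<le> 2 * S \<Longrightarrow> P u x = Op p' u x"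
    proof (rule local_symbol_representation[OF P S2], goal_cases)
      case (1 z)
      show ?case by (rule that; fact 1)
    qed
  obtain q' where q': "q' \<in> lsym UNIV m'" "\<And>M. (\<lambda>x \<xi>. q' x \<xi> - q x \<xi>) \<in> lsym UNIV M"
    "\<And>u x. u \<in> test_functions \<Longrightarrow> (\<And>y. norm y > 2 * S \<Longrightarrow> u y = 0) \<Longrightarrow> norm x \<le> 2 * S \<Longrightarrow> Q u x = Op q' u x"
    proof (rule local_symbol_representation[OF Q S2], goal_cases)
      case (1 z)
      show ?case by (rule that; fact 1)
    qed
  define cuts where "cuts = (\<lambda>(y::'a) (\<xi>::'a). cut y)"
  have cuts: "csym 0 cuts" unfolding cuts_def by (rule csym_test_function[OF cut_test])
  define w where "w y \<xi> = \<psi> y * comp_symbol q' cuts y \<xi>" for y \<xi>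
  have cs: "comp_symbol q' cuts \<in> lsym UNIV m'" using comp_symbol_lsym[OF q'(1) cuts] by simp
  have "w \<in> lsym UNIV m'"
    using lsym_mult[OF open_UNIV lsym_left[OF open_UNIV bump(1)[OF S(1), of 0]] cs] unfolding w_def[abs_def] \<psi>_def by simp
  then have w: "csym m' w" unfolding csym_def using \<psi>0 by (auto simp: w_def)
  define r where "r = comp_symbol p' w"
  have r: "r \<in> lsym UNIV (m + m')" unfolding r_def by (rule comp_symbol_lsym[OF p'(1) w])
  \<comment> \<open>Three zones. Up to \<open>S\<close> the cutoff \<open>\<psi>\<close> is
    \<open>1\<close>; from there to \<open>2 * S\<close> the function \<open>Q v\<close>, and with
    it \<open>Op q' v\<close>, vanishes; beyond \<open>2 * S\<close> the symbol \<open>q'\<close>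
    gives no information, but \<open>Q v\<close> and \<open>\<psi>\<close> are both
    \<open>0\<close>.\<close>
  have Qeq: "Q v = f" if v: "v \<in> test_functions" "\<And>y. norm y > 2 * R \<Longrightarrow> v y = 0"
    and f: "\<And>y. f y = \<psi> y * Op q' v y" for v f
  proof
    fix y
    have v2: "v y = 0" if "norm y > 2 * S" for y using that S v(2)[of y] R by simp
    show "Q v y = f y"
    proof (cases "norm y \<le> 2 * S")
      case True
      have "Q v y = Op q' v y" by (rule q'(3)[OF v(1) v2 True])
      then show ?thesis using R4(2)[OF v, of y] \<psi>1[of y] S(2) f[of y] by (cases "norm y \<le> S") auto
    next
      case False
      then have "norm y > R4" using S by linarith
      then show ?thesis using R4(2)[OF v] \<psi>0[of y] False f[of y] by simp
    qed
  qed
  have Qz: "Q v y = 0" if "v \<in> test_functions" "\<And>y. norm y > 2 * R \<Longrightarrow> v y = 0" "norm y > 2 * S" for v y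
    by (rule R4(2)[OF that(1,2)]) (use that(3) S in auto)
  have wave: "cis (x \<bullet> \<xi>) * r x \<xi> = P (Q (\<lambda>y. cis (y \<bullet> \<xi>) * cut y)) x" if x: "norm x < N" for x \<xi>
  proof -
    define v where "v = (\<lambda>y. cis (y \<bullet> \<xi>) * cut y)"
    have v: "v \<in> test_functions" unfolding v_def using ft_integrand_test[OF cut_test, of "- \<xi>"] by simp
    have v0: "v y = 0" if "norm y > 2 * R" for y using cut0[OF that] by (simp add: v_def)
    have Qv: "Q v = (\<lambda>y. cis (y \<bullet> \<xi>) * w y \<xi>)"
    proof (rule Qeq[OF v v0])
      fix y
      have "Op q' v y = cis (y \<bullet> \<xi>) * comp_symbol q' cuts y \<xi>"
        using Op_plane_wave[OF q'(1) cuts] unfolding v_def cuts_def by simp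
      then show "cis (y \<bullet> \<xi>) * w y \<xi> = \<psi> y * Op q' v y" by (simp add: w_def)
    qed
    have "P (Q v) x = Op p' (Q v) x"
      by (rule p'(3)[OF properly_supported_test[OF Qs v] Qz[OF v v0]]) (use x S in auto)
    also have "\<dots> = cis (x \<bullet> \<xi>) * r x \<xi>" unfolding Qv r_def by (rule Op_plane_wave[OF p'(1) w])
    finally show ?thesis by (simp add: v_def)
  qed
  have rep: "P (Q u) x = Op r u x" if u: "u \<in> test_functions" and x: "norm x < N" for u x
  proof -
    \<comment> \<open>The truncated function is \<open>Op cuts u\<close>. By
      \<open>Op_compose\<close> this leads to the quantization of the same \<open>w\<close> that
      describes the action on plane waves.\<close>
    define v where "v = (\<lambda>y. cut y * u y)"
    have v: "v \<in> test_functions" unfolding v_def by (rule test_functions_mult(2)[OF u test_functions_smooth[OF cut_test]])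
    have v0: "v y = 0" if "norm y > 2 * R" for y using cut0[OF that] by (simp add: v_def)
    have vOp: "v = Op cuts u" unfolding v_def cuts_def by (rule ext) (rule Op_left[OF u, symmetric])
    have Qv: "Q v = Op w u"
    proof (rule Qeq[OF v v0])
      fix y
      have "Op q' v y = Op (comp_symbol q' cuts) u y" unfolding vOp by (rule Op_compose[OF q'(1) cuts u])
      then show "Op w u y = \<psi> y * Op q' v y" unfolding w_def[abs_def] Op_mult_left by simp
    qed
    have "P (Q v) x = Op p' (Q v) x"
      by (rule p'(3)[OF properly_supported_test[OF Qs v] Qz[OF v v0]]) (use x S in auto)
    also have "\<dots> = Op r u x" unfolding Qv r_def by (rule Op_compose[OF p'(1) w u])
    finally have PQv: "P (Q v) x = Op r u x" .
    \<comment> \<open>The difference \<open>u - v\<close> vanishes on the ball of radius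
      \<open>R\<close>, so by locality the truncation is not felt at \<open>x\<close>.\<close>
    have "0 = P (Q (\<lambda>y. u y - v y)) x"
      by (rule loc[OF test_functions_diff[OF u v] _ x, symmetric]) (simp add: v_def cut1)
    also have "Q (\<lambda>y. u y - v y) = (\<lambda>y. Q u y - Q v y)" by (rule ext) (rule total_left_symbol_diff[OF Q u v])
    also have "P (\<lambda>y. Q u y - Q v y) x = P (Q u) x - P (Q v) x"
      by (rule total_left_symbol_diff[OF P properly_supported_test[OF Qs u] properly_supported_test[OF Qs v]])
    finally show ?thesis using PQv by simp
  qed
  have asym: "(\<lambda>x \<xi>. r x \<xi> - (\<Sum>k<K. comp_term k p q x \<xi>)) \<in> lsym (ball 0 N) (m + m' - real K)" for K
  proof -
    have pl: "p \<in> lsym (ball 0 N) m" and ql: "q \<in> lsym (ball 0 N) m'"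
      using P Q unfolding total_left_symbol_def symbols_eq_lsym by (auto intro: lsym_subset[OF subset_UNIV])
    have wl: "w \<in> lsym (ball 0 N) m'" by (rule lsym_subset[OF subset_UNIV csym_lsym[OF w]])
    \<comment> \<open>On the small ball \<open>\<psi>\<close> is \<open>1\<close>; removing the
      cutoff from the plane wave and replacing \<open>q'\<close> by \<open>q\<close> both cost only
      order \<open>-\<infinity>\<close>.\<close>
    have dw: "(\<lambda>x \<xi>. w x \<xi> - q x \<xi>) \<in> lsym (ball 0 N) M" for M
    proof -
      have "(\<lambda>x \<xi>. comp_symbol q' cuts x \<xi> - q' x \<xi>) \<in> lsym (ball 0 N) M"
        unfolding cuts_def cut_def by (rule lsym_subset[OF _ comp_symbol_cutoff[OF q'(1) R]]) (use N(2) in auto)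
      from lsym_add[OF open_ball this lsym_subset[OF subset_UNIV q'(2)]]
      have 1: "(\<lambda>x \<xi>. comp_symbol q' cuts x \<xi> - q' x \<xi> + (q' x \<xi> - q x \<xi>)) \<in> lsym (ball 0 N) M" .
      show ?thesis
        by (rule lsym_cong[OF open_ball _ 1]) (use \<psi>1 S(4) in \<open>auto simp: w_def\<close>)
    qed
    have t: "(\<lambda>x \<xi>. comp_term k p' w x \<xi> - comp_term k p q x \<xi>) \<in> lsym (ball 0 N) (m + m' - real K)" for k
      by (rule comp_term_perturb[OF open_ball pl wl lsym_subset[OF subset_UNIV p'(2)] dw ql])
    have "(\<lambda>x \<xi>. comp_remainder K p' w x \<xi> + (\<Sum>k<K. comp_term k p' w x \<xi> - comp_term k p q x \<xi>)) \<in> lsym (ball 0 N) (m + m' - real K)"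
      by (intro lsym_add lsym_sum open_ball t lsym_subset[OF subset_UNIV comp_remainder_lsym[OF p'(1) w]])
    then show ?thesis by (simp add: comp_remainder_def r_def sum_subtractf)
  qed
  show ?thesis by (rule that[OF r wave[unfolded cut_def] rep asym])
qed

text \<open>The local symbols glue: by proper support, \<open>P Q\<close> kills near a given ball all functions supported
  far away, so the value on the truncated plane wave does not depend on the truncation.\<close>

lemma composition_symbol:
  fixes P Q :: "('a::euclidean_space \<Rightarrow> complex) \<Rightarrow> 'a \<Rightarrow> complex"
  assumes P: "total_left_symbol m P p" and Q: "total_left_symbol m' Q q"
    and Ps: "properly_supported P" and Qs: "properly_supported Q"
  obtains r where "r \<in> lsym UNIV (m + m')"
    "\<And>u x. u \<in> test_functions \<Longrightarrow> P (Q u) x = Op r u x"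
    "\<And>K. (\<lambda>x \<xi>. r x \<xi> - (\<Sum>k<K. comp_term k p q x \<xi>)) \<in> lsym UNIV (m + m' - real K)"
proof -
  \<comment> \<open>Locality of the composition: on the ball of radius \<open>N\<close>,
    \<open>P\<close> sees \<open>Q u\<close> only within radius \<open>R1\<close>, and there
    \<open>Q\<close> sees \<open>u\<close> only within radius \<open>R2\<close>.\<close>
  have "\<exists>R\<ge>N. \<forall>u x. u \<in> test_functions \<longrightarrow> (\<forall>y. norm y < R \<longrightarrow> u y = 0) \<longrightarrow> norm x < N \<longrightarrow> P (Q u) x = 0" for N :: real
  proof -
    obtain R1 where R1: "R1 > 0" "\<And>u x. u \<in> test_functions \<Longrightarrow> (\<And>y. norm y < R1 \<Longrightarrow> u y = 0) \<Longrightarrow> norm x < N \<Longrightarrow> P u x = 0"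
      proof (rule properly_supported_local[OF Ps, where R = N], goal_cases)
        case (1 z)
        show ?case by (rule that; fact 1)
      qed
    obtain R2 where R2: "R2 > 0" "\<And>u x. u \<in> test_functions \<Longrightarrow> (\<And>y. norm y < R2 \<Longrightarrow> u y = 0) \<Longrightarrow> norm x < R1 \<Longrightarrow> Q u x = 0"
      proof (rule properly_supported_local[OF Qs, where R = R1], goal_cases)
        case (1 z)
        show ?case by (rule that; fact 1)
      qed
    have "P (Q u) x = 0" if u: "u \<in> test_functions" "\<And>y. norm y < max N R2 \<Longrightarrow> u y = 0" and x: "norm x < N" for u x
      by (rule R1(2)[OF properly_supported_test[OF Qs u(1)] R2(2)[OF u(1) u(2)] x]) auto
    then show ?thesis by (intro exI[of _ "max N R2"]) auto
  qed
  then obtain R :: "real \<Rightarrow> real" where R: "\<And>N. N \<le> R N"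
    "\<And>N u x. u \<in> test_functions \<Longrightarrow> (\<And>y. norm y < R N \<Longrightarrow> u y = 0) \<Longrightarrow> norm x < N \<Longrightarrow> P (Q u) x = 0"
    by metis
  define wv where "wv R' \<xi> = (\<lambda>y::'a. cis (y \<bullet> \<xi>) * bump 0 R' y)" for R' \<xi>
  define G where "G N r \<longleftrightarrow> r \<in> lsym UNIV (m + m') \<and>
    (\<forall>x \<xi>. norm x < N \<longrightarrow> cis (x \<bullet> \<xi>) * r x \<xi> = P (Q (wv (R N) \<xi>)) x) \<and>
    (\<forall>u x. u \<in> test_functions \<longrightarrow> norm x < N \<longrightarrow> P (Q u) x = Op r u x) \<and>
    (\<forall>K. (\<lambda>x \<xi>. r x \<xi> - (\<Sum>k<K. comp_term k p q x \<xi>)) \<in> lsym (ball 0 N) (m + m' - real K))" for N r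
  have "\<exists>r. G N r" if N: "N > 0" for N
  proof (rule composition_local[OF P Q Qs N R(1)[of N]], goal_cases)
    case (1 u x)
    show ?case by (rule R(2); fact 1)
  next
    case (2 r)
    show ?case unfolding G_def wv_def by (intro exI[of _ r] conjI allI impI 2; assumption)
  qed
  then obtain r where rG: "\<And>N. N > 0 \<Longrightarrow> G N (r N)" by metis
  have r: "\<And>N. N > 0 \<Longrightarrow> r N \<in> lsym UNIV (m + m')"
    "\<And>N x \<xi>. N > 0 \<Longrightarrow> norm x < N \<Longrightarrow> cis (x \<bullet> \<xi>) * r N x \<xi> = P (Q (wv (R N) \<xi>)) x"
    "\<And>N u x. N > 0 \<Longrightarrow> u \<in> test_functions \<Longrightarrow> norm x < N \<Longrightarrow> P (Q u) x = Op (r N) u x"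
    "\<And>N K. N > 0 \<Longrightarrow> (\<lambda>x \<xi>. r N x \<xi> - (\<Sum>k<K. comp_term k p q x \<xi>)) \<in> lsym (ball 0 N) (m + m' - real K)"
    using rG unfolding G_def by simp_all
  \<comment> \<open>The two truncated waves agree on the ball with the smaller radius
    \<open>R N\<close>, which is the ball on which \<open>P (Q u)\<close> near \<open>x\<close>
    depends. The plane wave has no zeros and can be cancelled.\<close>
  have le: "r N x \<xi> = r N' x \<xi>" if N: "N > 0" "N' > 0" "norm x < N" "norm x < N'" and RR: "R N \<le> R N'" for N N' x \<xi>
  proof -
    have RN: "R N > 0" "R N' > 0" using R(1)[of N] R(1)[of N'] N by linarith+
    have t: "wv (R N) \<xi> \<in> test_functions" "wv (R N') \<xi> \<in> test_functions"
      unfolding wv_def using ft_integrand_test[OF bump_test(1)[OF RN(1)], of "- \<xi>" 0] ft_integrand_test[OF bump_test(1)[OF RN(2)], of "- \<xi>" 0] by auto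
    have "0 = P (Q (\<lambda>y. wv (R N') \<xi> y - wv (R N) \<xi> y)) x"
    proof (rule R(2)[OF test_functions_diff[OF t(2,1)] _ N(3), symmetric])
      fix y :: 'a assume y: "norm y < R N"
      have "bump 0 (R N) y = 1" "bump 0 (R N') y = 1"
        using y RR by (auto intro!: bump(2) RN)
      then show "wv (R N') \<xi> y - wv (R N) \<xi> y = 0" by (simp add: wv_def)
    qed
    also have "Q (\<lambda>y. wv (R N') \<xi> y - wv (R N) \<xi> y) = (\<lambda>y. Q (wv (R N') \<xi>) y - Q (wv (R N) \<xi>) y)"
      by (rule ext) (rule total_left_symbol_diff[OF Q t(2,1)])
    also have "P (\<lambda>y. Q (wv (R N') \<xi>) y - Q (wv (R N) \<xi>) y) x = P (Q (wv (R N') \<xi>)) x - P (Q (wv (R N) \<xi>)) x"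
      by (rule total_left_symbol_diff[OF P properly_supported_test[OF Qs t(2)] properly_supported_test[OF Qs t(1)]])
    finally have "cis (x \<bullet> \<xi>) * r N' x \<xi> = cis (x \<bullet> \<xi>) * r N x \<xi>"
      using r(2)[OF N(1,3)] r(2)[OF N(2,4)] by simp
    then show ?thesis by simp
  qed
  have eq: "r N x \<xi> = r N' x \<xi>" if "N > 0" "N' > 0" "norm x < N" "norm x < N'" for N N' x \<xi>
    using le[OF that] le[OF that(2,1,4,3)] by (metis linear)
  \<comment> \<open>By \<open>eq\<close> every ball containing \<open>x\<close> gives the same
    value; the radius \<open>norm x + 1\<close> is an explicit choice of one.\<close>
  define rr where "rr x \<xi> = r (norm x + 1) x \<xi>" for x \<xi>
  have n1: "norm x + 1 > 0" for x :: 'a by (smt (verit) norm_ge_zero)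
  have rr: "rr x \<xi> = r N x \<xi>" if "norm x < N" for N x \<xi>
  proof -
    have "N > 0" using that norm_ge_zero[of x] by linarith
    then show ?thesis unfolding rr_def by (intro eq n1 that) auto
  qed
  have glue: "a \<in> lsym UNIV M" if "\<And>N::nat. N > 0 \<Longrightarrow> a \<in> lsym (ball 0 (real N)) M" for a :: "'a \<Rightarrow> 'a \<Rightarrow> complex" and M
  proof (rule lsym_exhaust)
    fix N :: nat
    show "a \<in> lsym (ball 0 (real N)) M"
      by (rule lsym_subset[OF _ that[of "Suc N"]]) auto
  qed
  have "rr \<in> lsym UNIV (m + m')"
    by (rule glue, rule lsym_cong[OF open_ball _ lsym_subset[OF subset_UNIV r(1)]]) (auto simp: rr)
  moreover have "P (Q u) x = Op rr u x" if "u \<in> test_functions" for u x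
    using r(3)[OF n1 that, of x x] by (simp add: Op_eq rr_def)
  moreover have "(\<lambda>x \<xi>. rr x \<xi> - (\<Sum>k<K. comp_term k p q x \<xi>)) \<in> lsym UNIV (m + m' - real K)" for K
    by (rule glue, rule lsym_cong[OF open_ball _ r(4)]) (auto simp: rr)
  ultimately show ?thesis using that by blast
qed

subsection \<open>Classical expansions\<close>

text \<open>Serves to glue smoothness away from \<open>\<xi> = 0\<close> with vanishing near
  \<open>\<xi> = 0\<close>.\<close>

lemma C_on_Un:
  assumes "open S" "open T"
  shows "C_on k S f \<Longrightarrow> C_on k T f \<Longrightarrow> C_on k (S \<union> T) f"
proof (induction k arbitrary: f)
  case 0
  then show ?case using continuous_on_open_Un[OF assms] by simp
next
  case (Suc k)
  note d = C_on_SucD[OF assms(1) Suc.prems(1)] C_on_SucD[OF assms(2) Suc.prems(2)]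
  show ?case
  proof (rule C_on_SucI)
    show "f differentiable (at x)" if "x \<in> S \<union> T" for x using that d(1)[of x] d(3)[of x] by blast
    show "C_on k (S \<union> T) (pdiff b f)" if "b \<in> Basis" for b by (rule Suc.IH[OF d(2)[OF that] d(4)[OF that]])
  qed
qed

lemma smooth_on_Un: "open S \<Longrightarrow> open T \<Longrightarrow> smooth_on S f \<Longrightarrow> smooth_on T f \<Longrightarrow> smooth_on (S \<union> T) f"
  unfolding smooth_on_def by (simp add: C_on_Un)

text \<open>The words in question are the permutations of a multiset with multiplicities
  \<open>\<alpha>\<close>, and their number is a multinomial coefficient. Letters of multiplicity
  \<open>0\<close> contribute the factor \<open>1\<close> to \<open>mfact \<alpha>\<close>.\<close>

lemma card_words_count:
  fixes \<alpha> :: "'a::euclidean_space \<Rightarrow> nat"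
  assumes \<alpha>: "\<alpha> \<in> multi_indices" "mlen \<alpha> = n"
  shows "complex_of_nat (card {l \<in> words n. count (mset l) = \<alpha>}) = fact n / of_nat (mfact \<alpha>)"
proof -
  define A where "A = mset (mword \<alpha>)"
  have cA: "count A = \<alpha>" unfolding A_def by (rule count_mword[OF \<alpha>(1)])
  have sA: "set_mset A \<subseteq> Basis" unfolding A_def using set_mword by simp
  have eq: "{l \<in> words n. count (mset l) = \<alpha>} = permutations_of_multiset A"
  proof (intro equalityI subsetI)
    fix l assume "l \<in> {l \<in> words n. count (mset l) = \<alpha>}"
    then have "count (mset l) = count A" by (simp add: cA)
    then show "l \<in> permutations_of_multiset A" by (simp add: permutations_of_multiset_def count_inject)
  next
    fix l assume "l \<in> permutations_of_multiset A"
    then have l: "mset l = A" by (simp add: permutations_of_multiset_def)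
    have "set l \<subseteq> Basis" using sA l by (metis set_mset_mset)
    moreover have "length l = n" using l \<alpha>(2) length_mword[of \<alpha>] by (metis A_def size_mset)
    ultimately show "l \<in> {l \<in> words n. count (mset l) = \<alpha>}" using l cA by (simp add: words_def)
  qed
  have size: "size A = n" unfolding A_def using length_mword[of \<alpha>] \<alpha>(2) by simp
  have "(\<Prod>x\<in>set_mset A. fact (count A x)) = (\<Prod>x\<in>Basis. fact (\<alpha> x) :: nat)"
    unfolding cA by (rule prod.mono_neutral_left[OF finite_Basis sA]) (auto simp: cA[symmetric] not_in_iff)
  then have prod: "(\<Prod>x\<in>set_mset A. fact (count A x)) = mfact \<alpha>" by (simp add: mfact_def)
  have c: "card (permutations_of_multiset A) = fact n div mfact \<alpha>" "mfact \<alpha> dvd fact n"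
    using card_permutations_of_multiset[of A] unfolding prod size by auto
  have "fact n = card (permutations_of_multiset A) * mfact \<alpha>" using c by simp
  then have "(fact n :: complex) = of_nat (card (permutations_of_multiset A)) * of_nat (mfact \<alpha>)"
    by (metis of_nat_fact of_nat_mult)
  moreover have "mfact \<alpha> \<noteq> 0" by (simp add: mfact_def)
  ultimately show ?thesis unfolding eq by simp
qed

lemma finite_multi_indices_eq: "finite {\<alpha> :: 'a::euclidean_space \<Rightarrow> nat. \<alpha> \<in> multi_indices \<and> mlen \<alpha> = n}"
  by (rule finite_subset[OF _ finite_multi_indices_le[of n]]) auto

lemma sum_words_multi_index:
  fixes G :: "('a::euclidean_space \<Rightarrow> nat) \<Rightarrow> complex"
  shows "(\<Sum>l\<in>words n. G (count (mset l))) = (\<Sum>\<alpha> | \<alpha> \<in> multi_indices \<and> mlen \<alpha> = n. fact n / of_nat (mfact \<alpha>) * G \<alpha>)"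
proof -
  have "(\<Sum>l\<in>words n. G (count (mset l))) =
    (\<Sum>\<alpha> | \<alpha> \<in> multi_indices \<and> mlen \<alpha> = n. \<Sum>l\<in>{l \<in> words n. count (mset l) = \<alpha>}. G (count (mset l)))"
    by (rule sum.group[OF finite_words finite_multi_indices_eq, symmetric])
      (auto simp: words_def count_list_multi_index mlen_count)
  also have "\<dots> = (\<Sum>\<alpha> | \<alpha> \<in> multi_indices \<and> mlen \<alpha> = n. fact n / of_nat (mfact \<alpha>) * G \<alpha>)"
  proof (rule sum.cong[OF refl])
    fix \<alpha> :: "'a \<Rightarrow> nat" assume \<alpha>: "\<alpha> \<in> {\<alpha>. \<alpha> \<in> multi_indices \<and> mlen \<alpha> = n}"
    have "(\<Sum>l\<in>{l \<in> words n. count (mset l) = \<alpha>}. G (count (mset l))) = (\<Sum>l\<in>{l \<in> words n. count (mset l) = \<alpha>}. G \<alpha>)"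
      by (rule sum.cong) auto
    then show "(\<Sum>l\<in>{l \<in> words n. count (mset l) = \<alpha>}. G (count (mset l))) = fact n / of_nat (mfact \<alpha>) * G \<alpha>"
      using card_words_count[of \<alpha> n] \<alpha> by simp
  qed
  finally show ?thesis .
qed

text \<open>The number \<open>fact n / mfact \<alpha>\<close> of words belonging to
  \<open>\<alpha>\<close> cancels the weight \<open>1 / fact n\<close>, and \<open>Dderiv\<close>
  absorbs the power of \<open>- \<i>\<close>. The open set \<open>S\<close> makes room for
  homogeneous functions, which need not be smooth at \<open>\<xi> = 0\<close>.\<close>

lemma comp_term_multi_index:
  fixes p q :: "'a::euclidean_space \<Rightarrow> 'a \<Rightarrow> complex"
  assumes S: "open S" "\<xi> \<in> S" and p: "smooth_on S (p x)" and q: "smooth_on UNIV (\<lambda>y. q y \<xi>)"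
  shows "comp_term n p q x \<xi> = (\<Sum>\<alpha> | \<alpha> \<in> multi_indices \<and> mlen \<alpha> = n.
    1 / of_nat (mfact \<alpha>) * (Dderiv \<alpha> (p x) \<xi> * mderiv \<alpha> (\<lambda>y. q y \<xi>) x))"
proof -
  have "ider l (p x) \<xi> = mderiv (count (mset l)) (p x) \<xi>" "ider l (\<lambda>y. q y \<xi>) x = mderiv (count (mset l)) (\<lambda>y. q y \<xi>) x"
    if "l \<in> words n" for l
    using ider_eq_mderiv[OF S(1) p wordsD(1)[OF that] S(2)] ider_eq_mderiv[OF open_UNIV q wordsD(1)[OF that] UNIV_I] by auto
  then have "comp_term n p q x \<xi> = (- \<i>) ^ n / fact n *
      (\<Sum>l\<in>words n. mderiv (count (mset l)) (p x) \<xi> * mderiv (count (mset l)) (\<lambda>y. q y \<xi>) x)"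
    by (simp add: comp_term_def)
  also have "\<dots> = (\<Sum>\<alpha> | \<alpha> \<in> multi_indices \<and> mlen \<alpha> = n. (- \<i>) ^ n / fact n *
      (fact n / of_nat (mfact \<alpha>) * (mderiv \<alpha> (p x) \<xi> * mderiv \<alpha> (\<lambda>y. q y \<xi>) x)))"
    unfolding sum_words_multi_index[where G = "\<lambda>\<alpha>. mderiv \<alpha> (p x) \<xi> * mderiv \<alpha> (\<lambda>y. q y \<xi>) x"]
    by (rule sum_distrib_left)
  also have "\<dots> = (\<Sum>\<alpha> | \<alpha> \<in> multi_indices \<and> mlen \<alpha> = n.
    1 / of_nat (mfact \<alpha>) * (Dderiv \<alpha> (p x) \<xi> * mderiv \<alpha> (\<lambda>y. q y \<xi>) x))"
    by (rule sum.cong) (auto simp: Dderiv_def)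
  finally show ?thesis .
qed

lemma smooth_on_slice_punctured:
  fixes a :: "'a::euclidean_space \<Rightarrow> 'a \<Rightarrow> complex"
  assumes "smooth_on (UNIV \<times> - {0}) (\<lambda>(x, \<xi>). a x \<xi>)"
  shows "smooth_on (- {0}) (a x)" "\<xi> \<noteq> 0 \<Longrightarrow> smooth_on UNIV (\<lambda>x. a x \<xi>)"
proof -
  have o: "open (UNIV \<times> - {0} :: ('a \<times> 'a) set)" by (intro open_Times) auto
  have o0: "open (- {0} :: 'a set)" by auto
  have l: "bounded_linear (\<lambda>y::'a. (0::'a, y))" "bounded_linear (\<lambda>z::'a. (z, 0::'a))"
    by (intro bounded_linear_Pair bounded_linear_zero bounded_linear_ident)+
  show "smooth_on (- {0}) (a x)"
    using smooth_on_compose_linear[OF l(1) o0 o _ assms, of "(x, 0)"] by simp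
  show "smooth_on UNIV (\<lambda>x. a x \<xi>)" if "\<xi> \<noteq> 0"
    using smooth_on_compose_linear[OF l(2) open_UNIV o _ assms, of "(0, \<xi>)"] that by simp
qed

lemma comp_term_smooth_on:
  fixes a b :: "'a::euclidean_space \<Rightarrow> 'a \<Rightarrow> complex"
  assumes V: "open V" and a: "smooth_on V (\<lambda>(x, \<xi>). a x \<xi>)" and b: "smooth_on V (\<lambda>(x, \<xi>). b x \<xi>)"
  shows "smooth_on V (\<lambda>(x, \<xi>). comp_term n a b x \<xi>)"
proof -
  have s: "smooth_on V (\<lambda>z. ider (map (Pair 0) l) (\<lambda>(x, \<xi>). a x \<xi>) z * ider (map (\<lambda>b. (b, 0)) l) (\<lambda>(x, \<xi>). b x \<xi>) z)"
    if "l \<in> words n" for l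
    by (intro smooth_on_mult V smooth_on_ider a b set_Pair_Basis wordsD(1)[OF that])
  have "smooth_on V (\<lambda>z. (- \<i>) ^ n / fact n * (\<Sum>l\<in>words n. ider (map (Pair 0) l) (\<lambda>(x, \<xi>). a x \<xi>) z * ider (map (\<lambda>b. (b, 0)) l) (\<lambda>(x, \<xi>). b x \<xi>) z))"
    by (rule smooth_on_mult[OF V smooth_on_const smooth_on_sum[OF V s]])
  then show ?thesis
    unfolding ider_slice_right ider_slice_left comp_term_def by (simp add: split_def)
qed

text \<open>Where \<open>\<phi>\<close> vanishes the two terms agree, so their difference has compact support in \<open>\<xi>\<close>.\<close>

lemma cutoff_comp_term:
  fixes a b :: "'a::euclidean_space \<Rightarrow> 'a \<Rightarrow> complex"
  assumes \<phi>: "\<phi> \<in> cutoffs"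
    and a: "smooth_on (UNIV \<times> - {0}) (\<lambda>(x, \<xi>). a x \<xi>)" and b: "smooth_on (UNIV \<times> - {0}) (\<lambda>(x, \<xi>). b x \<xi>)"
    and al: "(\<lambda>x \<xi>. (1 - \<phi> \<xi>) * a x \<xi>) \<in> lsym UNIV m" and bl: "(\<lambda>x \<xi>. (1 - \<phi> \<xi>) * b x \<xi>) \<in> lsym UNIV m'"
  shows "(\<lambda>x \<xi>. comp_term n (\<lambda>x \<xi>. (1 - \<phi> \<xi>) * a x \<xi>) (\<lambda>x \<xi>. (1 - \<phi> \<xi>) * b x \<xi>) x \<xi> - (1 - \<phi> \<xi>) * comp_term n a b x \<xi>) \<in> lsym UNIV M"
proof -
  have \<phi>t: "\<phi> \<in> test_functions" and ev: "\<forall>\<^sub>F x in nhds 0. \<phi> x = 1" using \<phi> by (auto simp: cutoffs_def)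
  obtain R where R: "R > 0" "\<And>\<xi>. norm \<xi> > R \<Longrightarrow> \<phi> \<xi> = 0" using test_functions_support[OF \<phi>t] by metis
  obtain W where W: "open W" "0 \<in> W" "\<And>x. x \<in> W \<Longrightarrow> \<phi> x = 1" using ev unfolding eventually_nhds by blast
  have o1: "open (UNIV \<times> - {0} :: ('a \<times> 'a) set)" and o2: "open (UNIV \<times> W :: ('a \<times> 'a) set)"
    using W(1) by (intro open_Times; auto)+
  have UN: "(UNIV \<times> - {0}) \<union> (UNIV \<times> W) = (UNIV :: ('a \<times> 'a) set)" using W(2) by auto
  have \<phi>s: "smooth_on S (\<lambda>z. 1 - \<phi> (snd z))" if "open S" for S :: "('a \<times> 'a) set"
    by (intro smooth_on_diff that smooth_on_const smooth_on_compose_linear0[OF bounded_linear_snd that open_UNIV UNIV_I test_functions_smooth[OF \<phi>t]])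
  have s1: "smooth_on (UNIV \<times> - {0}) (\<lambda>z. (1 - \<phi> (snd z)) * (\<lambda>(x, \<xi>). comp_term n a b x \<xi>) z)"
    by (intro smooth_on_mult o1 \<phi>s comp_term_smooth_on a b)
  \<comment> \<open>On \<open>W\<close> the factor \<open>1 - \<phi>\<close> is \<open>0\<close>, so
    the singularity of the homogeneous terms and their values at the origin do not enter.\<close>
  have "smooth_on (UNIV \<times> W) (\<lambda>z::'a \<times> 'a. 0 :: complex)" by simp
  then have s2: "smooth_on (UNIV \<times> W) (\<lambda>z. (1 - \<phi> (snd z)) * (\<lambda>(x, \<xi>). comp_term n a b x \<xi>) z)"
    by (rule smooth_on_cong[OF o2, rotated]) (auto simp: W(3))
  have s: "smooth_on UNIV (\<lambda>z. (1 - \<phi> (snd z)) * (\<lambda>(x, \<xi>). comp_term n a b x \<xi>) z)"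
    using smooth_on_Un[OF o1 o2 s1 s2] unfolding UN .
  define D where "D x \<xi> = comp_term n (\<lambda>x \<xi>. (1 - \<phi> \<xi>) * a x \<xi>) (\<lambda>x \<xi>. (1 - \<phi> \<xi>) * b x \<xi>) x \<xi> - (1 - \<phi> \<xi>) * comp_term n a b x \<xi>" for x \<xi>
  have "smooth_on UNIV (\<lambda>z. (\<lambda>(x, \<xi>). comp_term n (\<lambda>x \<xi>. (1 - \<phi> \<xi>) * a x \<xi>) (\<lambda>x \<xi>. (1 - \<phi> \<xi>) * b x \<xi>) x \<xi>) z
      - (1 - \<phi> (snd z)) * (\<lambda>(x, \<xi>). comp_term n a b x \<xi>) z)"
    by (rule smooth_on_diff[OF open_UNIV lsym_smooth_UNIV[OF comp_term_lsym[OF open_UNIV al bl]] s])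
  then have Ds: "smooth_on (UNIV \<times> UNIV) (\<lambda>(x, \<xi>). D x \<xi>)" unfolding D_def by (simp add: split_def)
  have "D x \<xi> = 0" if \<xi>: "norm \<xi> > R" for x \<xi>
  proof -
    have oR: "open {\<xi>::'a. norm \<xi> > R}" by (intro open_Collect_less continuous_intros)
    \<comment> \<open>The derivatives of \<open>a\<close> are in \<open>\<xi>\<close>, so the cutoff
      must be constant on an open set of frequencies; those of \<open>b\<close> are in
      \<open>x\<close>, with \<open>\<xi>\<close> fixed.\<close>
    have 1: "ider l (\<lambda>\<xi>. (1 - \<phi> \<xi>) * a x \<xi>) \<xi> = ider l (a x) \<xi>" for l
      by (rule ider_cong_open[OF oR]) (use \<xi> R(2) in auto)
    have 2: "(\<lambda>x. (1 - \<phi> \<xi>) * b x \<xi>) = (\<lambda>x. b x \<xi>)" using R(2)[OF \<xi>] by simp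
    show ?thesis unfolding D_def comp_term_def 1 2 using R(2)[OF \<xi>] by simp
  qed
  from lsym_smooth_bounded_support[OF open_UNIV Ds this] show ?thesis unfolding D_def .
qed

lemma finite_index_triples: "finite {(n::nat, j::nat, k::nat). n + j + k = l}"
  by (rule finite_subset[of _ "{..l} \<times> {..l} \<times> {..l}"]) auto

text \<open>The error has three sources, each of order at most \<open>m + m' - N\<close>: the
  remainder of the composition formula, the products of total index at least \<open>N\<close>, and,
  in the finitely many other products, the passage from two cutoffs to a single one.\<close>

lemma composition_expansion:
  fixes p q r :: "'a::euclidean_space \<Rightarrow> 'a \<Rightarrow> complex"
  assumes \<phi>: "\<phi> \<in> cutoffs"
    and pe: "\<And>N. (\<lambda>x \<xi>. p x \<xi> - (\<Sum>j<N. (1 - \<phi> \<xi>) * ps j x \<xi>)) \<in> lsym UNIV (m - real N)"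
    and qe: "\<And>N. (\<lambda>x \<xi>. q x \<xi> - (\<Sum>j<N. (1 - \<phi> \<xi>) * qs j x \<xi>)) \<in> lsym UNIV (m' - real N)"
    and sp: "\<And>j. smooth_on (UNIV \<times> - {0}) (\<lambda>(x, \<xi>). ps j x \<xi>)"
    and sq: "\<And>j. smooth_on (UNIV \<times> - {0}) (\<lambda>(x, \<xi>). qs j x \<xi>)"
    and re: "\<And>K. (\<lambda>x \<xi>. r x \<xi> - (\<Sum>k<K. comp_term k p q x \<xi>)) \<in> lsym UNIV (m + m' - real K)"
  shows "(\<lambda>x \<xi>. r x \<xi> - (\<Sum>l<N. (1 - \<phi> \<xi>) * (\<Sum>(n, j, k) | n + j + k = l. comp_term n (ps j) (qs k) x \<xi>)))
    \<in> lsym UNIV (m + m' - real N)"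
proof -
  \<comment> \<open>A single term is the difference of two consecutive remainders, which fixes its
    order.\<close>
  have cut: "(\<lambda>x \<xi>. (1 - \<phi> \<xi>) * fs j x \<xi>) \<in> lsym UNIV (\<mu> - real j)"
    if fe: "\<And>N. (\<lambda>x \<xi>. f x \<xi> - (\<Sum>j<N. (1 - \<phi> \<xi>) * fs j x \<xi>)) \<in> lsym UNIV (\<mu> - real N)"
    for f :: "'a \<Rightarrow> 'a \<Rightarrow> complex" and fs \<mu> j
  proof -
    have "(\<lambda>x \<xi>. f x \<xi> - (\<Sum>j<Suc j. (1 - \<phi> \<xi>) * fs j x \<xi>)) \<in> lsym UNIV (\<mu> - real j)"
      by (rule lsym_mono[OF _ fe]) simp
    from lsym_diff[OF open_UNIV fe[of j] this] show ?thesis by simp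
  qed
  \<comment> \<open>The remainder of the expansion takes the index \<open>N\<close>, so that all
    pieces \<open>a j\<close> with \<open>j \<le> N\<close> have order
    \<open>m - real j\<close>.\<close>
  define a where "a j = (if j < N then (\<lambda>x \<xi>. (1 - \<phi> \<xi>) * ps j x \<xi>) else (\<lambda>x \<xi>. p x \<xi> - (\<Sum>j<N. (1 - \<phi> \<xi>) * ps j x \<xi>)))" for j
  define b where "b j = (if j < N then (\<lambda>x \<xi>. (1 - \<phi> \<xi>) * qs j x \<xi>) else (\<lambda>x \<xi>. q x \<xi> - (\<Sum>j<N. (1 - \<phi> \<xi>) * qs j x \<xi>)))" for j
  have al: "a j \<in> lsym UNIV (m - real j)" if "j \<in> {..N}" for j
    using that cut[OF pe, of j] pe[of N] by (cases "j = N") (auto simp: a_def)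
  have bl: "b j \<in> lsym UNIV (m' - real j)" if "j \<in> {..N}" for j
    using that cut[OF qe, of j] qe[of N] by (cases "j = N") (auto simp: b_def)
  have pa: "p = (\<lambda>x \<xi>. \<Sum>j\<in>{..N}. a j x \<xi>)" and qb: "q = (\<lambda>x \<xi>. \<Sum>j\<in>{..N}. b j x \<xi>)"
    unfolding lessThan_Suc_atMost[symmetric] sum.lessThan_Suc by (auto simp: a_def b_def fun_eq_iff)
  have dec: "comp_term n p q x \<xi> = (\<Sum>j\<in>{..N}. \<Sum>k\<in>{..N}. comp_term n (a j) (b k) x \<xi>)" for n x \<xi>
  proof -
    have "comp_term n p q x \<xi> = comp_term n (\<lambda>x \<xi>. \<Sum>j\<in>{..N}. a j x \<xi>) q x \<xi>" using pa by simp
    also have "\<dots> = (\<Sum>j\<in>{..N}. comp_term n (a j) q x \<xi>)"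
      by (rule comp_term_sum_left[OF open_UNIV UNIV_I al])
    also have "\<dots> = (\<Sum>j\<in>{..N}. comp_term n (a j) (\<lambda>x \<xi>. \<Sum>k\<in>{..N}. b k x \<xi>) x \<xi>)" using qb by simp
    also have "\<dots> = (\<Sum>j\<in>{..N}. \<Sum>k\<in>{..N}. comp_term n (a j) (b k) x \<xi>)"
      by (rule sum.cong[OF refl]) (rule comp_term_sum_right[OF open_UNIV UNIV_I bl])
    finally show ?thesis .
  qed
  define h where "h = (\<lambda>(n, j, k) x \<xi>. comp_term n (a j) (b k) x \<xi>)"
  define g where "g = (\<lambda>(n, j, k) x \<xi>. comp_term n (ps j) (qs k) x \<xi>)"
  define Box where "Box = {..<N} \<times> {..N} \<times> {..N}"
  \<comment> \<open>Outside \<open>Lo\<close> the order is at most \<open>m + m' - N\<close>.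
    Inside, \<open>j\<close> and \<open>k\<close> are less than \<open>N\<close>, so only
    homogeneous terms occur and no remainders.\<close>
  define Lo where "Lo = {t \<in> Box. fst t + fst (snd t) + snd (snd t) < N}"
  have fB: "finite Box" by (simp add: Box_def)
  have LoB: "Lo \<subseteq> Box" by (auto simp: Lo_def)
  have fL: "finite Lo" by (rule finite_subset[OF LoB fB])
  have sumT: "(\<Sum>n<N. comp_term n p q x \<xi>) = (\<Sum>t\<in>Box - Lo. h t x \<xi>) + (\<Sum>t\<in>Lo. h t x \<xi>)" for x \<xi>
  proof -
    have "(\<Sum>n<N. comp_term n p q x \<xi>) = (\<Sum>t\<in>Box. h t x \<xi>)"
      unfolding dec Box_def h_def by (simp add: sum.cartesian_product split_def)
    then show ?thesis using sum.subset_diff[OF LoB fB, of "\<lambda>t. h t x \<xi>"] by simp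
  qed
  have hi: "h t \<in> lsym UNIV (m + m' - real N)" if t: "t \<in> Box - Lo" for t
  proof -
    obtain n j k where njk: "t = (n, j, k)" by (cases t)
    have *: "j \<in> {..N}" "k \<in> {..N}" "n + j + k \<ge> N" using t by (auto simp: njk Box_def Lo_def)
    have "comp_term n (a j) (b k) \<in> lsym UNIV (m + m' - real N)"
      by (rule lsym_mono[OF _ comp_term_lsym[OF open_UNIV al[OF *(1)] bl[OF *(2)]]]) (use *(3) in linarith)
    then show ?thesis by (simp add: h_def njk)
  qed
  have lo: "(\<lambda>x \<xi>. h t x \<xi> - (1 - \<phi> \<xi>) * g t x \<xi>) \<in> lsym UNIV (m + m' - real N)" if t: "t \<in> Lo" for t
  proof -
    obtain n j k where njk: "t = (n, j, k)" by (cases t)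
    have "j < N" "k < N" using t by (auto simp: njk Lo_def)
    then have "h t = comp_term n (\<lambda>x \<xi>. (1 - \<phi> \<xi>) * ps j x \<xi>) (\<lambda>x \<xi>. (1 - \<phi> \<xi>) * qs k x \<xi>)"
      by (simp add: h_def njk a_def b_def fun_eq_iff)
    moreover have "g t = comp_term n (ps j) (qs k)" by (simp add: g_def njk fun_eq_iff)
    ultimately show ?thesis using cutoff_comp_term[OF \<phi> sp sq cut[OF pe] cut[OF qe]] by simp
  qed
  have group: "(\<Sum>l<N. (1 - \<phi> \<xi>) * (\<Sum>(n, j, k) | n + j + k = l. comp_term n (ps j) (qs k) x \<xi>)) = (\<Sum>t\<in>Lo. (1 - \<phi> \<xi>) * g t x \<xi>)" for x \<xi>
  proof -
    have I: "{t. fst t + fst (snd t) + snd (snd t) = l} = {t \<in> Lo. fst t + fst (snd t) + snd (snd t) = l}" if "l < N" for l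
      using that by (auto simp: Lo_def Box_def)
    have "(\<Sum>t\<in>Lo. (1 - \<phi> \<xi>) * g t x \<xi>) = (\<Sum>l<N. \<Sum>t\<in>{t \<in> Lo. fst t + fst (snd t) + snd (snd t) = l}. (1 - \<phi> \<xi>) * g t x \<xi>)"
      by (rule sum.group[OF fL finite_lessThan, symmetric]) (auto simp: Lo_def)
    also have "\<dots> = (\<Sum>l<N. (1 - \<phi> \<xi>) * (\<Sum>(n, j, k) | n + j + k = l. comp_term n (ps j) (qs k) x \<xi>))"
      by (rule sum.cong[OF refl]) (simp add: I sum_distrib_left g_def split_def)
    finally show ?thesis ..
  qed
  have "(\<lambda>x \<xi>. (r x \<xi> - (\<Sum>n<N. comp_term n p q x \<xi>)) + ((\<Sum>t\<in>Box - Lo. h t x \<xi>) + (\<Sum>t\<in>Lo. h t x \<xi> - (1 - \<phi> \<xi>) * g t x \<xi>)))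
      \<in> lsym UNIV (m + m' - real N)"
    by (intro lsym_add lsym_sum open_UNIV re hi lo)
  then show ?thesis unfolding group sumT sum_subtractf by simp
qed

text \<open>The index \<open>n\<close> is the length of \<open>\<alpha>\<close>, so pairs of a
  triple \<open>(n, j, k)\<close> and a multi-index of length \<open>n\<close> correspond to the
  triples \<open>(j, k, \<alpha>)\<close>.\<close>

lemma expansion_term_eq:
  fixes ps qs :: "nat \<Rightarrow> 'a::euclidean_space \<Rightarrow> 'a \<Rightarrow> complex"
  assumes sp: "\<And>j. smooth_on (UNIV \<times> - {0}) (\<lambda>(x, \<xi>). ps j x \<xi>)"
    and sq: "\<And>j. smooth_on (UNIV \<times> - {0}) (\<lambda>(x, \<xi>). qs j x \<xi>)" and \<xi>: "\<xi> \<noteq> 0"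
  shows "(\<Sum>(n, j, k) | n + j + k = l. comp_term n (ps j) (qs k) x \<xi>) =
    (\<Sum>(j, k, \<alpha>) | \<alpha> \<in> multi_indices \<and> j + k + mlen \<alpha> = l.
       1 / of_nat (mfact \<alpha>) * (Dderiv \<alpha> (ps j x) \<xi> * mderiv \<alpha> (\<lambda>y. qs k y \<xi>) x))"
proof -
  define F where "F j k \<alpha> = 1 / of_nat (mfact \<alpha>) * (Dderiv \<alpha> (ps j x) \<xi> * mderiv \<alpha> (\<lambda>y. qs k y \<xi>) x)" for j k \<alpha>
  define A where "A t = {\<alpha> :: 'a \<Rightarrow> nat. \<alpha> \<in> multi_indices \<and> mlen \<alpha> = fst t}" for t :: "nat \<times> nat \<times> nat"
  define I where "I = {(n::nat, j::nat, k::nat). n + j + k = l}"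
  have "(\<Sum>(n, j, k)\<in>I. comp_term n (ps j) (qs k) x \<xi>) = (\<Sum>t\<in>I. \<Sum>\<alpha>\<in>A t. F (fst (snd t)) (snd (snd t)) \<alpha>)"
  proof (rule sum.cong[OF refl])
    fix t :: "nat \<times> nat \<times> nat"
    obtain n j k where t: "t = (n, j, k)" by (cases t)
    have "comp_term n (ps j) (qs k) x \<xi> = (\<Sum>\<alpha> | \<alpha> \<in> multi_indices \<and> mlen \<alpha> = n. F j k \<alpha>)"
      unfolding F_def
      by (rule comp_term_multi_index[of "- {0}"]) (use \<xi> smooth_on_slice_punctured[OF sp] smooth_on_slice_punctured[OF sq] in auto)
    then show "(case t of (n, j, k) \<Rightarrow> comp_term n (ps j) (qs k) x \<xi>) = (\<Sum>\<alpha>\<in>A t. F (fst (snd t)) (snd (snd t)) \<alpha>)"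
      by (simp add: t A_def)
  qed
  also have "\<dots> = (\<Sum>(t, \<alpha>)\<in>Sigma I A. F (fst (snd t)) (snd (snd t)) \<alpha>)"
    by (rule sum.Sigma) (use finite_index_triples finite_multi_indices_eq in \<open>auto simp: I_def A_def\<close>)
  also have "\<dots> = (\<Sum>(j, k, \<alpha>) | \<alpha> \<in> multi_indices \<and> j + k + mlen \<alpha> = l. F j k \<alpha>)"
    by (rule sum.reindex_bij_witness[of _ "\<lambda>(j, k, \<alpha>). ((mlen \<alpha>, j, k), \<alpha>)" "\<lambda>((n, j, k), \<alpha>). (j, k, \<alpha>)"])
      (auto simp: I_def A_def)
  finally show ?thesis unfolding F_def I_def .
qed

text \<open>Differentiating the homogeneity relation in \<open>\<xi>\<close> produces a factor
  \<open>t\<close> on the left, which accounts for the loss of one degree.\<close>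

lemma pdiff_homogeneous:
  fixes f :: "'a::euclidean_space \<Rightarrow> complex"
  assumes d: "\<And>\<xi>. \<xi> \<noteq> 0 \<Longrightarrow> f differentiable (at \<xi>)"
    and h: "\<And>\<xi> t. \<xi> \<noteq> 0 \<Longrightarrow> t > 0 \<Longrightarrow> f (t *\<^sub>R \<xi>) = complex_of_real (t powr \<mu>) * f \<xi>"
    and b: "b \<in> Basis" and \<xi>: "\<xi> \<noteq> 0" and t: "t > 0"
  shows "pdiff b f (t *\<^sub>R \<xi>) = complex_of_real (t powr (\<mu> - 1)) * pdiff b f \<xi>"
proof -
  have t\<xi>: "t *\<^sub>R \<xi> + 0 \<noteq> 0" using \<xi> t by simp
  have "pdiff b (\<lambda>\<xi>. f (t *\<^sub>R \<xi> + 0)) \<xi> = (\<Sum>b'\<in>Basis. ((t *\<^sub>R b) \<bullet> b') *\<^sub>R pdiff b' f (t *\<^sub>R \<xi> + 0))"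
    by (rule pdiff_compose_linear(2)[OF bounded_linear_scaleR_right d[OF t\<xi>]])
  also have "\<dots> = t *\<^sub>R (\<Sum>b'\<in>Basis. (b \<bullet> b') *\<^sub>R pdiff b' f (t *\<^sub>R \<xi>))" by (simp add: scaleR_sum_right)
  finally have 1: "pdiff b (\<lambda>\<xi>. f (t *\<^sub>R \<xi>)) \<xi> = t *\<^sub>R pdiff b f (t *\<^sub>R \<xi>)"
    by (simp add: sum_Basis_inner_scaleR[OF b])
  have "pdiff b (\<lambda>\<xi>. f (t *\<^sub>R \<xi>)) \<xi> = pdiff b (\<lambda>\<xi>. complex_of_real (t powr \<mu>) * f \<xi>) \<xi>"
    by (rule pdiff_cong_open[of "- {0}"]) (use \<xi> h t in auto)
  also have "\<dots> = complex_of_real (t powr \<mu>) * pdiff b f \<xi>" by (rule pdiff_cmult[OF d[OF \<xi>]])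
  finally have "t *\<^sub>R pdiff b f (t *\<^sub>R \<xi>) = complex_of_real (t powr \<mu>) * pdiff b f \<xi>" unfolding 1 .
  then have "(1 / t) *\<^sub>R (t *\<^sub>R pdiff b f (t *\<^sub>R \<xi>)) = (1 / t) *\<^sub>R (complex_of_real (t powr \<mu>) * pdiff b f \<xi>)" by simp
  then show ?thesis using t by (simp add: scaleR_conv_of_real powr_diff)
qed

lemma ider_homogeneous:
  fixes f :: "'a::euclidean_space \<Rightarrow> complex"
  assumes s: "smooth_on (- {0}) f"
    and h: "\<And>\<xi> t. \<xi> \<noteq> 0 \<Longrightarrow> t > 0 \<Longrightarrow> f (t *\<^sub>R \<xi>) = complex_of_real (t powr \<mu>) * f \<xi>"
  shows "set l \<subseteq> Basis \<Longrightarrow> \<xi> \<noteq> 0 \<Longrightarrow> t > 0 \<Longrightarrow>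
    ider l f (t *\<^sub>R \<xi>) = complex_of_real (t powr (\<mu> - real (length l))) * ider l f \<xi>"
proof (induction l arbitrary: \<xi> t)
  case Nil
  then show ?case using h by simp
next
  case (Cons b l)
  have o: "open (- {0} :: 'a set)" by auto
  have l: "set l \<subseteq> Basis" "b \<in> Basis" using Cons.prems by auto
  have d: "ider l f differentiable (at \<xi>)" if "\<xi> \<noteq> 0" for \<xi>
    by (rule smooth_on_differentiable[OF o smooth_on_ider[OF o s l(1)]]) (use that in simp)
  show ?case
    using pdiff_homogeneous[OF d Cons.IH[OF l(1)] l(2) Cons.prems(2,3)] by (simp add: algebra_simps)
qed

lemma classical_expansionD:
  assumes "classical_expansion m P ps"
  shows "smooth_on (UNIV \<times> - {0}) (\<lambda>(x, \<xi>). ps j x \<xi>)"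
    and "\<xi> \<noteq> 0 \<Longrightarrow> t > 0 \<Longrightarrow> ps j x (t *\<^sub>R \<xi>) = complex_of_real (t powr (m - real j)) * ps j x \<xi>"
  using assms unfolding classical_expansion_def by auto

lemma classical_expansion_symbolE:
  assumes "classical_expansion m P ps"
  obtains p where "total_left_symbol m P p"
    "\<And>\<phi> N. \<phi> \<in> cutoffs \<Longrightarrow> (\<lambda>x \<xi>. p x \<xi> - (\<Sum>j<N. (1 - \<phi> \<xi>) * ps j x \<xi>)) \<in> lsym UNIV (m - real N)"
proof -
  from assms obtain p where p: "total_left_symbol m P p"
    "\<forall>\<phi>\<in>cutoffs. \<forall>N. (\<lambda>x \<xi>. p x \<xi> - (\<Sum>j<N. (1 - \<phi> \<xi>) * ps j x \<xi>)) \<in> symbols (m - real N)"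
    unfolding classical_expansion_def by (elim conjE exE)
  show thesis by (rule that[OF p(1)], rule p(2)[unfolded symbols_eq_lsym, rule_format])
qed

text \<open>Joint smoothness is clear for the sum over words, which agrees with the sum over
  multi-indices on the open set \<open>\<xi> \<noteq> 0\<close>.\<close>

lemma expansion_term_smooth:
  fixes ps qs :: "nat \<Rightarrow> 'a::euclidean_space \<Rightarrow> 'a \<Rightarrow> complex"
  assumes sp: "\<And>j. smooth_on (UNIV \<times> - {0}) (\<lambda>(x, \<xi>). ps j x \<xi>)"
    and sq: "\<And>j. smooth_on (UNIV \<times> - {0}) (\<lambda>(x, \<xi>). qs j x \<xi>)"
  shows "smooth_on (UNIV \<times> - {0}) (\<lambda>(x, \<xi>). \<Sum>(j, k, \<alpha>) | \<alpha> \<in> multi_indices \<and> j + k + mlen \<alpha> = l.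
       1 / of_nat (mfact \<alpha>) * (Dderiv \<alpha> (ps j x) \<xi> * mderiv \<alpha> (\<lambda>y. qs k y \<xi>) x))"
proof -
  have o: "open (UNIV \<times> - {0} :: ('a \<times> 'a) set)" by (intro open_Times) auto
  have "smooth_on (UNIV \<times> - {0}) (\<lambda>z. \<Sum>t | fst t + fst (snd t) + snd (snd t) = l.
      (\<lambda>(x, \<xi>). comp_term (fst t) (ps (fst (snd t))) (qs (snd (snd t))) x \<xi>) z)"
    by (intro smooth_on_sum o comp_term_smooth_on sp sq)
  then show ?thesis
  proof (rule smooth_on_cong[OF o, rotated])
    fix z :: "'a \<times> 'a" assume z: "z \<in> UNIV \<times> - {0}"
    obtain x \<xi> where x: "z = (x, \<xi>)" by (cases z)
    have "\<xi> \<noteq> 0" using z x by simp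
    from expansion_term_eq[OF sp sq this, where l = l and x = x]
    show "(\<Sum>t | fst t + fst (snd t) + snd (snd t) = l. (\<lambda>(x, \<xi>). comp_term (fst t) (ps (fst (snd t))) (qs (snd (snd t))) x \<xi>) z) =
      (\<lambda>(x, \<xi>). \<Sum>(j, k, \<alpha>) | \<alpha> \<in> multi_indices \<and> j + k + mlen \<alpha> = l.
       1 / of_nat (mfact \<alpha>) * (Dderiv \<alpha> (ps j x) \<xi> * mderiv \<alpha> (\<lambda>y. qs k y \<xi>) x)) z"
      unfolding x prod.case by (simp only: split_def)
  qed
qed

text \<open>The derivatives in \<open>\<xi>\<close> lower the degree of the first factor to
  \<open>m - j - mlen \<alpha>\<close>, those in \<open>x\<close> keep the degree
  \<open>m' - k\<close> of the second, and the sum of the two is \<open>m + m' - l\<close>.\<close>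

lemma expansion_term_homogeneous:
  fixes ps qs :: "nat \<Rightarrow> 'a::euclidean_space \<Rightarrow> 'a \<Rightarrow> complex"
  assumes P: "classical_expansion m P ps" and Q: "classical_expansion m' Q qs" and \<xi>: "\<xi> \<noteq> 0" and t: "t > 0"
  shows "(\<Sum>(j, k, \<alpha>) | \<alpha> \<in> multi_indices \<and> j + k + mlen \<alpha> = l.
       1 / of_nat (mfact \<alpha>) * (Dderiv \<alpha> (ps j x) (t *\<^sub>R \<xi>) * mderiv \<alpha> (\<lambda>y. qs k y (t *\<^sub>R \<xi>)) x))
    = complex_of_real (t powr (m + m' - real l)) * (\<Sum>(j, k, \<alpha>) | \<alpha> \<in> multi_indices \<and> j + k + mlen \<alpha> = l.
       1 / of_nat (mfact \<alpha>) * (Dderiv \<alpha> (ps j x) \<xi> * mderiv \<alpha> (\<lambda>y. qs k y \<xi>) x))"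
  unfolding sum_distrib_left
proof (rule sum.cong[OF refl])
  fix s :: "nat \<times> nat \<times> ('a \<Rightarrow> nat)" assume s: "s \<in> {(j, k, \<alpha>). \<alpha> \<in> multi_indices \<and> j + k + mlen \<alpha> = l}"
  obtain j k \<alpha> where jk: "s = (j, k, \<alpha>)" by (cases s)
  have l: "real l = real j + real k + real (mlen \<alpha>)" using s by (auto simp: jk)
  note P1 = classical_expansionD[OF P] and Q1 = classical_expansionD[OF Q]
  have "ider (mword \<alpha>) (ps j x) (t *\<^sub>R \<xi>) = complex_of_real (t powr (m - real j - real (length (mword \<alpha>)))) * ider (mword \<alpha>) (ps j x) \<xi>"
    by (rule ider_homogeneous[OF smooth_on_slice_punctured(1)[OF P1(1)] P1(2) set_mword \<xi> t])
  then have ider: "ider (mword \<alpha>) (ps j x) (t *\<^sub>R \<xi>) = complex_of_real (t powr (m - real j - real (mlen \<alpha>))) * ider (mword \<alpha>) (ps j x) \<xi>"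
    unfolding length_mword .
  have 1: "Dderiv \<alpha> (ps j x) (t *\<^sub>R \<xi>) = complex_of_real (t powr (m - real j - real (mlen \<alpha>))) * Dderiv \<alpha> (ps j x) \<xi>"
    unfolding Dderiv_def mderiv_eq_ider using ider by (simp add: mult_ac)
  have "(\<lambda>y. qs k y (t *\<^sub>R \<xi>)) = (\<lambda>y. complex_of_real (t powr (m' - real k)) * qs k y \<xi>)"
    by (rule ext) (rule Q1(2)[OF \<xi> t])
  then have 2: "mderiv \<alpha> (\<lambda>y. qs k y (t *\<^sub>R \<xi>)) x = complex_of_real (t powr (m' - real k)) * mderiv \<alpha> (\<lambda>y. qs k y \<xi>) x"
    unfolding mderiv_eq_ider
    by (simp only: ider_cmult[OF open_UNIV smooth_on_slice_punctured(2)[OF Q1(1) \<xi>] set_mword UNIV_I])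
  have 3: "t powr (m + m' - real l) = t powr (m - real j - real (mlen \<alpha>)) * t powr (m' - real k)"
    unfolding l by (simp flip: powr_add add: algebra_simps)
  show "(case s of (j, k, \<alpha>) \<Rightarrow> 1 / of_nat (mfact \<alpha>) * (Dderiv \<alpha> (ps j x) (t *\<^sub>R \<xi>) * mderiv \<alpha> (\<lambda>y. qs k y (t *\<^sub>R \<xi>)) x))
    = complex_of_real (t powr (m + m' - real l)) * (case s of (j, k, \<alpha>) \<Rightarrow>
       1 / of_nat (mfact \<alpha>) * (Dderiv \<alpha> (ps j x) \<xi> * mderiv \<alpha> (\<lambda>y. qs k y \<xi>) x))"
    unfolding jk prod.case 1 2 3 of_real_mult by (simp only: mult_ac)
qed

section \<open>Operators with an exact left symbol; uniqueness of total and principal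
  symbols\<close>

lemma lsym_fst:
  fixes r :: "'x::euclidean_space \<Rightarrow> 'k::euclidean_space \<Rightarrow> complex"
  assumes "r \<in> lsym UNIV m"
  shows "(\<lambda>z::'x \<times> 'y::euclidean_space. r (fst z)) \<in> lsym UNIV m"
proof (rule lsymI)
  fix k
  have "symb k m UNIV r" by (rule lsymD[OF assms])
  then show "symb k m UNIV (\<lambda>z::'x \<times> 'y. r (fst z))"
  proof (induction k arbitrary: m r)
    have bd: "\<exists>C. \<forall>z\<in>K. \<forall>\<theta>. cmod (r (fst z) \<theta>) \<le> C * japanese \<theta> powr m"
      if r: "symb 0 m UNIV r" and K: "compact K" for K :: "('x \<times> 'y) set" and r :: "'x \<Rightarrow> 'k \<Rightarrow> complex" and m
    proof -
      have "compact (fst ` K)" by (intro compact_continuous_image K continuous_intros)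
      from symb_0D(2)[OF r this subset_UNIV] show ?thesis by auto
    qed
    {
      case (0 m r)
      have "continuous_on UNIV (\<lambda>q::('x \<times> 'y) \<times> 'k. (\<lambda>(x, \<theta>). r x \<theta>) (fst (fst q), snd q))"
        by (rule continuous_on_compose2[OF symb_0D(1)[OF 0]]) (auto intro!: continuous_intros)
      then show ?case by (intro symb_0I bd[OF 0]) (auto simp: split_def)
    next
      case (Suc k m r)
      show ?case
      proof (rule symb_SucI[OF _ bd[OF symb_SucD(1)[OF Suc.prems]]])
        fix z :: "'x \<times> 'y" and \<theta> :: 'k
        have "bounded_linear (\<lambda>q::('x \<times> 'y) \<times> 'k. (fst (fst q), snd q))"
          by (intro bounded_linear_Pair bounded_linear_snd bounded_linear_compose[OF bounded_linear_fst bounded_linear_fst])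
        from pdiff_compose_linear(1)[OF this, of "\<lambda>(x, \<theta>). r x \<theta>" "(z, \<theta>)" 0] symb_SucD(2)[OF Suc.prems, of "fst z" \<theta>]
        show "(\<lambda>(z, \<theta>). r (fst z) \<theta>) differentiable (at (z, \<theta>))" by (simp add: split_def)
      next
        fix b :: "'x \<times> 'y" assume "b \<in> Basis"
        then show "symb k m UNIV (\<lambda>z \<theta>. pdiff b (\<lambda>z. r (fst z) \<theta>) z)"
        proof (cases rule: Basis_PairE)
          case (1 c)
          have "(\<lambda>z \<theta>. pdiff b (\<lambda>z::'x \<times> 'y. r (fst z) \<theta>) z) = (\<lambda>z \<theta>. pdiff c (\<lambda>x. r x \<theta>) (fst z))"
            using pdiff_slice(1)[of c "\<lambda>x (y::'y). r x _"] by (auto simp: fun_eq_iff 1(2) split_def)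
          then show ?thesis using Suc.IH[OF symb_SucD(3)[OF Suc.prems 1(1)]] by simp
        next
          case (2 c)
          have "(\<lambda>z \<theta>. pdiff b (\<lambda>z::'x \<times> 'y. r (fst z) \<theta>) z) = (\<lambda>z \<theta>. 0)"
            using pdiff_slice(2)[of c "\<lambda>x (y::'y). r x _"] by (auto simp: fun_eq_iff 2(2) split_def)
          then show ?thesis by (simp add: symb_0)
        qed
      next
        fix c :: 'k assume "c \<in> Basis"
        from Suc.IH[OF symb_SucD(4)[OF Suc.prems this]]
        show "symb k (m - 1) UNIV (\<lambda>z::'x \<times> 'y. pdiff c (r (fst z)))" .
      qed
    }
  qed
qed

lemma Op_psido_total_left_symbol:
  fixes A :: "('a::euclidean_space \<Rightarrow> complex) \<Rightarrow> 'a \<Rightarrow> complex"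
  assumes r: "r \<in> lsym UNIV m" and A: "\<And>u x. u \<in> test_functions \<Longrightarrow> A u x = Op r u x"
  shows "A \<in> psido m" "total_left_symbol m A r"
proof -
  note K = schwartz_kernel_Op[OF r A] and O = osc_integral_Op_kernel[OF r]
  \<comment> \<open>For membership in \<open>psido\<close> the left symbol counts as an amplitude on
    the doubled base space that is constant in \<open>y\<close>.\<close>
  have "(\<lambda>(x::'a, y::'a). r x) \<in> symbols m"
    using lsym_fst[OF r, where 'y = 'a] unfolding symbols_eq_lsym by (simp add: split_def)
  then show "A \<in> psido m" unfolding psido_def using K O by blast
  \<comment> \<open>The quantization is exact, so the smooth part of the kernel is
    \<open>0\<close>.\<close>
  have "schwartz_kernel A (\<lambda>\<phi>. Op_kernel r \<phi> + (LINT z|lborel. 0 * \<phi> z))" using K by simp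
  then show "total_left_symbol m A r"
    unfolding total_left_symbol_def symbols_eq_lsym using r O smooth_on_const by blast
qed

text \<open>On a ball both symbols can be corrected to exact local ones, and these give the same
  result on truncated plane waves. By \<open>comp_symbol_cutoff\<close> the result determines each
  of them modulo order \<open>-\<infinity>\<close>.\<close>

lemma total_left_symbol_unique:
  fixes P :: "('a::euclidean_space \<Rightarrow> complex) \<Rightarrow> 'a \<Rightarrow> complex"
  assumes p: "total_left_symbol m P p" and p': "total_left_symbol m P p'" and R: "R > 0"
  shows "(\<lambda>x \<xi>. p x \<xi> - p' x \<xi>) \<in> lsym (ball 0 R) M"
proof -
  define d where "d x \<xi> = p x \<xi> - p' x \<xi>" for x \<xi>
  define cut where "cut = (\<lambda>(y::'a) (\<xi>::'a). bump 0 R y)"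
  have cut: "csym 0 cut" unfolding cut_def by (rule csym_test_function[OF bump_test(1)[OF R]])
  \<comment> \<open>Twice the radius, because the truncated waves are supported in the ball of
    radius \<open>2 * R\<close>.\<close>
  have R2: "2 * R > 0" using R by simp
  obtain q where q: "q \<in> lsym UNIV m" "\<And>M. (\<lambda>x \<xi>. q x \<xi> - p x \<xi>) \<in> lsym UNIV M"
    "\<And>u x. u \<in> test_functions \<Longrightarrow> (\<And>y. norm y > 2 * R \<Longrightarrow> u y = 0) \<Longrightarrow> norm x \<le> 2 * R \<Longrightarrow> P u x = Op q u x"
  proof (rule local_symbol_representation[OF p R2], goal_cases)
    case (1 z)
    show ?case by (rule that; fact 1)
  qed
  obtain q' where q': "q' \<in> lsym UNIV m" "\<And>M. (\<lambda>x \<xi>. q' x \<xi> - p' x \<xi>) \<in> lsym UNIV M"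
    "\<And>u x. u \<in> test_functions \<Longrightarrow> (\<And>y. norm y > 2 * R \<Longrightarrow> u y = 0) \<Longrightarrow> norm x \<le> 2 * R \<Longrightarrow> P u x = Op q' u x"
  proof (rule local_symbol_representation[OF p' R2], goal_cases)
    case (1 z)
    show ?case by (rule that; fact 1)
  qed
  have eq: "comp_symbol q cut x \<xi> = comp_symbol q' cut x \<xi>" if x: "x \<in> ball 0 R" for x \<xi>
  proof -
    define v where "v = (\<lambda>y. cis (y \<bullet> \<xi>) * cut y \<xi>)"
    have v: "v \<in> test_functions"
      unfolding v_def cut_def using ft_integrand_test[OF bump_test(1)[OF R], of "- \<xi>" 0] by simp
    have v0: "v y = 0" if "norm y > 2 * R" for y
      using bump_test(3)[OF R, of y 0] that by (simp add: v_def cut_def)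
    have x2: "norm x \<le> 2 * R" using x R by simp
    have "cis (x \<bullet> \<xi>) * comp_symbol q cut x \<xi> = cis (x \<bullet> \<xi>) * comp_symbol q' cut x \<xi>"
      unfolding Op_plane_wave[OF q(1) cut, symmetric] Op_plane_wave[OF q'(1) cut, symmetric] v_def[symmetric]
      using q(3)[OF v v0 x2] q'(3)[OF v v0 x2] by simp
    then show ?thesis by simp
  qed
  have "(\<lambda>x \<xi>. (comp_symbol q' cut x \<xi> - q' x \<xi>) + (q' x \<xi> - p' x \<xi>) - ((comp_symbol q cut x \<xi> - q x \<xi>) + (q x \<xi> - p x \<xi>))) \<in> lsym (ball 0 R) M"
    unfolding cut_def
    by (intro lsym_diff lsym_add open_ball comp_symbol_cutoff[OF q(1) R] comp_symbol_cutoff[OF q'(1) R]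
        lsym_subset[OF subset_UNIV q(2)] lsym_subset[OF subset_UNIV q'(2)])
  then show ?thesis by (rule lsym_cong[OF open_ball, rotated]) (simp add: eq)
qed

text \<open>A homogeneous function of degree \<open>m\<close> that is a symbol of order \<open>m - 1\<close> at infinity vanishes.\<close>

lemma principal_term_unique:
  fixes P :: "('a::euclidean_space \<Rightarrow> complex) \<Rightarrow> 'a \<Rightarrow> complex"
  assumes P: "classical_expansion m P ps" and P': "classical_expansion m P ps'" and \<xi>: "\<xi> \<noteq> 0"
  shows "ps 0 x \<xi> = ps' 0 x \<xi>"
proof (rule ccontr)
  assume ne: "ps 0 x \<xi> \<noteq> ps' 0 x \<xi>"
  define D where "D = ps 0 x \<xi> - ps' 0 x \<xi>"
  have D: "cmod D > 0" using ne by (simp add: D_def)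
  define \<phi> where "\<phi> = (bump 0 1 :: 'a \<Rightarrow> complex)"
  have \<phi>: "\<phi> \<in> cutoffs" unfolding \<phi>_def by (rule bump_cutoffs)
  obtain p where p: "total_left_symbol m P p"
    "\<And>\<phi> N. \<phi> \<in> cutoffs \<Longrightarrow> (\<lambda>x \<xi>. p x \<xi> - (\<Sum>j<N. (1 - \<phi> \<xi>) * ps j x \<xi>)) \<in> lsym UNIV (m - real N)"
  proof (rule classical_expansion_symbolE[OF P], goal_cases)
    case (1 z)
    show ?case by (rule that; fact 1)
  qed
  obtain p' where p': "total_left_symbol m P p'"
    "\<And>\<phi> N. \<phi> \<in> cutoffs \<Longrightarrow> (\<lambda>x \<xi>. p' x \<xi> - (\<Sum>j<N. (1 - \<phi> \<xi>) * ps' j x \<xi>)) \<in> lsym UNIV (m - real N)"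
  proof (rule classical_expansion_symbolE[OF P'], goal_cases)
    case (1 z)
    show ?case by (rule that; fact 1)
  qed
  define R where "R = norm x + 1"
  have R: "R > 0" unfolding R_def using norm_ge_zero[of x] by linarith
  have 1: "(\<lambda>x \<xi>. p x \<xi> - (1 - \<phi> \<xi>) * ps 0 x \<xi>) \<in> lsym (ball 0 R) (m - 1)"
    using lsym_subset[OF subset_UNIV p(2)[OF \<phi>, of 1]] by simp
  have 2: "(\<lambda>x \<xi>. p' x \<xi> - (1 - \<phi> \<xi>) * ps' 0 x \<xi>) \<in> lsym (ball 0 R) (m - 1)"
    using lsym_subset[OF subset_UNIV p'(2)[OF \<phi>, of 1]] by simp
  from lsym_diff[OF open_ball total_left_symbol_unique[OF p(1) p'(1) R] lsym_diff[OF open_ball 1 2]]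
  have "(\<lambda>x \<xi>. (1 - \<phi> \<xi>) * (ps 0 x \<xi> - ps' 0 x \<xi>)) \<in> lsym (ball 0 R) (m - 1)"
    by (rule lsym_cong[OF open_ball, rotated]) (simp add: algebra_simps)
  from lsym_bound[OF this, of "{x}"]
  obtain C where C: "\<And>\<xi>. cmod ((1 - \<phi> \<xi>) * (ps 0 x \<xi> - ps' 0 x \<xi>)) \<le> C * japanese \<xi> powr (m - 1)"
    by (auto simp: R_def)
  define n where "n = norm \<xi>"
  have n: "n > 0" using \<xi> by (simp add: n_def)
  define B where "B = \<bar>C\<bar> * (2 powr \<bar>m - 1\<bar> * n powr (m - 1))"
  \<comment> \<open>For such \<open>t\<close> the point \<open>t *\<^sub>R \<xi>\<close> has norm at
    least \<open>2\<close>. There the cutoff vanishes, and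
    \<open>japanese (t *\<^sub>R \<xi>)\<close> is comparable to \<open>t * n\<close>.\<close>
  have le: "t * cmod D \<le> B" if t: "t \<ge> 2 / n" for t
  proof -
    have tn: "t * n \<ge> 2" using t n by (simp add: pos_divide_le_eq)
    have t0: "t > 0" using t n by (smt (verit) divide_pos_pos)
    have nt: "norm (t *\<^sub>R \<xi>) = t * n" using t0 by (simp add: n_def)
    have "\<phi> (t *\<^sub>R \<xi>) = 0" unfolding \<phi>_def by (rule bump_test(3)) (use tn nt in auto)
    then have "t powr m * cmod D \<le> C * japanese (t *\<^sub>R \<xi>) powr (m - 1)"
      using C[of "t *\<^sub>R \<xi>"] classical_expansionD(2)[OF P \<xi> t0, of 0 x] classical_expansionD(2)[OF P' \<xi> t0, of 0 x]
      by (simp add: D_def norm_mult flip: right_diff_distrib)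
    also have "\<dots> \<le> \<bar>C\<bar> * japanese (t *\<^sub>R \<xi>) powr (m - 1)" by (simp add: mult_right_mono)
    also have "japanese (t *\<^sub>R \<xi>) powr (m - 1) \<le> 2 powr \<bar>m - 1\<bar> * (t * n) powr (m - 1)"
    \<comment> \<open>The sign of the exponent decides which comparison is used:
      \<open>japanese (t *\<^sub>R \<xi>) \<le> 2 * (t * n)\<close> for nonnegative powers,
      \<open>t * n \<le> japanese (t *\<^sub>R \<xi>)\<close> for negative ones.\<close>
    proof (cases "m \<ge> 1")
      case True
      have "japanese (t *\<^sub>R \<xi>) \<le> 2 * (t * n)" using japanese_le[of "t *\<^sub>R \<xi>"] tn unfolding nt by linarith
      then have "japanese (t *\<^sub>R \<xi>) powr (m - 1) \<le> (2 * (t * n)) powr (m - 1)" using True by (intro powr_mono2) auto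
      then show ?thesis using True tn by (simp add: powr_mult)
    next
      case False
      have "t * n \<le> japanese (t *\<^sub>R \<xi>)" using norm_le_japanese[of "t *\<^sub>R \<xi>"] unfolding nt .
      then have "japanese (t *\<^sub>R \<xi>) powr (m - 1) \<le> (t * n) powr (m - 1)" using False tn by (intro powr_mono2') auto
      also have "\<dots> \<le> 2 powr \<bar>m - 1\<bar> * (t * n) powr (m - 1)"
        using ge_one_powr_ge_zero[of 2 "\<bar>m - 1\<bar>"] by (simp add: mult_le_cancel_right1)
      finally show ?thesis .
    qed
    finally have "t powr m * cmod D \<le> \<bar>C\<bar> * (2 powr \<bar>m - 1\<bar> * (t * n) powr (m - 1))" by (simp add: mult_left_mono)
    also have "\<dots> = t powr (m - 1) * B" using t0 n by (simp add: B_def powr_mult)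
    also have "t powr m = t powr (m - 1) * t" using t0 by (simp add: powr_diff)
    finally have "t powr (m - 1) * (t * cmod D) \<le> t powr (m - 1) * B" by (simp only: mult.assoc)
    then show ?thesis using t0 by (simp add: mult_le_cancel_left_pos)
  qed
  \<comment> \<open>Large enough to be admissible in \<open>le\<close> and to force
    \<open>t * cmod D > B\<close>.\<close>
  define t where "t = max (2 / n) ((B + 1) / cmod D)"
  have "(B + 1) / cmod D \<le> t" by (simp add: t_def)
  then have "B + 1 \<le> t * cmod D" using D by (simp add: pos_divide_le_eq)
  moreover have "t * cmod D \<le> B" by (rule le) (simp add: t_def)
  ultimately show False by simp
qed

text \<open>The definite description in \<open>principal_symbol\<close> has a value because all
  expansions share their leading term.\<close>

lemma principal_symbol_eq:
  assumes "classical_expansion m P ps" "\<xi> \<noteq> 0"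
  shows "principal_symbol m P x \<xi> = ps 0 x \<xi>"
  unfolding principal_symbol_def
proof (rule the_equality)
  show "\<exists>ps'. classical_expansion m P ps' \<and> ps 0 x \<xi> = ps' 0 x \<xi>" by (intro exI[of _ ps] conjI assms(1) refl)
next
  fix z assume "\<exists>ps'. classical_expansion m P ps' \<and> z = ps' 0 x \<xi>"
  then obtain ps' where "classical_expansion m P ps'" "z = ps' 0 x \<xi>" by (elim exE conjE)
  then show "z = ps 0 x \<xi>" using principal_term_unique[OF _ assms] by simp
qed

theorem theorem5p5:
  fixes P Q :: "('a::euclidean_space \<Rightarrow> complex) \<Rightarrow> 'a \<Rightarrow> complex"
    and m m' :: real
    and p q :: "nat \<Rightarrow> 'a \<Rightarrow> 'a \<Rightarrow> complex"
  assumes "P \<in> psido_cl m" and "Q \<in> psido_cl m'"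
    and "properly_supported P" and "properly_supported Q"
    and "classical_expansion m P p" and "classical_expansion m' Q q"
  shows "P \<circ> Q \<in> psido_cl (m + m')
    \<and> classical_expansion (m + m') (P \<circ> Q)
        (\<lambda>l x \<xi>. \<Sum>(j, k, \<alpha>) | \<alpha> \<in> multi_indices \<and> j + k + mlen \<alpha> = l.
           1 / of_nat (mfact \<alpha>) * (Dderiv \<alpha> (p j x) \<xi> * mderiv \<alpha> (\<lambda>y. q k y \<xi>) x))
    \<and> (\<forall>x \<xi>. \<xi> \<noteq> 0 \<longrightarrow>
         principal_symbol (m + m') (P \<circ> Q) x \<xi> = principal_symbol m P x \<xi> * principal_symbol m' Q x \<xi>)"
proof -
  define R where "R l x \<xi> = (\<Sum>(j, k, \<alpha>) | \<alpha> \<in> multi_indices \<and> j + k + mlen \<alpha> = l.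
           1 / of_nat (mfact \<alpha>) * (Dderiv \<alpha> (p j x) \<xi> * mderiv \<alpha> (\<lambda>y. q k y \<xi>) x))" for l x \<xi>
  note P = classical_expansionD[OF assms(5)] and Q = classical_expansionD[OF assms(6)]
  obtain ps where ps: "total_left_symbol m P ps"
    "\<And>\<phi> N. \<phi> \<in> cutoffs \<Longrightarrow> (\<lambda>x \<xi>. ps x \<xi> - (\<Sum>j<N. (1 - \<phi> \<xi>) * p j x \<xi>)) \<in> lsym UNIV (m - real N)"
  proof (rule classical_expansion_symbolE[OF assms(5)], goal_cases)
    case (1 z)
    show ?case by (rule that; fact 1)
  qed
  obtain qs where qs: "total_left_symbol m' Q qs"
    "\<And>\<phi> N. \<phi> \<in> cutoffs \<Longrightarrow> (\<lambda>x \<xi>. qs x \<xi> - (\<Sum>j<N. (1 - \<phi> \<xi>) * q j x \<xi>)) \<in> lsym UNIV (m' - real N)"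
  proof (rule classical_expansion_symbolE[OF assms(6)], goal_cases)
    case (1 z)
    show ?case by (rule that; fact 1)
  qed
  obtain r where r: "r \<in> lsym UNIV (m + m')" "\<And>u x. u \<in> test_functions \<Longrightarrow> P (Q u) x = Op r u x"
    "\<And>K. (\<lambda>x \<xi>. r x \<xi> - (\<Sum>k<K. comp_term k ps qs x \<xi>)) \<in> lsym UNIV (m + m' - real K)"
  proof (rule composition_symbol[OF ps(1) qs(1) assms(3,4)], goal_cases)
    case (1 z)
    show ?case by (rule that; fact 1)
  qed
  have PQ: "(P \<circ> Q) u x = Op r u x" if "u \<in> test_functions" for u x using r(2)[OF that] by simp
  have exp: "(\<lambda>x \<xi>. r x \<xi> - (\<Sum>l<N. (1 - \<phi> \<xi>) * R l x \<xi>)) \<in> lsym UNIV (m + m' - real N)" if \<phi>: "\<phi> \<in> cutoffs" for \<phi> N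
  proof -
    \<comment> \<open>At \<open>\<xi> = 0\<close> the sums over words and over multi-indices may
      differ, as the derivatives of \<open>p j x\<close> are arbitrary there; the factor
      \<open>1 - \<phi>\<close> removes this point.\<close>
    have \<phi>0: "\<phi> 0 = 1" using \<phi> eventually_nhds_x_imp_x unfolding cutoffs_def by blast
    have eq: "(1 - \<phi> \<xi>) * (\<Sum>(n, j, k) | n + j + k = l. comp_term n (p j) (q k) x \<xi>) = (1 - \<phi> \<xi>) * R l x \<xi>" for l x \<xi>
      using expansion_term_eq[OF P(1) Q(1), where \<xi> = \<xi> and l = l and x = x] \<phi>0 unfolding R_def by (cases "\<xi> = 0") auto
    show ?thesis
      using composition_expansion[OF \<phi> ps(2)[OF \<phi>] qs(2)[OF \<phi>] P(1) Q(1) r(3), of N] unfolding eq .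
  qed
  have cl: "classical_expansion (m + m') (P \<circ> Q) R"
    unfolding classical_expansion_def
  proof (intro conjI allI impI exI[of _ r] ballI)
    show "P \<circ> Q \<in> psido (m + m')" by (rule Op_psido_total_left_symbol(1)[OF r(1) PQ])
    show "total_left_symbol (m + m') (P \<circ> Q) r" by (rule Op_psido_total_left_symbol(2)[OF r(1) PQ])
    show "smooth_on (UNIV \<times> - {0}) (\<lambda>(x, \<xi>). R j x \<xi>)" for j
      unfolding R_def by (rule expansion_term_smooth[OF P(1) Q(1)])
    show "R j x (t *\<^sub>R \<xi>) = complex_of_real (t powr (m + m' - real j)) * R j x \<xi>" if "\<xi> \<noteq> 0" "t > 0" for j x \<xi> t
      unfolding R_def by (rule expansion_term_homogeneous[OF assms(5,6) that])
    show "(\<lambda>x \<xi>. r x \<xi> - (\<Sum>l<N. (1 - \<phi> \<xi>) * R l x \<xi>)) \<in> symbols (m + m' - real N)" if "\<phi> \<in> cutoffs" for \<phi> N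
      unfolding symbols_eq_lsym by (rule exp[OF that])
  qed
  have R0: "R 0 x \<xi> = p 0 x \<xi> * q 0 x \<xi>" for x \<xi>
  proof -
    \<comment> \<open>For \<open>l = 0\<close> only the zero multi-index remains, so the principal
      term is a product without derivatives.\<close>
    have "{(j, k, \<alpha>). \<alpha> \<in> multi_indices \<and> j + k + mlen \<alpha> = 0} = {(0, 0, (\<lambda>b::'a. 0))}"
      by (auto simp: multi_indices_def mlen_def fun_eq_iff)
    moreover have "mword (\<lambda>b::'a. 0) = []" by (simp add: mword_def)
    ultimately show ?thesis by (simp add: R_def Dderiv_def mderiv_eq_ider mlen_def mfact_def)
  qed
  have "P \<circ> Q \<in> psido_cl (m + m')" unfolding psido_cl_def using cl by blast
  moreover have "principal_symbol (m + m') (P \<circ> Q) x \<xi> = principal_symbol m P x \<xi> * principal_symbol m' Q x \<xi>"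
    if "\<xi> \<noteq> 0" for x \<xi>
    unfolding principal_symbol_eq[OF cl that] principal_symbol_eq[OF assms(5) that] principal_symbol_eq[OF assms(6) that] R0 ..
  ultimately show ?thesis using cl unfolding R_def by (intro conjI allI impI)
qed

end
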